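(* Let $1\le r\le\infty$ or $r=\omega$, let $\Gamma\rightrightarrows M$ be a Lie groupoid of class $C^r$, and let $\mathcal G\le \mathrm{Bis}^r(\Gamma)$ be a subgroup which satisfies the (L)-condition and is fiberwise transitive. Then for any $\gamma\in\Gamma^o$ there is $\sigma\in\mathcal G$ such that $\sigma(\alpha(\gamma))=\gamma$. Moreover, for every open neighborhood $V$ in $M$ of the leaf $L_{\alpha(\gamma)}=\beta(\Gamma^o_{\alpha(\gamma)})$, such a $\sigma$ can be chosen so that $\operatorname{supp}(\beta\circ\sigma)\subseteq V$ if $1\le r\le\infty$ (respectively, if $r=\omega$, so that $\beta\circ\sigma$ is sufficiently $C^1$ close to the identity of $M$ on $M\setminus V$).
   Context: Groupoid notation. $\Gamma\rightrightarrows M$ is a Lie groupoid of class $C^r$ with manifold of units $M$, source map $\alpha$, target map $\beta$, and unit inclusion $\iota_M:M\hookrightarrow\Gamma$; the product $\gamma.\gamma'$ is defined when $\alpha(\gamma)=\beta(\gamma')$. A bisection of class $C^r$ is a $C^r$ map $\sigma:M\to\Gamma$ with $\alpha\circ\sigma=\mathrm{id}_M$ and $\beta\circ\sigma$ a $C^r$-diffeomorphism of $M$. The set $\mathrm{Bis}^r(\Gamma)$ of all of them is a group under $(\sigma\star\tau)(x)=\sigma(\beta(\tau(x))).\tau(x)$, with unit $\iota_M$. For a bisection, $\operatorname{supp}(\sigma)$ is the closure of $\{x\in M:\sigma(x)\ne\iota_M(x)\}$; for a diffeomorphism $f$ of $M$, $\operatorname{supp}(f)$ is the closure of $\{x: f(x)\neq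 x\}$. $\Gamma_x=\alpha^{-1}(x)$, $\Gamma_x^o$ is the connected component of (the unit at) $x$ in $\Gamma_x$, and $\Gamma^o=\bigcup_{x\in M}\Gamma^o_x$. The sets $\beta(\Gamma_x^o)$, $x\in M$, are the leaves of the (generalized) foliation $\mathcal F_\Gamma$ of $M$ determined by $\Gamma$. For a subgroup $\mathcal G\le\mathrm{Bis}^r(\Gamma)$, $I\mathcal G$ denotes the set of isotopies in $\mathcal G$, i.e. $C^r$ maps $\sigma:\mathbb R\times M\to\Gamma$, $(t,x)\mapsto\sigma_t(x)$, such that $\sigma_t\in\mathcal G$ for all $t$ and $\sigma_0=\iota_M$. Closeness convention. Given a compact $K\subseteq M$ and $\varepsilon>0$, two $C^1$ maps $f,g$ on $M$ are $(K,\varepsilon)$-close on a set $S\subseteq M$ if their 1-jets at every point of $K\cap S$ are at distance less than $\varepsilon$ with respect to a fixed metric on the 1-jet space inducing its topology. In a conclusion, "sufficiently $C^1$ close" means: for every prescribed $(K,\varepsilon)$ the object can be chosen $(K,\varepsilon)$-close. (L)-condition. For $1\le r\le\infty$: for all open relatively compact $U,V\subseteq M$ with $\overline U\subseteq V$ there is $(K,\varepsilon)$ such that for every $\sigma\in I\mathcal G$ with all $\sigma_t$ $(K,\varepsilon)$-close to $\iota_M$ on $M$ there is $\tau\in I\mathcal G$ with $\tau_t=\sigma_t$ on $U$ and $\operatorname{supp}(\tau_t)\subseteq V$ for all $t$. For $r=\omega$: the same, except that the conclusion on $\tau$ is replaced by: for every $(K',\varepsilon')$ there is $\tau\in I\mathcal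 G$ such that for all $t$, $\tau_t$ is $(K',\varepsilon')$-close to $\sigma_t$ on $U$ and $(K',\varepsilon')$-close to $\iota_M$ on $M\setminus V$. Fiberwise transitivity. $\mathcal G$ is fiberwise transitive if for every $x\in M$ there are $k=\dim\alpha^{-1}(x)$ isotopies $\sigma^1,\ldots,\sigma^k\in I\mathcal G$ such that the vectors $\frac{\partial\sigma^1_t}{\partial t}(x)|_{t=0},\ldots,\frac{\partial\sigma^k_t}{\partial t}(x)|_{t=0}$ are linearly independent. *)

theory Defs
  imports "HOL-Analysis.Analysis" "HOL-Algebra.Group"
begin

section \<open>Maps of class \<open>C\<^sup>r\<close> between open subsets of \<open>\<real>\<^sup>n\<close>\<close>

text \<open>
  \<open>\<real>\<^sup>n\<close> is \<^const>\<open>Euclidean_space\<close> \<open>n\<close>: the sequences \<open>x :: nat \<Rightarrow> real\<close> with \<open>x i = 0\<close> for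
  \<open>i \<ge> n\<close>.  Dimensions are therefore numbers rather than types, and dimension \<open>0\<close> is allowed.
\<close>

datatype regularity = Differentiable enat | Analytic

definition partial_deriv :: "nat \<Rightarrow> ((nat \<Rightarrow> real) \<Rightarrow> real) \<Rightarrow> (nat \<Rightarrow> real) \<Rightarrow> real" where
  "partial_deriv i f x = deriv (\<lambda>t. f (x(i := t))) (x i)"

primrec Ck_fun :: "nat \<Rightarrow> nat \<Rightarrow> (nat \<Rightarrow> real) set \<Rightarrow> ((nat \<Rightarrow> real) \<Rightarrow> real) \<Rightarrow> bool" where
  "Ck_fun 0 n D f \<longleftrightarrow> continuous_on D f"
| "Ck_fun (Suc k) n D f \<longleftrightarrow> continuous_on D f \<and>
     (\<forall>i<n. (\<forall>x\<in>D. (\<lambda>t. f (x(i := t))) differentiable (at (x i))) \<and>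
            Ck_fun k n D (partial_deriv i f))"

text \<open>Around each point, \<open>f\<close> is the sum of an (unconditionally) convergent power series indexed
  by the multi-indices \<open>\<mu>\<close>.\<close>

definition analytic_fun :: "nat \<Rightarrow> (nat \<Rightarrow> real) set \<Rightarrow> ((nat \<Rightarrow> real) \<Rightarrow> real) \<Rightarrow> bool" where
  "analytic_fun n D f \<longleftrightarrow>
     (\<forall>x\<in>D. \<exists>\<rho>>0. \<exists>a :: (nat \<Rightarrow> nat) \<Rightarrow> real. \<forall>y\<in>D. (\<forall>i<n. \<bar>y i - x i\<bar> < \<rho>) \<longrightarrow>
        ((\<lambda>\<mu>. a \<mu> * (\<Prod>i<n. (y i - x i) ^ \<mu> i)) has_sum f y) {\<mu>. \<forall>i\<ge>n. \<mu> i = 0})"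

definition Cr_fun :: "regularity \<Rightarrow> nat \<Rightarrow> (nat \<Rightarrow> real) set \<Rightarrow> ((nat \<Rightarrow> real) \<Rightarrow> real) \<Rightarrow> bool" where
  "Cr_fun r n D f \<longleftrightarrow>
     (case r of Differentiable e \<Rightarrow> \<forall>k. enat k \<le> e \<longrightarrow> Ck_fun k n D f
              | Analytic \<Rightarrow> analytic_fun n D f)"

definition Cr_vec :: "regularity \<Rightarrow> nat \<Rightarrow> nat \<Rightarrow> (nat \<Rightarrow> real) set
    \<Rightarrow> ((nat \<Rightarrow> real) \<Rightarrow> (nat \<Rightarrow> real)) \<Rightarrow> bool" where
  "Cr_vec r n m D f \<longleftrightarrow> (\<forall>j<m. Cr_fun r n D (\<lambda>u. f u j))"


section \<open>Manifolds\<close>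

type_synonym 'a chart = "'a set \<times> ('a \<Rightarrow> nat \<Rightarrow> real)"

record 'a mfd =
  mdim :: nat
  charts :: "'a chart set"

definition is_chart :: "nat \<Rightarrow> 'a::topological_space chart \<Rightarrow> bool" where
  "is_chart n = (\<lambda>(U, \<phi>). open U \<and> openin (Euclidean_space n) (\<phi> ` U) \<and>
     homeomorphic_map (top_of_set U) (subtopology (Euclidean_space n) (\<phi> ` U)) \<phi>)"

definition coord_rep :: "'a chart \<Rightarrow> 'b chart \<Rightarrow> ('a \<Rightarrow> 'b) \<Rightarrow> (nat \<Rightarrow> real) \<Rightarrow> (nat \<Rightarrow> real)" where
  "coord_rep c c' f = (\<lambda>u. snd c' (f (inv_into (fst c) (snd c) u)))"

definition Cr_compatible :: "regularity \<Rightarrow> nat \<Rightarrow> 'a chart \<Rightarrow> 'a chart \<Rightarrow> bool" where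
  "Cr_compatible r n c c' \<longleftrightarrow>
     Cr_vec r n n (snd c ` (fst c \<inter> fst c')) (coord_rep c c' id) \<and>
     Cr_vec r n n (snd c' ` (fst c \<inter> fst c')) (coord_rep c' c id)"

text \<open>The underlying space is the whole type; the Hausdorff property is expressed by its class.
  \<^const>\<open>charts\<close> is any \<open>C\<^sup>r\<close> atlas, not necessarily a maximal one.\<close>

definition manifold :: "regularity \<Rightarrow> 'a::t2_space mfd \<Rightarrow> bool" where
  "manifold r X \<longleftrightarrow>
     (\<forall>c\<in>charts X. is_chart (mdim X) c) \<and> (\<Union>c\<in>charts X. fst c) = UNIV \<and>
     (\<forall>c\<in>charts X. \<forall>c'\<in>charts X. Cr_compatible r (mdim X) c c')"

definition maximal_atlas :: "regularity \<Rightarrow> 'a::topological_space mfd \<Rightarrow> 'a chart set" where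
  "maximal_atlas r X =
     {c. is_chart (mdim X) c \<and> (\<forall>c'\<in>charts X. Cr_compatible r (mdim X) c c')}"

definition real_mfd :: "real mfd" where
  "real_mfd = \<lparr>mdim = 1, charts = {(UNIV, \<lambda>t i. if i = 0 then t else 0)}\<rparr>"

definition prod_chart :: "nat \<Rightarrow> 'a chart \<Rightarrow> 'b chart \<Rightarrow> ('a \<times> 'b) chart" where
  "prod_chart n c c' =
     (fst c \<times> fst c', \<lambda>(x, y) i. if i < n then snd c x i else snd c' y (i - n))"

definition prod_mfd :: "'a mfd \<Rightarrow> 'b mfd \<Rightarrow> ('a \<times> 'b) mfd" where
  "prod_mfd X Y =
     \<lparr>mdim = mdim X + mdim Y,
      charts = {prod_chart (mdim X) c c' | c c'. c \<in> charts X \<and> c' \<in> charts Y}\<rparr>"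

definition Cr_on :: "regularity \<Rightarrow> 'a::topological_space mfd \<Rightarrow> 'b::topological_space mfd
    \<Rightarrow> 'a set \<Rightarrow> ('a \<Rightarrow> 'b) \<Rightarrow> bool" where
  "Cr_on r X Y W f \<longleftrightarrow> open W \<and> continuous_on W f \<and>
     (\<forall>c\<in>charts X. \<forall>c'\<in>charts Y.
        Cr_vec r (mdim X) (mdim Y) (snd c ` (fst c \<inter> W \<inter> f -` fst c')) (coord_rep c c' f))"

abbreviation Cr_map :: "regularity \<Rightarrow> 'a::topological_space mfd \<Rightarrow> 'b::topological_space mfd
    \<Rightarrow> ('a \<Rightarrow> 'b) \<Rightarrow> bool" where
  "Cr_map r X Y f \<equiv> Cr_on r X Y UNIV f"

text \<open>Class \<open>C\<^sup>r\<close> on an arbitrary subset: local \<open>C\<^sup>r\<close> extensions exist.  On an embedded submanifold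
  \<open>S\<close> this is the same as being \<open>C\<^sup>r\<close> for the induced manifold structure.\<close>

definition Cr_on_subset :: "regularity \<Rightarrow> 'a::topological_space mfd \<Rightarrow> 'b::topological_space mfd
    \<Rightarrow> 'a set \<Rightarrow> ('a \<Rightarrow> 'b) \<Rightarrow> bool" where
  "Cr_on_subset r X Y S f \<longleftrightarrow>
     (\<forall>p\<in>S. \<exists>W F. p \<in> W \<and> Cr_on r X Y W F \<and> (\<forall>q\<in>W \<inter> S. F q = f q))"

definition diffeomorphism :: "regularity \<Rightarrow> 'a::topological_space mfd \<Rightarrow> ('a \<Rightarrow> 'a) \<Rightarrow> bool" where
  "diffeomorphism r X f \<longleftrightarrow> bij f \<and> Cr_map r X X f \<and> Cr_map r X X (inv_into UNIV f)"

text \<open>\<open>S\<close> is an embedded submanifold of dimension \<open>k\<close> (slice charts).\<close>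

definition submanifold_dim :: "regularity \<Rightarrow> 'a::topological_space mfd \<Rightarrow> 'a set \<Rightarrow> nat \<Rightarrow> bool" where
  "submanifold_dim r X S k \<longleftrightarrow> k \<le> mdim X \<and>
     (\<forall>p\<in>S. \<exists>(U, \<phi>)\<in>maximal_atlas r X.
        p \<in> U \<and> \<phi> ` (U \<inter> S) = {u \<in> \<phi> ` U. \<forall>i\<ge>k. u i = 0})"

definition charts_at :: "'a mfd \<Rightarrow> 'a \<Rightarrow> 'a chart set" where
  "charts_at X p = {c \<in> charts X. p \<in> fst c}"

text \<open>Jacobian matrix at \<open>p\<close> in the given charts; entries outside the \<open>dim Y \<times> dim X\<close> block are
  set to \<open>0\<close>.\<close>

definition jacobian :: "'a mfd \<Rightarrow> 'b mfd \<Rightarrow> 'a chart \<Rightarrow> 'b chart \<Rightarrow> ('a \<Rightarrow> 'b) \<Rightarrow> 'a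
    \<Rightarrow> (nat \<Rightarrow> nat \<Rightarrow> real)" where
  "jacobian X Y c c' f p =
     (\<lambda>j i. if j < mdim Y \<and> i < mdim X
            then partial_deriv i (\<lambda>u. coord_rep c c' f u j) (snd c p) else 0)"

definition submersion :: "regularity \<Rightarrow> 'a::topological_space mfd \<Rightarrow> 'b::topological_space mfd
    \<Rightarrow> ('a \<Rightarrow> 'b) \<Rightarrow> bool" where
  "submersion r X Y f \<longleftrightarrow> Cr_map r X Y f \<and>
     (\<forall>p. \<forall>c\<in>charts_at X p. \<forall>c'\<in>charts_at Y (f p). \<forall>v :: nat \<Rightarrow> real. \<exists>w :: nat \<Rightarrow> real.
        \<forall>j<mdim Y. (\<Sum>i<mdim X. jacobian X Y c c' f p j i * w i) = v j)"

text \<open>Linear independence in the tangent space at \<open>p\<close> of the velocities at time \<open>0\<close> of the curves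
  \<open>z i\<close>, \<open>i < k\<close>, through \<open>p\<close>; tangent vectors are given by their coordinates in a chart at \<open>p\<close>.\<close>

definition independent_velocities :: "'a mfd \<Rightarrow> 'a \<Rightarrow> nat \<Rightarrow> (nat \<Rightarrow> real \<Rightarrow> 'a) \<Rightarrow> bool" where
  "independent_velocities X p k z \<longleftrightarrow>
     (\<forall>(U, \<phi>)\<in>charts_at X p. \<forall>a :: nat \<Rightarrow> real.
        (\<forall>j<mdim X. (\<Sum>i<k. a i * deriv (\<lambda>t. \<phi> (z i t) j) 0) = 0) \<longrightarrow> (\<forall>i<k. a i = 0))"


section \<open>The space of 1-jets\<close>

text \<open>The 1-jet at \<open>x\<close> of \<open>f\<close> is the class of the maps, \<open>C\<^sup>1\<close> near \<open>x\<close>, that have the same value and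
  the same derivative at \<open>x\<close> as \<open>f\<close>, together with \<open>x\<close>.\<close>

type_synonym ('a, 'b) jet = "'a \<times> ('a \<Rightarrow> 'b) set"

definition C1_near :: "'a::topological_space mfd \<Rightarrow> 'b::topological_space mfd \<Rightarrow> 'a
    \<Rightarrow> ('a \<Rightarrow> 'b) \<Rightarrow> bool" where
  "C1_near X Y x f \<longleftrightarrow> (\<exists>W. x \<in> W \<and> Cr_on (Differentiable 1) X Y W f)"

definition jet1 :: "'a::topological_space mfd \<Rightarrow> 'b::topological_space mfd \<Rightarrow> 'a
    \<Rightarrow> ('a \<Rightarrow> 'b) \<Rightarrow> ('a, 'b) jet" where
  "jet1 X Y x f =
     (x, {g. C1_near X Y x g \<and> g x = f x \<and>
             (\<forall>c\<in>charts_at X x. \<forall>c'\<in>charts_at Y (f x).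
                jacobian X Y c c' g x = jacobian X Y c c' f x)})"

text \<open>The manifold topology of the jet space: a pair of charts gives the coordinates
  (coordinates of \<open>x\<close>, coordinates of \<open>f x\<close>, Jacobian) on jets, and preimages of open sets under
  these coordinates generate the topology.\<close>

definition jet_topology :: "'a::topological_space mfd \<Rightarrow> 'b::topological_space mfd
    \<Rightarrow> ('a, 'b) jet topology" where
  "jet_topology X Y = topology_generated_by
     {{jet1 X Y x f | x f. x \<in> fst c \<and> f x \<in> fst c' \<and> C1_near X Y x f \<and>
                            (snd c x, snd c' (f x), jacobian X Y c c' f x) \<in> N}
      | c c' N. c \<in> charts X \<and> c' \<in> charts Y \<and> open N}"

definition jet_metric :: "'a::topological_space mfd \<Rightarrow> 'b::topological_space mfd
    \<Rightarrow> (('a, 'b) jet \<Rightarrow> ('a, 'b) jet \<Rightarrow> real) \<Rightarrow> bool" where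
  "jet_metric X Y d \<longleftrightarrow>
     Metric_space (topspace (jet_topology X Y)) d \<and>
     Metric_space.mtopology (topspace (jet_topology X Y)) d = jet_topology X Y"

definition C1_close :: "'a::topological_space mfd \<Rightarrow> 'b::topological_space mfd
    \<Rightarrow> (('a, 'b) jet \<Rightarrow> ('a, 'b) jet \<Rightarrow> real) \<Rightarrow> 'a set \<Rightarrow> real \<Rightarrow> 'a set
    \<Rightarrow> ('a \<Rightarrow> 'b) \<Rightarrow> ('a \<Rightarrow> 'b) \<Rightarrow> bool" where
  "C1_close X Y d K \<epsilon> S f g \<longleftrightarrow> (\<forall>x\<in>K \<inter> S. d (jet1 X Y x f) (jet1 X Y x g) < \<epsilon>)"


section \<open>Lie groupoids and bisections\<close>

record ('g, 'm) groupoid =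
  arrows :: "'g mfd"
  units :: "'m mfd"
  src :: "'g \<Rightarrow> 'm"
  tgt :: "'g \<Rightarrow> 'm"
  unit_at :: "'m \<Rightarrow> 'g"
  arrow_comp :: "'g \<Rightarrow> 'g \<Rightarrow> 'g"
  inverse_arrow :: "'g \<Rightarrow> 'g"

definition is_groupoid :: "('g, 'm) groupoid \<Rightarrow> bool" where
  "is_groupoid \<Gamma> \<longleftrightarrow>
     (\<forall>x. src \<Gamma> (unit_at \<Gamma> x) = x \<and> tgt \<Gamma> (unit_at \<Gamma> x) = x) \<and>
     (\<forall>g h. src \<Gamma> g = tgt \<Gamma> h \<longrightarrow>
        src \<Gamma> (arrow_comp \<Gamma> g h) = src \<Gamma> h \<and> tgt \<Gamma> (arrow_comp \<Gamma> g h) = tgt \<Gamma> g) \<and>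
     (\<forall>g h k. src \<Gamma> g = tgt \<Gamma> h \<and> src \<Gamma> h = tgt \<Gamma> k \<longrightarrow>
        arrow_comp \<Gamma> (arrow_comp \<Gamma> g h) k = arrow_comp \<Gamma> g (arrow_comp \<Gamma> h k)) \<and>
     (\<forall>g. arrow_comp \<Gamma> g (unit_at \<Gamma> (src \<Gamma> g)) = g \<and> arrow_comp \<Gamma> (unit_at \<Gamma> (tgt \<Gamma> g)) g = g) \<and>
     (\<forall>g. src \<Gamma> (inverse_arrow \<Gamma> g) = tgt \<Gamma> g \<and> tgt \<Gamma> (inverse_arrow \<Gamma> g) = src \<Gamma> g \<and>
          arrow_comp \<Gamma> (inverse_arrow \<Gamma> g) g = unit_at \<Gamma> (src \<Gamma> g) \<and>
          arrow_comp \<Gamma> g (inverse_arrow \<Gamma> g) = unit_at \<Gamma> (tgt \<Gamma> g))"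

definition lie_groupoid :: "regularity \<Rightarrow> ('g::t2_space, 'm::t2_space) groupoid \<Rightarrow> bool" where
  "lie_groupoid r \<Gamma> \<longleftrightarrow>
     manifold r (arrows \<Gamma>) \<and> manifold r (units \<Gamma>) \<and> is_groupoid \<Gamma> \<and>
     submersion r (arrows \<Gamma>) (units \<Gamma>) (src \<Gamma>) \<and>
     submersion r (arrows \<Gamma>) (units \<Gamma>) (tgt \<Gamma>) \<and>
     Cr_map r (units \<Gamma>) (arrows \<Gamma>) (unit_at \<Gamma>) \<and>
     Cr_map r (arrows \<Gamma>) (arrows \<Gamma>) (inverse_arrow \<Gamma>) \<and>
     Cr_on_subset r (prod_mfd (arrows \<Gamma>) (arrows \<Gamma>)) (arrows \<Gamma>)
       {(g, h). src \<Gamma> g = tgt \<Gamma> h} (\<lambda>(g, h). arrow_comp \<Gamma> g h)"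

definition src_fibre :: "('g, 'm) groupoid \<Rightarrow> 'm \<Rightarrow> 'g set" where
  "src_fibre \<Gamma> x = {g. src \<Gamma> g = x}"

definition src_fibre_component :: "('g::topological_space, 'm) groupoid \<Rightarrow> 'm \<Rightarrow> 'g set" where
  "src_fibre_component \<Gamma> x = connected_component_set (src_fibre \<Gamma> x) (unit_at \<Gamma> x)"

definition identity_component :: "('g::topological_space, 'm) groupoid \<Rightarrow> 'g set" where
  "identity_component \<Gamma> = (\<Union>x. src_fibre_component \<Gamma> x)"

definition leaf :: "('g::topological_space, 'm) groupoid \<Rightarrow> 'm \<Rightarrow> 'm set" where
  "leaf \<Gamma> x = tgt \<Gamma> ` src_fibre_component \<Gamma> x"

definition bisection :: "regularity \<Rightarrow> ('g::topological_space, 'm::topological_space) groupoid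
    \<Rightarrow> ('m \<Rightarrow> 'g) \<Rightarrow> bool" where
  "bisection r \<Gamma> \<sigma> \<longleftrightarrow> Cr_map r (units \<Gamma>) (arrows \<Gamma>) \<sigma> \<and>
     (\<forall>x. src \<Gamma> (\<sigma> x) = x) \<and> diffeomorphism r (units \<Gamma>) (tgt \<Gamma> \<circ> \<sigma>)"

definition bisection_mult :: "('g, 'm) groupoid \<Rightarrow> ('m \<Rightarrow> 'g) \<Rightarrow> ('m \<Rightarrow> 'g) \<Rightarrow> ('m \<Rightarrow> 'g)" where
  "bisection_mult \<Gamma> \<sigma> \<tau> = (\<lambda>x. arrow_comp \<Gamma> (\<sigma> (tgt \<Gamma> (\<tau> x))) (\<tau> x))"

definition Bis :: "regularity \<Rightarrow> ('g::topological_space, 'm::topological_space) groupoid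
    \<Rightarrow> ('m \<Rightarrow> 'g) monoid" where
  "Bis r \<Gamma> = \<lparr>carrier = {\<sigma>. bisection r \<Gamma> \<sigma>}, mult = bisection_mult \<Gamma>, one = unit_at \<Gamma>\<rparr>"

definition supp_bisection :: "('g, 'm::topological_space) groupoid \<Rightarrow> ('m \<Rightarrow> 'g) \<Rightarrow> 'm set" where
  "supp_bisection \<Gamma> \<sigma> = closure {x. \<sigma> x \<noteq> unit_at \<Gamma> x}"

definition supp_diffeo :: "('m::topological_space \<Rightarrow> 'm) \<Rightarrow> 'm set" where
  "supp_diffeo f = closure {x. f x \<noteq> x}"

definition isotopies :: "regularity \<Rightarrow> ('g::topological_space, 'm::topological_space) groupoid
    \<Rightarrow> ('m \<Rightarrow> 'g) set \<Rightarrow> (real \<Rightarrow> 'm \<Rightarrow> 'g) set" where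
  "isotopies r \<Gamma> G =
     {\<sigma>. Cr_map r (prod_mfd real_mfd (units \<Gamma>)) (arrows \<Gamma>) (\<lambda>(t, x). \<sigma> t x) \<and>
         (\<forall>t. \<sigma> t \<in> G) \<and> \<sigma> 0 = unit_at \<Gamma>}"

text \<open>\<open>d\<close> is the metric on the space of 1-jets of maps from the units to the arrows.\<close>

definition L_condition :: "regularity \<Rightarrow> ('g::topological_space, 'm::topological_space) groupoid
    \<Rightarrow> (('m, 'g) jet \<Rightarrow> ('m, 'g) jet \<Rightarrow> real) \<Rightarrow> ('m \<Rightarrow> 'g) set \<Rightarrow> bool" where
  "L_condition r \<Gamma> d G \<longleftrightarrow>
     (let close = C1_close (units \<Gamma>) (arrows \<Gamma>) d in
      \<forall>U V. open U \<and> open V \<and> compact (closure U) \<and> compact (closure V) \<and> closure U \<subseteq> V \<longrightarrow>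
        (\<exists>K \<epsilon>. compact K \<and> \<epsilon> > 0 \<and>
          (\<forall>\<sigma>\<in>isotopies r \<Gamma> G. (\<forall>t. close K \<epsilon> UNIV (\<sigma> t) (unit_at \<Gamma>)) \<longrightarrow>
            (if r \<noteq> Analytic then
               \<exists>\<tau>\<in>isotopies r \<Gamma> G. \<forall>t. (\<forall>x\<in>U. \<tau> t x = \<sigma> t x) \<and> supp_bisection \<Gamma> (\<tau> t) \<subseteq> V
             else
               \<forall>K' \<epsilon>'. compact K' \<and> \<epsilon>' > 0 \<longrightarrow>
                 (\<exists>\<tau>\<in>isotopies r \<Gamma> G. \<forall>t. close K' \<epsilon>' U (\<tau> t) (\<sigma> t) \<and>
                    close K' \<epsilon>' (- V) (\<tau> t) (unit_at \<Gamma>))))))"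

text \<open>The \<open>k\<close> below is unique: the fibre contains \<open>unit_at \<Gamma> x\<close>, so its dimension is determined.\<close>

definition fiberwise_transitive :: "regularity \<Rightarrow>
    ('g::topological_space, 'm::topological_space) groupoid \<Rightarrow> ('m \<Rightarrow> 'g) set \<Rightarrow> bool" where
  "fiberwise_transitive r \<Gamma> G \<longleftrightarrow>
     (\<forall>x. \<exists>k. submanifold_dim r (arrows \<Gamma>) (src_fibre \<Gamma> x) k \<and>
        (\<exists>\<sigma> :: nat \<Rightarrow> real \<Rightarrow> 'm \<Rightarrow> 'g. (\<forall>i<k. \<sigma> i \<in> isotopies r \<Gamma> G) \<and>
           independent_velocities (arrows \<Gamma>) (unit_at \<Gamma> x) k (\<lambda>i t. \<sigma> i t x)))"

end

theory Submission imports Defs begin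

text \<open>
  A bisection \<open>\<sigma>\<close> acts on arrows by \<open>h \<mapsto> \<sigma> (tgt h) . h\<close>. This is an action of the group of bisections,
  it preserves every source fibre, and it sends the unit at \<open>x\<close> to \<open>\<sigma> x\<close>. The theorem therefore says
  that \<open>G\<close> can move the unit at \<open>x\<close> to any other arrow of the connected component of the source fibre.
  Being joined by a member of \<open>G\<close> is transitive, so on a connected space it relates all points as soon
  as every point has a neighbourhood in which any two points are joined
  (\<open>unit_joined_to_component\<close>). Right translations commute with the action, hence it suffices to
  prove this local statement at the units (\<open>joined_locally\<close>, \<open>local_moves\<close>).

  At the unit of \<open>y\<close>, fibrewise transitivity provides isotopies \<open>\<sigma>\<^sup>1, \<dots>, \<sigma>\<^sup>k\<close> whose velocities form a
  basis of the tangent space of the fibre. In a chart of the arrows adapted to the fibre,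
  \<open>\<sigma>\<^sup>i\<close> at time \<open>t\<close> translates all arrows near the unit by \<open>t v\<^sub>i\<close> up to an error \<open>\<epsilon> \<bar>t\<bar>\<close>
  (\<open>act_first_order\<close>), so that the composition of the \<open>k\<close> actions at times \<open>t\<^sub>1, \<dots>, t\<^sub>k\<close> is a small
  perturbation of the translation by \<open>\<Sum> t\<^sub>i v\<^sub>i\<close>. By Brouwer's fixed point theorem it still reaches
  every arrow near the starting point (\<open>iterated_approximate_translations_onto\<close>). Brouwer's theorem
  replaces the inverse function theorem because its conclusion is stable: one neighbourhood of the
  unit serves all continuous families that are uniformly close to the given ones.

  Stability is what the control of \<open>tgt \<Gamma> \<circ> \<sigma>\<close> rests on. Let \<open>V\<close> be a neighbourhood of the leaf. The
  (L)-condition turns \<open>\<sigma>\<^sup>i\<close> into an isotopy supported in \<open>V\<close> that agrees with \<open>\<sigma>\<^sup>i\<close> near \<open>y\<close>; in the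
  analytic case it only yields an isotopy that is close to \<open>\<sigma>\<^sup>i\<close> near \<open>y\<close> and close to the units
  outside \<open>V\<close>, and the neighbourhood of the unit must not shrink with the required closeness.
  The (L)-condition applies to isotopies that are close to the units at all times, so time is first
  reparametrised by \<open>t \<mapsto> a sin t\<close> with a small \<open>a > 0\<close>: this is analytic and bounded, and it only
  scales the velocities at time \<open>0\<close>.

  In the analytic case the closeness has to survive products of bisections whose number depends on
  the arrow that is to be reached. The relation \<open>joined\<close> therefore asks for arbitrarily good
  closeness to the identity on the compact subsets of some open neighbourhood of the complement of
  \<open>V\<close>; a product of two bisections is as close as required on \<open>K\<close> if both factors are close enough
  on a slightly larger compact set (\<open>composition_of_maps_close_to_id\<close>).

  All first-order estimates are derived from strict differentials in charts. They express
  differentiability by an estimate for pairs of nearby points, which restricts to the set of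
  composable pairs of arrows and gives Lipschitz bounds at once.
\<close>

section \<open>Independent vectors and Brouwer's theorem on cubes\<close>

text \<open>Gaussian elimination: a vector with a nonzero last coordinate clears the last equation from the
  others, and is itself given the coefficient that makes the last equation hold.\<close>

lemma homogeneous_system_nontrivial_solution:
  fixes v :: "'i \<Rightarrow> nat \<Rightarrow> real"
  assumes "finite I" "card I > m"
  shows "\<exists>c. (\<exists>i\<in>I. c i \<noteq> 0) \<and> (\<forall>j<m. (\<Sum>i\<in>I. c i * v i j) = 0)"
  using assms
proof (induction m arbitrary: I v)
  case 0
  then have "I \<noteq> {}" by auto
  then show ?case by (intro exI[of _ "\<lambda>_. 1"]) auto
next
  case (Suc m)
  show ?case
  proof (cases "\<forall>i\<in>I. v i m = 0")
    case True
    obtain c where c: "\<exists>i\<in>I. c i \<noteq> 0" "\<forall>j<m. (\<Sum>i\<in>I. c i * v i j) = 0"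
      using Suc.IH[of I v] Suc.prems by auto
    with True show ?thesis by (intro exI[of _ c]) (auto simp: less_Suc_eq)
  next
    case False
    then obtain p where p: "p \<in> I" "v p m \<noteq> 0" by auto
    define v' where "v' = (\<lambda>i j. v i j - v i m / v p m * v p j)"
    have "card (I - {p}) > m" using Suc.prems p by auto
    then obtain c where c: "\<exists>i\<in>I-{p}. c i \<noteq> 0" "\<forall>j<m. (\<Sum>i\<in>I-{p}. c i * v' i j) = 0"
      using Suc.IH[of "I-{p}" v'] Suc.prems by auto
    define s where "s = (\<Sum>i\<in>I-{p}. c i * (v i m / v p m))"
    define c' where "c' = c(p := - s)"
    have eq: "(\<Sum>i\<in>I. c' i * v i j) = (\<Sum>i\<in>I-{p}. c i * v' i j)" for j
    proof -
      have "(\<Sum>i\<in>I. c' i * v i j) = c' p * v p j + (\<Sum>i\<in>I-{p}. c' i * v i j)"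
        using p Suc.prems by (simp add: sum.remove)
      also have "(\<Sum>i\<in>I-{p}. c' i * v i j) = (\<Sum>i\<in>I-{p}. c i * v i j)"
        by (rule sum.cong) (auto simp: c'_def)
      also have "c' p * v p j = - (\<Sum>i\<in>I-{p}. c i * (v i m / v p m) * v p j)"
        by (simp add: c'_def s_def sum_distrib_right)
      finally show ?thesis
        by (simp add: v'_def algebra_simps sum_subtractf)
    qed
    have "\<exists>i\<in>I. c' i \<noteq> 0" using c(1) by (auto simp: c'_def)
    moreover have "(\<Sum>i\<in>I. c' i * v i j) = 0" if "j < Suc m" for j
    proof (cases "j = m")
      case True
      then show ?thesis unfolding eq by (auto simp: v'_def p)
    next
      case False
      with that c(2) show ?thesis unfolding eq by auto
    qed
    ultimately show ?thesis by blast
  qed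
qed

text \<open>The rows of \<open>A\<close> together with \<open>w\<close> are more than \<open>k\<close> vectors in a space of dimension \<open>k\<close>, so they
  satisfy a linear relation; by independence it involves \<open>w\<close>. Thus \<open>A\<close> generates the space, and \<open>B\<close>
  collects the coordinates of the standard basis.\<close>

lemma independent_vectors_dual_basis:
  fixes A :: "nat \<Rightarrow> nat \<Rightarrow> real"
  assumes ind: "\<And>a. (\<forall>j<k. (\<Sum>i<k. a i * A i j) = 0) \<Longrightarrow> \<forall>i<k. a i = 0"
  obtains B where "\<And>w j. j < k \<Longrightarrow> (\<Sum>i<k. (\<Sum>m<k. B i m * w m) * A i j) = w j"
    and "\<And>t i. i < k \<Longrightarrow> (\<Sum>m<k. B i m * (\<Sum>l<k. t l * A l m)) = t i"
proof -
  have "\<exists>t. \<forall>j<k. (\<Sum>i<k. t i * A i j) = w j" for w :: "nat \<Rightarrow> real"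
  proof -
    define v where "v = (\<lambda>i. if i < k then A i else w)"
    obtain c where c: "\<exists>i\<in>{..k}. c i \<noteq> 0" "\<forall>j<k. (\<Sum>i\<le>k. c i * v i j) = 0"
      using homogeneous_system_nontrivial_solution[of "{..k}" k v] by auto
    have sp: "(\<Sum>i\<le>k. c i * v i j) = (\<Sum>i<k. c i * A i j) + c k * w j" for j
      by (simp add: lessThan_Suc_atMost[symmetric] v_def)
    have "c k \<noteq> 0"
    proof
      assume "c k = 0"
      have "\<forall>i<k. c i = 0" by (rule ind) (use c(2) sp \<open>c k = 0\<close> in auto)
      with \<open>c k = 0\<close> c(1) show False by (metis atMost_iff le_neq_implies_less)
    qed
    moreover have "(\<Sum>i<k. (- c i / c k) * A i j) = - (\<Sum>i<k. c i * A i j) / c k" for j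
      by (simp add: sum_negf sum_divide_distrib)
    moreover have "(\<Sum>i<k. c i * A i j) = - c k * w j" if "j < k" for j
      using c(2) that unfolding sp by (simp add: eq_neg_iff_add_eq_0)
    ultimately have "\<forall>j<k. (\<Sum>i<k. (- c i / c k) * A i j) = w j"
      by (metis (no_types, lifting) minus_minus minus_mult_left nonzero_mult_div_cancel_left)
    then show ?thesis by (intro exI[of _ "\<lambda>i. - c i / c k"])
  qed
  then obtain T where T: "\<And>w j. j < k \<Longrightarrow> (\<Sum>i<k. T w i * A i j) = (w j :: real)"
    by metis
  define B where "B = (\<lambda>i m. T (\<lambda>j. if j = m then 1 else 0) i)"
  have B: "(\<Sum>i<k. (\<Sum>m<k. B i m * w m) * A i j) = w j" if "j < k" for w j
  proof -
    have "(\<Sum>i<k. (\<Sum>m<k. B i m * w m) * A i j) = (\<Sum>m<k. w m * (\<Sum>i<k. B i m * A i j))"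
      unfolding sum_distrib_left sum_distrib_right by (subst sum.swap) (simp only: mult_ac)
    also have "\<dots> = (\<Sum>m<k. w m * (if j = m then 1 else 0))"
      by (rule sum.cong) (use T that in \<open>auto simp: B_def\<close>)
    finally show ?thesis using that by (simp add: if_distrib cong: if_cong)
  qed
  have "(\<Sum>m<k. B i m * (\<Sum>l<k. t l * A l m)) = t i" if "i < k" for t i
  proof -
    let ?s = "\<lambda>i. (\<Sum>m<k. B i m * (\<Sum>l<k. t l * A l m))"
    have "\<forall>i<k. ?s i - t i = 0"
      by (rule ind) (auto simp: left_diff_distrib sum_subtractf B)
    then show ?thesis using that by auto
  qed
  with B that show ?thesis by blast
qed

definition coord_cube :: "nat \<Rightarrow> real \<Rightarrow> (nat \<Rightarrow> real) set" where
  "coord_cube n d = {x. (\<forall>i<n. \<bar>x i\<bar> \<le> d) \<and> (\<forall>i\<ge>n. x i = 0)}"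

lemma compact_coordinate_box:
  fixes u :: "nat \<Rightarrow> real"
  shows "compact {x. (\<forall>i<n. \<bar>x i - u i\<bar> \<le> d) \<and> (\<forall>i\<ge>n. x i = 0)}"
proof -
  have "{x. (\<forall>i<n. \<bar>x i - u i\<bar> \<le> d) \<and> (\<forall>i\<ge>n. x i = 0)}
      = PiE UNIV (\<lambda>i. if i < n then {u i - d .. u i + d} else {0})"
  proof (rule Set.set_eqI)
    fix x :: "nat \<Rightarrow> real"
    have "x \<in> PiE UNIV (\<lambda>i. if i < n then {u i - d .. u i + d} else {0})
        \<longleftrightarrow> (\<forall>i. x i \<in> (if i < n then {u i - d .. u i + d} else {0}))"
      by (simp add: PiE_UNIV_domain Pi_iff)
    also have "\<dots> \<longleftrightarrow> (\<forall>i. (i < n \<longrightarrow> \<bar>x i - u i\<bar> \<le> d) \<and> (n \<le> i \<longrightarrow> x i = 0))"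
      by (intro all_cong1) (simp add: abs_diff_le_iff)
    finally show "x \<in> {x. (\<forall>i<n. \<bar>x i - u i\<bar> \<le> d) \<and> (\<forall>i\<ge>n. x i = 0)}
        \<longleftrightarrow> x \<in> PiE UNIV (\<lambda>i. if i < n then {u i - d .. u i + d} else {0})"
      by auto
  qed
  moreover have "compactin (product_topology (\<lambda>i. euclidean) UNIV)
      (PiE UNIV (\<lambda>i. if i < n then {u i - d .. u i + d} else {0::real}))"
    by (subst compactin_PiE) (auto simp: compactin_euclidean_iff)
  ultimately show ?thesis
    by (simp add: euclidean_product_topology compactin_euclidean_iff)
qed

lemma compact_coord_cube: "compact (coord_cube n d)"
  using compact_coordinate_box[of n "\<lambda>_. 0" d] by (simp add: coord_cube_def)

lemma tendsto_nat_fun_iff: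
  fixes f :: "'a \<Rightarrow> nat \<Rightarrow> real"
  shows "(f \<longlongrightarrow> l) F \<longleftrightarrow> (\<forall>i. ((\<lambda>x. f x i) \<longlongrightarrow> l i) F)"
proof -
  have "(f \<longlongrightarrow> l) F \<longleftrightarrow> limitin (product_topology (\<lambda>i. euclidean) UNIV) f l F"
    by (simp add: euclidean_product_topology)
  also have "\<dots> \<longleftrightarrow> (\<forall>i. ((\<lambda>x. f x i) \<longlongrightarrow> l i) F)"
    by (subst limitin_componentwise) auto
  finally show ?thesis .
qed

text \<open>Kuhn's combinatorial lemma on finer and finer grids. A vertex is labelled in direction \<open>i\<close> by the
  sign of \<open>f x i - x i\<close>; a completely labelled cell has both signs in every direction, so at a limit of
  such cells \<open>f x i = x i\<close>.\<close>

lemma brouwer_coord_cube: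
  fixes f :: "(nat \<Rightarrow> real) \<Rightarrow> nat \<Rightarrow> real"
  assumes d: "d > 0"
    and cont: "\<And>i. i < n \<Longrightarrow> continuous_on (coord_cube n d) (\<lambda>x. f x i)"
    and maps: "\<And>x i. x \<in> coord_cube n d \<Longrightarrow> i < n \<Longrightarrow> \<bar>f x i\<bar> \<le> d"
  shows "\<exists>x\<in>coord_cube n d. \<forall>i<n. f x i = x i"
proof -
  define grid where "grid = (\<lambda>p (r::nat\<Rightarrow>nat) i. if i < n then - d + 2 * d * real (r i) / real p else 0)"
  define label where "label = (\<lambda>p r i. if r i = p then 1
      else if grid p r i \<le> f (grid p r) i then 0 else 1::nat)"
  have grid_in: "grid p r \<in> coord_cube n d" if "0 < p" "\<forall>i<n. r i \<le> p" for p r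
  proof -
    have "\<bar>- d + 2 * d * real (r i) / real p\<bar> \<le> d" if "i < n" for i
    proof -
      have x: "0 \<le> real (r i) / real p" "real (r i) / real p \<le> 1"
        using \<open>0 < p\<close> \<open>\<forall>i<n. r i \<le> p\<close> that by auto
      have "0 \<le> 2 * d * (real (r i) / real p)" "2 * d * (real (r i) / real p) \<le> 2 * d * 1"
        using x d by (intro mult_nonneg_nonneg mult_left_mono; simp)+
      then show ?thesis by simp
    qed
    then show ?thesis by (simp add: coord_cube_def grid_def)
  qed
  define full where "full = (\<lambda>p q. \<forall>i<n. \<exists>r s. (\<forall>j<n. q j \<le> r j \<and> r j \<le> q j + 1) \<and>
      (\<forall>j<n. q j \<le> s j \<and> s j \<le> q j + 1) \<and> label p r i \<noteq> label p s i)"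
  have "\<exists>q. (\<forall>i<n. q i < p) \<and> full p q" if "0 < p" for p
    unfolding full_def
  proof (rule kuhn_lemma[of p n "label p"])
    show "\<forall>x. (\<forall>i<n. x i \<le> p) \<longrightarrow> (\<forall>i<n. x i = 0 \<longrightarrow> label p x i = 0)"
    proof (intro allI impI)
      fix x i assume x: "\<forall>i<n. x i \<le> p" "i < n" "x i = 0"
      have "grid p x i = - d" using x by (simp add: grid_def)
      moreover have "\<bar>f (grid p x) i\<bar> \<le> d" using grid_in[OF that x(1)] maps x by auto
      ultimately show "label p x i = 0" using that x by (auto simp: label_def)
    qed
  next
    show "\<forall>x. (\<forall>i<n. x i \<le> p) \<longrightarrow> (\<forall>i<n. label p x i = 0 \<or> label p x i = 1)"
      "\<forall>x. (\<forall>i<n. x i \<le> p) \<longrightarrow> (\<forall>i<n. x i = p \<longrightarrow> label p x i = 1)"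
      by (auto simp: label_def)
  qed (use that in blast)+
  then obtain q where q: "\<And>p i. 0 < p \<Longrightarrow> i < n \<Longrightarrow> q p i < p" and "\<And>p. 0 < p \<Longrightarrow> full p (q p)"
    by metis
  then have q2: "\<exists>r s. (\<forall>j<n. q p j \<le> r j \<and> r j \<le> q p j + 1) \<and>
      (\<forall>j<n. q p j \<le> s j \<and> s j \<le> q p j + 1) \<and> label p r i \<noteq> label p s i"
    if "0 < p" "i < n" for p i
    using that unfolding full_def by blast
  define adj where "adj = (\<lambda>p c. \<forall>j<n. q p j \<le> c j \<and> c j \<le> q p j + 1)"
  define pair where "pair = (\<lambda>p i a b. adj p a \<and> adj p b \<and>
      grid p a i \<le> f (grid p a) i \<and> f (grid p b) i \<le> grid p b i)"
  have "\<exists>a b. pair p i a b" if "0 < p" "i < n" for p i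
  proof -
    have up: "grid p a i \<le> f (grid p a) i" if "label p a i = 0" for a
      using that by (auto simp: label_def split: if_splits)
    have lo: "f (grid p a) i \<le> grid p a i"
      if "label p a i \<noteq> 0" "\<forall>j<n. q p j \<le> a j \<and> a j \<le> q p j + 1" for a
    proof (cases "a i = p")
      case True
      have "\<forall>j<n. a j \<le> p" using that(2) q[OF \<open>0 < p\<close>] by fastforce
      then have "\<bar>f (grid p a) i\<bar> \<le> d" using grid_in maps \<open>0<p\<close> \<open>i<n\<close> by auto
      moreover have "grid p a i = d" using True \<open>0<p\<close> \<open>i<n\<close> by (simp add: grid_def)
      ultimately show ?thesis by auto
    qed (use that in \<open>auto simp: label_def split: if_splits\<close>)
    have "label p a i = 0 \<or> label p a i = 1" for a by (auto simp: label_def)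
    moreover obtain r s where "adj p r" "adj p s" "label p r i \<noteq> label p s i"
      using q2[OF \<open>0 < p\<close> \<open>i < n\<close>] unfolding adj_def by blast
    ultimately show ?thesis using up lo unfolding adj_def pair_def by metis
  qed
  then obtain a b where "\<And>p i. 0 < p \<Longrightarrow> i < n \<Longrightarrow> pair p i (a p i) (b p i)"
    by metis
  then have adj: "\<And>p i. 0 < p \<Longrightarrow> i < n \<Longrightarrow> adj p (a p i)" "\<And>p i. 0 < p \<Longrightarrow> i < n \<Longrightarrow> adj p (b p i)"
    and ab: "\<And>p i. 0 < p \<Longrightarrow> i < n \<Longrightarrow> grid p (a p i) i \<le> f (grid p (a p i)) i"
      "\<And>p i. 0 < p \<Longrightarrow> i < n \<Longrightarrow> f (grid p (b p i)) i \<le> grid p (b p i) i"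
    unfolding pair_def by blast+
  have a: "\<And>p i j. 0 < p \<Longrightarrow> i < n \<Longrightarrow> j < n \<Longrightarrow> q p j \<le> a p i j \<and> a p i j \<le> q p j + 1"
    and b: "\<And>p i j. 0 < p \<Longrightarrow> i < n \<Longrightarrow> j < n \<Longrightarrow> q p j \<le> b p i j \<and> b p i j \<le> q p j + 1"
    using adj unfolding adj_def by blast+
  have "seq_compact (coord_cube n d)"
    using compact_coord_cube compact_eq_seq_compact_metric by blast
  moreover have "grid (Suc m) (q (Suc m)) \<in> coord_cube n d" for m
    using q by (auto intro!: grid_in less_imp_le)
  ultimately obtain x s where x: "x \<in> coord_cube n d" "strict_mono (s :: nat \<Rightarrow> nat)"
    "((\<lambda>m. grid (Suc m) (q (Suc m))) \<circ> s) \<longlonglongrightarrow> x"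
    using seq_compactE[of "coord_cube n d" "\<lambda>m. grid (Suc m) (q (Suc m))"] by blast
  define z where "z = (\<lambda>m. grid (Suc (s m)) (q (Suc (s m))))"
  have z: "(\<lambda>m. z m i) \<longlonglongrightarrow> x i" for i
    using x(3) unfolding tendsto_nat_fun_iff o_def z_def by auto
  have near: "(\<lambda>m. grid (Suc (s m)) (c (Suc (s m)))) \<longlonglongrightarrow> x"
    "\<And>m. grid (Suc (s m)) (c (Suc (s m))) \<in> coord_cube n d"
    if c: "\<And>p j. 0 < p \<Longrightarrow> j < n \<Longrightarrow> q p j \<le> c p j \<and> c p j \<le> q p j + 1" for c
  proof -
    show "\<And>m. grid (Suc (s m)) (c (Suc (s m))) \<in> coord_cube n d"
    proof (rule grid_in)
      show "\<forall>i<n. c (Suc (s m)) i \<le> Suc (s m)" for m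
        using c[of "Suc (s m)"] q[of "Suc (s m)"] by fastforce
    qed simp
    have "(\<lambda>m. grid (Suc (s m)) (c (Suc (s m))) i) \<longlonglongrightarrow> x i" for i
    proof (cases "i < n")
      case True
      have "(\<lambda>m. 2 * d * inverse (real (Suc (s m)))) \<longlonglongrightarrow> 2 * d * 0"
        by (intro tendsto_mult tendsto_const)
           (rule LIMSEQ_subseq_LIMSEQ[OF LIMSEQ_inverse_real_of_nat x(2), unfolded o_def])
      then have lim: "(\<lambda>m. 2 * d * inverse (real (Suc (s m)))) \<longlonglongrightarrow> 0" by simp
      have "(\<lambda>m. grid (Suc (s m)) (c (Suc (s m))) i - z m i) \<longlonglongrightarrow> 0"
      proof (rule Lim_null_comparison[OF always_eventually lim], rule allI)
        fix m
        let ?p = "Suc (s m)"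
        have eq: "grid ?p (c ?p) i - z m i = 2 * d * (real (c ?p i) - real (q ?p i)) * inverse (real ?p)"
          using True unfolding z_def grid_def by (simp add: field_simps del: of_nat_Suc)
        have le: "0 \<le> real (c ?p i) - real (q ?p i)" "real (c ?p i) - real (q ?p i) \<le> 1"
          using c[of ?p i] True by auto
        have "2 * d * (real (c ?p i) - real (q ?p i)) * inverse (real ?p) \<le> 2 * d * 1 * inverse (real ?p)"
          using d le by (intro mult_right_mono mult_left_mono) auto
        then show "norm (grid ?p (c ?p) i - z m i) \<le> 2 * d * inverse (real ?p)"
          unfolding eq using d le by (simp add: abs_mult del: of_nat_Suc)
      qed
      from tendsto_add[OF this z[of i]] show ?thesis by simp
    next
      case False
      then have "x i = 0" using x(1) by (auto simp: coord_cube_def)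
      with False show ?thesis by (simp add: grid_def)
    qed
    then show "(\<lambda>m. grid (Suc (s m)) (c (Suc (s m)))) \<longlonglongrightarrow> x"
      unfolding tendsto_nat_fun_iff by blast
  qed
  have "f x i = x i" if i: "i < n" for i
  proof -
    have lim: "(\<lambda>m. f (grid (Suc (s m)) (c (Suc (s m)))) i) \<longlonglongrightarrow> f x i"
      "(\<lambda>m. grid (Suc (s m)) (c (Suc (s m))) i) \<longlonglongrightarrow> x i"
      if c: "\<And>p j. 0 < p \<Longrightarrow> j < n \<Longrightarrow> q p j \<le> c p j \<and> c p j \<le> q p j + 1" for c
      using continuous_on_tendsto_compose[OF cont[OF i] near(1)[OF c] x(1)] near(2)[OF c]
        near(1)[OF c, unfolded tendsto_nat_fun_iff] by auto
    have "x i \<le> f x i"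
      by (rule LIMSEQ_le[OF lim(2)[of "\<lambda>p. a p i"] lim(1)[of "\<lambda>p. a p i"]]) (use a ab i in auto)
    moreover have "f x i \<le> x i"
      by (rule LIMSEQ_le[OF lim(1)[of "\<lambda>p. b p i"] lim(2)[of "\<lambda>p. b p i"]]) (use b ab i in auto)
    ultimately show ?thesis by auto
  qed
  with x show ?thesis by blast
qed

section \<open>Charts and compact neighbourhoods\<close>

lemma common_radius:
  fixes P :: "nat \<Rightarrow> real \<Rightarrow> bool"
  assumes ex: "\<And>i. i < n \<Longrightarrow> \<exists>r>0. P i r" and mono: "\<And>i r s. P i r \<Longrightarrow> 0 < s \<Longrightarrow> s \<le> r \<Longrightarrow> P i s"
  shows "\<exists>r>0. \<forall>i<n. P i r"
proof -
  have "m \<le> n \<Longrightarrow> \<exists>r>0. \<forall>i<m. P i r" for m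
  proof (induction m)
    case 0
    show ?case by (intro exI[of _ 1]) simp
  next
    case (Suc m)
    then obtain r where r: "r > 0" "\<forall>i<m. P i r" by auto
    obtain s where s: "s > 0" "P m s" using ex[of m] Suc by auto
    have "\<forall>i<Suc m. P i (min r s)"
      using r s mono[of _ r "min r s"] mono[of m s "min r s"] by (auto simp: less_Suc_eq)
    then show ?case using r s by (intro exI[of _ "min r s"]) auto
  qed
  then show ?thesis by auto
qed

lemma Euclidean_space_eq: "Euclidean_space n = top_of_set {u. \<forall>i\<ge>n. u i = 0}"
  by (simp add: Euclidean_space_def euclidean_product_topology)

lemma subtopology_Euclidean_space:
  "openin (Euclidean_space n) D \<Longrightarrow> subtopology (Euclidean_space n) D = top_of_set D"
  using openin_subset[of "Euclidean_space n" D] unfolding Euclidean_space_eq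
  by (simp add: subtopology_subtopology Int_absorb1)

lemma openin_Euclidean_space_preimage:
  assumes D: "openin (Euclidean_space n) D" and g: "continuous_on D g" and T: "open T"
  shows "openin (Euclidean_space n) {v \<in> D. g v \<in> T}"
proof -
  have "openin (top_of_set D) (D \<inter> g -` T)" by (rule continuous_openin_preimage_gen[OF g T])
  then have "openin (Euclidean_space n) (D \<inter> g -` T)"
    using D unfolding subtopology_Euclidean_space[OF D, symmetric] by (rule openin_trans_full)
  then show ?thesis by (simp add: Int_def vimage_def)
qed

definition coord_box :: "nat \<Rightarrow> (nat \<Rightarrow> real) \<Rightarrow> real \<Rightarrow> (nat \<Rightarrow> real) set" where
  "coord_box n u r = {v. (\<forall>i<n. \<bar>v i - u i\<bar> < r) \<and> (\<forall>i\<ge>n. v i = 0)}"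

lemma coord_box_mono: "s \<le> r \<Longrightarrow> coord_box n u s \<subseteq> coord_box n u r"
  unfolding coord_box_def by (auto intro: less_le_trans)

text \<open>Open sets of \<open>nat \<Rightarrow> real\<close> restrict only finitely many coordinates; on \<open>Euclidean_space n\<close> the
  coordinates beyond \<open>n\<close> vanish, so one radius for the first \<open>n\<close> of them is enough.\<close>

lemma openin_Euclidean_space_coord_box:
  assumes "openin (Euclidean_space n) D" "u \<in> D"
  obtains r where "r > 0" "coord_box n u r \<subseteq> D"
proof -
  obtain T where T: "open T" "D = {u. \<forall>i\<ge>n. u i = 0} \<inter> T"
    using assms(1) unfolding Euclidean_space_eq openin_open by blast
  have "openin (product_topology (\<lambda>i. euclidean) UNIV) T"
    using T(1) by (simp add: euclidean_product_topology)
  moreover have "u \<in> T" using assms T by auto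
  ultimately obtain X where X: "u \<in> (\<Pi>\<^sub>E i\<in>UNIV. X i)" "\<And>i. open (X i)" "(\<Pi>\<^sub>E i\<in>UNIV. X i) \<subseteq> T"
    by (drule_tac product_topology_open_contains_basis) auto
  have "\<exists>r>0. \<forall>y. \<bar>y - u i\<bar> < r \<longrightarrow> y \<in> X i" for i
  proof -
    have "u i \<in> X i" using X(1) by (auto simp: PiE_UNIV_domain)
    then obtain r where "r > 0" "ball (u i) r \<subseteq> X i"
      using X(2)[of i] unfolding open_contains_ball by blast
    then show ?thesis by (intro exI[of _ r]) (auto simp: subset_iff dist_real_def abs_minus_commute)
  qed
  then have "\<exists>R>0. \<forall>i<n. \<forall>y. \<bar>y - u i\<bar> < R \<longrightarrow> y \<in> X i"
    by (intro common_radius) (auto intro: less_le_trans)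
  then obtain R where "R > 0" and R: "\<And>i. i < n \<Longrightarrow> \<forall>y. \<bar>y - u i\<bar> < R \<longrightarrow> y \<in> X i"
    by auto
  have "coord_box n u R \<subseteq> D"
  proof
    fix v assume v: "v \<in> coord_box n u R"
    have "v i \<in> X i" for i
    proof (cases "i < n")
      case True
      then show ?thesis using v R[of i] by (auto simp: coord_box_def)
    next
      case False
      moreover have "u i = 0" using False assms T by auto
      ultimately have "v i = u i" using v by (simp add: coord_box_def)
      then show ?thesis using X(1) by (auto simp: PiE_UNIV_domain)
    qed
    then have "v \<in> T" using X(3) by (auto simp: PiE_UNIV_domain)
    with v show "v \<in> D" unfolding T by (auto simp: coord_box_def)
  qed
  with \<open>R > 0\<close> that show thesis by blast
qed

lemma continuous_on_nat_fun_iff: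
  fixes f :: "'a::topological_space \<Rightarrow> nat \<Rightarrow> real"
  shows "continuous_on S f \<longleftrightarrow> (\<forall>i. continuous_on S (\<lambda>x. f x i))"
  unfolding continuous_on_def tendsto_nat_fun_iff by blast

lemma is_chartD:
  assumes "is_chart n c"
  shows "open (fst c)" "inj_on (snd c) (fst c)" "continuous_on (fst c) (snd c)"
    "openin (Euclidean_space n) (snd c ` fst c)"
    "\<And>q i. q \<in> fst c \<Longrightarrow> i \<ge> n \<Longrightarrow> snd c q i = 0"
    "\<And>W. open W \<Longrightarrow> W \<subseteq> fst c \<Longrightarrow> openin (Euclidean_space n) (snd c ` W)"
    "continuous_on (snd c ` fst c) (inv_into (fst c) (snd c))"
proof -
  obtain U \<phi> where c: "c = (U, \<phi>)" by (cases c)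
  have U: "open U" and im: "openin (Euclidean_space n) (\<phi> ` U)"
    and hom: "homeomorphic_map (top_of_set U) (subtopology (Euclidean_space n) (\<phi> ` U)) \<phi>"
    using assms unfolding is_chart_def c by auto
  have sub: "\<phi> ` U \<subseteq> {u. \<forall>i\<ge>n. u i = 0}" using openin_subset[OF im] by (simp add: topspace_Euclidean_space)
  have eq: "subtopology (Euclidean_space n) (\<phi> ` U) = top_of_set (\<phi> ` U)"
    unfolding Euclidean_space_eq using sub by (simp add: subtopology_subtopology Int_absorb1)
  show "open (fst c)" "openin (Euclidean_space n) (snd c ` fst c)" using U im c by auto
  show inj: "inj_on (snd c) (fst c)" using hom c by (simp add: homeomorphic_eq_everything_map)
  show "continuous_on (fst c) (snd c)"
    using hom unfolding c eq by (simp add: homeomorphic_eq_everything_map)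
  show "\<And>q i. q \<in> fst c \<Longrightarrow> i \<ge> n \<Longrightarrow> snd c q i = 0" using sub c by auto
  show "openin (Euclidean_space n) (snd c ` W)" if "open W" "W \<subseteq> fst c" for W
  proof -
    have "open_map (top_of_set U) (top_of_set (\<phi> ` U)) \<phi>"
      using hom unfolding eq by (rule homeomorphic_imp_open_map)
    moreover have "openin (top_of_set U) W"
      using that U c by (simp add: openin_open_eq)
    ultimately have "openin (top_of_set (\<phi> ` U)) (\<phi> ` W)" by (simp add: open_map_def)
    then show ?thesis
      using im unfolding eq[symmetric] c snd_conv by (rule openin_trans_full)
  qed
  obtain g where g: "homeomorphic_maps (top_of_set U) (top_of_set (\<phi> ` U)) \<phi> g"
    using hom unfolding eq homeomorphic_map_maps by auto
  then have "continuous_on (\<phi> ` U) g" "\<And>x. x \<in> U \<Longrightarrow> g (\<phi> x) = x"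
    unfolding homeomorphic_maps_def by auto
  then show "continuous_on (snd c ` fst c) (inv_into (fst c) (snd c))"
    by (subst continuous_on_cong[OF refl, of _ _ g]) (use inj c in auto)
qed

lemma chart_inv [simp]:
  "is_chart n c \<Longrightarrow> q \<in> fst c \<Longrightarrow> inv_into (fst c) (snd c) (snd c q) = q"
  by (simp add: inv_into_f_f is_chartD(2))

lemma coord_rep_chart [simp]:
  "is_chart n c \<Longrightarrow> q \<in> fst c \<Longrightarrow> coord_rep c c' F (snd c q) = snd c' (F q)"
  by (simp add: coord_rep_def)

lemma continuous_on_chart_coord: "is_chart n c \<Longrightarrow> continuous_on (fst c) (\<lambda>q. snd c q i)"
  using is_chartD(3)[of n c] unfolding continuous_on_nat_fun_iff[of "fst c" "snd c"] by blast

lemma chart_nbhd_surj: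
  assumes c: "is_chart n c" "p \<in> fst c" and W: "open W" "p \<in> W"
  obtains r where "r > 0" "\<And>v. v \<in> coord_box n (snd c p) r \<Longrightarrow> \<exists>q\<in>fst c \<inter> W. snd c q = v"
proof -
  have "openin (Euclidean_space n) (snd c ` (fst c \<inter> W))"
    using is_chartD(1,6)[OF c(1)] W by auto
  moreover have "snd c p \<in> snd c ` (fst c \<inter> W)" using c W by auto
  ultimately obtain r where "r > 0" "coord_box n (snd c p) r \<subseteq> snd c ` (fst c \<inter> W)"
    by (rule openin_Euclidean_space_coord_box)
  with that show thesis by fast
qed

text \<open>The coordinates of a chart recover the topology near a point.\<close>

lemma chart_nbhd_sub:
  assumes c: "is_chart n c" "p \<in> fst c" and W: "open W" "p \<in> W"
  obtains r where "r > 0" "\<And>q. q \<in> fst c \<Longrightarrow> (\<forall>i<n. \<bar>snd c q i - snd c p i\<bar> < r) \<Longrightarrow> q \<in> W"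
proof -
  obtain r where r: "r > 0" "\<And>v. v \<in> coord_box n (snd c p) r \<Longrightarrow> \<exists>q\<in>fst c \<inter> W. snd c q = v"
    using chart_nbhd_surj[OF assms] by blast
  have "q \<in> W" if q: "q \<in> fst c" "\<forall>i<n. \<bar>snd c q i - snd c p i\<bar> < r" for q
  proof -
    have "snd c q \<in> coord_box n (snd c p) r"
      using q is_chartD(5)[OF c(1)] by (auto simp: coord_box_def)
    then obtain q' where "q' \<in> fst c \<inter> W" "snd c q' = snd c q" using r by blast
    then show ?thesis using is_chartD(2)[OF c(1)] q by (auto dest: inj_onD)
  qed
  with r that show thesis by blast
qed

lemma open_chart_nbhd:
  assumes c: "is_chart n c" and r: "\<And>i. i < n \<Longrightarrow> continuous_on (fst c) (g i :: _ \<Rightarrow> real)"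
  shows "open {q \<in> fst c. \<forall>i<n. g i q < r}"
proof -
  have "open (fst c \<inter> (\<Inter>i\<in>{..<n}. fst c \<inter> g i -` {..<r}))"
    using is_chartD(1)[OF c] r
    by (intro open_Int open_INT ballI continuous_open_preimage) auto
  moreover have "{q \<in> fst c. \<forall>i<n. g i q < r} = fst c \<inter> (\<Inter>i\<in>{..<n}. fst c \<inter> g i -` {..<r})"
    by auto
  ultimately show ?thesis by simp
qed

text \<open>A manifold is locally compact: a closed coordinate box is compact and the inverse of a chart is
  continuous.\<close>

lemma chart_compact_nbhd:
  assumes c: "is_chart n c" "p \<in> fst c" and W: "open W" "p \<in> W"
  obtains Q W' where "compact Q" "open W'" "p \<in> W'" "W' \<subseteq> Q" "Q \<subseteq> W \<inter> fst c"
proof -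
  obtain r where r: "r > 0" "\<And>v. v \<in> coord_box n (snd c p) r \<Longrightarrow> \<exists>q\<in>fst c \<inter> W. snd c q = v"
    using chart_nbhd_surj[OF assms] by blast
  define B where "B = {x. (\<forall>i<n. \<bar>x i - snd c p i\<bar> \<le> r/2) \<and> (\<forall>i\<ge>n. x i = 0)}"
  have B: "B \<subseteq> coord_box n (snd c p) r" using r(1) unfolding B_def coord_box_def by force
  then have B2: "B \<subseteq> snd c ` (fst c \<inter> W)" using r by fast
  define Q where "Q = inv_into (fst c) (snd c) ` B"
  define W' where "W' = {q \<in> fst c. \<forall>i<n. \<bar>snd c q i - snd c p i\<bar> < r/2}"
  have "compact Q" unfolding Q_def
  proof (rule compact_continuous_image)
    show "continuous_on B (inv_into (fst c) (snd c))"
      by (rule continuous_on_subset[OF is_chartD(7)[OF c(1)]]) (use B2 in auto)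
    show "compact B" unfolding B_def by (rule compact_coordinate_box)
  qed
  moreover have "Q \<subseteq> W \<inter> fst c" using B2 c unfolding Q_def by force
  moreover have "open W'" unfolding W'_def
    by (rule open_chart_nbhd[OF c(1)]) (intro continuous_intros continuous_on_chart_coord[OF c(1)])
  moreover have "p \<in> W'" using c r by (auto simp: W'_def)
  moreover have "W' \<subseteq> Q"
  proof
    fix q assume q: "q \<in> W'"
    then have "snd c q \<in> B" using is_chartD(5)[OF c(1)] by (auto simp: W'_def B_def intro: less_imp_le)
    moreover have "inv_into (fst c) (snd c) (snd c q) = q" using q c by (auto simp: W'_def)
    ultimately show "q \<in> Q" unfolding Q_def by force
  qed
  ultimately show thesis using that by blast
qed


section \<open>Strict differentials in charts\<close>

definition l1norm :: "nat \<Rightarrow> (nat \<Rightarrow> real) \<Rightarrow> real" where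
  "l1norm n x = (\<Sum>i<n. \<bar>x i\<bar>)"

definition entry_norm :: "nat \<Rightarrow> nat \<Rightarrow> (nat \<Rightarrow> nat \<Rightarrow> real) \<Rightarrow> real" where
  "entry_norm m n A = (\<Sum>j<m. \<Sum>i<n. \<bar>A j i\<bar>)"

lemma l1norm_nonneg [simp]: "0 \<le> l1norm n x" by (simp add: l1norm_def sum_nonneg)
lemma entry_norm_nonneg [simp]: "0 \<le> entry_norm m n A" by (simp add: entry_norm_def sum_nonneg)

lemma l1norm_add: "l1norm n (\<lambda>i. x i + y i) \<le> l1norm n x + l1norm n y"
  unfolding l1norm_def sum.distrib[symmetric] by (intro sum_mono abs_triangle_ineq)

lemma l1norm_cong: "(\<And>i. i < n \<Longrightarrow> x i = y i) \<Longrightarrow> l1norm n x = l1norm n y"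
  by (simp add: l1norm_def)

lemma l1norm_minus_commute: "l1norm n (\<lambda>i. x i - y i) = l1norm n (\<lambda>i. y i - x i)"
  by (simp add: l1norm_def abs_minus_commute)

lemma l1norm_triangle: "l1norm n (\<lambda>i. x i - z i) \<le> l1norm n (\<lambda>i. x i - y i) + l1norm n (\<lambda>i. y i - z i)"
  using l1norm_add[of n "\<lambda>i. x i - y i" "\<lambda>i. y i - z i"] by simp

lemma l1norm_scale: "l1norm n (\<lambda>i. a * x i) = \<bar>a\<bar> * l1norm n x"
  by (simp add: l1norm_def abs_mult sum_distrib_left)

lemma abs_le_l1norm: "i < n \<Longrightarrow> \<bar>x i\<bar> \<le> l1norm n x"
  unfolding l1norm_def by (rule member_le_sum[of i "{..<n}" "\<lambda>i. \<bar>x i\<bar>"]) auto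

lemma l1norm_lin: "l1norm m (\<lambda>j. \<Sum>i<n. A j i * x i) \<le> entry_norm m n A * l1norm n x"
proof -
  have "\<bar>\<Sum>i<n. A j i * x i\<bar> \<le> (\<Sum>i<n. \<bar>A j i\<bar>) * l1norm n x" for j
  proof -
    have "\<bar>\<Sum>i<n. A j i * x i\<bar> \<le> (\<Sum>i<n. \<bar>A j i\<bar> * \<bar>x i\<bar>)"
      using sum_abs[of "\<lambda>i. A j i * x i" "{..<n}"] by (simp add: abs_mult)
    also have "\<dots> \<le> (\<Sum>i<n. \<bar>A j i\<bar> * l1norm n x)"
      by (intro sum_mono mult_left_mono abs_le_l1norm) auto
    finally show ?thesis by (simp add: sum_distrib_right)
  qed
  then have "l1norm m (\<lambda>j. \<Sum>i<n. A j i * x i) \<le> (\<Sum>j<m. (\<Sum>i<n. \<bar>A j i\<bar>) * l1norm n x)"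
    unfolding l1norm_def[of m] by (intro sum_mono)
  then show ?thesis by (simp add: entry_norm_def sum_distrib_right)
qed

text \<open>Strict differentiability at \<open>p\<close> of \<open>F\<close> in the coordinates \<open>x\<close> and \<open>y\<close>: the linear approximation is
  required for all pairs of points near \<open>p\<close>, not only for the pairs that contain \<open>p\<close>. A continuously
  differentiable function has this property, and it passes to subsets.\<close>

definition strict_diff :: "nat \<Rightarrow> nat \<Rightarrow> ('a::topological_space \<Rightarrow> nat \<Rightarrow> real) \<Rightarrow> ('b \<Rightarrow> nat \<Rightarrow> real)
    \<Rightarrow> ('a \<Rightarrow> 'b) \<Rightarrow> 'a \<Rightarrow> (nat \<Rightarrow> nat \<Rightarrow> real) \<Rightarrow> bool" where
  "strict_diff n m x y F p A \<longleftrightarrow> (\<forall>e>0. \<exists>W. open W \<and> p \<in> W \<and> (\<forall>q\<in>W. \<forall>q'\<in>W.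
     l1norm m (\<lambda>j. (y (F q) j - y (F q') j) - (\<Sum>i<n. A j i * (x q i - x q' i)))
       \<le> e * l1norm n (\<lambda>i. x q i - x q' i)))"

lemma strict_diffD:
  assumes "strict_diff n m x y F p A" "e > 0"
  obtains W where "open W" "p \<in> W" "\<And>q q'. q \<in> W \<Longrightarrow> q' \<in> W \<Longrightarrow>
     l1norm m (\<lambda>j. (y (F q) j - y (F q') j) - (\<Sum>i<n. A j i * (x q i - x q' i)))
       \<le> e * l1norm n (\<lambda>i. x q i - x q' i)"
  using assms(1)[unfolded strict_diff_def, rule_format, OF assms(2)]
  by (elim exE conjE) (rule that, assumption, assumption, drule (1) bspec, drule (1) bspec, assumption)

lemma strict_diff_lipschitz:
  assumes "strict_diff n m x y F p A" "e > 0"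
  obtains W where "open W" "p \<in> W" "\<And>q q'. q \<in> W \<Longrightarrow> q' \<in> W \<Longrightarrow>
     l1norm m (\<lambda>j. y (F q) j - y (F q') j) \<le> (entry_norm m n A + e) * l1norm n (\<lambda>i. x q i - x q' i)"
proof -
  obtain W where W: "open W" "p \<in> W" "\<And>q q'. q \<in> W \<Longrightarrow> q' \<in> W \<Longrightarrow>
     l1norm m (\<lambda>j. (y (F q) j - y (F q') j) - (\<Sum>i<n. A j i * (x q i - x q' i)))
       \<le> e * l1norm n (\<lambda>i. x q i - x q' i)"
    using strict_diffD[OF assms] by blast
  have "l1norm m (\<lambda>j. y (F q) j - y (F q') j) \<le> (entry_norm m n A + e) * l1norm n (\<lambda>i. x q i - x q' i)"
    if "q \<in> W" "q' \<in> W" for q q'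
    using W(3)[OF that] l1norm_lin[where m=m and n=n and A=A and x="\<lambda>i. x q i - x q' i"]
      l1norm_add[of m "\<lambda>j. (y (F q) j - y (F q') j) - (\<Sum>i<n. A j i * (x q i - x q' i))"
        "\<lambda>j. \<Sum>i<n. A j i * (x q i - x q' i)"]
    by (simp add: distrib_right)
  with W that show thesis by blast
qed

text \<open>The chain rule. The error of \<open>F\<close> is multiplied by the size of \<open>B\<close>, and the error of \<open>G\<close> by a
  Lipschitz constant of \<open>F\<close>.\<close>

lemma strict_diff_compose:
  assumes F: "strict_diff n m x y F p A" and G: "strict_diff m l y z G (F p) B"
    and cont: "\<And>V. open V \<Longrightarrow> F p \<in> V \<Longrightarrow> \<exists>W. open W \<and> p \<in> W \<and> F ` W \<subseteq> V"
  shows "strict_diff n l x z (\<lambda>q. G (F q)) p (\<lambda>j i. \<Sum>k<m. B j k * A k i)"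
  unfolding strict_diff_def
proof (intro allI impI)
  fix e :: real assume e: "e > 0"
  define e1 where "e1 = e / (2 * (entry_norm m n A + 1))"
  define e2 where "e2 = e / (2 * (entry_norm l m B + 1))"
  have pos: "entry_norm m n A + 1 > 0" "entry_norm l m B + 1 > 0" using entry_norm_nonneg[of m n A] entry_norm_nonneg[of l m B] by linarith+
  have e12: "e1 > 0" "e2 > 0" using e pos by (auto simp: e1_def e2_def)
  obtain V where V: "open V" "F p \<in> V" "\<And>q q'. q \<in> V \<Longrightarrow> q' \<in> V \<Longrightarrow>
     l1norm l (\<lambda>j. (z (G q) j - z (G q') j) - (\<Sum>i<m. B j i * (y q i - y q' i)))
       \<le> e1 * l1norm m (\<lambda>i. y q i - y q' i)"
    using strict_diffD[OF G e12(1)] by blast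
  obtain W1 where W1: "open W1" "p \<in> W1" "F ` W1 \<subseteq> V" using cont[OF V(1,2)] by blast
  obtain W2 where W2: "open W2" "p \<in> W2" "\<And>q q'. q \<in> W2 \<Longrightarrow> q' \<in> W2 \<Longrightarrow>
     l1norm m (\<lambda>j. y (F q) j - y (F q') j) \<le> (entry_norm m n A + 1) * l1norm n (\<lambda>i. x q i - x q' i)"
    using strict_diff_lipschitz[OF F zero_less_one] by blast
  obtain W3 where W3: "open W3" "p \<in> W3" "\<And>q q'. q \<in> W3 \<Longrightarrow> q' \<in> W3 \<Longrightarrow>
     l1norm m (\<lambda>j. (y (F q) j - y (F q') j) - (\<Sum>i<n. A j i * (x q i - x q' i)))
       \<le> e2 * l1norm n (\<lambda>i. x q i - x q' i)"
    using strict_diffD[OF F e12(2)] by blast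
  have "l1norm l (\<lambda>j. (z (G (F q)) j - z (G (F q')) j) - (\<Sum>i<n. (\<Sum>k<m. B j k * A k i) * (x q i - x q' i)))
       \<le> e * l1norm n (\<lambda>i. x q i - x q' i)" (is "l1norm l ?T \<le> _")
    if q: "q \<in> W1 \<inter> W2 \<inter> W3" "q' \<in> W1 \<inter> W2 \<inter> W3" for q q'
  proof -
    let ?d = "l1norm n (\<lambda>i. x q i - x q' i)"
    let ?R = "\<lambda>j. (y (F q) j - y (F q') j) - (\<Sum>i<n. A j i * (x q i - x q' i))"
    let ?S = "\<lambda>j. (z (G (F q)) j - z (G (F q')) j) - (\<Sum>i<m. B j i * (y (F q) i - y (F q') i))"
    have sw: "(\<Sum>i<n. (\<Sum>k<m. B j k * A k i) * (x q i - x q' i))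
        = (\<Sum>k<m. B j k * (\<Sum>i<n. A k i * (x q i - x q' i)))" for j
      unfolding sum_distrib_left sum_distrib_right by (subst sum.swap) (simp only: mult_ac)
    have "?T = (\<lambda>j. ?S j + (\<Sum>k<m. B j k * ?R k))"
      unfolding sw by (simp add: right_diff_distrib sum_subtractf fun_eq_iff)
    then have "l1norm l ?T \<le> l1norm l ?S + l1norm l (\<lambda>j. \<Sum>k<m. B j k * ?R k)" by (simp only: l1norm_add)
    also have "l1norm l ?S \<le> e1 * l1norm m (\<lambda>i. y (F q) i - y (F q') i)"
      using q W1 by (intro V) auto
    also have "\<dots> \<le> e1 * ((entry_norm m n A + 1) * ?d)"
      using q e12 by (intro mult_left_mono W2(3)) auto
    also have "l1norm l (\<lambda>j. \<Sum>k<m. B j k * ?R k) \<le> entry_norm l m B * l1norm m ?R" by (rule l1norm_lin)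
    also have "\<dots> \<le> (entry_norm l m B + 1) * (e2 * ?d)"
      using q by (intro mult_mono W3(3)) auto
    also have "e1 * ((entry_norm m n A + 1) * ?d) = e/2 * ?d" using pos by (simp add: e1_def field_simps)
    also have "(entry_norm l m B + 1) * (e2 * ?d) = e/2 * ?d" using pos by (simp add: e2_def field_simps)
    finally show ?thesis by (simp add: algebra_simps)
  qed
  moreover have "open (W1 \<inter> W2 \<inter> W3)" "p \<in> W1 \<inter> W2 \<inter> W3" using W1 W2 W3 by auto
  ultimately show "\<exists>W. open W \<and> p \<in> W \<and> (\<forall>q\<in>W. \<forall>q'\<in>W.
     l1norm l (\<lambda>j. (z (G (F q)) j - z (G (F q')) j) - (\<Sum>i<n. (\<Sum>k<m. B j k * A k i) * (x q i - x q' i)))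
       \<le> e * l1norm n (\<lambda>i. x q i - x q' i))" by blast
qed

lemma abs_diff_le_of_derivative_near:
  fixes g :: "real \<Rightarrow> real"
  assumes "\<And>t. t \<in> closed_segment a b \<Longrightarrow> (g has_field_derivative g' t) (at t)"
    and "\<And>t. t \<in> closed_segment a b \<Longrightarrow> \<bar>g' t - A\<bar> \<le> e"
  shows "\<bar>g b - g a - A * (b - a)\<bar> \<le> e * \<bar>b - a\<bar>"
proof -
  have "norm ((\<lambda>t. g t - A * t) b - (\<lambda>t. g t - A * t) a) \<le> e * norm (b - a)"
  proof (rule field_differentiable_bound[OF convex_closed_segment])
    fix t assume t: "t \<in> closed_segment a b"
    show "((\<lambda>t. g t - A * t) has_field_derivative (g' t - A)) (at t within closed_segment a b)"
      by (rule DERIV_subset[OF _ subset_UNIV]) (use assms(1)[OF t] in \<open>auto intro!: derivative_eq_intros\<close>)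
    show "norm (g' t - A) \<le> e" using assms(2)[OF t] by simp
  qed auto
  then show ?thesis by (simp add: algebra_simps)
qed

lemma Ck_fun_1_iff:
  "Ck_fun 1 n D f \<longleftrightarrow> continuous_on D f \<and> (\<forall>i<n. (\<forall>x\<in>D. (\<lambda>t. f (x(i := t))) differentiable (at (x i))) \<and>
     continuous_on D (partial_deriv i f))"
  by (simp add: One_nat_def del: One_nat_def[symmetric])

text \<open>From \<open>w\<close> to \<open>v\<close> one coordinate is changed at a time; on each of these segments the mean value
  estimate applies, because the partial derivatives vary by less than \<open>e\<close> in a small box.\<close>

lemma C1_strictly_differentiable:
  assumes f: "Ck_fun 1 n D f" and D: "openin (Euclidean_space n) D" "u \<in> D" and e: "e > 0"
  shows "\<exists>r>0. \<forall>v\<in>coord_box n u r. \<forall>w\<in>coord_box n u r.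
    \<bar>f v - f w - (\<Sum>i<n. partial_deriv i f u * (v i - w i))\<bar> \<le> e * l1norm n (\<lambda>i. v i - w i)"
proof -
  have "\<exists>r>0. coord_box n u r \<subseteq> {v \<in> D. \<bar>partial_deriv i f v - partial_deriv i f u\<bar> < e}" if "i < n" for i
  proof -
    have "continuous_on D (\<lambda>v. \<bar>partial_deriv i f v - partial_deriv i f u\<bar>)"
      using f that unfolding Ck_fun_1_iff by (auto intro!: continuous_intros)
    from openin_Euclidean_space_preimage[OF D(1) this, of "{..<e}"]
    have "openin (Euclidean_space n) {v \<in> D. \<bar>partial_deriv i f v - partial_deriv i f u\<bar> < e}" by simp
    moreover have "u \<in> {v \<in> D. \<bar>partial_deriv i f v - partial_deriv i f u\<bar> < e}" using D(2) e by simp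
    ultimately show ?thesis by (metis openin_Euclidean_space_coord_box)
  qed
  moreover have "coord_box n u s \<subseteq> {v \<in> D. \<bar>partial_deriv i f v - partial_deriv i f u\<bar> < e}"
    if "coord_box n u r \<subseteq> {v \<in> D. \<bar>partial_deriv i f v - partial_deriv i f u\<bar> < e}" "0 < s" "s \<le> r" for i r s
    using coord_box_mono[OF that(3)] that(1) by (rule subset_trans)
  ultimately have "\<exists>r>0. \<forall>i<n. coord_box n u r \<subseteq> {v \<in> D. \<bar>partial_deriv i f v - partial_deriv i f u\<bar> < e}"
    by (rule common_radius)
  then obtain r where "r > 0"
    and r: "\<And>i. i < n \<Longrightarrow> coord_box n u r \<subseteq> {v \<in> D. \<bar>partial_deriv i f v - partial_deriv i f u\<bar> < e}"
    by auto
  have box: "v \<in> D" "\<bar>partial_deriv i f v - partial_deriv i f u\<bar> \<le> e" if "v \<in> coord_box n u r" "i < n" for v i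
    using r[OF that(2)] that(1) by auto
  have "\<bar>f v - f w - (\<Sum>i<n. partial_deriv i f u * (v i - w i))\<bar> \<le> e * l1norm n (\<lambda>i. v i - w i)"
    if v: "v \<in> coord_box n u r" and w: "w \<in> coord_box n u r" for v w
  proof -
    \<comment> \<open>the corners of a path from \<open>w\<close> to \<open>v\<close> along the coordinate directions\<close>
    define z where "z = (\<lambda>m i. if i < m then v i else w i)"
    have step: "\<bar>f (z (Suc m)) - f (z m) - partial_deriv m f u * (v m - w m)\<bar> \<le> e * \<bar>v m - w m\<bar>"
      if m: "m < n" for m
    proof -
      have zin: "(z m)(m := t) \<in> coord_box n u r" if "t \<in> closed_segment (w m) (v m)" for t
      proof -
        have "\<bar>w m - u m\<bar> < r" "\<bar>v m - u m\<bar> < r" using v w m by (auto simp: coord_box_def)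
        then have "\<bar>t - u m\<bar> < r" using that by (auto simp: closed_segment_eq_real_ivl split: if_splits)
        then show ?thesis using v w m by (auto simp: coord_box_def z_def)
      qed
      have "\<bar>f ((z m)(m := v m)) - f ((z m)(m := w m)) - partial_deriv m f u * (v m - w m)\<bar> \<le> e * \<bar>v m - w m\<bar>"
      proof (rule abs_diff_le_of_derivative_near)
        fix t assume t: "t \<in> closed_segment (w m) (v m)"
        let ?z = "(z m)(m := t)"
        have "?z \<in> D" using box(1)[OF zin[OF t] m] .
        then have "(\<lambda>s. f (?z(m := s))) differentiable (at (?z m))"
          using f m unfolding Ck_fun_1_iff by blast
        then show "((\<lambda>t. f ((z m)(m := t))) has_field_derivative partial_deriv m f ?z) (at t)"
          unfolding partial_deriv_def by (simp add: DERIV_deriv_iff_real_differentiable)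
        show "\<bar>partial_deriv m f ?z - partial_deriv m f u\<bar> \<le> e"
          using box(2)[OF zin[OF t] m] .
      qed
      moreover have "(z m)(m := v m) = z (Suc m)" "(z m)(m := w m) = z m"
        by (auto simp: z_def fun_eq_iff)
      ultimately show ?thesis by simp
    qed
    have "\<bar>f (z m) - f (z 0) - (\<Sum>i<m. partial_deriv i f u * (v i - w i))\<bar> \<le> e * l1norm m (\<lambda>i. v i - w i)"
      if "m \<le> n" for m
      using that
    proof (induction m)
      case (Suc m)
      then have "\<bar>f (z m) - f (z 0) - (\<Sum>i<m. partial_deriv i f u * (v i - w i))\<bar> \<le> e * l1norm m (\<lambda>i. v i - w i)"
        by simp
      moreover have "e * l1norm (Suc m) (\<lambda>i. v i - w i) = e * l1norm m (\<lambda>i. v i - w i) + e * \<bar>v m - w m\<bar>"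
        by (simp add: l1norm_def distrib_left)
      ultimately show ?case using step[of m] Suc.prems by simp
    qed (simp add: l1norm_def)
    moreover have "z 0 = w" "z n = v" using v w by (auto simp: z_def coord_box_def fun_eq_iff)
    ultimately show ?thesis by (metis order_refl)
  qed
  with \<open>r > 0\<close> show ?thesis by blast
qed

text \<open>The estimate is tested on pairs of points on a coordinate line.\<close>

lemma strict_diff_imp_partial_deriv:
  assumes c: "is_chart n c" "p \<in> fst c" and F: "strict_diff n m (snd c) (snd c') F p A" and ij: "i < n" "j < m"
  shows "partial_deriv i (\<lambda>u. coord_rep c c' F u j) (snd c p) = A j i"
proof -
  let ?g = "\<lambda>t. coord_rep c c' F ((snd c p)(i := t)) j"
  have "(?g has_field_derivative A j i) (at (snd c p i))"
    unfolding DERIV_def LIM_eq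
  proof (intro allI impI)
    fix e :: real assume e: "e > 0"
    obtain W where W: "open W" "p \<in> W" "\<And>q q'. q \<in> W \<Longrightarrow> q' \<in> W \<Longrightarrow>
     l1norm m (\<lambda>j. (snd c' (F q) j - snd c' (F q') j) - (\<Sum>i<n. A j i * (snd c q i - snd c q' i)))
       \<le> e/2 * l1norm n (\<lambda>i. snd c q i - snd c q' i)"
      using strict_diffD[OF F half_gt_zero[OF e]] by blast
    obtain r where r: "r > 0" "\<And>v. v \<in> coord_box n (snd c p) r \<Longrightarrow> \<exists>q\<in>fst c \<inter> W. snd c q = v"
      using chart_nbhd_surj[OF c W(1,2)] by blast
    have "norm ((?g (snd c p i + h) - ?g (snd c p i)) / h - A j i) < e" if h: "h \<noteq> 0" "\<bar>h\<bar> < r" for h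
    proof -
      have "(snd c p)(i := snd c p i + h) \<in> coord_box n (snd c p) r"
        using h ij r is_chartD(5)[OF c] by (auto simp: coord_box_def)
      then obtain q where q: "q \<in> fst c \<inter> W" "snd c q = (snd c p)(i := snd c p i + h)" using r by blast
      have d: "snd c q l - snd c p l = (if l = i then h else 0)" for l using q by auto
      have "\<bar>(snd c' (F q) j - snd c' (F p) j) - (\<Sum>i<n. A j i * (snd c q i - snd c p i))\<bar>
          \<le> e/2 * l1norm n (\<lambda>i. snd c q i - snd c p i)"
        by (rule order_trans[OF abs_le_l1norm[OF ij(2)] W(3)]) (use q W in auto)
      moreover have "(\<Sum>i<n. A j i * (snd c q i - snd c p i)) = A j i * h"
        unfolding d using ij by (simp add: if_distrib[of "\<lambda>x. _ * x"] cong: if_cong)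
      moreover have "l1norm n (\<lambda>i. snd c q i - snd c p i) = \<bar>h\<bar>"
        unfolding d l1norm_def using ij by (simp add: if_distrib[of abs] cong: if_cong)
      moreover have "?g (snd c p i + h) = snd c' (F q) j" "?g (snd c p i) = snd c' (F p) j"
        using c q by (simp_all add: q(2)[symmetric])
      ultimately have *: "\<bar>(?g (snd c p i + h) - ?g (snd c p i)) - A j i * h\<bar> \<le> e/2 * \<bar>h\<bar>" by simp
      have "\<bar>(?g (snd c p i + h) - ?g (snd c p i)) / h - A j i\<bar>
          = \<bar>(?g (snd c p i + h) - ?g (snd c p i)) - A j i * h\<bar> / \<bar>h\<bar>"
        using h by (simp add: abs_divide[symmetric] diff_divide_distrib)
      also have "\<dots> \<le> e/2" using * h by (simp add: divide_le_eq)
      finally show ?thesis using e by simp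
    qed
    then show "\<exists>s>0. \<forall>h. h \<noteq> 0 \<and> norm (h - 0) < s \<longrightarrow>
      norm ((?g (snd c p i + h) - ?g (snd c p i)) / h - A j i) < e" using r(1) by auto
  qed
  then show ?thesis unfolding partial_deriv_def by (rule DERIV_imp_deriv)
qed

lemma strict_diff_imp_jacobian:
  assumes "is_chart (mdim X) c" "p \<in> fst c" and "strict_diff (mdim X) (mdim Y) (snd c) (snd c') F p A"
  shows "jacobian X Y c c' F p = (\<lambda>j i. if j < mdim Y \<and> i < mdim X then A j i else 0)"
  unfolding jacobian_def using strict_diff_imp_partial_deriv[OF assms] by (auto simp: fun_eq_iff)

lemma strict_diff_cong_matrix:
  assumes "strict_diff n m x y F p A" "\<And>i j. i < n \<Longrightarrow> j < m \<Longrightarrow> A j i = A' j i"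
  shows "strict_diff n m x y F p A'"
proof -
  have "l1norm m (\<lambda>j. h j - (\<Sum>i<n. A' j i * k i)) = l1norm m (\<lambda>j. h j - (\<Sum>i<n. A j i * k i))" for h k
    using assms(2) by (intro l1norm_cong) simp
  then show ?thesis using assms(1) unfolding strict_diff_def by presburger
qed

definition C1_in_charts :: "nat \<Rightarrow> nat \<Rightarrow> 'a set \<Rightarrow> 'a chart \<Rightarrow> 'b chart \<Rightarrow> ('a \<Rightarrow> 'b) \<Rightarrow> bool" where
  "C1_in_charts n m W c c' F \<longleftrightarrow>
     (\<forall>j<m. Ck_fun 1 n (snd c ` (fst c \<inter> W \<inter> F -` fst c')) (\<lambda>u. coord_rep c c' F u j))"

lemma C1_in_charts_strict_diff:
  fixes F :: "'a::topological_space \<Rightarrow> 'b::topological_space"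
  assumes c: "is_chart n c" "p \<in> fst c" and W: "open W" "p \<in> W" "continuous_on W F"
    and c': "open (fst c')" "F p \<in> fst c'"
    and C1: "C1_in_charts n m W c c' F"
  shows "strict_diff n m (snd c) (snd c') F p (\<lambda>j i. partial_deriv i (\<lambda>u. coord_rep c c' F u j) (snd c p))"
  unfolding strict_diff_def
proof (intro allI impI)
  fix e :: real assume e: "e > 0"
  let ?N = "fst c \<inter> W \<inter> F -` fst c'"
  have N: "open ?N"
    using W c' is_chartD(1)[OF c(1)] continuous_open_preimage[OF W(3,1) c'(1)]
    by (metis Int_assoc open_Int)
  have D: "openin (Euclidean_space n) (snd c ` ?N)" "snd c p \<in> snd c ` ?N"
    using is_chartD(6)[OF c(1) N] c W c' by auto
  define P where "P = (\<lambda>j r. \<forall>v\<in>coord_box n (snd c p) r. \<forall>w\<in>coord_box n (snd c p) r.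
    \<bar>coord_rep c c' F v j - coord_rep c c' F w j - (\<Sum>i<n. partial_deriv i (\<lambda>u. coord_rep c c' F u j) (snd c p) * (v i - w i))\<bar>
    \<le> e / (real m + 1) * l1norm n (\<lambda>i. v i - w i))"
  have "\<exists>r>0. P j r" if "j < m" for j
  proof -
    have "Ck_fun 1 n (snd c ` ?N) (\<lambda>u. coord_rep c c' F u j)" using C1 that by (simp add: C1_in_charts_def)
    moreover have "e / (real m + 1) > 0" using e by simp
    ultimately show ?thesis unfolding P_def by (rule C1_strictly_differentiable[OF _ D])
  qed
  moreover have "P j s" if "P j r" "0 < s" "s \<le> r" for j r s
    using that(1) coord_box_mono[OF that(3)] unfolding P_def by blast
  ultimately have "\<exists>R>0. \<forall>j<m. P j R" by (rule common_radius)
  then obtain R where "R > 0" and R: "\<And>j. j < m \<Longrightarrow> P j R" by auto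
  define W' where "W' = {q \<in> fst c. \<forall>i<n. \<bar>snd c q i - snd c p i\<bar> < R}"
  have "open W'" unfolding W'_def
    by (rule open_chart_nbhd[OF c(1)]) (intro continuous_intros continuous_on_chart_coord[OF c(1)])
  moreover have "p \<in> W'" using c \<open>R > 0\<close> by (simp add: W'_def)
  moreover have "l1norm m (\<lambda>j. (snd c' (F q) j - snd c' (F q') j) -
       (\<Sum>i<n. partial_deriv i (\<lambda>u. coord_rep c c' F u j) (snd c p) * (snd c q i - snd c q' i)))
       \<le> e * l1norm n (\<lambda>i. snd c q i - snd c q' i)" if q: "q \<in> W'" "q' \<in> W'" for q q'
  proof -
    have box: "snd c q \<in> coord_box n (snd c p) R" "snd c q' \<in> coord_box n (snd c p) R"
      using q is_chartD(5)[OF c(1)] unfolding coord_box_def W'_def by auto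
    have "l1norm m (\<lambda>j. (snd c' (F q) j - snd c' (F q') j) -
       (\<Sum>i<n. partial_deriv i (\<lambda>u. coord_rep c c' F u j) (snd c p) * (snd c q i - snd c q' i)))
       \<le> (\<Sum>j<m. e / (real m + 1) * l1norm n (\<lambda>i. snd c q i - snd c q' i))"
      unfolding l1norm_def[of m]
    proof (rule sum_mono)
      fix j assume "j \<in> {..<m}"
      then have "j < m" by simp
      then show "\<bar>(snd c' (F q) j - snd c' (F q') j) -
       (\<Sum>i<n. partial_deriv i (\<lambda>u. coord_rep c c' F u j) (snd c p) * (snd c q i - snd c q' i))\<bar>
       \<le> e / (real m + 1) * l1norm n (\<lambda>i. snd c q i - snd c q' i)"
        using R[OF \<open>j < m\<close>, unfolded P_def, rule_format, OF box] q c
        by (simp only: W'_def mem_Collect_eq coord_rep_chart)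
    qed
    also have "\<dots> = (real m / (real m + 1)) * (e * l1norm n (\<lambda>i. snd c q i - snd c q' i))" by simp
    also have "\<dots> \<le> 1 * (e * l1norm n (\<lambda>i. snd c q i - snd c q' i))"
      using e by (intro mult_right_mono) auto
    finally show ?thesis by simp
  qed
  ultimately show "\<exists>W. open W \<and> p \<in> W \<and> (\<forall>q\<in>W. \<forall>q'\<in>W.
     l1norm m (\<lambda>j. (snd c' (F q) j - snd c' (F q') j) - (\<Sum>i<n. partial_deriv i (\<lambda>u. coord_rep c c' F u j) (snd c p) * (snd c q i - snd c q' i)))
       \<le> e * l1norm n (\<lambda>i. snd c q i - snd c q' i))" by blast
qed

section \<open>Real-analytic functions are continuously differentiable\<close>

abbreviation multi_indices :: "nat \<Rightarrow> (nat \<Rightarrow> nat) set" where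
  "multi_indices n \<equiv> {\<mu>. \<forall>i\<ge>n. \<mu> i = 0}"

text \<open>At the corner \<open>x + (r, \<dots>, r)\<close> of a box inside the domain the power series has the terms
  \<open>a \<mu> * r ^ \<bar>\<mu>\<bar>\<close>. Unconditional convergence there is absolute convergence, and this bounds the series
  in the whole box.\<close>

lemma analytic_fun_expansion:
  assumes f: "analytic_fun n D f" and D: "openin (Euclidean_space n) D" "x \<in> D"
  obtains r a where "r > 0" "coord_box n x r \<subseteq> D"
    "\<And>y. y \<in> coord_box n x r \<Longrightarrow> ((\<lambda>\<mu>. a \<mu> * (\<Prod>i<n. (y i - x i) ^ \<mu> i)) has_sum f y) (multi_indices n)"
    "(\<lambda>\<mu>. \<bar>a \<mu>\<bar> * r ^ (\<Sum>i<n. \<mu> i)) summable_on multi_indices n"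
proof -
  obtain \<rho> a where \<rho>: "\<rho> > 0" and hs: "\<And>y. y \<in> D \<Longrightarrow> (\<forall>i<n. \<bar>y i - x i\<bar> < \<rho>) \<Longrightarrow>
        ((\<lambda>\<mu>. a \<mu> * (\<Prod>i<n. (y i - x i) ^ \<mu> i)) has_sum f y) (multi_indices n)"
    using f D(2) unfolding analytic_fun_def by blast
  obtain r0 where r0: "r0 > 0" "coord_box n x r0 \<subseteq> D"
    using openin_Euclidean_space_coord_box[OF D] by blast
  define r where "r = min \<rho> r0 / 2"
  have r: "r > 0" "r < \<rho>" "r < r0" using \<rho> r0 by (auto simp: r_def min_def)
  define y where "y = (\<lambda>i. if i < n then x i + r else 0)"
  have "y \<in> D" using r r0 by (auto simp: y_def coord_box_def subset_iff)
  then have "((\<lambda>\<mu>. a \<mu> * (\<Prod>i<n. (y i - x i) ^ \<mu> i)) has_sum f y) (multi_indices n)"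
    using r by (intro hs) (auto simp: y_def)
  then have "(\<lambda>\<mu>. a \<mu> * (\<Prod>i<n. (y i - x i) ^ \<mu> i)) summable_on multi_indices n"
    by (rule has_sum_imp_summable)
  moreover have "(\<Prod>i<n. (y i - x i) ^ \<mu> i) = r ^ (\<Sum>i<n. \<mu> i)" for \<mu>
    by (simp add: y_def power_sum)
  ultimately have "(\<lambda>\<mu>. a \<mu> * r ^ (\<Sum>i<n. \<mu> i)) summable_on multi_indices n" by simp
  then have "(\<lambda>\<mu>. norm (a \<mu> * r ^ (\<Sum>i<n. \<mu> i))) summable_on multi_indices n"
    by (rule summable_on_iff_abs_summable_on_real[THEN iffD1])
  then have s: "(\<lambda>\<mu>. \<bar>a \<mu>\<bar> * r ^ (\<Sum>i<n. \<mu> i)) summable_on multi_indices n"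
    using r by (simp add: abs_mult)
  have "coord_box n x r \<subseteq> D" using coord_box_mono[of r r0 n x] r r0 by auto
  moreover have "((\<lambda>\<mu>. a \<mu> * (\<Prod>i<n. (y i - x i) ^ \<mu> i)) has_sum f y) (multi_indices n)"
    if "y \<in> coord_box n x r" for y
    using that r \<open>coord_box n x r \<subseteq> D\<close> by (intro hs) (auto simp: coord_box_def)
  ultimately show thesis using that r(1) s by blast
qed

text \<open>The second-order Taylor estimate for a power. The factor \<open>R\<^sup>2\<close> on the left keeps the exponents of
  \<open>R\<close> on the right from becoming negative.\<close>

lemma power_second_order:
  fixes s t R :: real
  assumes "\<bar>s\<bar> \<le> R" "\<bar>t\<bar> \<le> R"
  shows "R\<^sup>2 * \<bar>t ^ m - s ^ m - real m * s ^ (m - 1) * (t - s)\<bar> \<le> (real m)\<^sup>2 * R ^ m * (t - s)\<^sup>2"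
proof (induction m)
  case (Suc m)
  let ?E = "t ^ m - s ^ m - real m * s ^ (m - 1) * (t - s)"
  have R: "R \<ge> 0" using assms by auto
  have "t ^ Suc m - s ^ Suc m - real (Suc m) * s ^ (Suc m - 1) * (t - s)
      = t * ?E + real m * s ^ (m - 1) * (t - s)\<^sup>2"
    by (cases m) (simp_all add: algebra_simps power2_eq_square)
  then have "R\<^sup>2 * \<bar>t ^ Suc m - s ^ Suc m - real (Suc m) * s ^ (Suc m - 1) * (t - s)\<bar>
      \<le> R\<^sup>2 * (\<bar>t\<bar> * \<bar>?E\<bar> + real m * \<bar>s\<bar> ^ (m - 1) * (t - s)\<^sup>2)"
    by (intro mult_left_mono) (auto intro!: order_trans[OF abs_triangle_ineq] simp: abs_mult power_abs)
  also have "\<dots> = \<bar>t\<bar> * (R\<^sup>2 * \<bar>?E\<bar>) + real m * (R\<^sup>2 * \<bar>s\<bar> ^ (m - 1)) * (t - s)\<^sup>2"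
    by (simp add: algebra_simps)
  also have "\<dots> \<le> R * ((real m)\<^sup>2 * R ^ m * (t - s)\<^sup>2) + real m * R ^ Suc m * (t - s)\<^sup>2"
  proof (rule add_mono)
    show "\<bar>t\<bar> * (R\<^sup>2 * \<bar>?E\<bar>) \<le> R * ((real m)\<^sup>2 * R ^ m * (t - s)\<^sup>2)"
      by (rule mult_mono[OF assms(2) Suc.IH]) (use R in auto)
    have "real m * (R\<^sup>2 * \<bar>s\<bar> ^ (m - 1)) \<le> real m * R ^ Suc m"
    proof (cases m)
      case (Suc l)
      have "\<bar>s\<bar> ^ l \<le> R ^ l" using assms by (intro power_mono) auto
      then have "R\<^sup>2 * \<bar>s\<bar> ^ l \<le> R\<^sup>2 * R ^ l" by (intro mult_left_mono) auto
      then have "R\<^sup>2 * \<bar>s\<bar> ^ (m - 1) \<le> R ^ Suc m" using Suc by (simp add: power2_eq_square)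
      then show ?thesis by (intro mult_left_mono) auto
    qed simp
    then show "real m * (R\<^sup>2 * \<bar>s\<bar> ^ (m - 1)) * (t - s)\<^sup>2 \<le> real m * R ^ Suc m * (t - s)\<^sup>2"
      by (intro mult_right_mono) auto
  qed
  also have "\<dots> = ((real m)\<^sup>2 + real m) * (R ^ Suc m * (t - s)\<^sup>2)" by (simp add: algebra_simps)
  also have "\<dots> \<le> (real (Suc m))\<^sup>2 * (R ^ Suc m * (t - s)\<^sup>2)"
  proof (rule mult_right_mono)
    show "(real m)\<^sup>2 + real m \<le> (real (Suc m))\<^sup>2" by (simp add: power2_eq_square algebra_simps)
  qed (use R in simp)
  finally show ?case by (simp add: mult.assoc)
qed simp

lemma square_le_4_power: "(real m)\<^sup>2 \<le> 4 ^ m"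
proof -
  have "real m \<le> 2 ^ m" by (metis less_exp less_imp_le of_nat_le_iff of_nat_numeral of_nat_power)
  then have "(real m)\<^sup>2 \<le> (2 ^ m)\<^sup>2" by (intro power_mono) auto
  also have "\<dots> = (4::real) ^ m" by (simp add: power2_eq_square power_mult_distrib[symmetric])
  finally show ?thesis .
qed

lemma le_4_power: "real m \<le> 4 ^ m"
proof -
  have "real m \<le> (real m)\<^sup>2" by (cases m) (auto simp: power2_eq_square)
  also have "\<dots> \<le> 4 ^ m" by (rule square_le_4_power)
  finally show ?thesis .
qed

lemma continuous_on_coord_lipschitz:
  fixes g :: "(nat \<Rightarrow> real) \<Rightarrow> real"
  assumes "\<And>x. x \<in> D \<Longrightarrow> \<exists>r>0. \<exists>C. \<forall>y\<in>D. (\<forall>i<n. \<bar>y i - x i\<bar> < r) \<longrightarrow> \<bar>g y - g x\<bar> \<le> C * l1norm n (\<lambda>i. y i - x i)"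
  shows "continuous_on D g"
  unfolding continuous_on_def
proof
  fix x assume x: "x \<in> D"
  obtain r C where r: "r > 0" "\<And>y. y \<in> D \<Longrightarrow> (\<forall>i<n. \<bar>y i - x i\<bar> < r) \<Longrightarrow> \<bar>g y - g x\<bar> \<le> C * l1norm n (\<lambda>i. y i - x i)"
    using assms[OF x] by blast
  have co: "((\<lambda>y. y i) \<longlongrightarrow> x i) (at x within D)" for i
    using tendsto_ident_at[of x D] unfolding tendsto_nat_fun_iff by blast
  have "((\<lambda>y. C * l1norm n (\<lambda>i. y i - x i)) \<longlongrightarrow> C * (\<Sum>i<n. \<bar>x i - x i\<bar>)) (at x within D)"
    unfolding l1norm_def by (intro tendsto_intros co)
  then have lim: "((\<lambda>y. C * l1norm n (\<lambda>i. y i - x i)) \<longlongrightarrow> 0) (at x within D)" by simp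
  have "eventually (\<lambda>y. \<bar>y i - x i\<bar> < r) (at x within D)" for i
    using tendstoD[OF co \<open>r > 0\<close>] by (simp add: dist_real_def)
  then have "eventually (\<lambda>y. \<forall>i\<in>{..<n}. \<bar>y i - x i\<bar> < r) (at x within D)"
    by (intro eventually_ball_finite) auto
  moreover have "eventually (\<lambda>y. y \<in> D) (at x within D)" by (simp add: eventually_at_topological) blast
  ultimately have "eventually (\<lambda>y. norm (g y - g x) \<le> C * l1norm n (\<lambda>i. y i - x i)) (at x within D)"
    by eventually_elim (use r(2) in auto)
  then have "((\<lambda>y. g y - g x) \<longlongrightarrow> 0) (at x within D)" by (rule Lim_null_comparison[OF _ lim])
  then show "(g \<longlongrightarrow> g x) (at x within D)" by (rule LIM_zero_cancel)
qed

lemma has_sum_abs_le: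
  fixes g h :: "'a \<Rightarrow> real"
  assumes "(g has_sum G) A" "h summable_on A" "\<And>\<mu>. \<mu> \<in> A \<Longrightarrow> \<bar>g \<mu>\<bar> \<le> h \<mu>"
  shows "\<bar>G\<bar> \<le> infsum h A"
proof -
  have "(h has_sum infsum h A) A" using assms(2) by (rule has_sum_infsum)
  then have "G \<le> infsum h A" "- infsum h A \<le> G"
    using assms(1,3) has_sum_mono[of g A G h "infsum h A"]
      has_sum_mono[of "\<lambda>x. - h x" A "- infsum h A" g G] by (auto simp: has_sum_uminus abs_le_iff) force+
  then show ?thesis by auto
qed

lemma has_sum_diff_real:
  fixes g h :: "'a \<Rightarrow> real"
  shows "(g has_sum G) A \<Longrightarrow> (h has_sum H) A \<Longrightarrow> ((\<lambda>x. g x - h x) has_sum (G - H)) A"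
  using has_sum_add[of g A G "\<lambda>x. - h x" "- H"] by (simp add: has_sum_uminusI)

text \<open>Termwise differentiation. Differentiating a monomial of degree \<open>s\<close> produces factors of at most
  \<open>s\<close> and \<open>s\<^sup>2\<close>, which are at most \<open>4 ^ s\<close>; in a box of a quarter of the radius of absolute
  convergence, all the series that occur are therefore dominated by the convergent series
  \<open>\<Sum> \<bar>a \<mu>\<bar> r ^ \<bar>\<mu>\<bar>\<close>. This gives the derivative with a quadratic remainder, and Lipschitz estimates
  for the function and for its partial derivatives.\<close>

lemma analytic_fun_imp_C1:
  assumes f: "analytic_fun n D f" and D: "openin (Euclidean_space n) D"
  shows "Ck_fun 1 n D f"
proof -
  \<comment> \<open>the part of a monomial that does not involve the variable \<open>i\<close>, and its degree\<close>
  define P where "P = (\<lambda>i x (\<mu>::nat\<Rightarrow>nat) (y::nat\<Rightarrow>real). \<Prod>j\<in>{..<n}-{i}. (y j - x j :: real) ^ \<mu> j)"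
  define S where "S = (\<lambda>i (\<mu>::nat\<Rightarrow>nat). \<Sum>j\<in>{..<n}-{i}. \<mu> j)"
  have P_le: "\<bar>P i x \<mu> y\<bar> \<le> \<delta> ^ S i \<mu>" if "\<forall>j<n. \<bar>y j - x j\<bar> \<le> \<delta>" for i x \<mu> y \<delta>
  proof -
    have "\<bar>P i x \<mu> y\<bar> = (\<Prod>j\<in>{..<n}-{i}. \<bar>y j - x j\<bar> ^ \<mu> j)" by (simp add: P_def abs_prod power_abs)
    also have "\<dots> \<le> (\<Prod>j\<in>{..<n}-{i}. \<delta> ^ \<mu> j)"
      using that by (intro prod_mono conjI power_mono) auto
    finally show ?thesis by (simp add: S_def power_sum)
  qed
  have sum_split: "(\<Sum>j<n. \<mu> j) = \<mu> i + S i \<mu>" if "i < n" for i and \<mu> :: "nat \<Rightarrow> nat"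
    using that by (simp add: S_def sum.remove)
  have prod_split: "(\<Prod>j<n. (y j - x j) ^ \<mu> j) = (y i - x i) ^ \<mu> i * P i x \<mu> y" if "i < n" for i \<mu> x and y :: "nat\<Rightarrow>real"
    using that by (simp add: P_def prod.remove)
  have cont_f: "\<exists>r>0. \<exists>C. \<forall>y\<in>D. (\<forall>i<n. \<bar>y i - x i\<bar> < r) \<longrightarrow> \<bar>f y - f x\<bar> \<le> C * l1norm n (\<lambda>i. y i - x i)"
    and deriv_f: "i < n \<Longrightarrow> (\<lambda>t. f (x(i := t))) differentiable (at (x i))"
    and cont_df: "i < n \<Longrightarrow> \<exists>r>0. \<exists>C. \<forall>y\<in>D. (\<forall>j<n. \<bar>y j - x j\<bar> < r) \<longrightarrow>
        \<bar>partial_deriv i f y - partial_deriv i f x\<bar> \<le> C * l1norm n (\<lambda>i. y i - x i)" if x: "x \<in> D" for x i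
  proof -
    obtain r a where r: "r > 0" "coord_box n x r \<subseteq> D"
      and hs: "\<And>y. y \<in> coord_box n x r \<Longrightarrow> ((\<lambda>\<mu>. a \<mu> * (\<Prod>i<n. (y i - x i) ^ \<mu> i)) has_sum f y) (multi_indices n)"
      and b: "(\<lambda>\<mu>. \<bar>a \<mu>\<bar> * r ^ (\<Sum>i<n. \<mu> i)) summable_on multi_indices n"
      using analytic_fun_expansion[OF f D x] by blast
    define B where "B = infsum (\<lambda>\<mu>. \<bar>a \<mu>\<bar> * r ^ (\<Sum>i<n. \<mu> i)) (multi_indices n)"
    \<comment> \<open>the quotient \<open>4\<close> absorbs the factors \<open>m\<close> and \<open>m\<^sup>2\<close>, since both are at most \<open>4 ^ m\<close>\<close>
    define R where "R = r / 4"
    \<comment> \<open>a box of radius \<open>R'\<close> lies in the ball of radius \<open>R\<close> of the norm \<open>l1norm n\<close>\<close>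
    define R' where "R' = R / (real n + 1)"
    have R: "R > 0" "4 * R = r" "R' > 0" "R' \<le> R" "R < r" using r
      by (auto simp: R_def R'_def divide_simps)
    have Dbox: "y i = 0" if "y \<in> D" "i \<ge> n" for y i
      using openin_subset[OF D] that by (auto simp: topspace_Euclidean_space)
    have l1norm_le: "l1norm n (\<lambda>i. y i - x i) \<le> R" if "\<forall>i<n. \<bar>y i - x i\<bar> < R'" for y
    proof -
      have "l1norm n (\<lambda>i. y i - x i) \<le> (\<Sum>i<n. R')"
        unfolding l1norm_def using that by (intro sum_mono) (auto intro: less_imp_le)
      also have "\<dots> = (real n / (real n + 1)) * R" by (simp add: R'_def)
      also have "\<dots> \<le> 1 * R" using R by (intro mult_right_mono) auto
      finally show ?thesis by simp
    qed
    have rk: "r ^ k = R ^ k * 4 ^ k" for k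
      unfolding R(2)[symmetric] by (simp add: power_mult_distrib)
    have R_pow: "R ^ k * real m \<le> r ^ k" "R ^ k * (real m)\<^sup>2 \<le> r ^ k" if "m \<le> k" for k m
    proof -
      have "real m \<le> 4 ^ k" using le_4_power[of k] that by (meson le_trans of_nat_mono order_trans)
      then have "R ^ k * real m \<le> R ^ k * 4 ^ k" using R by (intro mult_left_mono) auto
      then show "R ^ k * real m \<le> r ^ k" unfolding rk .
      have "(real m)\<^sup>2 \<le> (real k)\<^sup>2" using that by (intro power_mono) auto
      then have "(real m)\<^sup>2 \<le> 4 ^ k" using square_le_4_power[of k] by linarith
      then have "R ^ k * (real m)\<^sup>2 \<le> R ^ k * 4 ^ k" using R by (intro mult_left_mono) auto
      then show "R ^ k * (real m)\<^sup>2 \<le> r ^ k" unfolding rk .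
    qed
    have in_box: "y \<in> coord_box n x r" if "y \<in> D" "\<forall>i<n. \<bar>y i - x i\<bar> \<le> R" for y
      using that R Dbox unfolding coord_box_def by fastforce
    have xx: "x \<in> coord_box n x r" using in_box[OF x] R by simp
    have fx: "((\<lambda>\<mu>. a \<mu> * (\<Prod>i<n. (x i - x i) ^ \<mu> i)) has_sum f x) (multi_indices n)" by (rule hs[OF xx])
    have scaled: "(\<lambda>\<mu>. K * (\<bar>a \<mu>\<bar> * r ^ (\<Sum>i<n. \<mu> i))) summable_on multi_indices n"
      "infsum (\<lambda>\<mu>. K * (\<bar>a \<mu>\<bar> * r ^ (\<Sum>i<n. \<mu> i))) (multi_indices n) = K * B" for K
      using b unfolding B_def by (auto intro: summable_on_cmult_right infsum_cmult_right)
    show "\<exists>r>0. \<exists>C. \<forall>y\<in>D. (\<forall>i<n. \<bar>y i - x i\<bar> < r) \<longrightarrow> \<bar>f y - f x\<bar> \<le> C * l1norm n (\<lambda>i. y i - x i)"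
    proof (rule exI[of _ R'], rule conjI[OF R(3)], rule exI[of _ "B / R"], intro ballI impI)
      fix y assume y: "y \<in> D" "\<forall>i<n. \<bar>y i - x i\<bar> < R'"
      define \<delta> where "\<delta> = l1norm n (\<lambda>i. y i - x i)"
      have \<delta>: "\<forall>i<n. \<bar>y i - x i\<bar> \<le> \<delta>" "0 \<le> \<delta>" "\<delta> \<le> R"
        using l1norm_le[OF y(2)] abs_le_l1norm[of _ n "\<lambda>i. y i - x i"] by (auto simp: \<delta>_def)
      have "y \<in> coord_box n x r" using y R \<delta> by (intro in_box) (auto intro: order_trans)
      from has_sum_diff_real[OF hs[OF this] fx]
      have "\<bar>f y - f x\<bar> \<le> infsum (\<lambda>\<mu>. \<delta> / R * (\<bar>a \<mu>\<bar> * r ^ (\<Sum>i<n. \<mu> i))) (multi_indices n)"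
      proof (rule has_sum_abs_le[OF _ scaled(1)])
        fix \<mu> :: "nat \<Rightarrow> nat" assume \<mu>: "\<mu> \<in> multi_indices n"
        let ?s = "\<Sum>i<n. \<mu> i"
        show "\<bar>a \<mu> * (\<Prod>i<n. (y i - x i) ^ \<mu> i) - a \<mu> * (\<Prod>i<n. (x i - x i) ^ \<mu> i)\<bar>
           \<le> \<delta> / R * (\<bar>a \<mu>\<bar> * r ^ ?s)"
        proof (cases "?s = 0")
          case True
          then show ?thesis using \<delta> R by simp
        next
          case False
          then obtain i where "i < n" "\<mu> i \<noteq> 0" by auto
          then have 0: "(\<Prod>i<n. (x i - x i) ^ \<mu> i) = 0" by (intro prod_zero) auto
          obtain k where k: "?s = Suc k" using False by (cases ?s) auto
          have "\<bar>\<Prod>i<n. (y i - x i) ^ \<mu> i\<bar> \<le> (\<Prod>i<n. \<delta> ^ \<mu> i)"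
            unfolding abs_prod power_abs using \<delta> by (intro prod_mono conjI power_mono) auto
          also have "\<dots> = \<delta> * \<delta> ^ k" by (simp add: power_sum[symmetric] k)
          also have "\<dots> \<le> \<delta> * R ^ k" using \<delta> by (intro mult_left_mono power_mono) auto
          also have "\<dots> = \<delta> / R * R ^ ?s" using R by (simp add: k)
          also have "\<dots> \<le> \<delta> / R * r ^ ?s" using R \<delta> by (intro mult_left_mono power_mono) auto
          finally have "\<bar>a \<mu>\<bar> * \<bar>\<Prod>i<n. (y i - x i) ^ \<mu> i\<bar> \<le> \<bar>a \<mu>\<bar> * (\<delta> / R * r ^ ?s)"
            by (intro mult_left_mono) auto
          then show ?thesis unfolding 0 by (simp add: abs_mult mult_ac)
        qed
      qed
      then show "\<bar>f y - f x\<bar> \<le> B / R * l1norm n (\<lambda>i. y i - x i)"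
        unfolding scaled(2) \<delta>_def by (simp add: mult.commute)
    qed
    define g where "g = (\<lambda>i y. infsum (\<lambda>\<mu>. a \<mu> * (real (\<mu> i) * (y i - x i) ^ (\<mu> i - 1) * P i x \<mu> y)) (multi_indices n))"
    have g_sum: "((\<lambda>\<mu>. a \<mu> * (real (\<mu> i) * (y i - x i) ^ (\<mu> i - 1) * P i x \<mu> y)) has_sum g i y) (multi_indices n)"
      if i: "i < n" and y: "\<forall>j<n. \<bar>y j - x j\<bar> \<le> R" for i y
    proof -
      have "(\<lambda>\<mu>. a \<mu> * (real (\<mu> i) * (y i - x i) ^ (\<mu> i - 1) * P i x \<mu> y)) summable_on (multi_indices n)"
      proof (rule abs_summable_summable[OF Infinite_Sum.abs_summable_on_comparison_test'[OF scaled(1)[of "1/R"]]])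
        fix \<mu> :: "nat \<Rightarrow> nat" assume \<mu>: "\<mu> \<in> multi_indices n"
        have "\<bar>real (\<mu> i) * (y i - x i) ^ (\<mu> i - 1) * P i x \<mu> y\<bar> \<le> 1/R * r ^ (\<Sum>i<n. \<mu> i)"
        proof (cases "\<mu> i")
          case 0
          then show ?thesis using r R by simp
        next
          case (Suc k)
          have "\<bar>real (\<mu> i) * (y i - x i) ^ (\<mu> i - 1) * P i x \<mu> y\<bar> \<le> real (\<mu> i) * R ^ k * R ^ S i \<mu>"
            unfolding abs_mult using P_le[OF y] Suc y i R by (intro mult_mono) (auto simp: power_abs intro!: power_mono)
          also have "\<dots> = 1/R * (R ^ (\<mu> i + S i \<mu>) * real (\<mu> i))" using Suc R by (simp add: power_add field_simps)
          also have "\<dots> \<le> 1/R * r ^ (\<mu> i + S i \<mu>)" using R by (intro mult_left_mono R_pow(1)) auto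
          finally show ?thesis using sum_split[OF i] by simp
        qed
        then have "\<bar>a \<mu>\<bar> * \<bar>real (\<mu> i) * (y i - x i) ^ (\<mu> i - 1) * P i x \<mu> y\<bar> \<le> \<bar>a \<mu>\<bar> * (1/R * r ^ (\<Sum>i<n. \<mu> i))"
          by (intro mult_left_mono) auto
        then show "norm (a \<mu> * (real (\<mu> i) * (y i - x i) ^ (\<mu> i - 1) * P i x \<mu> y)) \<le> 1 / R * (\<bar>a \<mu>\<bar> * r ^ (\<Sum>i<n. \<mu> i))"
          by (simp add: abs_mult mult_ac)
      qed
      then show ?thesis unfolding g_def by (rule has_sum_infsum)
    qed
    have deriv: "((\<lambda>t. f (y(i := t))) has_field_derivative g i y) (at (y i))"
      if i: "i < n" and y: "y \<in> D" "\<forall>j<n. \<bar>y j - x j\<bar> < R" for i y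
    proof -
      have y': "\<forall>j<n. \<bar>y j - x j\<bar> \<le> R" using y(2) by auto
      have ybox: "y \<in> coord_box n x r" using in_box[OF y(1) y'] .
      \<comment> \<open>moving the coordinate \<open>i\<close> by less than \<open>\<rho>\<close> does not leave the box of radius \<open>R\<close> around \<open>x\<close>\<close>
      define \<rho> where "\<rho> = R - \<bar>y i - x i\<bar>"
      have "\<rho> > 0" using y i by (simp add: \<rho>_def)
      have est: "\<bar>f (y(i := y i + h)) - f y - h * g i y\<bar> \<le> B / R\<^sup>2 * h\<^sup>2" if h: "\<bar>h\<bar> < \<rho>" for h
      proof -
        let ?z = "y(i := y i + h)"
        have z: "\<forall>j<n. \<bar>?z j - x j\<bar> \<le> R" using y' h by (auto simp: \<rho>_def)
        then have "?z \<in> coord_box n x r" using ybox R i by (force simp: coord_box_def)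
        moreover have "P i x \<mu> ?z = P i x \<mu> y" for \<mu>
          unfolding P_def by (rule prod.cong) auto
        ultimately have "((\<lambda>\<mu>. a \<mu> * ((y i + h - x i) ^ \<mu> i * P i x \<mu> y)) has_sum f ?z) (multi_indices n)"
          using hs[of ?z] unfolding prod_split[OF i, of ?z x] by simp
        moreover have "((\<lambda>\<mu>. a \<mu> * ((y i - x i) ^ \<mu> i * P i x \<mu> y)) has_sum f y) (multi_indices n)"
          using hs[OF ybox] prod_split[OF i, of y x] by simp
        ultimately have "((\<lambda>\<mu>. a \<mu> * ((y i + h - x i) ^ \<mu> i * P i x \<mu> y) - a \<mu> * ((y i - x i) ^ \<mu> i * P i x \<mu> y)
            - h * (a \<mu> * (real (\<mu> i) * (y i - x i) ^ (\<mu> i - 1) * P i x \<mu> y))) has_sum (f ?z - f y - h * g i y)) (multi_indices n)"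
          by (intro has_sum_diff_real has_sum_cmult_right g_sum i y')
        then have "\<bar>f ?z - f y - h * g i y\<bar> \<le> infsum (\<lambda>\<mu>. h\<^sup>2 / R\<^sup>2 * (\<bar>a \<mu>\<bar> * r ^ (\<Sum>i<n. \<mu> i))) (multi_indices n)"
        proof (rule has_sum_abs_le[OF _ scaled(1)])
          fix \<mu> :: "nat \<Rightarrow> nat" assume \<mu>: "\<mu> \<in> multi_indices n"
          let ?E = "(y i + h - x i) ^ \<mu> i - (y i - x i) ^ \<mu> i - real (\<mu> i) * (y i - x i) ^ (\<mu> i - 1) * h"
          have "R\<^sup>2 * \<bar>?E\<bar> \<le> (real (\<mu> i))\<^sup>2 * R ^ \<mu> i * h\<^sup>2"
            using power_second_order[of "y i - x i" R "y i + h - x i" "\<mu> i"] y' z[rule_format, OF i] i by simp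
          also have "\<dots> = (R ^ \<mu> i * (real (\<mu> i))\<^sup>2) * h\<^sup>2" by simp
          also have "\<dots> \<le> r ^ \<mu> i * h\<^sup>2" by (intro mult_right_mono R_pow) auto
          finally have E: "\<bar>?E\<bar> \<le> h\<^sup>2 / R\<^sup>2 * r ^ \<mu> i" using R by (simp add: field_simps)
          have "\<bar>P i x \<mu> y\<bar> \<le> r ^ S i \<mu>" using P_le[of y x r i \<mu>] y' R by force
          then have "\<bar>?E\<bar> * \<bar>P i x \<mu> y\<bar> \<le> (h\<^sup>2 / R\<^sup>2 * r ^ \<mu> i) * r ^ S i \<mu>"
            using E r by (intro mult_mono) auto
          then have "\<bar>a \<mu>\<bar> * (\<bar>?E\<bar> * \<bar>P i x \<mu> y\<bar>) \<le> \<bar>a \<mu>\<bar> * ((h\<^sup>2 / R\<^sup>2 * r ^ \<mu> i) * r ^ S i \<mu>)"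
            by (intro mult_left_mono) auto
          also have "\<dots> = h\<^sup>2 / R\<^sup>2 * (\<bar>a \<mu>\<bar> * r ^ (\<Sum>i<n. \<mu> i))" by (simp add: sum_split[OF i] power_add)
          finally have "\<bar>a \<mu> * (?E * P i x \<mu> y)\<bar> \<le> h\<^sup>2 / R\<^sup>2 * (\<bar>a \<mu>\<bar> * r ^ (\<Sum>i<n. \<mu> i))" by (simp add: abs_mult)
          then show "\<bar>a \<mu> * ((y i + h - x i) ^ \<mu> i * P i x \<mu> y) - a \<mu> * ((y i - x i) ^ \<mu> i * P i x \<mu> y)
            - h * (a \<mu> * (real (\<mu> i) * (y i - x i) ^ (\<mu> i - 1) * P i x \<mu> y))\<bar> \<le> h\<^sup>2 / R\<^sup>2 * (\<bar>a \<mu>\<bar> * r ^ (\<Sum>i<n. \<mu> i))"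
            by (simp add: algebra_simps)
        qed
        then show ?thesis unfolding scaled(2) by (simp add: mult.commute)
      qed
      show ?thesis unfolding DERIV_def
      proof (rule LIM_zero_cancel, rule Lim_null_comparison[where g = "\<lambda>h. B / R\<^sup>2 * \<bar>h\<bar>"])
        show "((\<lambda>h. B / R\<^sup>2 * \<bar>h\<bar>) \<longlongrightarrow> 0) (at 0)"
          by (intro tendsto_eq_intros refl) auto
        show "\<forall>\<^sub>F h in at 0. norm ((f (y(i := y i + h)) - f (y(i := y i))) / h - g i y) \<le> B / R\<^sup>2 * \<bar>h\<bar>"
          unfolding eventually_at
        proof (intro exI[of _ \<rho>] conjI ballI impI)
          fix h :: real assume h: "h \<noteq> 0 \<and> dist h 0 < \<rho>"
          have "\<bar>(f (y(i := y i + h)) - f y) / h - g i y\<bar> = \<bar>f (y(i := y i + h)) - f y - h * g i y\<bar> / \<bar>h\<bar>"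
            using h by (simp add: abs_divide[symmetric] diff_divide_distrib)
          also have "\<dots> \<le> (B / R\<^sup>2 * h\<^sup>2) / \<bar>h\<bar>" using h est[of h] by (intro divide_right_mono) auto
          also have "\<dots> = B / R\<^sup>2 * \<bar>h\<bar>" using h by (simp add: power2_eq_square abs_if)
          finally show "norm ((f (y(i := y i + h)) - f (y(i := y i))) / h - g i y) \<le> B / R\<^sup>2 * \<bar>h\<bar>" by simp
        qed (rule \<open>\<rho> > 0\<close>)
      qed
    qed
    show "(\<lambda>t. f (x(i := t))) differentiable (at (x i))" if "i < n"
      using deriv[OF that x] R real_differentiable_def by fastforce
    show "\<exists>r>0. \<exists>C. \<forall>y\<in>D. (\<forall>j<n. \<bar>y j - x j\<bar> < r) \<longrightarrow>
        \<bar>partial_deriv i f y - partial_deriv i f x\<bar> \<le> C * l1norm n (\<lambda>i. y i - x i)" if i: "i < n"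
    proof (rule exI[of _ R'], rule conjI[OF R(3)], rule exI[of _ "B / R\<^sup>2"], intro ballI impI)
      fix y assume y: "y \<in> D" "\<forall>i<n. \<bar>y i - x i\<bar> < R'"
      define \<delta> where "\<delta> = l1norm n (\<lambda>i. y i - x i)"
      have \<delta>: "\<forall>i<n. \<bar>y i - x i\<bar> \<le> \<delta>" "0 \<le> \<delta>" "\<delta> \<le> R"
        using l1norm_le[OF y(2)] abs_le_l1norm[of _ n "\<lambda>i. y i - x i"] by (auto simp: \<delta>_def)
      have yR: "\<forall>i<n. \<bar>y i - x i\<bar> < R" "\<forall>i<n. \<bar>y i - x i\<bar> \<le> R" using y R by force+
      have pd: "partial_deriv i f y = g i y" "partial_deriv i f x = g i x"
        unfolding partial_deriv_def using deriv[OF i y(1) yR(1)] deriv[OF i x] R by (auto intro: DERIV_imp_deriv)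
      have "\<forall>j<n. \<bar>x j - x j\<bar> \<le> R" using R by simp
      from has_sum_diff_real[OF g_sum[OF i yR(2)] g_sum[OF i this]]
      have "\<bar>g i y - g i x\<bar> \<le> infsum (\<lambda>\<mu>. \<delta> / R\<^sup>2 * (\<bar>a \<mu>\<bar> * r ^ (\<Sum>i<n. \<mu> i))) (multi_indices n)"
      proof (rule has_sum_abs_le[OF _ scaled(1)])
        fix \<mu> :: "nat \<Rightarrow> nat" assume \<mu>: "\<mu> \<in> multi_indices n"
        let ?T = "\<lambda>y. real (\<mu> i) * (y i - x i) ^ (\<mu> i - 1) * P i x \<mu> y"
        have "\<bar>?T y - ?T x\<bar> \<le> \<delta> / R\<^sup>2 * r ^ (\<mu> i + S i \<mu>)"
        proof (cases "\<mu> i")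
          case 0
          then show ?thesis using r R \<delta> by simp
        next
          case (Suc k)
          show ?thesis
          proof (cases "k + S i \<mu>")
            case 0
            then have "\<forall>j\<in>{..<n}-{i}. \<mu> j = 0" by (auto simp: S_def)
            then have "P i x \<mu> y = 1" "P i x \<mu> x = 1" unfolding P_def by (auto intro!: prod.neutral)
            then show ?thesis using 0 Suc r R \<delta> by simp
          next
            case (Suc l)
            have "?T x = 0"
            proof (cases "k = 0")
              case True
              then have "S i \<mu> \<noteq> 0" using Suc by simp
              then obtain j where "j \<in> {..<n}-{i}" "\<mu> j \<noteq> 0"
                unfolding S_def by (rule sum.not_neutral_contains_not_neutral)
              then have "P i x \<mu> x = 0" unfolding P_def by (intro prod_zero) auto
              then show ?thesis by simp
            qed (use \<open>\<mu> i = Suc k\<close> in simp)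
            have "\<bar>?T y\<bar> \<le> real (\<mu> i) * \<delta> ^ k * \<delta> ^ S i \<mu>"
              unfolding abs_mult using P_le[OF \<delta>(1)] \<open>\<mu> i = Suc k\<close> \<delta> i by (intro mult_mono) (auto simp: power_abs intro!: power_mono)
            also have "\<dots> = real (\<mu> i) * (\<delta> * \<delta> ^ l)" using Suc by (simp add: power_add[symmetric] mult.assoc)
            also have "\<dots> \<le> real (\<mu> i) * (\<delta> * R ^ l)" using \<delta> by (intro mult_left_mono power_mono) auto
            also have "\<dots> = \<delta> / R\<^sup>2 * (R ^ (Suc (Suc l)) * real (\<mu> i))" using R by (simp add: field_simps power2_eq_square)
            also have "Suc (Suc l) = \<mu> i + S i \<mu>" using Suc \<open>\<mu> i = Suc k\<close> by simp
            also have "\<delta> / R\<^sup>2 * (R ^ (\<mu> i + S i \<mu>) * real (\<mu> i)) \<le> \<delta> / R\<^sup>2 * r ^ (\<mu> i + S i \<mu>)"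
              using \<delta> R by (intro mult_left_mono R_pow(1)) auto
            finally show ?thesis unfolding \<open>?T x = 0\<close> by simp
          qed
        qed
        then have "\<bar>a \<mu>\<bar> * \<bar>?T y - ?T x\<bar> \<le> \<bar>a \<mu>\<bar> * (\<delta> / R\<^sup>2 * r ^ (\<mu> i + S i \<mu>))" by (intro mult_left_mono) auto
        then show "\<bar>a \<mu> * ?T y - a \<mu> * ?T x\<bar> \<le> \<delta> / R\<^sup>2 * (\<bar>a \<mu>\<bar> * r ^ (\<Sum>i<n. \<mu> i))"
          unfolding sum_split[OF i] by (simp add: abs_mult[symmetric] right_diff_distrib mult_ac)
      qed
      then show "\<bar>partial_deriv i f y - partial_deriv i f x\<bar> \<le> B / R\<^sup>2 * l1norm n (\<lambda>i. y i - x i)"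
        unfolding scaled(2) pd \<delta>_def by (simp add: mult.commute)
    qed
  qed
  show ?thesis unfolding Ck_fun_1_iff
  proof (intro conjI allI impI ballI)
    show "continuous_on D f" by (rule continuous_on_coord_lipschitz) (rule cont_f)
    show "continuous_on D (partial_deriv i f)" if "i < n" for i
      by (rule continuous_on_coord_lipschitz) (rule cont_df[OF _ that])
  qed (rule deriv_f)
qed

lemma Cr_fun_imp_C1:
  assumes "r \<noteq> Differentiable 0" "openin (Euclidean_space n) D" "Cr_fun r n D f"
  shows "Ck_fun 1 n D f"
proof (cases r)
  case (Differentiable e)
  then have "enat 1 \<le> e" using assms(1) by (metis gr_zeroI ileI1 one_eSuc one_enat_def)
  then show ?thesis using assms(3) Differentiable unfolding Cr_fun_def by auto
next
  case Analytic
  then show ?thesis using assms analytic_fun_imp_C1 by (simp add: Cr_fun_def)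
qed

section \<open>Continuously differentiable maps of manifolds\<close>

definition atlas :: "'a::topological_space mfd \<Rightarrow> bool" where
  "atlas X \<longleftrightarrow> (\<forall>c\<in>charts X. is_chart (mdim X) c) \<and> (\<Union>c\<in>charts X. fst c) = UNIV"

abbreviation C1_on :: "'a::topological_space mfd \<Rightarrow> 'b::topological_space mfd \<Rightarrow> 'a set \<Rightarrow> ('a \<Rightarrow> 'b) \<Rightarrow> bool" where
  "C1_on X Y W F \<equiv> Cr_on (Differentiable 1) X Y W F"

lemma manifold_imp_atlas: "manifold r X \<Longrightarrow> atlas X"
  by (simp add: manifold_def atlas_def)

lemma atlasD:
  assumes "atlas X"
  shows "c \<in> charts X \<Longrightarrow> is_chart (mdim X) c" "c \<in> charts_at X p \<Longrightarrow> is_chart (mdim X) c"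
    "c \<in> charts X \<Longrightarrow> open (fst c)"
    "\<exists>c\<in>charts X. p \<in> fst c"
  using assms is_chartD(1) unfolding atlas_def charts_at_def by blast+

lemma open_coord_domain:
  assumes "is_chart n c" "open (fst c')" "open W" "continuous_on W F"
  shows "open (fst c \<inter> W \<inter> F -` fst c')"
  using assms is_chartD(1)[OF assms(1)] continuous_open_preimage[OF assms(4,3,2)]
  by (metis Int_assoc open_Int)

lemma Cr_fun_1_iff: "Cr_fun (Differentiable 1) n D f \<longleftrightarrow> Ck_fun 1 n D f"
proof -
  have "enat k \<le> 1 \<longleftrightarrow> k = 0 \<or> k = 1" for k
    by (auto simp: one_enat_def)
  then show ?thesis by (auto simp: Cr_fun_def Ck_fun_1_iff)
qed

lemma Cr_on_imp_C1_on:
  assumes r: "r \<noteq> Differentiable 0" and "atlas X" "atlas Y" and F: "Cr_on r X Y W F"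
  shows "C1_on X Y W F"
  unfolding Cr_on_def Cr_vec_def Cr_fun_1_iff
proof (intro conjI ballI allI impI)
  fix c c' j assume c: "c \<in> charts X" "c' \<in> charts Y" "j < mdim Y"
  have ic: "is_chart (mdim X) c" using assms(2) c(1) by (rule atlasD(1))
  have "openin (Euclidean_space (mdim X)) (snd c ` (fst c \<inter> W \<inter> F -` fst c'))"
    by (rule is_chartD(6)[OF ic open_coord_domain[OF ic]])
      (use F atlasD(3)[OF assms(3) c(2)] in \<open>auto simp: Cr_on_def\<close>)
  moreover have "Cr_fun r (mdim X) (snd c ` (fst c \<inter> W \<inter> F -` fst c')) (\<lambda>u. coord_rep c c' F u j)"
    using F c by (auto simp: Cr_on_def Cr_vec_def)
  ultimately show "Ck_fun 1 (mdim X) (snd c ` (fst c \<inter> W \<inter> F -` fst c')) (\<lambda>u. coord_rep c c' F u j)"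
    using r by (intro Cr_fun_imp_C1)
qed (use F in \<open>auto simp: Cr_on_def\<close>)

lemma C1_onD:
  assumes "C1_on X Y W F"
  shows "open W" "continuous_on W F"
    "c \<in> charts X \<Longrightarrow> c' \<in> charts Y \<Longrightarrow> C1_in_charts (mdim X) (mdim Y) W c c' F"
  using assms unfolding Cr_on_def Cr_vec_def Cr_fun_1_iff C1_in_charts_def by auto

lemma C1_on_strict_diff:
  assumes "atlas X" "atlas Y" "C1_on X Y W F" "p \<in> W" "c \<in> charts_at X p" "c' \<in> charts_at Y (F p)"
  shows "strict_diff (mdim X) (mdim Y) (snd c) (snd c') F p (jacobian X Y c c' F p)"
proof (rule strict_diff_cong_matrix)
  show "strict_diff (mdim X) (mdim Y) (snd c) (snd c') F p (\<lambda>j i. partial_deriv i (\<lambda>u. coord_rep c c' F u j) (snd c p))"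
    by (rule C1_in_charts_strict_diff[where W = W]) (use assms C1_onD[OF assms(3)] in \<open>auto simp: charts_at_def atlasD\<close>)
qed (simp add: jacobian_def)

lemma continuous_on_jacobian:
  assumes "atlas X" "C1_on X Y W F" "c \<in> charts X" "c' \<in> charts Y"
  shows "continuous_on (fst c \<inter> W \<inter> F -` fst c') (\<lambda>p. jacobian X Y c c' F p j i)"
proof (cases "j < mdim Y \<and> i < mdim X")
  case True
  let ?N = "fst c \<inter> W \<inter> F -` fst c'"
  have "continuous_on (snd c ` ?N) (partial_deriv i (\<lambda>u. coord_rep c c' F u j))"
    using C1_onD(3)[OF assms(2-4)] True unfolding C1_in_charts_def Ck_fun_1_iff by blast
  moreover have "continuous_on ?N (snd c)"
    using is_chartD(3)[OF atlasD(1)[OF assms(1,3)]] by (rule continuous_on_subset) auto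
  ultimately show ?thesis using True continuous_on_compose2[of "snd c ` ?N" _ ?N "snd c"]
    by (simp add: jacobian_def)
next
  case False
  then show ?thesis
    by (intro continuous_on_eq[OF continuous_on_const[of _ 0]]) (auto simp: jacobian_def)
qed

lemma isCont_imp_image_nbhd:
  assumes "open W" "continuous_on W F" "p \<in> W" "open V" "F p \<in> V"
  shows "\<exists>W'. open W' \<and> p \<in> W' \<and> F ` W' \<subseteq> V"
  using continuous_open_preimage[OF assms(2,1,4)] assms by (intro exI[of _ "W \<inter> F -` V"]) auto

lemma C1_near_strict_diff:
  assumes "atlas X" "atlas Y" "C1_near X Y p F" "c \<in> charts_at X p" "c' \<in> charts_at Y (F p)"
  shows "strict_diff (mdim X) (mdim Y) (snd c) (snd c') F p (jacobian X Y c c' F p)"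
  using assms unfolding C1_near_def by (auto intro: C1_on_strict_diff)

text \<open>Strict differentials compose, and in charts they are the Jacobian matrices.\<close>

lemma jacobian_compose:
  assumes "atlas X" "atlas Y" "atlas Z" and F: "C1_near X Y p F" and G: "C1_near Y Z (F p) G"
    and c: "c \<in> charts_at X p" "c' \<in> charts_at Y (F p)" "c'' \<in> charts_at Z (G (F p))"
  shows "jacobian X Z c c'' (\<lambda>x. G (F x)) p = (\<lambda>j i. if j < mdim Z \<and> i < mdim X
    then \<Sum>k<mdim Y. jacobian Y Z c' c'' G (F p) j k * jacobian X Y c c' F p k i else 0)"
proof (rule strict_diff_imp_jacobian)
  obtain W where W: "p \<in> W" "open W" "continuous_on W F"
    using F unfolding C1_near_def by (auto dest: C1_onD)
  show "strict_diff (mdim X) (mdim Z) (snd c) (snd c'') (\<lambda>x. G (F x)) p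
    (\<lambda>j i. \<Sum>k<mdim Y. jacobian Y Z c' c'' G (F p) j k * jacobian X Y c c' F p k i)"
    by (rule strict_diff_compose[OF C1_near_strict_diff[OF assms(1,2) F c(1,2)] C1_near_strict_diff[OF assms(2,3) G c(2,3)]])
      (use isCont_imp_image_nbhd[OF W(2,3,1)] in blast)
qed (use c assms in \<open>auto simp: charts_at_def atlasD\<close>)


section \<open>Product charts\<close>

lemma continuous_on_coordinate: "continuous_on S (\<lambda>x::nat \<Rightarrow> real. x k)"
  using continuous_on_id[of S] unfolding id_def continuous_on_nat_fun_iff by blast

lemma is_chartI:
  assumes U: "open U" "inj_on \<phi> U" "continuous_on U \<phi>" and im: "openin (Euclidean_space n) (\<phi> ` U)"
    and inv: "continuous_on (\<phi> ` U) (inv_into U \<phi>)"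
  shows "is_chart n (U, \<phi>)"
proof -
  have "homeomorphic_maps (top_of_set U) (top_of_set (\<phi> ` U)) \<phi> (inv_into U \<phi>)"
    unfolding homeomorphic_maps_def using U inv
    by (auto simp: inv_into_into f_inv_into_f)
  then show ?thesis using U im
    by (auto simp: is_chart_def subtopology_Euclidean_space homeomorphic_map_maps)
qed

lemma sum_lessThan_add:
  "(\<Sum>i<n + (m::nat). f i) = (\<Sum>i<n. f i) + (\<Sum>i<m. (f (n + i) :: 'a::comm_monoid_add))"
  by (induction m) (auto simp: add.assoc)

lemma prod_chart_apply:
  "snd (prod_chart n c c') (x, y) i = (if i < n then snd c x i else snd c' y (i - n))"
  "fst (prod_chart n c c') = fst c \<times> fst c'"
  by (simp_all add: prod_chart_def)

text \<open>The coordinates of a product chart are those of the first factor followed by those of the second,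
  shifted by \<open>n\<close>; its inverse is the pair of the inverses applied to the two blocks.\<close>

lemma is_chart_prod_chart:
  assumes c: "is_chart n c" and c': "is_chart m c'"
  shows "is_chart (n + m) (prod_chart n c c')"
proof -
  define \<Phi> where "\<Phi> = snd (prod_chart n c c')"
  define U where "U = fst c \<times> fst c'"
  define lo where "lo = (\<lambda>w::nat\<Rightarrow>real. \<lambda>i. if i < n then w i else 0)"
  define hi where "hi = (\<lambda>w::nat\<Rightarrow>real. \<lambda>i. w (n + i))"
  have \<Phi>: "\<Phi> (x, y) i = (if i < n then snd c x i else snd c' y (i - n))" for x y i
    by (simp add: \<Phi>_def prod_chart_apply)
  have lo: "lo (\<Phi> (x, y)) = snd c x" if "x \<in> fst c" for x y
    using is_chartD(5)[OF c that] by (auto simp: lo_def \<Phi> fun_eq_iff)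
  have hi: "hi (\<Phi> (x, y)) = snd c' y" for x y
    by (auto simp: hi_def \<Phi> fun_eq_iff)
  have clo: "continuous_on S lo" and chi: "continuous_on S hi" for S
  proof -
    have "continuous_on S (\<lambda>w. if i < n then w i else 0)" for i
      by (cases "i < n") (auto intro: continuous_on_coordinate)
    then show "continuous_on S lo" "continuous_on S hi"
      unfolding lo_def hi_def continuous_on_nat_fun_iff by (auto intro: continuous_on_coordinate)
  qed
  have im: "\<Phi> ` U = {w. (\<forall>i\<ge>n+m. w i = 0) \<and> lo w \<in> snd c ` fst c \<and> hi w \<in> snd c' ` fst c'}"
  proof (intro equalityI subsetI)
    fix w assume "w \<in> \<Phi> ` U"
    then obtain x y where w: "w = \<Phi> (x, y)" "x \<in> fst c" "y \<in> fst c'" by (auto simp: U_def)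
    then show "w \<in> {w. (\<forall>i\<ge>n+m. w i = 0) \<and> lo w \<in> snd c ` fst c \<and> hi w \<in> snd c' ` fst c'}"
      using lo[OF w(2)] hi is_chartD(5)[OF c' w(3)] by (auto simp: \<Phi>)
  next
    fix w assume "w \<in> {w. (\<forall>i\<ge>n+m. w i = 0) \<and> lo w \<in> snd c ` fst c \<and> hi w \<in> snd c' ` fst c'}"
    then obtain x y where xy: "x \<in> fst c" "lo w = snd c x" "y \<in> fst c'" "hi w = snd c' y"
      and "\<forall>i\<ge>n+m. w i = 0" by auto
    have "w i = \<Phi> (x, y) i" for i
    proof (cases "i < n")
      case True
      then show ?thesis using fun_cong[OF xy(2), of i] by (simp add: \<Phi> lo_def)
    next
      case False
      then show ?thesis using fun_cong[OF xy(4), of "i - n"] by (simp add: \<Phi> hi_def)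
    qed
    then show "w \<in> \<Phi> ` U" using xy by (auto simp: U_def intro!: image_eqI[of _ _ "(x, y)"])
  qed
  have inj: "inj_on \<Phi> U"
  proof (rule inj_onI)
    fix p q assume pq: "p \<in> U" "q \<in> U" "\<Phi> p = \<Phi> q"
    obtain x y x' y' where e: "p = (x, y)" "q = (x', y')" by (cases p, cases q) auto
    have "snd c x = snd c x'" "snd c' y = snd c' y'"
      using pq lo hi unfolding e by (auto simp: U_def) metis+
    then show "p = q" using pq is_chartD(2)[OF c] is_chartD(2)[OF c'] unfolding e
      by (auto simp: U_def inj_on_def)
  qed
  have "is_chart (n + m) (U, \<Phi>)"
  proof (rule is_chartI[OF _ inj])
    show "open U" unfolding U_def by (rule open_Times[OF is_chartD(1)[OF c] is_chartD(1)[OF c']])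
    have "continuous_on U (\<lambda>p. \<Phi> p i)" for i
    proof -
      have "continuous_on U (\<lambda>p. snd c (fst p) i)" for i
        by (rule continuous_on_compose2[OF continuous_on_chart_coord[OF c] continuous_on_fst[OF continuous_on_id]])
          (auto simp: U_def)
      moreover have "continuous_on U (\<lambda>p. snd c' (snd p) i)" for i
        by (rule continuous_on_compose2[OF continuous_on_chart_coord[OF c'] continuous_on_snd[OF continuous_on_id]])
          (auto simp: U_def)
      ultimately show ?thesis by (cases "i < n") (simp_all add: \<Phi>_def prod_chart_def case_prod_unfold)
    qed
    then show "continuous_on U \<Phi>" unfolding continuous_on_nat_fun_iff[of _ \<Phi>] by blast
    obtain T1 where T1: "open T1" "snd c ` fst c = {u. \<forall>i\<ge>n. u i = 0} \<inter> T1"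
      using is_chartD(4)[OF c] unfolding Euclidean_space_eq openin_open by blast
    obtain T2 where T2: "open T2" "snd c' ` fst c' = {u. \<forall>i\<ge>m. u i = 0} \<inter> T2"
      using is_chartD(4)[OF c'] unfolding Euclidean_space_eq openin_open by blast
    have "open (lo -` T1 \<inter> hi -` T2)"
      using clo[of UNIV] chi[of UNIV] T1(1) T2(1) by (intro open_Int open_vimage) auto
    moreover have "\<Phi> ` U = {u. \<forall>i\<ge>n+m. u i = 0} \<inter> (lo -` T1 \<inter> hi -` T2)"
      unfolding im T1(2) T2(2) by (auto simp: lo_def hi_def)
    ultimately show "openin (Euclidean_space (n + m)) (\<Phi> ` U)"
      unfolding Euclidean_space_eq openin_open by blast
    have inv: "inv_into U \<Phi> w = (inv_into (fst c) (snd c) (lo w), inv_into (fst c') (snd c') (hi w))"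
      if w: "w \<in> \<Phi> ` U" for w
    proof -
      obtain x y where w: "w = \<Phi> (x, y)" "x \<in> fst c" "y \<in> fst c'" using w by (auto simp: U_def)
      then have "inv_into U \<Phi> w = (x, y)" using inj by (simp add: U_def)
      then show ?thesis using w lo hi c c' by simp
    qed
    have "continuous_on (\<Phi> ` U) (\<lambda>w. (inv_into (fst c) (snd c) (lo w), inv_into (fst c') (snd c') (hi w)))"
      by (rule continuous_on_Pair[OF continuous_on_compose2[OF is_chartD(7)[OF c] clo]
          continuous_on_compose2[OF is_chartD(7)[OF c'] chi]]) (auto simp: im)
    then show "continuous_on (\<Phi> ` U) (inv_into U \<Phi>)"
      by (subst continuous_on_cong[OF refl inv]) auto
  qed
  then show ?thesis by (simp add: U_def \<Phi>_def prod_chart_def)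
qed

lemma atlas_prod_mfd: "atlas X \<Longrightarrow> atlas Y \<Longrightarrow> atlas (prod_mfd X Y)"
  unfolding atlas_def
proof (intro conjI ballI)
  fix c assume "(\<forall>c\<in>charts X. is_chart (mdim X) c) \<and> \<Union> (fst ` charts X) = UNIV"
    "(\<forall>c\<in>charts Y. is_chart (mdim Y) c) \<and> \<Union> (fst ` charts Y) = UNIV" "c \<in> charts (prod_mfd X Y)"
  then show "is_chart (mdim (prod_mfd X Y)) c"
    by (auto simp: prod_mfd_def is_chart_prod_chart simp del: split_paired_Ex)
next
  assume at: "(\<forall>c\<in>charts X. is_chart (mdim X) c) \<and> \<Union> (fst ` charts X) = UNIV"
    "(\<forall>c\<in>charts Y. is_chart (mdim Y) c) \<and> \<Union> (fst ` charts Y) = UNIV"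
  have "z \<in> \<Union> (fst ` charts (prod_mfd X Y))" for z
  proof -
    obtain c c' where "c \<in> charts X" "fst z \<in> fst c" "c' \<in> charts Y" "snd z \<in> fst c'"
      using at by blast
    then have "prod_chart (mdim X) c c' \<in> charts (prod_mfd X Y)" "z \<in> fst (prod_chart (mdim X) c c')"
      by (auto simp: prod_mfd_def prod_chart_apply mem_Times_iff simp del: split_paired_Ex)
    then show ?thesis by blast
  qed
  then show "\<Union> (fst ` charts (prod_mfd X Y)) = UNIV" by blast
qed

abbreviation real_chart :: "real chart" where
  "real_chart \<equiv> (UNIV, \<lambda>t i. if i = 0 then t else 0)"

lemma atlas_real_mfd: "atlas real_mfd"
proof -
  have im: "range (\<lambda>(t::real) (i::nat). if i = 0 then t else 0) = {u. \<forall>i\<ge>1. u i = 0}"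
  proof (intro equalityI subsetI)
    fix u :: "nat \<Rightarrow> real" assume "u \<in> {u. \<forall>i\<ge>1. u i = 0}"
    then have "u = (\<lambda>i. if i = 0 then u 0 else 0)" by (auto simp: fun_eq_iff)
    then show "u \<in> range (\<lambda>t i. if i = 0 then t else 0)" by blast
  qed auto
  have inj: "inj (\<lambda>(t::real) (i::nat). if i = 0 then t else 0)"
    by (auto simp: inj_on_def fun_eq_iff)
  have "is_chart 1 real_chart"
  proof (rule is_chartI[OF open_UNIV inj])
    show "continuous_on UNIV (\<lambda>(t::real) (i::nat). if i = 0 then t else 0)"
      unfolding continuous_on_nat_fun_iff
    proof
      show "continuous_on UNIV (\<lambda>t::real. if i = 0 then t else 0)" for i :: nat
        by (cases "i = 0") (auto intro: continuous_intros)
    qed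
    show "openin (Euclidean_space 1) (range (\<lambda>(t::real) (i::nat). if i = 0 then t else 0))"
      unfolding im Euclidean_space_eq using openin_topspace[of "top_of_set {u. \<forall>i\<ge>1. u i = (0::real)}"] by simp
    have "inv_into UNIV (\<lambda>(t::real) (i::nat). if i = 0 then t else 0) w = w 0"
      if w: "w \<in> range (\<lambda>(t::real) (i::nat). if i = 0 then t else 0)" for w
    proof -
      obtain t where "w = (\<lambda>i. if i = 0 then t else 0)" using w by blast
      then show ?thesis using inv_f_f[OF inj, of t] by simp
    qed
    then show "continuous_on (range (\<lambda>(t::real) (i::nat). if i = 0 then t else 0))
      (inv_into UNIV (\<lambda>(t::real) (i::nat). if i = 0 then t else 0))"
      by (subst continuous_on_cong[OF refl, of _ _ "\<lambda>w. w 0"]) (auto intro: continuous_on_coordinate)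
  qed
  then show ?thesis by (simp add: atlas_def real_mfd_def)
qed


section \<open>Jets\<close>

text \<open>The sets that generate the topology of the space of 1-jets.\<close>

definition jet_coord_nbhd :: "'a::topological_space mfd \<Rightarrow> 'b::topological_space mfd \<Rightarrow> 'a chart \<Rightarrow> 'b chart
    \<Rightarrow> ((nat \<Rightarrow> real) \<times> (nat \<Rightarrow> real) \<times> (nat \<Rightarrow> nat \<Rightarrow> real)) set \<Rightarrow> ('a, 'b) jet set" where
  "jet_coord_nbhd X Y c c' N = {jet1 X Y x f | x f. x \<in> fst c \<and> f x \<in> fst c' \<and> C1_near X Y x f \<and>
     (snd c x, snd c' (f x), jacobian X Y c c' f x) \<in> N}"

lemma jet_topology_eq:
  "jet_topology X Y = topology_generated_by
     {jet_coord_nbhd X Y c c' N | c c' N. c \<in> charts X \<and> c' \<in> charts Y \<and> open N}"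
  unfolding jet_topology_def jet_coord_nbhd_def ..

lemma openin_jet_coord_nbhd:
  "c \<in> charts X \<Longrightarrow> c' \<in> charts Y \<Longrightarrow> open N \<Longrightarrow> openin (jet_topology X Y) (jet_coord_nbhd X Y c c' N)"
  unfolding jet_topology_eq by (rule topology_generated_by_Basis) blast

lemma jet1_eqD:
  assumes "jet1 X Y x f = jet1 X Y x' f'" "C1_near X Y x' f'"
  shows "x' = x" "f' x = f x"
    "\<And>c c'. c \<in> charts_at X x \<Longrightarrow> c' \<in> charts_at Y (f x) \<Longrightarrow> jacobian X Y c c' f' x = jacobian X Y c c' f x"
proof -
  have "f' \<in> snd (jet1 X Y x' f')" using assms(2) by (simp add: jet1_def)
  then have *: "f' \<in> snd (jet1 X Y x f)" using assms(1) by simp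
  show "x' = x" using assms(1) by (simp add: jet1_def)
  show "f' x = f x"
    "\<And>c c'. c \<in> charts_at X x \<Longrightarrow> c' \<in> charts_at Y (f x) \<Longrightarrow> jacobian X Y c c' f' x = jacobian X Y c c' f x"
    using * by (auto simp: jet1_def)
qed

lemma jet1_in_jet_coord_nbhd:
  assumes "c \<in> charts X" "c' \<in> charts Y" "C1_near X Y x f"
  shows "jet1 X Y x f \<in> jet_coord_nbhd X Y c c' N \<longleftrightarrow>
    x \<in> fst c \<and> f x \<in> fst c' \<and> (snd c x, snd c' (f x), jacobian X Y c c' f x) \<in> N"
proof
  assume "jet1 X Y x f \<in> jet_coord_nbhd X Y c c' N"
  then obtain x' f' where eq: "jet1 X Y x f = jet1 X Y x' f'" and f': "C1_near X Y x' f'" and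
    *: "x' \<in> fst c" "f' x' \<in> fst c'" "(snd c x', snd c' (f' x'), jacobian X Y c c' f' x') \<in> N"
    unfolding jet_coord_nbhd_def by blast
  note e = jet1_eqD[OF eq f']
  show "x \<in> fst c \<and> f x \<in> fst c' \<and> (snd c x, snd c' (f x), jacobian X Y c c' f x) \<in> N"
    using * e(3)[of c c'] assms(1,2) unfolding e(1) e(2) by (simp add: charts_at_def)
qed (use assms in \<open>auto simp: jet_coord_nbhd_def\<close>)

lemma topspace_jet_topology:
  assumes "atlas X" "atlas Y"
  shows "topspace (jet_topology X Y) = {jet1 X Y x f | x f. C1_near X Y x f}"
proof -
  have "jet1 X Y x f \<in> \<Union>{jet_coord_nbhd X Y c c' N | c c' N. c \<in> charts X \<and> c' \<in> charts Y \<and> open N}"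
    if "C1_near X Y x f" for x f
  proof -
    obtain c c' where c: "c \<in> charts X" "x \<in> fst c" "c' \<in> charts Y" "f x \<in> fst c'"
      using atlasD(4)[OF assms(1)] atlasD(4)[OF assms(2)] by metis
    then have "jet1 X Y x f \<in> jet_coord_nbhd X Y c c' UNIV"
      using that by (simp add: jet1_in_jet_coord_nbhd)
    then show ?thesis using c by blast
  qed
  moreover have "j \<in> {jet1 X Y x f | x f. C1_near X Y x f}" if "j \<in> jet_coord_nbhd X Y c c' N" for j c c' N
    using that unfolding jet_coord_nbhd_def by blast
  ultimately show ?thesis unfolding jet_topology_eq topology_generated_by_topspace by blast
qed

lemma jet1_in_topspace:
  "atlas X \<Longrightarrow> atlas Y \<Longrightarrow> C1_near X Y x f \<Longrightarrow> jet1 X Y x f \<in> topspace (jet_topology X Y)"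
  by (auto simp: topspace_jet_topology)

lemma continuous_on_nat2_fun_iff:
  fixes f :: "'a::topological_space \<Rightarrow> nat \<Rightarrow> nat \<Rightarrow> real"
  shows "continuous_on S f \<longleftrightarrow> (\<forall>j i. continuous_on S (\<lambda>x. f x j i))"
proof
  assume "continuous_on S f"
  then have "continuous_on S (\<lambda>x. f x j)" for j by (rule continuous_on_product_then_coordinatewise)
  then show "\<forall>j i. continuous_on S (\<lambda>x. f x j i)" unfolding continuous_on_nat_fun_iff by blast
next
  assume "\<forall>j i. continuous_on S (\<lambda>x. f x j i)"
  then have "continuous_on S (\<lambda>x. f x j)" for j unfolding continuous_on_nat_fun_iff[of _ "\<lambda>x. f x j"] by blast
  then show "continuous_on S f" by (rule continuous_on_coordinatewise_then_product)
qed

lemma continuous_map_jets: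
  fixes xs :: "'t::topological_space \<Rightarrow> 'a::topological_space" and fs :: "'t \<Rightarrow> 'a \<Rightarrow> 'b::topological_space"
  assumes at: "atlas X" "atlas Y" and xs: "continuous_on UNIV xs" and fx: "continuous_on UNIV (\<lambda>s. fs s (xs s))"
    and C1: "\<And>s. C1_near X Y (xs s) (fs s)"
    and jac: "\<And>c c' j i. c \<in> charts X \<Longrightarrow> c' \<in> charts Y \<Longrightarrow>
      continuous_on {s. xs s \<in> fst c \<and> fs s (xs s) \<in> fst c'} (\<lambda>s. jacobian X Y c c' (fs s) (xs s) j i)"
  shows "continuous_map euclidean (jet_topology X Y) (\<lambda>s. jet1 X Y (xs s) (fs s))"
  unfolding jet_topology_eq
proof (rule continuous_on_generated_topo)
  fix G assume "G \<in> {jet_coord_nbhd X Y c c' N | c c' N. c \<in> charts X \<and> c' \<in> charts Y \<and> open N}"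
  then obtain c c' N where G: "G = jet_coord_nbhd X Y c c' N" "c \<in> charts X" "c' \<in> charts Y" "open N" by blast
  let ?D = "{s. xs s \<in> fst c \<and> fs s (xs s) \<in> fst c'}"
  have D: "open ?D"
  proof -
    have "?D = xs -` fst c \<inter> (\<lambda>s. fs s (xs s)) -` fst c'" by auto
    moreover have "open (fst c)" "open (fst c')" using at G atlasD(3) by blast+
    ultimately show ?thesis using xs fx by (simp add: open_Int open_vimage)
  qed
  have 1: "continuous_on ?D (\<lambda>s. snd c (xs s))"
    by (rule continuous_on_compose2[OF is_chartD(3)[OF atlasD(1)[OF at(1) G(2)]] continuous_on_subset[OF xs]]) auto
  have 2: "continuous_on ?D (\<lambda>s. snd c' (fs s (xs s)))"
    by (rule continuous_on_compose2[OF is_chartD(3)[OF atlasD(1)[OF at(2) G(3)]] continuous_on_subset[OF fx]]) auto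
  have 3: "continuous_on ?D (\<lambda>s. jacobian X Y c c' (fs s) (xs s))"
    unfolding continuous_on_nat2_fun_iff using jac[OF G(2,3)] by blast
  have "open (?D \<inter> (\<lambda>s. (snd c (xs s), snd c' (fs s (xs s)), jacobian X Y c c' (fs s) (xs s))) -` N)"
    by (intro continuous_open_preimage[OF _ D G(4)] continuous_on_Pair 1 2 3)
  moreover have "(\<lambda>s. jet1 X Y (xs s) (fs s)) -` G = ?D \<inter> (\<lambda>s. (snd c (xs s), snd c' (fs s (xs s)), jacobian X Y c c' (fs s) (xs s))) -` N"
    unfolding G(1) vimage_def using jet1_in_jet_coord_nbhd[OF G(2,3) C1] by blast
  ultimately show "openin euclidean ((\<lambda>s. jet1 X Y (xs s) (fs s)) -` G \<inter> topspace euclidean)" by simp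
next
  show "(\<lambda>s. jet1 X Y (xs s) (fs s)) ` topspace euclidean
    \<subseteq> \<Union>{jet_coord_nbhd X Y c c' N | c c' N. c \<in> charts X \<and> c' \<in> charts Y \<and> open N}"
    using jet1_in_topspace[OF at C1] unfolding jet_topology_eq topology_generated_by_topspace by blast
qed

lemma continuous_map_jet1:
  assumes at: "atlas X" "atlas Y" and F: "C1_on X Y UNIV F"
  shows "continuous_map euclidean (jet_topology X Y) (\<lambda>x. jet1 X Y x F)"
proof (rule continuous_map_jets[OF at])
  show "continuous_on {s. s \<in> fst c \<and> F s \<in> fst c'} (\<lambda>s. jacobian X Y c c' F s j i)"
    if "c \<in> charts X" "c' \<in> charts Y" for c c' j i
  proof -
    have "{s. s \<in> fst c \<and> F s \<in> fst c'} = fst c \<inter> UNIV \<inter> F -` fst c'" by auto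
    then show ?thesis using continuous_on_jacobian[OF at(1) F that] by simp
  qed
qed (use C1_onD[OF F] F in \<open>auto simp: C1_near_def\<close>)

text \<open>Continuity of the composition of 1-jets. Only jets with matching base points compose, hence the
  formulation by neighbourhoods. For a generating set \<open>Q\<close> the claim is, in coordinates, the continuity
  of matrix multiplication; finite intersections and unions are inherited.\<close>

lemma jet_compose_nbhds:
  assumes at: "atlas X" "atlas Y" "atlas Z"
    and f0: "C1_near X Y p f0" and g0: "C1_near Y Z (f0 p) g0" and gf0: "C1_near X Z p (\<lambda>x. g0 (f0 x))"
    and Q: "openin (jet_topology X Z) Q" "jet1 X Z p (\<lambda>x. g0 (f0 x)) \<in> Q"
  shows "\<exists>O1 O2. openin (jet_topology X Y) O1 \<and> jet1 X Y p f0 \<in> O1 \<and>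
    openin (jet_topology Y Z) O2 \<and> jet1 Y Z (f0 p) g0 \<in> O2 \<and>
    (\<forall>x f g. C1_near X Y x f \<longrightarrow> C1_near Y Z (f x) g \<longrightarrow> C1_near X Z x (\<lambda>x. g (f x)) \<longrightarrow>
       jet1 X Y x f \<in> O1 \<longrightarrow> jet1 Y Z (f x) g \<in> O2 \<longrightarrow> jet1 X Z x (\<lambda>x. g (f x)) \<in> Q)"
    (is "?P Q")
proof -
  have "generate_topology_on {jet_coord_nbhd X Z c c' N | c c' N. c \<in> charts X \<and> c' \<in> charts Z \<and> open N} Q"
    using Q(1) unfolding jet_topology_eq openin_topology_generated_by_iff .
  then show ?thesis using Q(2)
  proof (induction rule: generate_topology_on.induct)
    case (Int a b)
    then have "jet1 X Z p (\<lambda>x. g0 (f0 x)) \<in> a" "jet1 X Z p (\<lambda>x. g0 (f0 x)) \<in> b" by auto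
    with Int obtain A1 A2 B1 B2 where
      "openin (jet_topology X Y) A1" "jet1 X Y p f0 \<in> A1" "openin (jet_topology Y Z) A2" "jet1 Y Z (f0 p) g0 \<in> A2"
      "openin (jet_topology X Y) B1" "jet1 X Y p f0 \<in> B1" "openin (jet_topology Y Z) B2" "jet1 Y Z (f0 p) g0 \<in> B2"
      and A: "\<forall>x f g. C1_near X Y x f \<longrightarrow> C1_near Y Z (f x) g \<longrightarrow> C1_near X Z x (\<lambda>x. g (f x)) \<longrightarrow>
       jet1 X Y x f \<in> A1 \<longrightarrow> jet1 Y Z (f x) g \<in> A2 \<longrightarrow> jet1 X Z x (\<lambda>x. g (f x)) \<in> a"
      and B: "\<forall>x f g. C1_near X Y x f \<longrightarrow> C1_near Y Z (f x) g \<longrightarrow> C1_near X Z x (\<lambda>x. g (f x)) \<longrightarrow>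
       jet1 X Y x f \<in> B1 \<longrightarrow> jet1 Y Z (f x) g \<in> B2 \<longrightarrow> jet1 X Z x (\<lambda>x. g (f x)) \<in> b"
      by auto
    then show ?case
      by (intro exI[of _ "A1 \<inter> B1"] exI[of _ "A2 \<inter> B2"]) (auto intro: openin_Int)
  next
    case (UN K)
    then obtain k where k: "k \<in> K" "jet1 X Z p (\<lambda>x. g0 (f0 x)) \<in> k" by auto
    from UN.IH[OF k] obtain A1 A2 where
      "openin (jet_topology X Y) A1" "jet1 X Y p f0 \<in> A1" "openin (jet_topology Y Z) A2" "jet1 Y Z (f0 p) g0 \<in> A2"
      "\<forall>x f g. C1_near X Y x f \<longrightarrow> C1_near Y Z (f x) g \<longrightarrow> C1_near X Z x (\<lambda>x. g (f x)) \<longrightarrow>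
       jet1 X Y x f \<in> A1 \<longrightarrow> jet1 Y Z (f x) g \<in> A2 \<longrightarrow> jet1 X Z x (\<lambda>x. g (f x)) \<in> k"
      by auto
    with k(1) show ?case by (intro exI[of _ A1] exI[of _ A2]) auto
  next
    case (Basis s)
    then obtain c c'' N where s: "s = jet_coord_nbhd X Z c c'' N" "c \<in> charts X" "c'' \<in> charts Z" "open N" by blast
    then have p: "p \<in> fst c" "g0 (f0 p) \<in> fst c''"
      "(snd c p, snd c'' (g0 (f0 p)), jacobian X Z c c'' (\<lambda>x. g0 (f0 x)) p) \<in> N"
      using Basis gf0 by (auto simp: jet1_in_jet_coord_nbhd)
    obtain c' where c': "c' \<in> charts Y" "f0 p \<in> fst c'" using atlasD(4)[OF at(2)] by blast
    \<comment> \<open>the chain rule as a continuous map of the coordinates of two jets\<close>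
    define \<Phi> :: "((nat \<Rightarrow> real) \<times> (nat \<Rightarrow> real) \<times> (nat \<Rightarrow> nat \<Rightarrow> real)) \<times>
        ((nat \<Rightarrow> real) \<times> (nat \<Rightarrow> real) \<times> (nat \<Rightarrow> nat \<Rightarrow> real)) \<Rightarrow> (nat \<Rightarrow> real) \<times> (nat \<Rightarrow> real) \<times> (nat \<Rightarrow> nat \<Rightarrow> real)"
      where "\<Phi> = (\<lambda>((u, v, A), (v', w, B)). (u, w, \<lambda>j i. if j < mdim Z \<and> i < mdim X
        then \<Sum>k<mdim Y. B j k * A k i else 0))"
    have comp: "(snd c x, snd c'' (g (f x)), jacobian X Z c c'' (\<lambda>x. g (f x)) x)
        = \<Phi> ((snd c x, snd c' (f x), jacobian X Y c c' f x), (snd c' (f x), snd c'' (g (f x)), jacobian Y Z c' c'' g (f x)))"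
      if "C1_near X Y x f" "C1_near Y Z (f x) g" "x \<in> fst c" "f x \<in> fst c'" "g (f x) \<in> fst c''" for x f g
      using jacobian_compose[OF at that(1,2), of c c' c''] that s c' by (simp add: \<Phi>_def charts_at_def)
    have Fc: "continuous_on UNIV (\<lambda>q. case q of ((u :: nat \<Rightarrow> real, v :: nat \<Rightarrow> real, A), (v' :: nat \<Rightarrow> real, w :: nat \<Rightarrow> real, B)) \<Rightarrow> \<lambda>j i. if j < mdim Z \<and> i < mdim X
        then \<Sum>k<mdim Y. (B :: nat \<Rightarrow> nat \<Rightarrow> real) j k * (A :: nat \<Rightarrow> nat \<Rightarrow> real) k i else 0)"
      (is "continuous_on UNIV ?F")
    proof -
      have id2: "continuous_on UNIV (\<lambda>A :: nat \<Rightarrow> nat \<Rightarrow> real. A j i)" for j i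
        using continuous_on_nat2_fun_iff[of UNIV "\<lambda>A. A"] by (simp add: continuous_on_id)
      have B: "continuous_on UNIV (\<lambda>q :: ((nat \<Rightarrow> real) \<times> (nat \<Rightarrow> real) \<times> (nat \<Rightarrow> nat \<Rightarrow> real)) \<times> (nat \<Rightarrow> real) \<times> (nat \<Rightarrow> real) \<times> (nat \<Rightarrow> nat \<Rightarrow> real).
          snd (snd (snd q)) j k)" and A: "continuous_on UNIV (\<lambda>q :: ((nat \<Rightarrow> real) \<times> (nat \<Rightarrow> real) \<times> (nat \<Rightarrow> nat \<Rightarrow> real)) \<times> (nat \<Rightarrow> real) \<times> (nat \<Rightarrow> real) \<times> (nat \<Rightarrow> nat \<Rightarrow> real).
          snd (snd (fst q)) j k)" for j k
        by (rule continuous_on_compose2[OF id2 continuous_on_snd[OF continuous_on_snd[OF continuous_on_snd[OF continuous_on_id]]]], simp)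
          (rule continuous_on_compose2[OF id2 continuous_on_snd[OF continuous_on_snd[OF continuous_on_fst[OF continuous_on_id]]]], simp)
      have "continuous_on UNIV (\<lambda>q. ?F q j i)" for j i
      proof (cases "j < mdim Z \<and> i < mdim X")
        case True
        then show ?thesis
          unfolding case_prod_unfold by simp (intro continuous_on_sum continuous_on_mult A B)
      qed (unfold case_prod_unfold, rule continuous_on_eq[OF continuous_on_const[of _ 0]], auto)
      then have "\<forall>j i. continuous_on UNIV (\<lambda>q. ?F q j i)" by (intro allI)
      then show ?thesis by (rule iffD2[OF continuous_on_nat2_fun_iff])
    qed
    have "continuous_on UNIV (\<lambda>q. (fst (fst q), fst (snd (snd q)), ?F q))"
      by (intro continuous_on_Pair continuous_on_fst continuous_on_snd continuous_on_id Fc)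
    moreover have "\<Phi> = (\<lambda>q. (fst (fst q), fst (snd (snd q)), ?F q))"
      by (simp add: \<Phi>_def case_prod_unfold)
    ultimately have "open (\<Phi> -` N)" using s(4) by (simp add: open_vimage)
    moreover have "((snd c p, snd c' (f0 p), jacobian X Y c c' f0 p), (snd c' (f0 p), snd c'' (g0 (f0 p)), jacobian Y Z c' c'' g0 (f0 p))) \<in> \<Phi> -` N"
      using p comp[OF f0 g0 p(1) c'(2) p(2)] by simp
    ultimately obtain N1 N2 where N: "open N1" "open N2" "N1 \<times> N2 \<subseteq> \<Phi> -` N"
      "(snd c p, snd c' (f0 p), jacobian X Y c c' f0 p) \<in> N1"
      "(snd c' (f0 p), snd c'' (g0 (f0 p)), jacobian Y Z c' c'' g0 (f0 p)) \<in> N2"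
      by (rule open_prod_elim) (simp only: mem_Times_iff fst_conv snd_conv)
    show ?case
    proof (intro exI conjI allI impI)
      show "openin (jet_topology X Y) (jet_coord_nbhd X Y c c' N1)"
        "openin (jet_topology Y Z) (jet_coord_nbhd Y Z c' c'' N2)"
        using s c' N by (auto intro: openin_jet_coord_nbhd)
      show "jet1 X Y p f0 \<in> jet_coord_nbhd X Y c c' N1"
        "jet1 Y Z (f0 p) g0 \<in> jet_coord_nbhd Y Z c' c'' N2"
        using s c' N p f0 g0 by (auto simp: jet1_in_jet_coord_nbhd)
      fix x f g
      assume fg: "C1_near X Y x f" "C1_near Y Z (f x) g" "C1_near X Z x (\<lambda>x. g (f x))"
        "jet1 X Y x f \<in> jet_coord_nbhd X Y c c' N1" "jet1 Y Z (f x) g \<in> jet_coord_nbhd Y Z c' c'' N2"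
      then have x: "x \<in> fst c" "f x \<in> fst c'" "g (f x) \<in> fst c''"
        "(snd c x, snd c' (f x), jacobian X Y c c' f x) \<in> N1"
        "(snd c' (f x), snd c'' (g (f x)), jacobian Y Z c' c'' g (f x)) \<in> N2"
        using s c' by (auto simp: jet1_in_jet_coord_nbhd)
      then show "jet1 X Z x (\<lambda>x. g (f x)) \<in> s"
        using comp[OF fg(1,2) x(1-3)] N(3) fg(3) s by (auto simp: jet1_in_jet_coord_nbhd)
    qed
  qed auto
qed

lemma jet_metricD:
  assumes d: "jet_metric X Y d"
  shows "j \<in> topspace (jet_topology X Y) \<Longrightarrow> d j j = 0"
    "j \<in> topspace (jet_topology X Y) \<Longrightarrow> j' \<in> topspace (jet_topology X Y) \<Longrightarrow> d j j' = d j' j"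
    "j \<in> topspace (jet_topology X Y) \<Longrightarrow> j' \<in> topspace (jet_topology X Y) \<Longrightarrow> j'' \<in> topspace (jet_topology X Y) \<Longrightarrow> d j j'' \<le> d j j' + d j' j''"
    "openin (jet_topology X Y) Q \<Longrightarrow> j \<in> Q \<Longrightarrow> \<exists>r>0. \<forall>j'\<in>topspace (jet_topology X Y). d j j' < r \<longrightarrow> j' \<in> Q"
    "j \<in> topspace (jet_topology X Y) \<Longrightarrow> openin (jet_topology X Y) {j' \<in> topspace (jet_topology X Y). d j j' < r}"
proof -
  have ms: "Metric_space (topspace (jet_topology X Y)) d"
    and top: "Metric_space.mtopology (topspace (jet_topology X Y)) d = jet_topology X Y"
    using d unfolding jet_metric_def by auto
  interpret Metric_space "topspace (jet_topology X Y)" d by (rule ms)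
  show "j \<in> topspace (jet_topology X Y) \<Longrightarrow> d j j = 0" by simp
  show "j \<in> topspace (jet_topology X Y) \<Longrightarrow> j' \<in> topspace (jet_topology X Y) \<Longrightarrow> d j j' = d j' j"
    by (rule commute)
  show "j \<in> topspace (jet_topology X Y) \<Longrightarrow> j' \<in> topspace (jet_topology X Y) \<Longrightarrow> j'' \<in> topspace (jet_topology X Y) \<Longrightarrow> d j j'' \<le> d j j' + d j' j''"
    by (rule triangle)
  show "\<exists>r>0. \<forall>j'\<in>topspace (jet_topology X Y). d j j' < r \<longrightarrow> j' \<in> Q"
    if Q: "openin (jet_topology X Y) Q" and j: "j \<in> Q"
  proof -
    have "openin mtopology Q" using Q top by simp
    then obtain r where r: "r > 0" "mball j r \<subseteq> Q" using j unfolding openin_mtopology by blast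
    moreover have "j \<in> topspace (jet_topology X Y)" using Q j openin_subset by blast
    ultimately show ?thesis by (intro exI[of _ r]) (auto simp: mball_def)
  qed
  show "openin (jet_topology X Y) {j' \<in> topspace (jet_topology X Y). d j j' < r}"
    if "j \<in> topspace (jet_topology X Y)"
  proof -
    have "openin mtopology (mball j r)" by (rule openin_mball)
    moreover have "mball j r = {j' \<in> topspace (jet_topology X Y). d j j' < r}"
      using that by (auto simp: mball_def)
    ultimately show ?thesis using top by simp
  qed
qed

text \<open>A Lebesgue number argument for the metric on jets: around each \<open>s\<close> half of the radius that fits into
  \<open>Q s\<close> is used up by moving \<open>s\<close>, and the other half remains for the jet \<open>j\<close>.\<close>

lemma compact_uniform_jet_nbhds:
  fixes J :: "'t::topological_space \<Rightarrow> ('a::topological_space, 'b::topological_space) jet"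
  assumes d: "jet_metric X Y d" and T: "compact T" and J: "continuous_map euclidean (jet_topology X Y) J"
    and W: "\<And>s. s \<in> T \<Longrightarrow> open (W s) \<and> s \<in> W s"
    and Q: "\<And>s. s \<in> T \<Longrightarrow> openin (jet_topology X Y) (Q s) \<and> J s \<in> Q s"
  shows "\<exists>F e. finite F \<and> F \<subseteq> T \<and> e > 0 \<and> (\<forall>s\<in>T. \<exists>s0\<in>F. s \<in> W s0 \<and>
    (\<forall>j\<in>topspace (jet_topology X Y). d (J s) j < e \<longrightarrow> j \<in> Q s0))"
proof -
  have Jt: "J s \<in> topspace (jet_topology X Y)" for s
    using J unfolding continuous_map_def by auto
  have "\<forall>s\<in>T. \<exists>r>0. \<forall>j\<in>topspace (jet_topology X Y). d (J s) j < r \<longrightarrow> j \<in> Q s"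
    using jet_metricD(4)[OF d] Q by blast
  then obtain r where r: "\<And>s. s \<in> T \<Longrightarrow> r s > 0"
    "\<And>s j. s \<in> T \<Longrightarrow> j \<in> topspace (jet_topology X Y) \<Longrightarrow> d (J s) j < r s \<Longrightarrow> j \<in> Q s"
    by metis
  define V where "V = (\<lambda>s. W s \<inter> {t. d (J s) (J t) < r s / 2})"
  have V: "open (V s)" "s \<in> V s" if "s \<in> T" for s
  proof -
    have "openin euclidean {t \<in> topspace euclidean. J t \<in> {j' \<in> topspace (jet_topology X Y). d (J s) j' < r s / 2}}"
      by (rule openin_continuous_map_preimage[OF J jet_metricD(5)[OF d Jt]])
    then have "open {t. d (J s) (J t) < r s / 2}" using Jt by simp
    then show "open (V s)" using W[OF that] by (auto simp: V_def)
    show "s \<in> V s" using W[OF that] r(1)[OF that] jet_metricD(1)[OF d Jt] by (simp add: V_def)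
  qed
  obtain F where F: "F \<subseteq> T" "finite F" "T \<subseteq> (\<Union>s\<in>F. V s)"
    using compactE_image[OF T, of T V] V by blast
  define e where "e = Min (insert 1 ((\<lambda>s. r s / 2) ` F))"
  have "e > 0" using F r unfolding e_def by auto
  have e: "e \<le> r s / 2" if "s \<in> F" for s
    unfolding e_def by (rule Min_le) (use F that in auto)
  have "\<exists>s0\<in>F. s \<in> W s0 \<and> (\<forall>j\<in>topspace (jet_topology X Y). d (J s) j < e \<longrightarrow> j \<in> Q s0)" if s: "s \<in> T" for s
  proof -
    obtain s0 where s0: "s0 \<in> F" "s \<in> V s0" using F(3) s by blast
    have "j \<in> Q s0" if j: "j \<in> topspace (jet_topology X Y)" "d (J s) j < e" for j
    proof (rule r(2)[OF _ j(1)])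
      show "s0 \<in> T" using s0 F by blast
      show "d (J s0) j < r s0"
        using jet_metricD(3)[OF d Jt[of s0] Jt[of s] j(1)] s0 e[OF s0(1)] j(2) by (auto simp: V_def)
    qed
    then show ?thesis using s0 by (auto simp: V_def)
  qed
  with F \<open>e > 0\<close> show ?thesis by blast
qed

section \<open>Local transitivity of a family of approximate translations\<close>

primrec iterate_acts :: "(nat \<Rightarrow> real \<Rightarrow> 'g \<Rightarrow> 'g) \<Rightarrow> (nat \<Rightarrow> real) \<Rightarrow> nat \<Rightarrow> 'g \<Rightarrow> 'g" where
  "iterate_acts A t 0 h = h"
| "iterate_acts A t (Suc m) h = A m (t m) (iterate_acts A t m h)"

lemma l1norm_mono: "k \<le> n \<Longrightarrow> l1norm k x \<le> l1norm n x"
  unfolding l1norm_def by (rule sum_mono2) auto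

lemma l1norm_sum_scale_le:
  fixes t :: "nat \<Rightarrow> real" and v :: "nat \<Rightarrow> nat \<Rightarrow> real"
  assumes "\<And>i. i < m \<Longrightarrow> \<bar>t i\<bar> \<le> \<delta>" "m \<le> k" "0 \<le> \<delta>"
  shows "l1norm n (\<lambda>j. \<Sum>i<m. t i * v i j) \<le> \<delta> * (\<Sum>i<k. l1norm n (v i))"
proof -
  have "\<bar>\<Sum>i<m. t i * v i j\<bar> \<le> (\<Sum>i<m. \<bar>t i\<bar> * \<bar>v i j\<bar>)" for j
    using sum_abs[of "\<lambda>i. t i * v i j" "{..<m}"] by (simp add: abs_mult)
  then have "l1norm n (\<lambda>j. \<Sum>i<m. t i * v i j) \<le> (\<Sum>j<n. \<Sum>i<m. \<bar>t i\<bar> * \<bar>v i j\<bar>)"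
    unfolding l1norm_def by (intro sum_mono)
  also have "\<dots> = (\<Sum>i<m. \<bar>t i\<bar> * l1norm n (v i))"
    unfolding l1norm_def sum_distrib_left by (rule sum.swap)
  also have "\<dots> \<le> (\<Sum>i<m. \<delta> * l1norm n (v i))"
    using assms(1) by (intro sum_mono mult_right_mono) auto
  also have "\<dots> \<le> (\<Sum>i<k. \<delta> * l1norm n (v i))"
    by (rule sum_mono2) (use assms(2,3) in auto)
  finally show ?thesis by (simp add: sum_distrib_left)
qed

lemma open_chart_less:
  "is_chart n c \<Longrightarrow> continuous_on (fst c) g \<Longrightarrow> open {q \<in> fst c. g q < (r::real)}"
  using continuous_open_preimage[of "fst c" g "{..<r}"] is_chartD(1)[of n c]
  by (auto simp: Int_def vimage_def)

lemma continuous_on_l1norm_chart: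
  "is_chart n c \<Longrightarrow> continuous_on (fst c) (\<lambda>q. l1norm n (\<lambda>j. snd c q j - u j))"
  unfolding l1norm_def by (intro continuous_intros continuous_on_chart_coord)

text \<open>Let \<open>A i t\<close> translate the points near \<open>e\<close> by \<open>t * v i\<close> up to an error \<open>\<epsilon> * \<bar>t\<bar>\<close>, where the first \<open>k\<close>
  coordinates of the vectors \<open>v i\<close> form a basis. If \<open>A'\<close> is uniformly close to \<open>A\<close>, then the iterated
  map \<open>F t\<close> applied to \<open>h1\<close> differs from \<open>h1 + \<Sum> t\<^sub>i v\<^sub>i\<close> by a small multiple of the bound \<open>\<delta>\<close> for \<open>t\<close>.
  With \<open>B\<close> the inverse of this basis, the map \<open>t \<mapsto> t - B (F t - h2)\<close> sends the cube \<open>\<bar>t\<^sub>i\<bar> \<le> \<delta>\<close> to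
  itself, and a fixed point \<open>t\<close> solves \<open>F t = h2\<close> in the first \<open>k\<close> coordinates; the others vanish
  on the slice \<open>S\<close>. The numbers \<open>\<delta>\<close>, \<open>\<eta>\<close> and the neighbourhood \<open>W\<close> are chosen for \<open>A\<close> alone: later they
  have to serve all approximations \<open>A'\<close> at once.\<close>

lemma iterated_approximate_translations_onto:
  fixes e :: "'g::topological_space" and v :: "nat \<Rightarrow> nat \<Rightarrow> real" and A :: "nat \<Rightarrow> real \<Rightarrow> 'g \<Rightarrow> 'g"
  assumes c: "is_chart n c" "e \<in> fst c" and k: "k \<le> n"
    and slice: "snd c ` (fst c \<inter> S) = {u \<in> snd c ` fst c. \<forall>i\<ge>k. u i = 0}"
    and ind: "\<And>a. (\<forall>j<k. (\<Sum>i<k. a i * v i j) = 0) \<Longrightarrow> \<forall>i<k. a i = 0"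
    and est: "\<And>\<epsilon>. \<epsilon> > 0 \<Longrightarrow> \<exists>W \<delta>. open W \<and> e \<in> W \<and> \<delta> > 0 \<and> (\<forall>i<k. \<forall>t. \<bar>t\<bar> \<le> \<delta> \<longrightarrow> (\<forall>h\<in>W.
        l1norm n (\<lambda>j. snd c (A i t h) j - snd c h j - t * v i j) \<le> \<epsilon> * \<bar>t\<bar>))"
    and W0: "open W0" "e \<in> W0" and \<delta>0: "\<delta>0 > 0"
  shows "\<exists>\<delta> \<eta> W. 0 < \<delta> \<and> \<delta> \<le> \<delta>0 \<and> \<eta> > 0 \<and> open W \<and> e \<in> W \<and>
    (\<forall>A'. (\<forall>i<k. continuous_on UNIV (\<lambda>(t, h). A' i t h)) \<longrightarrow> (\<forall>i<k. \<forall>t. \<forall>h\<in>S. A' i t h \<in> S) \<longrightarrow>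
       (\<forall>i<k. \<forall>t. \<bar>t\<bar> \<le> \<delta> \<longrightarrow> (\<forall>h\<in>W0. A' i t h \<in> fst c \<and>
          l1norm n (\<lambda>j. snd c (A' i t h) j - snd c (A i t h) j) \<le> \<eta>)) \<longrightarrow>
       (\<forall>h1\<in>W \<inter> S. \<forall>h2\<in>W \<inter> S. \<exists>t. iterate_acts A' t k h1 = h2))"
proof -
  let ?\<psi> = "snd c"
  obtain B where B1: "\<And>w j. j < k \<Longrightarrow> (\<Sum>i<k. (\<Sum>m<k. B i m * w m) * v i j) = w j"
    and B2: "\<And>t i. i < k \<Longrightarrow> (\<Sum>m<k. B i m * (\<Sum>l<k. t l * v l m)) = t i"
    using independent_vectors_dual_basis[OF ind] by blast
  define b where "b = entry_norm k k B"
  define vb where "vb = (\<Sum>i<k. l1norm n (v i))"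
  have b: "b \<ge> 0" "vb \<ge> 0" by (simp_all add: b_def vb_def sum_nonneg)
  \<comment> \<open>the \<open>k\<close> steps contribute at most \<open>2 k \<epsilon> \<delta> \<le> \<delta> / (2 (b + 1))\<close> to the error, before \<open>B\<close> enlarges it by \<open>b\<close>\<close>
  define \<epsilon> where "\<epsilon> = 1 / (4 * (b + 1) * (real k + 1))"
  have \<epsilon>: "\<epsilon> > 0" using b by (simp add: \<epsilon>_def)
  obtain W1 \<delta>1 where W1: "open W1" "e \<in> W1" "\<delta>1 > 0" and est1: "\<And>i t h. i < k \<Longrightarrow> \<bar>t\<bar> \<le> \<delta>1 \<Longrightarrow> h \<in> W1 \<Longrightarrow>
      l1norm n (\<lambda>j. ?\<psi> (A i t h) j - ?\<psi> h j - t * v i j) \<le> \<epsilon> * \<bar>t\<bar>"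
    using est[OF \<epsilon>] by (elim exE conjE) simp
  obtain r where r: "r > 0" and rW: "\<And>q. q \<in> fst c \<Longrightarrow> (\<forall>i<n. \<bar>?\<psi> q i - ?\<psi> e i\<bar> < r) \<Longrightarrow> q \<in> W1 \<inter> W0"
    using chart_nbhd_sub[OF c, of "W1 \<inter> W0"] W1 W0 by auto
  \<comment> \<open>\<open>\<delta> K\<close> bounds the distance that the iteration covers; it keeps all iterates in the box of radius \<open>r\<close>\<close>
  define K where "K = 2 * \<epsilon> * real k + vb + 1"
  have K: "K > 0" using \<epsilon> b by (simp add: K_def add_nonneg_pos)
  define \<delta> where "\<delta> = min (min \<delta>0 \<delta>1) (r / (2 * K))"
  have \<delta>: "\<delta> > 0" "\<delta> \<le> \<delta>0" "\<delta> \<le> \<delta>1" "\<delta> \<le> r / (2 * K)" using \<delta>0 W1 r K by (auto simp: \<delta>_def)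
  have \<delta>K: "\<delta> * K \<le> r / 2" using \<delta>(4) K by (simp add: field_simps)
  define \<eta> where "\<eta> = \<epsilon> * \<delta>"
  have \<eta>: "\<eta> > 0" using \<epsilon> \<delta> by (simp add: \<eta>_def)
  \<comment> \<open>the distance of \<open>h1\<close> and \<open>h2\<close> is at most \<open>2 \<rho> \<le> \<delta> / (2 (b + 1))\<close>, the second half of the admissible error\<close>
  define \<rho> where "\<rho> = min (r / 2) (\<delta> / (4 * (b + 1)))"
  have \<rho>: "\<rho> > 0" "\<rho> \<le> r / 2" "\<rho> \<le> \<delta> / (4 * (b + 1))" unfolding \<rho>_def using r \<delta>(1) b by (simp, linarith+)
  define W where "W = {q \<in> fst c. l1norm n (\<lambda>j. ?\<psi> q j - ?\<psi> e j) < \<rho>}"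
  have oW: "open W" unfolding W_def
    by (rule open_chart_less[OF c(1) continuous_on_l1norm_chart[OF c(1)]])
  have eW: "e \<in> W" using c \<rho> by (simp add: W_def l1norm_def)
  have main: "\<exists>t. iterate_acts A' t k h1 = h2"
    if A': "\<forall>i<k. continuous_on UNIV (\<lambda>(t, h). A' i t h)" "\<forall>i<k. \<forall>t. \<forall>h\<in>S. A' i t h \<in> S"
      and cl: "\<forall>i<k. \<forall>t. \<bar>t\<bar> \<le> \<delta> \<longrightarrow> (\<forall>h\<in>W0. A' i t h \<in> fst c \<and>
          l1norm n (\<lambda>j. ?\<psi> (A' i t h) j - ?\<psi> (A i t h) j) \<le> \<eta>)"
      and h: "h1 \<in> W \<inter> S" "h2 \<in> W \<inter> S" for A' h1 h2
  proof -
    define F where "F = (\<lambda>t. iterate_acts A' t k h1)"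
    have h12: "h1 \<in> fst c" "h2 \<in> fst c" "h1 \<in> S" "h2 \<in> S"
      "l1norm n (\<lambda>j. ?\<psi> h1 j - ?\<psi> e j) < \<rho>" "l1norm n (\<lambda>j. ?\<psi> h2 j - ?\<psi> e j) < \<rho>"
      using h by (auto simp: W_def)
    have cont: "continuous_on UNIV (\<lambda>t. iterate_acts A' t m h1)" if "m \<le> k" for m
      using that
    proof (induction m)
      case (Suc m)
      have "continuous_on UNIV (\<lambda>t::nat \<Rightarrow> real. (t m, iterate_acts A' t m h1))"
        using Suc by (intro continuous_on_Pair continuous_on_coordinate) auto
      moreover have "continuous_on UNIV (\<lambda>(t, h). A' m t h)" using A'(1) Suc.prems by auto
      ultimately show ?case
        using continuous_on_compose2[of UNIV "\<lambda>(t, h). A' m t h" UNIV "\<lambda>t. (t m, iterate_acts A' t m h1)"] by simp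
    qed simp
    have track: "iterate_acts A' t m h1 \<in> fst c \<and> iterate_acts A' t m h1 \<in> S \<and>
        l1norm n (\<lambda>j. ?\<psi> (iterate_acts A' t m h1) j - ?\<psi> h1 j - (\<Sum>i<m. t i * v i j)) \<le> real m * (2 * \<epsilon> * \<delta>)"
      if t: "\<forall>i<k. \<bar>t i\<bar> \<le> \<delta>" and m: "m \<le> k" for t m
      using m
    proof (induction m)
      case 0
      then show ?case using h12 by (simp add: l1norm_def)
    next
      case (Suc m)
      let ?x = "iterate_acts A' t m h1"
      let ?s = "\<lambda>j. \<Sum>i<m. t i * v i j"
      have IH: "?x \<in> fst c" "?x \<in> S" "l1norm n (\<lambda>j. ?\<psi> ?x j - ?\<psi> h1 j - ?s j) \<le> real m * (2 * \<epsilon> * \<delta>)"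
        using Suc by auto
      have tm: "\<bar>t m\<bar> \<le> \<delta>" using t Suc.prems by auto
      have "l1norm n (\<lambda>j. ?\<psi> ?x j - ?\<psi> e j)
          \<le> l1norm n (\<lambda>j. (?\<psi> ?x j - ?\<psi> h1 j - ?s j) + ?s j) + l1norm n (\<lambda>j. ?\<psi> h1 j - ?\<psi> e j)"
        using l1norm_add[of n "\<lambda>j. (?\<psi> ?x j - ?\<psi> h1 j - ?s j) + ?s j" "\<lambda>j. ?\<psi> h1 j - ?\<psi> e j"] by simp
      also have "l1norm n (\<lambda>j. (?\<psi> ?x j - ?\<psi> h1 j - ?s j) + ?s j)
          \<le> l1norm n (\<lambda>j. ?\<psi> ?x j - ?\<psi> h1 j - ?s j) + l1norm n ?s" by (rule l1norm_add)
      also have "l1norm n ?s \<le> \<delta> * vb"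
        unfolding vb_def by (rule l1norm_sum_scale_le) (use t Suc.prems \<delta> in auto)
      finally have "l1norm n (\<lambda>j. ?\<psi> ?x j - ?\<psi> e j) < real m * (2 * \<epsilon> * \<delta>) + \<delta> * vb + \<rho>"
        using IH(3) h12(5) by linarith
      also have "\<dots> \<le> real k * (2 * \<epsilon> * \<delta>) + \<delta> * vb + \<rho>"
        using Suc.prems \<epsilon> \<delta> by (intro add_right_mono mult_right_mono) auto
      also have "\<dots> = \<delta> * K - \<delta> + \<rho>" by (simp add: K_def algebra_simps)
      also have "\<dots> \<le> r" using \<delta>K \<rho> \<delta> by linarith
      finally have near: "l1norm n (\<lambda>j. ?\<psi> ?x j - ?\<psi> e j) < r" .
      have "\<forall>i<n. \<bar>?\<psi> ?x i - ?\<psi> e i\<bar> < r"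
        using abs_le_l1norm[where x = "\<lambda>j. ?\<psi> ?x j - ?\<psi> e j" and n = n] near by (auto intro: le_less_trans)
      then have xW: "?x \<in> W1" "?x \<in> W0" using rW[OF IH(1)] by auto
      have mk: "m < k" using Suc.prems by simp
      define y where "y = A' m (t m) ?x"
      have y: "y \<in> fst c" "l1norm n (\<lambda>j. ?\<psi> y j - ?\<psi> (A m (t m) ?x) j) \<le> \<eta>"
        using cl mk tm xW(2) unfolding y_def by blast+
      have "y \<in> S" using A'(2) mk IH(2) unfolding y_def by blast
      have "l1norm n (\<lambda>j. ?\<psi> (A m (t m) ?x) j - ?\<psi> ?x j - t m * v m j) \<le> \<epsilon> * \<bar>t m\<bar>"
        using mk tm \<delta> xW(1) by (intro est1) auto
      also have "\<dots> \<le> \<epsilon> * \<delta>" using tm \<epsilon> by (intro mult_left_mono) auto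
      finally have st: "l1norm n (\<lambda>j. ?\<psi> (A m (t m) ?x) j - ?\<psi> ?x j - t m * v m j) \<le> \<epsilon> * \<delta>" .
      have "l1norm n (\<lambda>j. ?\<psi> y j - ?\<psi> h1 j - (\<Sum>i<Suc m. t i * v i j))
          = l1norm n (\<lambda>j. (?\<psi> y j - ?\<psi> (A m (t m) ?x) j) + ((?\<psi> (A m (t m) ?x) j - ?\<psi> ?x j - t m * v m j)
             + (?\<psi> ?x j - ?\<psi> h1 j - ?s j)))"
        by (rule l1norm_cong) simp
      also have "\<dots> \<le> l1norm n (\<lambda>j. ?\<psi> y j - ?\<psi> (A m (t m) ?x) j)
          + (l1norm n (\<lambda>j. ?\<psi> (A m (t m) ?x) j - ?\<psi> ?x j - t m * v m j) + l1norm n (\<lambda>j. ?\<psi> ?x j - ?\<psi> h1 j - ?s j))"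
        by (rule order_trans[OF l1norm_add add_left_mono[OF l1norm_add]])
      also have "\<dots> \<le> \<eta> + (\<epsilon> * \<delta> + real m * (2 * \<epsilon> * \<delta>))" using y(2) st IH(3) by linarith
      also have "\<dots> = real (Suc m) * (2 * \<epsilon> * \<delta>)" by (simp add: \<eta>_def algebra_simps)
      finally show ?case using y(1) \<open>y \<in> S\<close> by (simp add: y_def)
    qed
    have cubeD: "\<forall>i<k. \<bar>t i\<bar> \<le> \<delta>" if "t \<in> coord_cube k \<delta>" for t
      using that by (auto simp: coord_cube_def)
    define \<Psi> where "\<Psi> = (\<lambda>t i. t i - (\<Sum>m<k. B i m * (?\<psi> (F t) m - ?\<psi> h2 m)))"
    have "\<exists>t\<in>coord_cube k \<delta>. \<forall>i<k. \<Psi> t i = t i"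
    proof (rule brouwer_coord_cube[OF \<delta>(1)])
      fix i assume "i < k"
      have "continuous_on (coord_cube k \<delta>) (\<lambda>t. ?\<psi> (F t) m)" for m
      proof (rule continuous_on_compose2[OF continuous_on_chart_coord[OF c(1)]])
        show "continuous_on (coord_cube k \<delta>) F"
          unfolding F_def by (rule continuous_on_subset[OF cont]) auto
        show "F ` coord_cube k \<delta> \<subseteq> fst c" using track[OF cubeD order_refl] by (auto simp: F_def)
      qed
      then show "continuous_on (coord_cube k \<delta>) (\<lambda>t. \<Psi> t i)"
        unfolding \<Psi>_def by (intro continuous_intros continuous_on_coordinate)
    next
      fix t i assume t: "t \<in> coord_cube k \<delta>" and i: "i < k"
      let ?err = "\<lambda>j. ?\<psi> (F t) j - ?\<psi> h1 j - (\<Sum>i<k. t i * v i j)"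
      let ?z = "\<lambda>j. ?err j + (?\<psi> h1 j - ?\<psi> h2 j)"
      have "(\<Sum>m<k. B i m * (?\<psi> (F t) m - ?\<psi> h2 m)) = (\<Sum>m<k. B i m * (?z m + (\<Sum>l<k. t l * v l m)))"
        by (rule sum.cong) auto
      also have "\<dots> = (\<Sum>m<k. B i m * ?z m) + t i"
        by (simp only: distrib_left sum.distrib B2[OF i])
      finally have eq: "\<Psi> t i = - (\<Sum>m<k. B i m * ?z m)" by (simp add: \<Psi>_def)
      have "\<bar>\<Psi> t i\<bar> \<le> l1norm k (\<lambda>i. \<Sum>m<k. B i m * ?z m)"
        unfolding eq abs_minus_cancel using i by (rule abs_le_l1norm)
      also have "\<dots> \<le> b * l1norm k ?z" unfolding b_def by (rule l1norm_lin)
      also have "l1norm k ?z \<le> l1norm n ?z" using k by (rule l1norm_mono)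
      also have "l1norm n ?z \<le> l1norm n ?err + l1norm n (\<lambda>j. ?\<psi> h1 j - ?\<psi> h2 j)" by (rule l1norm_add)
      also have "l1norm n ?err \<le> real k * (2 * \<epsilon> * \<delta>)" using track[OF cubeD[OF t] order_refl] by (simp add: F_def)
      also have "l1norm n (\<lambda>j. ?\<psi> h1 j - ?\<psi> h2 j) \<le> l1norm n (\<lambda>j. ?\<psi> h1 j - ?\<psi> e j) + l1norm n (\<lambda>j. ?\<psi> e j - ?\<psi> h2 j)"
        by (rule l1norm_triangle)
      also have "\<dots> \<le> \<rho> + \<rho>" using h12(5,6) by (simp add: l1norm_minus_commute[of n "?\<psi> e"])
      also have "\<rho> + \<rho> \<le> \<delta> / (4 * (b + 1)) + \<delta> / (4 * (b + 1))" using \<rho>(3) by linarith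
      also have "\<dots> = \<delta> / (2 * (b + 1))"
      proof -
        have "\<delta> / (4 * x) + \<delta> / (4 * x) = \<delta> / (2 * x)" for x :: real
          by (cases "x = 0") (simp_all add: field_simps)
        then show ?thesis .
      qed
      also have "real k * (2 * \<epsilon> * \<delta>) = (real k / (real k + 1)) * (\<delta> / (2 * (b + 1)))"
        using b by (simp add: \<epsilon>_def divide_simps)
      also have "\<dots> \<le> 1 * (\<delta> / (2 * (b + 1)))" using b \<delta> by (intro mult_right_mono) auto
      finally have "\<bar>\<Psi> t i\<bar> \<le> b * (\<delta> / (2 * (b + 1)) + \<delta> / (2 * (b + 1)))"
        using b(1) by (simp add: mult_left_mono)
      also have "\<dots> = (b / (b + 1)) * \<delta>"
      proof -
        have "b * (\<delta> / (2 * x) + \<delta> / (2 * x)) = (b / x) * \<delta>" for x :: real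
          by (cases "x = 0") (simp_all add: field_simps)
        then show ?thesis .
      qed
      also have "\<dots> \<le> 1 * \<delta>" using b \<delta> by (intro mult_right_mono) auto
      finally show "\<bar>\<Psi> t i\<bar> \<le> \<delta>" by simp
    qed
    then obtain t where t: "t \<in> coord_cube k \<delta>" "\<forall>i<k. \<Psi> t i = t i" by blast
    have Ft: "F t \<in> fst c" "F t \<in> S" using track[OF cubeD[OF t(1)] order_refl] by (auto simp: F_def)
    have z: "\<forall>i<k. (\<Sum>m<k. B i m * (?\<psi> (F t) m - ?\<psi> h2 m)) = 0" using t(2) by (simp add: \<Psi>_def)
    have "?\<psi> (F t) j = ?\<psi> h2 j" for j
    proof (cases "j < k")
      case True
      have "?\<psi> (F t) j - ?\<psi> h2 j = (\<Sum>i<k. (\<Sum>m<k. B i m * (?\<psi> (F t) m - ?\<psi> h2 m)) * v i j)"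
        using B1[OF True, of "\<lambda>m. ?\<psi> (F t) m - ?\<psi> h2 m"] by simp
      also have "\<dots> = 0" using z by simp
      finally show ?thesis by simp
    next
      case False
      have "?\<psi> (F t) \<in> ?\<psi> ` (fst c \<inter> S)" "?\<psi> h2 \<in> ?\<psi> ` (fst c \<inter> S)" using Ft h12 by auto
      then show ?thesis using False unfolding slice by auto
    qed
    then have "F t = h2" using is_chartD(2)[OF c(1)] Ft h12 by (auto simp: inj_on_def fun_eq_iff)
    then show ?thesis by (auto simp: F_def)
  qed
  show ?thesis
    by (intro exI[of _ \<delta>] exI[of _ \<eta>] exI[of _ W] conjI \<delta>(1,2) \<eta> oW eW allI impI ballI) (rule main)
qed

section \<open>Strict differentials in a Lie groupoid\<close>

text \<open>Adapted charts of the source fibres belong to the maximal atlas, whereas differentiability of maps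
  is expressed in the charts of the atlas; this passes from one to the other.\<close>

lemma chart_change_strict_diff:
  fixes c c' :: "'a::topological_space chart"
  assumes r: "r \<noteq> Differentiable 0" and c: "is_chart n c" "is_chart n c'" and p: "p \<in> fst c" "p \<in> fst c'"
    and C: "Cr_vec r n n (snd c ` (fst c \<inter> fst c')) (coord_rep c c' id)"
  shows "\<exists>J. strict_diff n n (snd c) (snd c') (\<lambda>q. q) p J"
proof -
  have "openin (Euclidean_space n) (snd c ` (fst c \<inter> fst c'))"
    using is_chartD(1)[OF c(1)] is_chartD(1)[OF c(2)] by (intro is_chartD(6)[OF c(1)]) auto
  then have "Ck_fun 1 n (snd c ` (fst c \<inter> fst c')) (\<lambda>u. coord_rep c c' id u j)" if "j < n" for j
    by (rule Cr_fun_imp_C1[OF r]) (use C that in \<open>simp add: Cr_vec_def\<close>)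
  then have C1: "C1_in_charts n n UNIV c c' id" unfolding C1_in_charts_def vimage_id Int_UNIV_right id_apply by (intro allI impI)
  have "strict_diff n n (snd c) (snd c') id p (\<lambda>j i. partial_deriv i (\<lambda>u. coord_rep c c' id u j) (snd c p))"
    by (rule C1_in_charts_strict_diff[OF c(1) p(1) open_UNIV UNIV_I continuous_on_id' is_chartD(1)[OF c(2)] _ C1]) (simp add: p)
  then show ?thesis by (auto simp: id_def)
qed

lemma strict_diff_prod_id:
  assumes a: "strict_diff n m x y (\<lambda>q. q) p A" and b: "strict_diff n' m' x' y' (\<lambda>q. q) p' A'"
  shows "strict_diff (n + n') (m + m') (\<lambda>(q, q') i. if i < n then x q i else x' q' (i - n))
    (\<lambda>(q, q') i. if i < m then y q i else y' q' (i - m)) (\<lambda>q. q) (p, p')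
    (\<lambda>j i. if j < m then (if i < n then A j i else 0) else if i < n then 0 else A' (j - m) (i - n))"
  unfolding strict_diff_def
proof (intro allI impI)
  fix e :: real assume e: "e > 0"
  obtain W where W: "open W" "p \<in> W" "\<And>q q'. q \<in> W \<Longrightarrow> q' \<in> W \<Longrightarrow>
     l1norm m (\<lambda>j. (y q j - y q' j) - (\<Sum>i<n. A j i * (x q i - x q' i))) \<le> e * l1norm n (\<lambda>i. x q i - x q' i)"
    using strict_diffD[OF a e] by blast
  obtain W' where W': "open W'" "p' \<in> W'" "\<And>q q'. q \<in> W' \<Longrightarrow> q' \<in> W' \<Longrightarrow>
     l1norm m' (\<lambda>j. (y' q j - y' q' j) - (\<Sum>i<n'. A' j i * (x' q i - x' q' i))) \<le> e * l1norm n' (\<lambda>i. x' q i - x' q' i)"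
    using strict_diffD[OF b e] by blast
  show "\<exists>W. open W \<and> (p, p') \<in> W \<and> (\<forall>q\<in>W. \<forall>q'\<in>W.
     l1norm (m + m') (\<lambda>j. ((case q of (q, q') \<Rightarrow> \<lambda>i. if i < m then y q i else y' q' (i - m)) j -
        (case q' of (q, q') \<Rightarrow> \<lambda>i. if i < m then y q i else y' q' (i - m)) j) -
        (\<Sum>i<n + n'. (if j < m then (if i < n then A j i else 0) else if i < n then 0 else A' (j - m) (i - n)) *
          ((case q of (q, q') \<Rightarrow> \<lambda>i. if i < n then x q i else x' q' (i - n)) i -
           (case q' of (q, q') \<Rightarrow> \<lambda>i. if i < n then x q i else x' q' (i - n)) i)))
     \<le> e * l1norm (n + n') (\<lambda>i. (case q of (q, q') \<Rightarrow> \<lambda>i. if i < n then x q i else x' q' (i - n)) i -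
           (case q' of (q, q') \<Rightarrow> \<lambda>i. if i < n then x q i else x' q' (i - n)) i))"
  proof (intro exI[of _ "W \<times> W'"] conjI ballI)
    fix q q' assume "q \<in> W \<times> W'" "q' \<in> W \<times> W'"
    then obtain g h g' h' where q: "q = (g, h)" "q' = (g', h')" "g \<in> W" "h \<in> W'" "g' \<in> W" "h' \<in> W'" by auto
    show "l1norm (m + m') (\<lambda>j. ((case q of (q, q') \<Rightarrow> \<lambda>i. if i < m then y q i else y' q' (i - m)) j -
        (case q' of (q, q') \<Rightarrow> \<lambda>i. if i < m then y q i else y' q' (i - m)) j) -
        (\<Sum>i<n + n'. (if j < m then (if i < n then A j i else 0) else if i < n then 0 else A' (j - m) (i - n)) *
          ((case q of (q, q') \<Rightarrow> \<lambda>i. if i < n then x q i else x' q' (i - n)) i -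
           (case q' of (q, q') \<Rightarrow> \<lambda>i. if i < n then x q i else x' q' (i - n)) i)))
     \<le> e * l1norm (n + n') (\<lambda>i. (case q of (q, q') \<Rightarrow> \<lambda>i. if i < n then x q i else x' q' (i - n)) i -
           (case q' of (q, q') \<Rightarrow> \<lambda>i. if i < n then x q i else x' q' (i - n)) i)"
      using W(3)[OF q(3,5)] W'(3)[OF q(4,6)] unfolding l1norm_def q(1,2)
      by (simp add: sum_lessThan_add distrib_left)
  qed (use W W' in \<open>auto intro: open_Times\<close>)
qed

text \<open>Pairs of points that differ only in time.\<close>

lemma strict_diff_time_estimate:
  assumes "strict_diff (1 + d) n (snd (prod_chart 1 real_chart c)) y \<Phi> (0, p) A" "\<epsilon> > 0"
  shows "\<exists>\<delta> Y. \<delta> > 0 \<and> open Y \<and> p \<in> Y \<and> (\<forall>t. \<bar>t\<bar> \<le> \<delta> \<longrightarrow> (\<forall>z\<in>Y.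
    l1norm n (\<lambda>j. y (\<Phi> (t, z)) j - y (\<Phi> (0, z)) j - t * A j 0) \<le> \<epsilon> * \<bar>t\<bar>))"
proof -
  let ?x = "snd (prod_chart 1 real_chart c)"
  obtain W where W: "open W" "(0, p) \<in> W" "\<And>q q'. q \<in> W \<Longrightarrow> q' \<in> W \<Longrightarrow>
     l1norm n (\<lambda>j. (y (\<Phi> q) j - y (\<Phi> q') j) - (\<Sum>i<1 + d. A j i * (?x q i - ?x q' i)))
       \<le> \<epsilon> * l1norm (1 + d) (\<lambda>i. ?x q i - ?x q' i)"
    using strict_diffD[OF assms] by blast
  obtain T Y where TY: "open T" "open Y" "0 \<in> T" "p \<in> Y" "T \<times> Y \<subseteq> W"
    using open_prod_elim[OF W(1,2)] by (metis mem_Times_iff fst_conv snd_conv)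
  obtain \<delta> where \<delta>: "\<delta> > 0" "cball 0 \<delta> \<subseteq> T" using TY by (meson open_contains_cball)
  have "l1norm n (\<lambda>j. y (\<Phi> (t, z)) j - y (\<Phi> (0, z)) j - t * A j 0) \<le> \<epsilon> * \<bar>t\<bar>" if t: "\<bar>t\<bar> \<le> \<delta>" and z: "z \<in> Y" for t z
  proof -
    have "(t, z) \<in> W" "(0, z) \<in> W" using t z \<delta> TY by (auto simp: subset_iff)
    moreover have "(\<Sum>i<(1::nat). f i) = f 0" for f :: "nat \<Rightarrow> real" by simp
    ultimately show ?thesis using W(3)[of "(t, z)" "(0, z)"]
      by (simp add: l1norm_def sum_lessThan_add prod_chart_apply mult.commute[of _ t] del: One_nat_def)
  qed
  with \<delta> TY show ?thesis by blast
qed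

lemma DERIV_of_linear_approximation:
  fixes f :: "real \<Rightarrow> real"
  assumes "\<And>e. e > 0 \<Longrightarrow> \<exists>\<delta>>0. \<forall>t. \<bar>t\<bar> \<le> \<delta> \<longrightarrow> \<bar>f t - f 0 - t * a\<bar> \<le> e * \<bar>t\<bar>"
  shows "(f has_field_derivative a) (at 0)"
  unfolding DERIV_def LIM_eq
proof (intro allI impI)
  fix e :: real assume e: "e > 0"
  obtain \<delta> where \<delta>: "\<delta> > 0" and est: "\<And>t. \<bar>t\<bar> \<le> \<delta> \<Longrightarrow> \<bar>f t - f 0 - t * a\<bar> \<le> e/2 * \<bar>t\<bar>"
    using assms[OF half_gt_zero[OF e]] by auto
  have "norm ((f (0 + h) - f 0) / h - a) < e" if h: "h \<noteq> 0" "\<bar>h\<bar> < \<delta>" for h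
  proof -
    have "\<bar>(f h - f 0) / h - a\<bar> = \<bar>f h - f 0 - h * a\<bar> / \<bar>h\<bar>"
      using h by (simp add: abs_divide[symmetric] diff_divide_distrib)
    also have "\<dots> \<le> e / 2" using est[of h] h by (simp add: divide_le_eq)
    finally show ?thesis using e by simp
  qed
  then show "\<exists>s>0. \<forall>h. h \<noteq> 0 \<and> norm (h - 0) < s \<longrightarrow> norm ((f (0 + h) - f 0) / h - a) < e"
    using \<delta> by auto
qed

lemma strict_diff_time_derivative:
  assumes s: "strict_diff (1 + d) n (snd (prod_chart 1 real_chart c)) y \<Phi> (0, p) A" and j: "j < n"
  shows "((\<lambda>t. y (\<Phi> (t, p)) j) has_field_derivative A j 0) (at 0)"
proof (rule DERIV_of_linear_approximation)
  fix e :: real assume e: "e > 0"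
  obtain \<delta> Y where \<delta>: "\<delta> > 0" "p \<in> Y" and est: "\<forall>t. \<bar>t\<bar> \<le> \<delta> \<longrightarrow> (\<forall>z\<in>Y.
    l1norm n (\<lambda>j. y (\<Phi> (t, z)) j - y (\<Phi> (0, z)) j - t * A j 0) \<le> e * \<bar>t\<bar>)"
    using strict_diff_time_estimate[OF s e] by (elim exE conjE)
  have "\<bar>y (\<Phi> (t, p)) j - y (\<Phi> (0, p)) j - t * A j 0\<bar> \<le> e * \<bar>t\<bar>" if "\<bar>t\<bar> \<le> \<delta>" for t
    using abs_le_l1norm[where x = "\<lambda>j. y (\<Phi> (t, p)) j - y (\<Phi> (0, p)) j - t * A j 0", OF j] est[rule_format, of t p] that \<delta>(2)
    by linarith
  then show "\<exists>\<delta>>0. \<forall>t. \<bar>t\<bar> \<le> \<delta> \<longrightarrow> \<bar>y (\<Phi> (t, p)) j - y (\<Phi> (0, p)) j - t * A j 0\<bar> \<le> e * \<bar>t\<bar>"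
    using \<delta>(1) by blast
qed

definition act :: "('g, 'm) groupoid \<Rightarrow> ('m \<Rightarrow> 'g) \<Rightarrow> 'g \<Rightarrow> 'g" where
  "act \<Gamma> \<sigma> h = arrow_comp \<Gamma> (\<sigma> (tgt \<Gamma> h)) h"

lemma groupoidD:
  assumes "lie_groupoid r \<Gamma>"
  shows "src \<Gamma> (unit_at \<Gamma> x) = x" "tgt \<Gamma> (unit_at \<Gamma> x) = x"
    "src \<Gamma> g = tgt \<Gamma> h \<Longrightarrow> src \<Gamma> (arrow_comp \<Gamma> g h) = src \<Gamma> h"
    "src \<Gamma> g = tgt \<Gamma> h \<Longrightarrow> tgt \<Gamma> (arrow_comp \<Gamma> g h) = tgt \<Gamma> g"
    "src \<Gamma> g = tgt \<Gamma> h \<Longrightarrow> src \<Gamma> h = tgt \<Gamma> k \<Longrightarrow>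
        arrow_comp \<Gamma> (arrow_comp \<Gamma> g h) k = arrow_comp \<Gamma> g (arrow_comp \<Gamma> h k)"
    "arrow_comp \<Gamma> g (unit_at \<Gamma> (src \<Gamma> g)) = g" "arrow_comp \<Gamma> (unit_at \<Gamma> (tgt \<Gamma> g)) g = g"
    "src \<Gamma> (inverse_arrow \<Gamma> g) = tgt \<Gamma> g" "tgt \<Gamma> (inverse_arrow \<Gamma> g) = src \<Gamma> g"
    "arrow_comp \<Gamma> (inverse_arrow \<Gamma> g) g = unit_at \<Gamma> (src \<Gamma> g)"
    "arrow_comp \<Gamma> g (inverse_arrow \<Gamma> g) = unit_at \<Gamma> (tgt \<Gamma> g)"
  using assms unfolding lie_groupoid_def is_groupoid_def by blast+

lemma lie_groupoidD:
  fixes \<Gamma> :: "('g::t2_space, 'm::t2_space) groupoid"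
  assumes "lie_groupoid r \<Gamma>"
  shows "atlas (arrows \<Gamma>)" "atlas (units \<Gamma>)" "continuous_on UNIV (tgt \<Gamma>)" "continuous_on UNIV (src \<Gamma>)"
    "Cr_map r (arrows \<Gamma>) (units \<Gamma>) (tgt \<Gamma>)" "Cr_map r (units \<Gamma>) (arrows \<Gamma>) (unit_at \<Gamma>)"
    "Cr_on_subset r (prod_mfd (arrows \<Gamma>) (arrows \<Gamma>)) (arrows \<Gamma>)
       {(g, h). src \<Gamma> g = tgt \<Gamma> h} (\<lambda>(g, h). arrow_comp \<Gamma> g h)"
  using assms manifold_imp_atlas unfolding lie_groupoid_def submersion_def Cr_on_def by blast+

lemma continuous_on_arrow_comp:
  fixes \<Gamma> :: "('g::t2_space, 'm::t2_space) groupoid"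
  assumes "lie_groupoid r \<Gamma>"
  shows "continuous_on {(g, h). src \<Gamma> g = tgt \<Gamma> h} (\<lambda>(g, h). arrow_comp \<Gamma> g h)" (is "continuous_on ?S ?m")
  unfolding continuous_on_def
proof
  fix p assume p: "p \<in> ?S"
  then obtain W F where W: "p \<in> W" "Cr_on r (prod_mfd (arrows \<Gamma>) (arrows \<Gamma>)) (arrows \<Gamma>) W F" "\<forall>q\<in>W \<inter> ?S. F q = ?m q"
    using lie_groupoidD(7)[OF assms] unfolding Cr_on_subset_def by blast
  have "open W" "continuous_on W F" using W(2) by (auto simp: Cr_on_def)
  then have "(F \<longlongrightarrow> F p) (at p)" using W(1) by (simp add: continuous_on_eq_continuous_at isCont_def)
  then have "(F \<longlongrightarrow> F p) (at p within ?S)" by (rule tendsto_within_subset) auto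
  moreover have "eventually (\<lambda>q. F q = ?m q) (at p within ?S)"
    using W \<open>open W\<close> by (auto simp: eventually_at_topological)
  moreover have "F p = ?m p" using W p by auto
  ultimately show "(?m \<longlongrightarrow> ?m p) (at p within ?S)"
    using tendsto_cong[of F ?m "at p within ?S" "?m p"] by (simp only:)
qed

lemma continuous_on_act:
  fixes \<Gamma> :: "('g::t2_space, 'm::t2_space) groupoid"
  assumes \<Gamma>: "lie_groupoid r \<Gamma>" and \<sigma>: "continuous_on UNIV (\<lambda>(t, x). \<sigma> t x)" "\<And>t x. src \<Gamma> (\<sigma> t x) = x"
  shows "continuous_on UNIV (\<lambda>(t, h). act \<Gamma> (\<sigma> t) h)"
proof -
  have "continuous_on UNIV (\<lambda>p. (case (fst p, tgt \<Gamma> (snd p)) of (t, x) \<Rightarrow> \<sigma> t x, snd p))"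
    by (intro continuous_on_Pair continuous_on_compose2[OF \<sigma>(1)] continuous_on_compose2[OF lie_groupoidD(3)[OF \<Gamma>]]
        continuous_on_fst continuous_on_snd continuous_on_id) auto
  then have "continuous_on UNIV (\<lambda>p. case (\<sigma> (fst p) (tgt \<Gamma> (snd p)), snd p) of (g, h) \<Rightarrow> arrow_comp \<Gamma> g h)"
    by (intro continuous_on_compose2[OF continuous_on_arrow_comp[OF \<Gamma>]]) (auto simp: \<sigma>(2))
  then show ?thesis by (simp add: act_def case_prod_unfold)
qed

text \<open>Near a pair of units the multiplication is the restriction of a differentiable map on an open set
  of pairs of arrows. Its strict differential, applied to two composable pairs with the same second
  member, gives an estimate in which only the first members occur.\<close>

lemma arrow_comp_strict_differential:
  fixes \<Gamma> :: "('g::t2_space, 'm::t2_space) groupoid"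
  assumes r: "r \<noteq> Differentiable 0" and \<Gamma>: "lie_groupoid r \<Gamma>"
    and \<psi>: "\<psi> \<in> maximal_atlas r (arrows \<Gamma>)" "unit_at \<Gamma> y \<in> fst \<psi>"
  defines "n \<equiv> mdim (arrows \<Gamma>)"
  shows "\<exists>M. \<forall>\<epsilon>>0. \<exists>W. open W \<and> unit_at \<Gamma> y \<in> W \<and> (\<forall>g\<in>W. \<forall>g'\<in>W. \<forall>h\<in>W.
    src \<Gamma> g = tgt \<Gamma> h \<longrightarrow> src \<Gamma> g' = tgt \<Gamma> h \<longrightarrow>
    l1norm n (\<lambda>j. snd \<psi> (arrow_comp \<Gamma> g h) j - snd \<psi> (arrow_comp \<Gamma> g' h) j - (\<Sum>i<n. M j i * (snd \<psi> g i - snd \<psi> g' i)))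
      \<le> \<epsilon> * l1norm n (\<lambda>i. snd \<psi> g i - snd \<psi> g' i))"
proof -
  let ?e = "unit_at \<Gamma> y"
  let ?P = "prod_mfd (arrows \<Gamma>) (arrows \<Gamma>)"
  note at = lie_groupoidD(1)[OF \<Gamma>]
  have ee: "(?e, ?e) \<in> {(g, h). src \<Gamma> g = tgt \<Gamma> h}" using groupoidD(1,2)[OF \<Gamma>] by simp
  obtain W F where W: "(?e, ?e) \<in> W" "Cr_on r ?P (arrows \<Gamma>) W F"
    and F: "\<forall>q\<in>W \<inter> {(g, h). src \<Gamma> g = tgt \<Gamma> h}. F q = (case q of (g, h) \<Rightarrow> arrow_comp \<Gamma> g h)"
    using lie_groupoidD(7)[OF \<Gamma>] ee unfolding Cr_on_subset_def by blast
  have Fe: "F (?e, ?e) = ?e" using F W(1) ee groupoidD(7)[OF \<Gamma>, of ?e] groupoidD(2)[OF \<Gamma>] by auto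
  have C1: "C1_on ?P (arrows \<Gamma>) W F" by (rule Cr_on_imp_C1_on[OF r atlas_prod_mfd[OF at at] at W(2)])
  obtain c where c: "c \<in> charts (arrows \<Gamma>)" "?e \<in> fst c" using atlasD(4)[OF at] by blast
  let ?pc = "prod_chart n c c" and ?p\<psi> = "prod_chart n \<psi> \<psi>"
  have ic: "is_chart n c" using atlasD(1)[OF at c(1)] by (simp add: n_def)
  have i\<psi>: "is_chart n \<psi>" and comp: "Cr_compatible r n \<psi> c"
    using \<psi>(1) c(1) by (auto simp: maximal_atlas_def n_def)
  obtain J where J: "strict_diff n n (snd c) (snd \<psi>) (\<lambda>q. q) ?e J"
    using chart_change_strict_diff[OF r ic i\<psi> c(2) \<psi>(2)] comp by (auto simp: Cr_compatible_def Int_commute)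
  obtain J' where J': "strict_diff n n (snd \<psi>) (snd c) (\<lambda>q. q) ?e J'"
    using chart_change_strict_diff[OF r i\<psi> ic \<psi>(2) c(2)] comp by (auto simp: Cr_compatible_def Int_commute)
  have "?pc \<in> charts_at ?P (?e, ?e)"
    using c by (auto simp: charts_at_def prod_mfd_def prod_chart_apply n_def simp del: split_paired_Ex)
  then have "strict_diff (n + n) n (snd ?pc) (snd c) F (?e, ?e) (jacobian ?P (arrows \<Gamma>) ?pc c F (?e, ?e))"
    using C1_on_strict_diff[OF atlas_prod_mfd[OF at at] at C1 W(1), of ?pc c] c Fe
    by (simp add: charts_at_def prod_mfd_def n_def)
  then obtain M0 where M0: "strict_diff (n + n) n (snd ?pc) (snd c) F (?e, ?e) M0" by blast
  have "strict_diff (n + n) (n + n) (snd ?p\<psi>) (snd ?pc) (\<lambda>q. q) (?e, ?e)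
    (\<lambda>j i. if j < n then (if i < n then J' j i else 0) else if i < n then 0 else J' (j - n) (i - n))"
    using strict_diff_prod_id[OF J' J'] by (simp add: prod_chart_def)
  then obtain D where D: "strict_diff (n + n) (n + n) (snd ?p\<psi>) (snd ?pc) (\<lambda>q. q) (?e, ?e) D" by blast
  obtain M1 where M1: "strict_diff (n + n) n (snd ?p\<psi>) (snd c) F (?e, ?e) M1"
    using strict_diff_compose[OF D M0] by blast
  have "strict_diff (n + n) n (snd ?p\<psi>) (snd \<psi>) (\<lambda>q. F q) (?e, ?e) (\<lambda>j i. \<Sum>k<n. J j k * M1 k i)"
    by (rule strict_diff_compose[OF M1]) (use J Fe isCont_imp_image_nbhd[OF C1_onD(1,2)[OF C1] W(1)] in auto)
  then obtain M where M: "strict_diff (n + n) n (snd ?p\<psi>) (snd \<psi>) F (?e, ?e) M" by blast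
  show ?thesis
  proof (intro exI[of _ M] allI impI)
    fix \<epsilon> :: real assume \<epsilon>: "\<epsilon> > 0"
    obtain V where V: "open V" "(?e, ?e) \<in> V" "\<And>q q'. q \<in> V \<Longrightarrow> q' \<in> V \<Longrightarrow>
       l1norm n (\<lambda>j. (snd \<psi> (F q) j - snd \<psi> (F q') j) - (\<Sum>i<n + n. M j i * (snd ?p\<psi> q i - snd ?p\<psi> q' i)))
         \<le> \<epsilon> * l1norm (n + n) (\<lambda>i. snd ?p\<psi> q i - snd ?p\<psi> q' i)"
      using strict_diffD[OF M \<epsilon>] by blast
    have "open (V \<inter> W)" "(?e, ?e) \<in> V \<inter> W" using V W(1) C1_onD(1)[OF C1] by auto
    then obtain A B where AB: "open A" "open B" "?e \<in> A" "?e \<in> B" "A \<times> B \<subseteq> V \<inter> W"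
      by (metis open_prod_elim mem_Times_iff fst_conv snd_conv)
    have "l1norm n (\<lambda>j. snd \<psi> (arrow_comp \<Gamma> g h) j - snd \<psi> (arrow_comp \<Gamma> g' h) j - (\<Sum>i<n. M j i * (snd \<psi> g i - snd \<psi> g' i)))
      \<le> \<epsilon> * l1norm n (\<lambda>i. snd \<psi> g i - snd \<psi> g' i)"
      if g: "g \<in> A \<inter> B" "g' \<in> A \<inter> B" "h \<in> A \<inter> B" "src \<Gamma> g = tgt \<Gamma> h" "src \<Gamma> g' = tgt \<Gamma> h" for g g' h
    proof -
      have in_VW: "(g, h) \<in> V" "(g', h) \<in> V" "(g, h) \<in> W" "(g', h) \<in> W" using g AB by auto
      then have "F (g, h) = arrow_comp \<Gamma> g h" "F (g', h) = arrow_comp \<Gamma> g' h" using F g by auto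
      with V(3)[OF in_VW(1,2)] show ?thesis
        by (simp add: l1norm_def sum_lessThan_add prod_chart_apply)
    qed
    then show "\<exists>W. open W \<and> ?e \<in> W \<and> (\<forall>g\<in>W. \<forall>g'\<in>W. \<forall>h\<in>W.
      src \<Gamma> g = tgt \<Gamma> h \<longrightarrow> src \<Gamma> g' = tgt \<Gamma> h \<longrightarrow>
      l1norm n (\<lambda>j. snd \<psi> (arrow_comp \<Gamma> g h) j - snd \<psi> (arrow_comp \<Gamma> g' h) j - (\<Sum>i<n. M j i * (snd \<psi> g i - snd \<psi> g' i)))
      \<le> \<epsilon> * l1norm n (\<lambda>i. snd \<psi> g i - snd \<psi> g' i))"
      using AB by (intro exI[of _ "A \<inter> B"]) auto
  qed
qed

section \<open>Local transitivity in the source fibres\<close>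

lemma common_nbhd:
  assumes "\<And>i. i < (k::nat) \<Longrightarrow> \<exists>W \<delta>. open W \<and> p \<in> W \<and> (\<delta>::real) > 0 \<and> (\<forall>t. \<bar>t\<bar> \<le> \<delta> \<longrightarrow> (\<forall>h\<in>W. Q i t h))"
  shows "\<exists>W \<delta>. open W \<and> p \<in> W \<and> \<delta> > 0 \<and> (\<forall>i<k. \<forall>t. \<bar>t\<bar> \<le> \<delta> \<longrightarrow> (\<forall>h\<in>W. Q i t h))"
proof -
  have "m \<le> k \<Longrightarrow> \<exists>W \<delta>. open W \<and> p \<in> W \<and> \<delta> > 0 \<and> (\<forall>i<m. \<forall>t. \<bar>t\<bar> \<le> \<delta> \<longrightarrow> (\<forall>h\<in>W. Q i t h))" for m
  proof (induction m)
    case 0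
    show ?case by (intro exI[of _ UNIV] exI[of _ 1]) auto
  next
    case (Suc m)
    then obtain W \<delta> where W: "open W" "p \<in> W" "\<delta> > 0" "\<forall>i<m. \<forall>t. \<bar>t\<bar> \<le> \<delta> \<longrightarrow> (\<forall>h\<in>W. Q i t h)"
      by auto
    obtain W' \<delta>' where W': "open W'" "p \<in> W'" "\<delta>' > 0" "\<forall>t. \<bar>t\<bar> \<le> \<delta>' \<longrightarrow> (\<forall>h\<in>W'. Q m t h)"
      using assms[of m] Suc.prems by auto
    show ?case
      by (rule exI[of _ "W \<inter> W'"], rule exI[of _ "min \<delta> \<delta>'"]) (use W W' in \<open>auto simp: less_Suc_eq\<close>)
  qed
  then show ?thesis by blast
qed

lemma joint_nbhd:
  assumes "continuous_on UNIV (\<lambda>(t::real, x). \<sigma> t x)" "open V" "\<sigma> 0 p \<in> V"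
  shows "\<exists>W \<delta>. open W \<and> p \<in> W \<and> \<delta> > 0 \<and> (\<forall>t. \<bar>t\<bar> \<le> \<delta> \<longrightarrow> (\<forall>x\<in>W. \<sigma> t x \<in> V))"
proof -
  have "open ((\<lambda>(t, x). \<sigma> t x) -` V)" "(0, p) \<in> (\<lambda>(t, x). \<sigma> t x) -` V"
    using assms by (auto intro: open_vimage)
  then obtain T Y where TY: "open T" "open Y" "0 \<in> T" "p \<in> Y" "T \<times> Y \<subseteq> (\<lambda>(t, x). \<sigma> t x) -` V"
    by (metis open_prod_elim mem_Times_iff fst_conv snd_conv)
  obtain \<delta> where \<delta>: "\<delta> > 0" "cball 0 \<delta> \<subseteq> T" using TY by (meson open_contains_cball)
  then have "\<sigma> t x \<in> V" if "\<bar>t\<bar> \<le> \<delta>" "x \<in> Y" for t x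
  proof -
    have "t \<in> T" using that \<delta> by auto
    then show ?thesis using TY(5) that by auto
  qed
  with \<delta> TY show ?thesis by blast
qed

lemma isotopy_strict_diff:
  fixes \<Gamma> :: "('g::t2_space, 'm::t2_space) groupoid"
  assumes r: "r \<noteq> Differentiable 0" and \<Gamma>: "lie_groupoid r \<Gamma>"
    and \<psi>: "\<psi> \<in> maximal_atlas r (arrows \<Gamma>)" "unit_at \<Gamma> y \<in> fst \<psi>"
    and \<sigma>: "Cr_map r (prod_mfd real_mfd (units \<Gamma>)) (arrows \<Gamma>) (\<lambda>(t, x). \<sigma> t x)" "\<sigma> 0 = unit_at \<Gamma>"
    and cM: "cM \<in> charts_at (units \<Gamma>) y"
  shows "\<exists>A. strict_diff (1 + mdim (units \<Gamma>)) (mdim (arrows \<Gamma>)) (snd (prod_chart 1 real_chart cM)) (snd \<psi>) (\<lambda>(t, x). \<sigma> t x) (0, y) A"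
proof -
  let ?e = "unit_at \<Gamma> y" and ?n = "mdim (arrows \<Gamma>)" and ?P = "prod_mfd real_mfd (units \<Gamma>)"
  let ?F = "\<lambda>(t, x). \<sigma> t x" and ?pc = "prod_chart 1 real_chart cM"
  note at = lie_groupoidD(1)[OF \<Gamma>] and atP = atlas_prod_mfd[OF atlas_real_mfd lie_groupoidD(2)[OF \<Gamma>]]
  have C1: "C1_on ?P (arrows \<Gamma>) UNIV ?F" by (rule Cr_on_imp_C1_on[OF r atP at \<sigma>(1)])
  obtain c where c: "c \<in> charts (arrows \<Gamma>)" "?e \<in> fst c" using atlasD(4)[OF at] by blast
  have ic: "is_chart ?n c" using atlasD(1)[OF at c(1)] .
  have i\<psi>: "is_chart ?n \<psi>" and comp: "Cr_compatible r ?n \<psi> c"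
    using \<psi>(1) c(1) by (auto simp: maximal_atlas_def)
  obtain J where J: "strict_diff ?n ?n (snd c) (snd \<psi>) (\<lambda>q. q) ?e J"
    using chart_change_strict_diff[OF r ic i\<psi> c(2) \<psi>(2)] comp by (auto simp: Cr_compatible_def Int_commute)
  have Fe: "?F (0, y) = ?e" using \<sigma>(2) by simp
  have "mdim ?P = 1 + mdim (units \<Gamma>)" by (simp add: prod_mfd_def real_mfd_def)
  moreover have "?pc \<in> charts_at ?P (0, y)"
  proof -
    have "real_chart \<in> charts real_mfd" "mdim real_mfd = 1" by (simp_all add: real_mfd_def)
    then have "?pc \<in> charts ?P" using cM unfolding prod_mfd_def charts_at_def
      by (simp del: split_paired_Ex) metis
    then show ?thesis using cM by (simp add: charts_at_def prod_chart_apply)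
  qed
  ultimately have "strict_diff (1 + mdim (units \<Gamma>)) ?n (snd ?pc) (snd c) ?F (0, y) (jacobian ?P (arrows \<Gamma>) ?pc c ?F (0, y))"
    using C1_on_strict_diff[OF atP at C1, of "(0, y)" ?pc c] c Fe by (simp add: charts_at_def)
  then obtain A where A: "strict_diff (1 + mdim (units \<Gamma>)) ?n (snd ?pc) (snd c) ?F (0, y) A" by blast
  have "strict_diff (1 + mdim (units \<Gamma>)) ?n (snd ?pc) (snd \<psi>) (\<lambda>q. ?F q) (0, y) (\<lambda>j i. \<Sum>k<?n. J j k * A k i)"
    by (rule strict_diff_compose[OF A]) (use J Fe isCont_imp_image_nbhd[OF C1_onD(1,2)[OF C1], of "(0, y)"] in auto)
  then show ?thesis by blast
qed

text \<open>The multiplication is differentiated in its first factor at the pair of units. This shows that the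
  arrows \<open>h\<close> near the unit are all moved by \<open>t * u\<close> up to a small error, with one vector \<open>u\<close>. For \<open>h\<close>
  equal to the unit the action yields the curve \<open>t \<mapsto> \<sigma> t y\<close>, so \<open>u\<close> is the velocity of this curve.\<close>

lemma act_first_order:
  fixes \<Gamma> :: "('g::t2_space, 'm::t2_space) groupoid"
  assumes r: "r \<noteq> Differentiable 0" and \<Gamma>: "lie_groupoid r \<Gamma>"
    and \<psi>: "\<psi> \<in> maximal_atlas r (arrows \<Gamma>)" "unit_at \<Gamma> y \<in> fst \<psi>"
    and \<sigma>: "Cr_map r (prod_mfd real_mfd (units \<Gamma>)) (arrows \<Gamma>) (\<lambda>(t, x). \<sigma> t x)" "\<sigma> 0 = unit_at \<Gamma>"
      "\<And>t x. src \<Gamma> (\<sigma> t x) = x"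
    and A: "strict_diff (1 + mdim (units \<Gamma>)) (mdim (arrows \<Gamma>)) (snd (prod_chart 1 real_chart cM)) (snd \<psi>) (\<lambda>(t, x). \<sigma> t x) (0, y) A"
    and \<epsilon>: "\<epsilon> > 0"
  defines "n \<equiv> mdim (arrows \<Gamma>)"
  shows "\<exists>W \<delta>. open W \<and> unit_at \<Gamma> y \<in> W \<and> \<delta> > 0 \<and> (\<forall>t. \<bar>t\<bar> \<le> \<delta> \<longrightarrow> (\<forall>h\<in>W.
    l1norm n (\<lambda>j. snd \<psi> (act \<Gamma> (\<sigma> t) h) j - snd \<psi> h j - t * A j 0) \<le> \<epsilon> * \<bar>t\<bar>))"
proof -
  let ?e = "unit_at \<Gamma> y" and ?\<psi> = "snd \<psi>"
  have cont: "continuous_on UNIV (\<lambda>(t, x). \<sigma> t x)" using \<sigma>(1) by (simp add: Cr_on_def)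
  obtain M where M: "\<And>\<epsilon>. \<epsilon> > 0 \<Longrightarrow> \<exists>W. open W \<and> ?e \<in> W \<and> (\<forall>g\<in>W. \<forall>g'\<in>W. \<forall>h\<in>W.
    src \<Gamma> g = tgt \<Gamma> h \<longrightarrow> src \<Gamma> g' = tgt \<Gamma> h \<longrightarrow>
    l1norm n (\<lambda>j. ?\<psi> (arrow_comp \<Gamma> g h) j - ?\<psi> (arrow_comp \<Gamma> g' h) j - (\<Sum>i<n. M j i * (?\<psi> g i - ?\<psi> g' i)))
      \<le> \<epsilon> * l1norm n (\<lambda>i. ?\<psi> g i - ?\<psi> g' i))"
    using arrow_comp_strict_differential[OF r \<Gamma> \<psi>] unfolding n_def by blast
  define w where "w = (\<lambda>j. A j 0)"
  define u where "u = (\<lambda>j. \<Sum>i<n. M j i * w i)"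
  have E: "\<exists>W \<delta>. open W \<and> ?e \<in> W \<and> \<delta> > 0 \<and> (\<forall>t. \<bar>t\<bar> \<le> \<delta> \<longrightarrow> (\<forall>h\<in>W.
    l1norm n (\<lambda>j. ?\<psi> (act \<Gamma> (\<sigma> t) h) j - ?\<psi> h j - t * u j) \<le> \<epsilon> * \<bar>t\<bar>))" if \<epsilon>: "\<epsilon> > 0" for \<epsilon>
  proof -
    \<comment> \<open>half of the error comes from the multiplication, half from the isotopy\<close>
    define \<epsilon>1 where "\<epsilon>1 = \<epsilon> / (2 * (l1norm n w + 1))"
    define \<epsilon>2 where "\<epsilon>2 = min 1 (\<epsilon> / (2 * (entry_norm n n M + 1)))"
    have pos: "l1norm n w + 1 > 0" "entry_norm n n M + 1 > 0"
      using l1norm_nonneg[of n w] entry_norm_nonneg[of n n M] by linarith+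
    have cancel: "\<epsilon> / (2 * x) * (x * \<tau>) = \<epsilon> / 2 * \<tau>" if "x > 0" for x \<tau> :: real
      using that by simp
    have e12: "\<epsilon>1 > 0" "\<epsilon>2 > 0" "\<epsilon>2 \<le> 1" using \<epsilon> pos by (auto simp: \<epsilon>1_def \<epsilon>2_def)
    obtain V where V: "open V" "?e \<in> V" and VM: "\<forall>g\<in>V. \<forall>g'\<in>V. \<forall>h\<in>V.
      src \<Gamma> g = tgt \<Gamma> h \<longrightarrow> src \<Gamma> g' = tgt \<Gamma> h \<longrightarrow>
      l1norm n (\<lambda>j. ?\<psi> (arrow_comp \<Gamma> g h) j - ?\<psi> (arrow_comp \<Gamma> g' h) j - (\<Sum>i<n. M j i * (?\<psi> g i - ?\<psi> g' i)))
      \<le> \<epsilon>1 * l1norm n (\<lambda>i. ?\<psi> g i - ?\<psi> g' i)"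
      using M[OF e12(1)] by (elim exE conjE)
    obtain \<delta>1 Y1 where Y1: "\<delta>1 > 0" "open Y1" "y \<in> Y1" and tim: "\<forall>t. \<bar>t\<bar> \<le> \<delta>1 \<longrightarrow> (\<forall>z\<in>Y1.
      l1norm n (\<lambda>j. ?\<psi> ((\<lambda>(t, x). \<sigma> t x) (t, z)) j - ?\<psi> ((\<lambda>(t, x). \<sigma> t x) (0, z)) j - t * A j 0) \<le> \<epsilon>2 * \<bar>t\<bar>)"
      using strict_diff_time_estimate[OF A e12(2)] unfolding n_def by (elim exE conjE)
    have "\<sigma> 0 y \<in> V" using V(2) \<sigma>(2) by simp
    from joint_nbhd[OF cont V(1) this]
    obtain \<delta>2 Y2 where Y2: "open Y2" "y \<in> Y2" "\<delta>2 > 0" "\<forall>t. \<bar>t\<bar> \<le> \<delta>2 \<longrightarrow> (\<forall>z\<in>Y2. \<sigma> t z \<in> V)"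
      by (elim exE conjE)
    have "l1norm n (\<lambda>j. ?\<psi> (act \<Gamma> (\<sigma> t) h) j - ?\<psi> h j - t * u j) \<le> \<epsilon> * \<bar>t\<bar>"
      if t: "\<bar>t\<bar> \<le> min \<delta>1 \<delta>2" and h: "h \<in> V \<inter> tgt \<Gamma> -` (Y1 \<inter> Y2)" for t h
    proof -
      let ?z = "tgt \<Gamma> h"
      let ?g = "\<sigma> t ?z" and ?g' = "\<sigma> 0 ?z"
      have gV: "?g \<in> V" "?g' \<in> V" "h \<in> V" using h t Y2(4)[rule_format, of t ?z] Y2(4)[rule_format, of 0 ?z] Y2(3) by auto
      have s: "src \<Gamma> ?g = ?z" "src \<Gamma> ?g' = ?z" by (rule \<sigma>(3))+
      have c: "arrow_comp \<Gamma> ?g h = act \<Gamma> (\<sigma> t) h" "arrow_comp \<Gamma> ?g' h = h"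
        using groupoidD(7)[OF \<Gamma>] \<sigma>(2) by (simp_all add: act_def)
      let ?D = "\<lambda>j. ?\<psi> ?g j - ?\<psi> ?g' j"
      have 1: "l1norm n (\<lambda>j. ?D j - t * w j) \<le> \<epsilon>2 * \<bar>t\<bar>"
        using tim[rule_format, of t ?z] t h by (simp add: w_def)
      have "l1norm n ?D \<le> l1norm n (\<lambda>j. ?D j - t * w j) + l1norm n (\<lambda>j. t * w j)"
        using l1norm_add[of n "\<lambda>j. ?D j - t * w j" "\<lambda>j. t * w j"] by simp
      also have "\<dots> \<le> 1 * \<bar>t\<bar> + \<bar>t\<bar> * l1norm n w"
        unfolding l1norm_scale using 1 e12(3) mult_right_mono[of \<epsilon>2 1 "\<bar>t\<bar>"] by simp
      finally have 2: "l1norm n ?D \<le> (l1norm n w + 1) * \<bar>t\<bar>" by (simp add: algebra_simps)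
      have "l1norm n (\<lambda>j. ?\<psi> (act \<Gamma> (\<sigma> t) h) j - ?\<psi> h j - (\<Sum>i<n. M j i * ?D i)) \<le> \<epsilon>1 * l1norm n ?D"
        using VM[rule_format, OF gV s] unfolding c .
      also have "\<dots> \<le> \<epsilon>1 * ((l1norm n w + 1) * \<bar>t\<bar>)" using 2 e12 by (intro mult_left_mono) auto
      also have "\<dots> = \<epsilon> / 2 * \<bar>t\<bar>" unfolding \<epsilon>1_def using cancel[OF pos(1)] by (simp only: mult_ac)
      finally have 3: "l1norm n (\<lambda>j. ?\<psi> (act \<Gamma> (\<sigma> t) h) j - ?\<psi> h j - (\<Sum>i<n. M j i * ?D i)) \<le> \<epsilon> / 2 * \<bar>t\<bar>" .
      have "l1norm n (\<lambda>j. \<Sum>i<n. M j i * (?D i - t * w i)) \<le> entry_norm n n M * l1norm n (\<lambda>j. ?D j - t * w j)" by (rule l1norm_lin)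
      also have "\<dots> \<le> (entry_norm n n M + 1) * (\<epsilon> / (2 * (entry_norm n n M + 1)) * \<bar>t\<bar>)"
      proof (rule mult_mono)
        have "\<epsilon>2 * \<bar>t\<bar> \<le> \<epsilon> / (2 * (entry_norm n n M + 1)) * \<bar>t\<bar>" by (intro mult_right_mono) (auto simp: \<epsilon>2_def)
        then show "l1norm n (\<lambda>j. ?D j - t * w j) \<le> \<epsilon> / (2 * (entry_norm n n M + 1)) * \<bar>t\<bar>" using 1 by linarith
      qed (use pos in auto)
      also have "\<dots> = \<epsilon> / 2 * \<bar>t\<bar>" using cancel[OF pos(2)] by (simp only: mult_ac)
      finally have 4: "l1norm n (\<lambda>j. \<Sum>i<n. M j i * (?D i - t * w i)) \<le> \<epsilon> / 2 * \<bar>t\<bar>" .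
      have "(\<Sum>i<n. M j i * (?D i - t * w i)) = (\<Sum>i<n. M j i * ?D i) - t * u j" for j
        unfolding u_def right_diff_distrib sum_subtractf sum_distrib_left by (simp add: mult.left_commute)
      then have "(\<lambda>j. ?\<psi> (act \<Gamma> (\<sigma> t) h) j - ?\<psi> h j - t * u j)
          = (\<lambda>j. (?\<psi> (act \<Gamma> (\<sigma> t) h) j - ?\<psi> h j - (\<Sum>i<n. M j i * ?D i)) + (\<Sum>i<n. M j i * (?D i - t * w i)))"
        by auto
      then have "l1norm n (\<lambda>j. ?\<psi> (act \<Gamma> (\<sigma> t) h) j - ?\<psi> h j - t * u j)
          \<le> l1norm n (\<lambda>j. ?\<psi> (act \<Gamma> (\<sigma> t) h) j - ?\<psi> h j - (\<Sum>i<n. M j i * ?D i)) + l1norm n (\<lambda>j. \<Sum>i<n. M j i * (?D i - t * w i))"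
        by (simp only: l1norm_add)
      then show ?thesis using 3 4 by simp
    qed
    moreover have "open (V \<inter> tgt \<Gamma> -` (Y1 \<inter> Y2))"
      using V(1) Y1 Y2 lie_groupoidD(3)[OF \<Gamma>] by (auto intro!: open_Int open_vimage)
    moreover have "?e \<in> V \<inter> tgt \<Gamma> -` (Y1 \<inter> Y2)" using V Y1 Y2 groupoidD(2)[OF \<Gamma>] by auto
    moreover have "min \<delta>1 \<delta>2 > 0" using Y1 Y2 by simp
    ultimately show ?thesis by blast
  qed
  have "u j = w j" if j: "j < n" for j
  proof (rule DERIV_unique)
    show "((\<lambda>t. ?\<psi> (\<sigma> t y) j) has_field_derivative w j) (at 0)"
      using strict_diff_time_derivative[OF A, of j] j by (simp add: n_def w_def)
    show "((\<lambda>t. ?\<psi> (\<sigma> t y) j) has_field_derivative u j) (at 0)"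
    proof (rule DERIV_of_linear_approximation)
      fix \<epsilon> :: real assume "\<epsilon> > 0"
      from E[OF this] obtain W \<delta> where W: "?e \<in> W" "\<delta> > 0" "\<forall>t. \<bar>t\<bar> \<le> \<delta> \<longrightarrow> (\<forall>h\<in>W.
        l1norm n (\<lambda>j. ?\<psi> (act \<Gamma> (\<sigma> t) h) j - ?\<psi> h j - t * u j) \<le> \<epsilon> * \<bar>t\<bar>)" by (elim exE conjE)
      have "\<bar>?\<psi> (\<sigma> t y) j - ?\<psi> (\<sigma> 0 y) j - t * u j\<bar> \<le> \<epsilon> * \<bar>t\<bar>" if "\<bar>t\<bar> \<le> \<delta>" for t
      proof -
        have "act \<Gamma> (\<sigma> t) ?e = \<sigma> t y"
          using groupoidD(2)[OF \<Gamma>] groupoidD(6)[OF \<Gamma>, of "\<sigma> t y"] \<sigma>(3) by (simp add: act_def)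
        then show ?thesis
          using abs_le_l1norm[where x = "\<lambda>j. ?\<psi> (act \<Gamma> (\<sigma> t) ?e) j - ?\<psi> ?e j - t * u j", OF j] W(3)[rule_format, OF that W(1)] \<sigma>(2)
          by simp
      qed
      with W(2) show "\<exists>\<delta>>0. \<forall>t. \<bar>t\<bar> \<le> \<delta> \<longrightarrow> \<bar>?\<psi> (\<sigma> t y) j - ?\<psi> (\<sigma> 0 y) j - t * u j\<bar> \<le> \<epsilon> * \<bar>t\<bar>" by blast
    qed
  qed
  then have "l1norm n (\<lambda>j. x j - t * A j 0) = l1norm n (\<lambda>j. x j - t * u j)" for x t
    by (intro l1norm_cong) (simp add: w_def)
  then show ?thesis using E[OF \<epsilon>] by simp
qed

lemma chart_l1norm_nbhd:
  assumes c: "is_chart n c" "p \<in> fst c" and W: "open W" "p \<in> W"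
  shows "\<exists>r>0. \<forall>q\<in>fst c. l1norm n (\<lambda>j. snd c q j - snd c p j) < r \<longrightarrow> q \<in> W"
proof -
  obtain r where r: "r > 0" "\<And>q. q \<in> fst c \<Longrightarrow> (\<forall>i<n. \<bar>snd c q i - snd c p i\<bar> < r) \<Longrightarrow> q \<in> W"
    using chart_nbhd_sub[OF assms] by blast
  have "q \<in> W" if "q \<in> fst c" "l1norm n (\<lambda>j. snd c q j - snd c p j) < r" for q
    using abs_le_l1norm[where x = "\<lambda>j. snd c q j - snd c p j" and n = n] that r(2)[OF that(1)]
    by (auto intro: le_less_trans)
  with r(1) show ?thesis by blast
qed

text \<open>The curves run in the source fibre, hence their velocities have zero coordinates beyond \<open>k\<close> in an
  adapted chart. A linear relation between the first \<open>k\<close> coordinates is therefore a relation between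
  the velocities, and the differential of the change of charts carries it to a chart of the atlas.\<close>

lemma fibre_velocities_independent:
  fixes \<Gamma> :: "('g::t2_space, 'm::t2_space) groupoid"
  assumes r: "r \<noteq> Differentiable 0" and \<Gamma>: "lie_groupoid r \<Gamma>"
    and \<psi>: "\<psi> \<in> maximal_atlas r (arrows \<Gamma>)" "unit_at \<Gamma> y \<in> fst \<psi>"
    and slice: "snd \<psi> ` (fst \<psi> \<inter> src_fibre \<Gamma> y) = {u \<in> snd \<psi> ` fst \<psi>. \<forall>i\<ge>k. u i = 0}"
    and \<sigma>: "\<And>i. i < k \<Longrightarrow> Cr_map r (prod_mfd real_mfd (units \<Gamma>)) (arrows \<Gamma>) (\<lambda>(t, x). \<sigma> i t x)"
      "\<And>i. i < k \<Longrightarrow> \<sigma> i 0 = unit_at \<Gamma>" "\<And>i t x. i < k \<Longrightarrow> src \<Gamma> (\<sigma> i t x) = x"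
    and ind: "independent_velocities (arrows \<Gamma>) (unit_at \<Gamma> y) k (\<lambda>i t. \<sigma> i t y)"
    and A: "\<And>i. i < k \<Longrightarrow> strict_diff (1 + mdim (units \<Gamma>)) (mdim (arrows \<Gamma>)) (snd (prod_chart 1 real_chart cM)) (snd \<psi>) (\<lambda>(t, x). \<sigma> i t x) (0, y) (A i)"
    and a: "\<forall>j<k. (\<Sum>i<k. a i * A i j 0) = 0"
  shows "\<forall>i<k. a i = 0"
proof -
  let ?e = "unit_at \<Gamma> y" and ?n = "mdim (arrows \<Gamma>)"
  note at = lie_groupoidD(1)[OF \<Gamma>]
  obtain c where c: "c \<in> charts (arrows \<Gamma>)" "?e \<in> fst c" using atlasD(4)[OF at] by blast
  have ic: "is_chart ?n c" using atlasD(1)[OF at c(1)] .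
  have i\<psi>: "is_chart ?n \<psi>" and comp: "Cr_compatible r ?n \<psi> c"
    using \<psi>(1) c(1) by (auto simp: maximal_atlas_def)
  obtain J where J: "strict_diff ?n ?n (snd \<psi>) (snd c) (\<lambda>q. q) ?e J"
    using chart_change_strict_diff[OF r i\<psi> ic \<psi>(2) c(2)] comp by (auto simp: Cr_compatible_def Int_commute)
  have vanish: "A i j 0 = 0" if i: "i < k" and j: "k \<le> j" "j < ?n" for i j
  proof (rule DERIV_unique)
    have cont: "continuous_on UNIV (\<lambda>(t, x). \<sigma> i t x)" using \<sigma>(1)[OF i] by (simp add: Cr_on_def)
    show "((\<lambda>t. snd \<psi> (\<sigma> i t y) j) has_field_derivative A i j 0) (at 0)"
      using strict_diff_time_derivative[OF A[OF i] j(2)] by simp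
    have "\<sigma> i 0 y \<in> fst \<psi>" using \<psi>(2) \<sigma>(2)[OF i] by simp
    from joint_nbhd[OF cont is_chartD(1)[OF i\<psi>] this]
    obtain Y \<delta> where Y: "y \<in> Y" "\<delta> > 0" "\<forall>t. \<bar>t\<bar> \<le> \<delta> \<longrightarrow> (\<forall>x\<in>Y. \<sigma> i t x \<in> fst \<psi>)" by (elim exE conjE)
    have zero: "snd \<psi> (\<sigma> i t y) j = 0" if "\<bar>t\<bar> \<le> \<delta>" for t
    proof -
      have "\<sigma> i t y \<in> fst \<psi> \<inter> src_fibre \<Gamma> y" using Y that \<sigma>(3)[OF i] by (auto simp: src_fibre_def)
      then have "snd \<psi> (\<sigma> i t y) \<in> {u \<in> snd \<psi> ` fst \<psi>. \<forall>i\<ge>k. u i = 0}" unfolding slice[symmetric] by blast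
      then show ?thesis using j by simp
    qed
    show "((\<lambda>t. snd \<psi> (\<sigma> i t y) j) has_field_derivative 0) (at 0)"
      by (rule DERIV_of_linear_approximation) (use zero Y(2) in \<open>auto intro!: exI[of _ \<delta>]\<close>)
  qed
  have sum0: "(\<Sum>i<k. a i * A i j 0) = 0" if "j < ?n" for j
    using a vanish that by (cases "j < k") auto
  have vel: "deriv (\<lambda>t. snd c (\<sigma> i t y) j) 0 = (\<Sum>l<?n. J j l * A i l 0)" if i: "i < k" and j: "j < ?n" for i j
  proof (rule DERIV_imp_deriv)
    have cont: "continuous_on UNIV (\<lambda>(t, x). \<sigma> i t x)" using \<sigma>(1)[OF i] by (simp add: Cr_on_def)
    have "strict_diff (1 + mdim (units \<Gamma>)) ?n (snd (prod_chart 1 real_chart cM)) (snd c) (\<lambda>q. (\<lambda>(t, x). \<sigma> i t x) q) (0, y)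
        (\<lambda>j i'. \<Sum>l<?n. J j l * A i l i')"
      by (rule strict_diff_compose[OF A[OF i]])
        (use J \<sigma>(2)[OF i] isCont_imp_image_nbhd[OF open_UNIV cont UNIV_I, of _ "(0, y)"] in auto)
    from strict_diff_time_derivative[OF this j]
    show "((\<lambda>t. snd c (\<sigma> i t y) j) has_field_derivative (\<Sum>l<?n. J j l * A i l 0)) (at 0)" by simp
  qed
  have "(\<Sum>i<k. a i * deriv (\<lambda>t. snd c (\<sigma> i t y) j) 0) = 0" if j: "j < ?n" for j
  proof -
    have "(\<Sum>i<k. a i * deriv (\<lambda>t. snd c (\<sigma> i t y) j) 0) = (\<Sum>i<k. a i * (\<Sum>l<?n. J j l * A i l 0))"
      by (rule sum.cong) (use vel[OF _ j] in auto)
    also have "\<dots> = (\<Sum>l<?n. J j l * (\<Sum>i<k. a i * A i l 0))"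
      unfolding sum_distrib_left by (subst sum.swap) (simp only: mult_ac)
    also have "\<dots> = 0" using sum0 by simp
    finally show ?thesis .
  qed
  moreover have "c \<in> charts_at (arrows \<Gamma>) ?e" using c by (simp add: charts_at_def)
  ultimately show ?thesis using ind unfolding independent_velocities_def by (cases c) auto
qed

text \<open>The estimate of \<open>act_first_order\<close> enters \<open>iterated_approximate_translations_onto\<close>. Since the
  multiplication is Lipschitz in its first factor near the units, isotopies \<open>\<tau>\<close> that are close to \<open>\<sigma>\<close>
  near \<open>y\<close> have actions that are close to those of \<open>\<sigma>\<close>.\<close>

lemma isotopies_locally_transitive:
  fixes \<Gamma> :: "('g::t2_space, 'm::t2_space) groupoid"
  assumes r: "r \<noteq> Differentiable 0" and \<Gamma>: "lie_groupoid r \<Gamma>"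
    and \<psi>: "\<psi> \<in> maximal_atlas r (arrows \<Gamma>)" "unit_at \<Gamma> y \<in> fst \<psi>"
    and slice: "snd \<psi> ` (fst \<psi> \<inter> src_fibre \<Gamma> y) = {u \<in> snd \<psi> ` fst \<psi>. \<forall>i\<ge>k. u i = 0}"
    and k: "k \<le> mdim (arrows \<Gamma>)"
    and \<sigma>: "\<And>i. i < k \<Longrightarrow> Cr_map r (prod_mfd real_mfd (units \<Gamma>)) (arrows \<Gamma>) (\<lambda>(t, x). \<sigma> i t x)"
      "\<And>i. i < k \<Longrightarrow> \<sigma> i 0 = unit_at \<Gamma>" "\<And>i t x. i < k \<Longrightarrow> src \<Gamma> (\<sigma> i t x) = x"
    and ind: "independent_velocities (arrows \<Gamma>) (unit_at \<Gamma> y) k (\<lambda>i t. \<sigma> i t y)"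
    and Y: "open Y" "y \<in> Y" and \<delta>0: "\<delta>0 > 0"
  shows "\<exists>\<delta> \<eta> W. \<delta> > 0 \<and> \<delta> \<le> \<delta>0 \<and> \<eta> > 0 \<and> open W \<and> unit_at \<Gamma> y \<in> W \<and>
    (\<forall>\<tau>. (\<forall>i<k. continuous_on UNIV (\<lambda>(t, x). \<tau> i t x)) \<longrightarrow> (\<forall>i<k. \<forall>t x. src \<Gamma> (\<tau> i t x) = x) \<longrightarrow>
      (\<forall>i<k. \<forall>t. \<bar>t\<bar> \<le> \<delta> \<longrightarrow> (\<forall>z\<in>Y. \<tau> i t z \<in> fst \<psi> \<and>
        l1norm (mdim (arrows \<Gamma>)) (\<lambda>j. snd \<psi> (\<tau> i t z) j - snd \<psi> (\<sigma> i t z) j) \<le> \<eta>)) \<longrightarrow>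
      (\<forall>h1\<in>W \<inter> src_fibre \<Gamma> y. \<forall>h2\<in>W \<inter> src_fibre \<Gamma> y. \<exists>t. iterate_acts (\<lambda>i t. act \<Gamma> (\<tau> i t)) t k h1 = h2))"
proof -
  let ?e = "unit_at \<Gamma> y" and ?n = "mdim (arrows \<Gamma>)" and ?\<psi> = "snd \<psi>"
  have i\<psi>: "is_chart ?n \<psi>" using \<psi>(1) by (auto simp: maximal_atlas_def)
  obtain cM where cM: "cM \<in> charts_at (units \<Gamma>) y"
    using atlasD(4)[OF lie_groupoidD(2)[OF \<Gamma>], of y] by (auto simp: charts_at_def)
  have "\<exists>A. strict_diff (1 + mdim (units \<Gamma>)) ?n (snd (prod_chart 1 real_chart cM)) ?\<psi> (\<lambda>(t, x). \<sigma> i t x) (0, y) A" if "i < k" for i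
    by (rule isotopy_strict_diff[OF r \<Gamma> \<psi> \<sigma>(1)[OF that] \<sigma>(2)[OF that] cM])
  then obtain A where A: "\<And>i. i < k \<Longrightarrow> strict_diff (1 + mdim (units \<Gamma>)) ?n (snd (prod_chart 1 real_chart cM)) ?\<psi> (\<lambda>(t, x). \<sigma> i t x) (0, y) (A i)"
    by metis
  obtain M where M: "\<And>\<epsilon>. \<epsilon> > 0 \<Longrightarrow> \<exists>W. open W \<and> ?e \<in> W \<and> (\<forall>g\<in>W. \<forall>g'\<in>W. \<forall>h\<in>W.
    src \<Gamma> g = tgt \<Gamma> h \<longrightarrow> src \<Gamma> g' = tgt \<Gamma> h \<longrightarrow>
    l1norm ?n (\<lambda>j. ?\<psi> (arrow_comp \<Gamma> g h) j - ?\<psi> (arrow_comp \<Gamma> g' h) j - (\<Sum>i<?n. M j i * (?\<psi> g i - ?\<psi> g' i)))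
      \<le> \<epsilon> * l1norm ?n (\<lambda>i. ?\<psi> g i - ?\<psi> g' i))"
    using arrow_comp_strict_differential[OF r \<Gamma> \<psi>] by blast
  define L where "L = entry_norm ?n ?n M + 1"
  have L: "L \<ge> 1" by (simp add: L_def)
  obtain V1 where V1: "open V1" "?e \<in> V1" and VM: "\<forall>g\<in>V1. \<forall>g'\<in>V1. \<forall>h\<in>V1.
    src \<Gamma> g = tgt \<Gamma> h \<longrightarrow> src \<Gamma> g' = tgt \<Gamma> h \<longrightarrow>
    l1norm ?n (\<lambda>j. ?\<psi> (arrow_comp \<Gamma> g h) j - ?\<psi> (arrow_comp \<Gamma> g' h) j - (\<Sum>i<?n. M j i * (?\<psi> g i - ?\<psi> g' i)))
      \<le> 1 * l1norm ?n (\<lambda>i. ?\<psi> g i - ?\<psi> g' i)"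
    using M[OF zero_less_one] by (elim exE conjE)
  have lip: "l1norm ?n (\<lambda>j. ?\<psi> (arrow_comp \<Gamma> g h) j - ?\<psi> (arrow_comp \<Gamma> g' h) j) \<le> L * l1norm ?n (\<lambda>i. ?\<psi> g i - ?\<psi> g' i)"
    if g: "g \<in> V1" "g' \<in> V1" "h \<in> V1" and s: "src \<Gamma> g = tgt \<Gamma> h" "src \<Gamma> g' = tgt \<Gamma> h" for g g' h
  proof -
    let ?D = "\<lambda>i. ?\<psi> g i - ?\<psi> g' i"
    have "l1norm ?n (\<lambda>j. ?\<psi> (arrow_comp \<Gamma> g h) j - ?\<psi> (arrow_comp \<Gamma> g' h) j)
       \<le> l1norm ?n (\<lambda>j. ?\<psi> (arrow_comp \<Gamma> g h) j - ?\<psi> (arrow_comp \<Gamma> g' h) j - (\<Sum>i<?n. M j i * ?D i)) + l1norm ?n (\<lambda>j. \<Sum>i<?n. M j i * ?D i)"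
      using l1norm_add[of ?n "\<lambda>j. ?\<psi> (arrow_comp \<Gamma> g h) j - ?\<psi> (arrow_comp \<Gamma> g' h) j - (\<Sum>i<?n. M j i * ?D i)" "\<lambda>j. \<Sum>i<?n. M j i * ?D i"] by simp
    also have "\<dots> \<le> 1 * l1norm ?n ?D + entry_norm ?n ?n M * l1norm ?n ?D"
      using VM[rule_format, OF g s] l1norm_lin[where m = ?n and n = ?n and A = M and x = ?D] by (rule add_mono)
    finally show ?thesis by (simp add: L_def algebra_simps)
  qed
  obtain Vc where Vc: "open Vc" "?e \<in> Vc" and comp_in: "\<And>g h. g \<in> Vc \<Longrightarrow> h \<in> Vc \<Longrightarrow> src \<Gamma> g = tgt \<Gamma> h \<Longrightarrow> arrow_comp \<Gamma> g h \<in> fst \<psi>"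
  proof -
    let ?S = "{(g, h). src \<Gamma> g = tgt \<Gamma> h}"
    have "openin (top_of_set ?S) (?S \<inter> (\<lambda>(g, h). arrow_comp \<Gamma> g h) -` fst \<psi>)"
      by (rule continuous_openin_preimage_gen[OF continuous_on_arrow_comp[OF \<Gamma>] is_chartD(1)[OF i\<psi>]])
    then obtain T where T: "open T" "?S \<inter> (\<lambda>(g, h). arrow_comp \<Gamma> g h) -` fst \<psi> = ?S \<inter> T"
      unfolding openin_open by blast
    have "(?e, ?e) \<in> ?S \<inter> (\<lambda>(g, h). arrow_comp \<Gamma> g h) -` fst \<psi>"
      using \<psi>(2) groupoidD(1,2)[OF \<Gamma>] groupoidD(7)[OF \<Gamma>, of ?e] by simp
    then have "(?e, ?e) \<in> T" using T(2) by blast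
    then obtain P Q where PQ: "open P" "open Q" "?e \<in> P" "?e \<in> Q" "P \<times> Q \<subseteq> T"
      using T(1) by (metis open_prod_elim mem_Times_iff fst_conv snd_conv)
    show thesis
    proof (rule that[of "P \<inter> Q"])
      fix g h assume "g \<in> P \<inter> Q" "h \<in> P \<inter> Q" "src \<Gamma> g = tgt \<Gamma> h"
      then have "(g, h) \<in> ?S \<inter> T" using PQ by auto
      then show "arrow_comp \<Gamma> g h \<in> fst \<psi>" unfolding T(2)[symmetric] by auto
    qed (use PQ in auto)
  qed
  obtain r1 where r1: "r1 > 0" and r1V: "\<And>q. q \<in> fst \<psi> \<Longrightarrow> l1norm ?n (\<lambda>j. ?\<psi> q j - ?\<psi> ?e j) < r1 \<Longrightarrow> q \<in> V1 \<inter> Vc"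
    using chart_l1norm_nbhd[OF i\<psi> \<psi>(2), of "V1 \<inter> Vc"] V1 Vc by auto
  let ?near = "{q \<in> fst \<psi>. l1norm ?n (\<lambda>j. ?\<psi> q j - ?\<psi> ?e j) < r1 / 2}"
  have near: "open ?near" "?e \<in> ?near"
    by (rule open_chart_less[OF i\<psi> continuous_on_l1norm_chart[OF i\<psi>]]) (use r1 \<psi>(2) in \<open>simp add: l1norm_def\<close>)
  have "\<exists>Ys \<delta>. open Ys \<and> y \<in> Ys \<and> \<delta> > 0 \<and> (\<forall>i<k. \<forall>t. \<bar>t\<bar> \<le> \<delta> \<longrightarrow> (\<forall>z\<in>Ys. \<sigma> i t z \<in> ?near))"
  proof (rule common_nbhd)
    fix i assume i: "i < k"
    have "continuous_on UNIV (\<lambda>(t, x). \<sigma> i t x)" using \<sigma>(1)[OF i] by (simp add: Cr_on_def)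
    moreover have "\<sigma> i 0 y \<in> ?near" using near(2) \<sigma>(2)[OF i] by simp
    ultimately show "\<exists>Ys \<delta>. open Ys \<and> y \<in> Ys \<and> \<delta> > 0 \<and> (\<forall>t. \<bar>t\<bar> \<le> \<delta> \<longrightarrow> (\<forall>z\<in>Ys. \<sigma> i t z \<in> ?near))"
      using near(1) by (intro joint_nbhd)
  qed
  then obtain Ys \<delta>s where Ys: "open Ys" "y \<in> Ys" "\<delta>s > 0" "\<forall>i<k. \<forall>t. \<bar>t\<bar> \<le> \<delta>s \<longrightarrow> (\<forall>z\<in>Ys. \<sigma> i t z \<in> ?near)"
    by (elim exE conjE)
  define W0 where "W0 = V1 \<inter> Vc \<inter> tgt \<Gamma> -` (Ys \<inter> Y)"
  have W0: "open W0" "?e \<in> W0"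
    unfolding W0_def using V1 Vc Ys Y lie_groupoidD(3)[OF \<Gamma>] groupoidD(2)[OF \<Gamma>]
    by (auto intro!: open_Int open_vimage)
  have est: "\<exists>W \<delta>. open W \<and> ?e \<in> W \<and> \<delta> > 0 \<and> (\<forall>i<k. \<forall>t. \<bar>t\<bar> \<le> \<delta> \<longrightarrow> (\<forall>h\<in>W.
        l1norm ?n (\<lambda>j. ?\<psi> (act \<Gamma> (\<sigma> i t) h) j - ?\<psi> h j - t * A i j 0) \<le> \<epsilon> * \<bar>t\<bar>))" if "\<epsilon> > 0" for \<epsilon>
    by (rule common_nbhd, rule act_first_order[OF r \<Gamma> \<psi> \<sigma>(1) \<sigma>(2) \<sigma>(3) A that])
  have ind': "\<forall>i<k. a i = 0" if "\<forall>j<k. (\<Sum>i<k. a i * A i j 0) = 0" for a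
    by (rule fibre_velocities_independent[OF r \<Gamma> \<psi> slice \<sigma> ind A that])
  have \<delta>s0: "min \<delta>s \<delta>0 > 0" using Ys(3) \<delta>0 by simp
  have "\<exists>\<delta> \<eta> W. 0 < \<delta> \<and> \<delta> \<le> min \<delta>s \<delta>0 \<and> \<eta> > 0 \<and> open W \<and> ?e \<in> W \<and>
    (\<forall>A'. (\<forall>i<k. continuous_on UNIV (\<lambda>(t, h). A' i t h)) \<longrightarrow> (\<forall>i<k. \<forall>t. \<forall>h\<in>src_fibre \<Gamma> y. A' i t h \<in> src_fibre \<Gamma> y) \<longrightarrow>
       (\<forall>i<k. \<forall>t. \<bar>t\<bar> \<le> \<delta> \<longrightarrow> (\<forall>h\<in>W0. A' i t h \<in> fst \<psi> \<and>
          l1norm ?n (\<lambda>j. ?\<psi> (A' i t h) j - ?\<psi> (act \<Gamma> (\<sigma> i t) h) j) \<le> \<eta>)) \<longrightarrow>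
       (\<forall>h1\<in>W \<inter> src_fibre \<Gamma> y. \<forall>h2\<in>W \<inter> src_fibre \<Gamma> y. \<exists>t. iterate_acts A' t k h1 = h2))"
    by (rule iterated_approximate_translations_onto[where v = "\<lambda>i j. A i j 0", OF i\<psi> \<psi>(2) k slice ind' est W0 \<delta>s0])
  then obtain \<delta> \<eta> W where \<delta>: "0 < \<delta>" "\<delta> \<le> min \<delta>s \<delta>0" "\<eta> > 0" "open W" "?e \<in> W"
    and core: "\<forall>A'. (\<forall>i<k. continuous_on UNIV (\<lambda>(t, h). A' i t h)) \<longrightarrow> (\<forall>i<k. \<forall>t. \<forall>h\<in>src_fibre \<Gamma> y. A' i t h \<in> src_fibre \<Gamma> y) \<longrightarrow>
       (\<forall>i<k. \<forall>t. \<bar>t\<bar> \<le> \<delta> \<longrightarrow> (\<forall>h\<in>W0. A' i t h \<in> fst \<psi> \<and>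
          l1norm ?n (\<lambda>j. ?\<psi> (A' i t h) j - ?\<psi> (act \<Gamma> (\<sigma> i t) h) j) \<le> \<eta>)) \<longrightarrow>
       (\<forall>h1\<in>W \<inter> src_fibre \<Gamma> y. \<forall>h2\<in>W \<inter> src_fibre \<Gamma> y. \<exists>t. iterate_acts A' t k h1 = h2)"
    by (elim exE conjE)
  \<comment> \<open>\<open>r1 / 2\<close> keeps the values of \<open>\<tau>\<close> in the region of the Lipschitz estimate\<close>
  define \<eta>' where "\<eta>' = min (r1 / 2) (\<eta> / L)"
  have \<eta>': "\<eta>' > 0" "\<eta>' \<le> r1 / 2" "L * \<eta>' \<le> \<eta>"
    using r1 \<delta>(3) L by (auto simp: \<eta>'_def min_def field_simps)
  have fin: "\<forall>h1\<in>W \<inter> src_fibre \<Gamma> y. \<forall>h2\<in>W \<inter> src_fibre \<Gamma> y. \<exists>t. iterate_acts (\<lambda>i t. act \<Gamma> (\<tau> i t)) t k h1 = h2"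
    if \<tau>: "\<forall>i<k. continuous_on UNIV (\<lambda>(t, x). \<tau> i t x)" "\<forall>i<k. \<forall>t x. src \<Gamma> (\<tau> i t x) = x"
      and cl: "\<forall>i<k. \<forall>t. \<bar>t\<bar> \<le> \<delta> \<longrightarrow> (\<forall>z\<in>Y. \<tau> i t z \<in> fst \<psi> \<and>
        l1norm ?n (\<lambda>j. ?\<psi> (\<tau> i t z) j - ?\<psi> (\<sigma> i t z) j) \<le> \<eta>')" for \<tau>
  proof (rule core[THEN spec, of "\<lambda>i t. act \<Gamma> (\<tau> i t)", THEN mp, THEN mp, THEN mp]; intro allI impI ballI)
    show "continuous_on UNIV (\<lambda>(t, h). act \<Gamma> (\<tau> i t) h)" if "i < k" for i
      by (rule continuous_on_act[OF \<Gamma>]) (use \<tau> that in auto)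
    show "act \<Gamma> (\<tau> i t) h \<in> src_fibre \<Gamma> y" if "i < k" "h \<in> src_fibre \<Gamma> y" for i t h
      using groupoidD(3)[OF \<Gamma>, of "\<tau> i t (tgt \<Gamma> h)" h] \<tau>(2) that by (simp add: act_def src_fibre_def)
    show "act \<Gamma> (\<tau> i t) h \<in> fst \<psi> \<and> l1norm ?n (\<lambda>j. ?\<psi> (act \<Gamma> (\<tau> i t) h) j - ?\<psi> (act \<Gamma> (\<sigma> i t) h) j) \<le> \<eta>"
      if i: "i < k" and t: "\<bar>t\<bar> \<le> \<delta>" and h: "h \<in> W0" for i t h
    proof -
      let ?z = "tgt \<Gamma> h"
      let ?g = "\<tau> i t ?z" and ?g' = "\<sigma> i t ?z"
      have z: "?z \<in> Y" "?z \<in> Ys" "h \<in> V1" "h \<in> Vc" using h by (auto simp: W0_def)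
      have g': "?g' \<in> fst \<psi>" "l1norm ?n (\<lambda>j. ?\<psi> ?g' j - ?\<psi> ?e j) < r1 / 2"
        using Ys(4)[rule_format, OF i _ z(2), of t] t \<delta>(2) by auto
      have g: "?g \<in> fst \<psi>" "l1norm ?n (\<lambda>j. ?\<psi> ?g j - ?\<psi> ?g' j) \<le> \<eta>'"
        using cl[rule_format, OF i t z(1)] by auto
      have "l1norm ?n (\<lambda>j. ?\<psi> ?g j - ?\<psi> ?e j) < r1"
        using l1norm_triangle[of ?n "?\<psi> ?g" "?\<psi> ?e" "?\<psi> ?g'"] g(2) g'(2) \<eta>'(2) by linarith
      then have gV: "?g \<in> V1" "?g \<in> Vc" using r1V[OF g(1)] by auto
      have g'V: "?g' \<in> V1" using r1V[OF g'(1)] g'(2) r1 by auto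
      have s: "src \<Gamma> ?g = ?z" "src \<Gamma> ?g' = ?z" using \<tau>(2) \<sigma>(3) i by auto
      have "l1norm ?n (\<lambda>j. ?\<psi> (act \<Gamma> (\<tau> i t) h) j - ?\<psi> (act \<Gamma> (\<sigma> i t) h) j) \<le> L * l1norm ?n (\<lambda>j. ?\<psi> ?g j - ?\<psi> ?g' j)"
        unfolding act_def by (rule lip[OF gV(1) g'V z(3) s])
      also have "\<dots> \<le> L * \<eta>'" using g(2) L by (intro mult_left_mono) auto
      finally show ?thesis using \<eta>'(3) comp_in[OF gV(2) z(4) s(1)] by (simp add: act_def)
    qed
  qed
  have le0: "\<delta> \<le> \<delta>0" using \<delta>(2) by simp
  show ?thesis
    by (rule exI[of _ \<delta>], rule exI[of _ \<eta>'], rule exI[of _ W], intro conjI \<delta>(1,4,5) \<eta>'(1) le0 allI impI) (rule fin)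
qed

section \<open>Bounded reparametrisation of time\<close>

lemma openin_line_eventually:
  assumes D: "openin (Euclidean_space n) D" and x: "x \<in> D" and i: "i < n"
  shows "eventually (\<lambda>t. x(i := t) \<in> D) (nhds (x i))"
proof -
  obtain r where r: "r > 0" "coord_box n x r \<subseteq> D" using openin_Euclidean_space_coord_box[OF D x] by blast
  have xz: "\<forall>j\<ge>n. x j = 0" using openin_subset[OF D] x by (auto simp: topspace_Euclidean_space)
  have "x(i := t) \<in> D" if "dist t (x i) < r" for t
    using r that xz i by (auto simp: coord_box_def dist_real_def intro!: subsetD[OF r(2)])
  then show ?thesis using r(1) unfolding eventually_nhds_metric by blast
qed

lemma has_derivative_eventually_cong:
  assumes "eventually (\<lambda>t. f t = g t) (nhds (x::real))"
  shows "f differentiable (at x) \<longleftrightarrow> g differentiable (at x)" "deriv f x = deriv g x"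
proof -
  have "(f has_real_derivative D) (at x) \<longleftrightarrow> (g has_real_derivative D) (at x)" for D
    by (rule DERIV_cong_ev[OF refl assms refl])
  then show "f differentiable (at x) \<longleftrightarrow> g differentiable (at x)" by (simp add: real_differentiable_def)
  show "deriv f x = deriv g x" by (rule deriv_cong_ev[OF assms refl])
qed

lemma Ck_fun_cong:
  assumes D: "openin (Euclidean_space n) D" and eq: "\<And>x. x \<in> D \<Longrightarrow> f x = g x"
  shows "Ck_fun k n D f \<Longrightarrow> Ck_fun k n D g"
  using eq
proof (induction k arbitrary: f g)
  case 0
  then show ?case using continuous_on_cong[of D D f g] by simp
next
  case (Suc k)
  have ev: "eventually (\<lambda>t. f (x(i := t)) = g (x(i := t))) (nhds (x i))" if "x \<in> D" "i < n" for x i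
    using openin_line_eventually[OF D that] by eventually_elim (rule Suc.prems(2))
  have pd: "partial_deriv i f x = partial_deriv i g x" if "x \<in> D" "i < n" for x i
    unfolding partial_deriv_def by (rule has_derivative_eventually_cong(2)[OF ev[OF that]])
  have "continuous_on D g" using Suc.prems continuous_on_cong[of D D f g] by simp
  moreover have "(\<lambda>t. g (x(i := t))) differentiable (at (x i))" if "i < n" "x \<in> D" for i x
    using Suc.prems(1) that has_derivative_eventually_cong(1)[OF ev[OF that(2,1)]] by simp
  moreover have "Ck_fun k n D (partial_deriv i g)" if "i < n" for i
    by (rule Suc.IH[of "partial_deriv i f"]) (use Suc.prems(1) that pd in auto)
  ultimately show ?case by simp
qed

lemma Ck_fun_SucD: "Ck_fun (Suc k) n D f \<Longrightarrow> Ck_fun k n D f"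
  by (induction k arbitrary: f) auto

lemma Ck_fun_has_derivative:
  assumes "Ck_fun (Suc k) n D f" "x \<in> D" "i < n"
  shows "((\<lambda>t. f (x(i := t))) has_real_derivative partial_deriv i f x) (at (x i))"
  using assms by (simp add: partial_deriv_def DERIV_deriv_iff_real_differentiable)

lemma Ck_fun_SucI:
  assumes D: "openin (Euclidean_space n) D" and c: "continuous_on D f"
    and d: "\<And>x i. x \<in> D \<Longrightarrow> i < n \<Longrightarrow> ((\<lambda>t. f (x(i := t))) has_real_derivative f' i x) (at (x i))"
    and C: "\<And>i. i < n \<Longrightarrow> Ck_fun k n D (f' i)"
  shows "Ck_fun (Suc k) n D f"
proof -
  have "partial_deriv i f x = f' i x" if "x \<in> D" "i < n" for x i
    unfolding partial_deriv_def by (rule DERIV_imp_deriv[OF d[OF that]])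
  then have "Ck_fun k n D (partial_deriv i f)" if "i < n" for i
    using Ck_fun_cong[OF D _ C[OF that]] that by auto
  then show ?thesis using c d by (auto simp: real_differentiable_def)
qed

lemma Ck_fun_continuous: "Ck_fun k n D f \<Longrightarrow> continuous_on D f"
  by (cases k) auto

lemma Ck_fun_add:
  assumes D: "openin (Euclidean_space n) D"
  shows "Ck_fun k n D f \<Longrightarrow> Ck_fun k n D g \<Longrightarrow> Ck_fun k n D (\<lambda>x. f x + g x)"
proof (induction k arbitrary: f g)
  case (Suc k)
  show ?case
  proof (rule Ck_fun_SucI[OF D, where f' = "\<lambda>i x. partial_deriv i f x + partial_deriv i g x"])
    show "continuous_on D (\<lambda>x. f x + g x)"
      using Suc.prems by (auto intro!: continuous_intros)
    show "((\<lambda>t. f (x(i := t)) + g (x(i := t))) has_real_derivative partial_deriv i f x + partial_deriv i g x) (at (x i))"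
      if "x \<in> D" "i < n" for x i
      using Ck_fun_has_derivative[OF Suc.prems(1) that] Ck_fun_has_derivative[OF Suc.prems(2) that] by (rule DERIV_add)
  qed (use Suc in auto)
qed (auto intro!: continuous_intros)

lemma Ck_fun_mult:
  assumes D: "openin (Euclidean_space n) D"
  shows "Ck_fun k n D f \<Longrightarrow> Ck_fun k n D g \<Longrightarrow> Ck_fun k n D (\<lambda>x. f x * g x)"
proof (induction k arbitrary: f g)
  case (Suc k)
  show ?case
  proof (rule Ck_fun_SucI[OF D, where f' = "\<lambda>i x. partial_deriv i f x * g x + partial_deriv i g x * f x"])
    show "continuous_on D (\<lambda>x. f x * g x)"
      using Suc.prems by (auto intro!: continuous_intros)
    show "((\<lambda>t. f (x(i := t)) * g (x(i := t))) has_real_derivative partial_deriv i f x * g x + partial_deriv i g x * f x) (at (x i))"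
      if "x \<in> D" "i < n" for x i
      using DERIV_mult[OF Ck_fun_has_derivative[OF Suc.prems(1) that] Ck_fun_has_derivative[OF Suc.prems(2) that]] by (simp only: fun_upd_triv)
    show "Ck_fun k n D (\<lambda>x. partial_deriv i f x * g x + partial_deriv i g x * f x)" if "i < n" for i
      by (rule Ck_fun_add[OF D]; rule Suc.IH) (use Suc.prems that Ck_fun_SucD in auto)
  qed
qed (auto intro!: continuous_intros)

text \<open>The phase \<open>\<phi>\<close> makes the family closed under differentiation, since \<open>cos\<close> is a shifted \<open>sin\<close>.\<close>

lemma Ck_fun_sin:
  assumes D: "openin (Euclidean_space n) D"
  shows "Ck_fun k n D (\<lambda>x. b * sin (x 0 + \<phi>))"
proof (induction k arbitrary: b \<phi>)
  case (Suc k)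
  show ?case
  proof (rule Ck_fun_SucI[OF D, where f' = "\<lambda>i x. (if i = 0 then b else 0) * sin (x 0 + (\<phi> + pi / 2))"])
    show "continuous_on D (\<lambda>x. b * sin (x 0 + \<phi>))"
      by (intro continuous_intros continuous_on_coordinate)
    show "((\<lambda>t. b * sin ((x(i := t)) 0 + \<phi>)) has_real_derivative (if i = 0 then b else 0) * sin (x 0 + (\<phi> + pi / 2))) (at (x i))" for x i
    proof (cases "i = 0")
      case True
      have "sin (x 0 + (\<phi> + pi / 2)) = cos (x 0 + \<phi>)" by (simp add: sin_add cos_add add.assoc[symmetric])
      then show ?thesis using True by (auto intro!: derivative_eq_intros)
    qed simp
  qed (rule Suc.IH)
qed (auto intro!: continuous_intros continuous_on_coordinate)

text \<open>In a product chart of the real line and the units, time is the coordinate \<open>0\<close>; this is the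
  substitution \<open>t \<mapsto> \<delta> sin t\<close> in such coordinates.\<close>

definition sin_time :: "real \<Rightarrow> (nat \<Rightarrow> real) \<Rightarrow> (nat \<Rightarrow> real)" where
  "sin_time \<delta> u = u(0 := \<delta> * sin (u 0))"

lemma continuous_on_sin_time: "continuous_on S (sin_time \<delta>)"
  unfolding continuous_on_nat_fun_iff
proof
  show "continuous_on S (\<lambda>u. sin_time \<delta> u i)" for i
    by (cases "i = 0") (auto simp: sin_time_def intro!: continuous_intros continuous_on_coordinate)
qed

lemma Ck_fun_sin_time:
  assumes D: "openin (Euclidean_space n) D" and D': "openin (Euclidean_space n) D'"
    and maps: "\<And>u. u \<in> D' \<Longrightarrow> sin_time \<delta> u \<in> D"
  shows "Ck_fun k n D f \<Longrightarrow> Ck_fun k n D' (\<lambda>u. f (sin_time \<delta> u))"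
proof (induction k arbitrary: f)
  case 0
  then show ?case
    using continuous_on_compose2[of D f D' "sin_time \<delta>"] continuous_on_sin_time maps by auto
next
  case (Suc k)
  show ?case
  proof (rule Ck_fun_SucI[OF D', where f' = "\<lambda>i u. partial_deriv i f (sin_time \<delta> u) * (if i = 0 then \<delta> * sin (u 0 + pi / 2) else 1)"])
    show "continuous_on D' (\<lambda>u. f (sin_time \<delta> u))"
      using continuous_on_compose2[of D f D' "sin_time \<delta>"] continuous_on_sin_time maps Ck_fun_continuous[OF Suc.prems] by auto
    show "((\<lambda>t. f (sin_time \<delta> (u(i := t)))) has_real_derivative
        partial_deriv i f (sin_time \<delta> u) * (if i = 0 then \<delta> * sin (u 0 + pi / 2) else 1)) (at (u i))"
      if u: "u \<in> D'" and i: "i < n" for u i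
    proof (cases "i = 0")
      case True
      have *: "((\<lambda>s. f ((sin_time \<delta> u)(0 := s))) has_real_derivative partial_deriv 0 f (sin_time \<delta> u)) (at (\<delta> * sin (u 0)))"
      proof -
        have "sin_time \<delta> u 0 = \<delta> * sin (u 0)" by (simp add: sin_time_def)
        then show ?thesis using Ck_fun_has_derivative[OF Suc.prems maps[OF u] i] by (simp only: True)
      qed
      have "((\<lambda>t. \<delta> * sin t) has_real_derivative \<delta> * sin (u 0 + pi / 2)) (at (u 0))"
        by (auto intro!: derivative_eq_intros simp: sin_add)
      from DERIV_chain2[OF * this]
      have "((\<lambda>t. f ((sin_time \<delta> u)(0 := \<delta> * sin t))) has_real_derivative
        partial_deriv 0 f (sin_time \<delta> u) * (\<delta> * sin (u 0 + pi / 2))) (at (u 0))" .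
      moreover have "sin_time \<delta> (u(0 := t)) = (sin_time \<delta> u)(0 := \<delta> * sin t)" for t
        by (simp add: sin_time_def)
      ultimately show ?thesis by (simp only: True if_True simp_thms)
    next
      case False
      have e: "sin_time \<delta> (u(i := t)) = (sin_time \<delta> u)(i := t)" "sin_time \<delta> u i = u i" for t
        using False by (auto simp: sin_time_def fun_eq_iff)
      show ?thesis using Ck_fun_has_derivative[OF Suc.prems maps[OF u] i]
        by (simp only: e if_not_P[OF False] mult_1_right)
    qed
    show "Ck_fun k n D' (\<lambda>u. partial_deriv i f (sin_time \<delta> u) * (if i = 0 then \<delta> * sin (u 0 + pi / 2) else 1))"
      if i: "i < n" for i
    proof (rule Ck_fun_mult[OF D'])
      show "Ck_fun k n D' (\<lambda>u. partial_deriv i f (sin_time \<delta> u))" by (rule Suc.IH) (use Suc.prems i in auto)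
      show "Ck_fun k n D' (\<lambda>u. if i = 0 then \<delta> * sin (u 0 + pi / 2) else 1)"
      proof (cases "i = 0")
        case False
        have one: "Ck_fun k n D' (\<lambda>u. 1)"
        proof -
          have "Ck_fun k n D' (\<lambda>u. c)" for c :: real
          proof (induction k arbitrary: c)
            case (Suc k)
            show ?case by (rule Ck_fun_SucI[OF D', where f' = "\<lambda>i x. 0"]) (use Suc in \<open>auto intro: continuous_intros\<close>)
          qed (auto intro: continuous_intros)
          then show ?thesis .
        qed
        show ?thesis using False one by simp
      qed (use Ck_fun_sin[OF D'] in simp)
    qed
  qed
qed

lemma fps_power_abs_le:
  fixes F G :: "real fps"
  assumes "\<And>m. \<bar>fps_nth F m\<bar> \<le> fps_nth G m"
  shows "\<bar>fps_nth (F ^ p) m\<bar> \<le> fps_nth (G ^ p) m"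
proof (induction p arbitrary: m)
  case 0
  show ?case by (simp add: fps_one_def)
next
  case (Suc p)
  have G: "0 \<le> fps_nth G i" for i using assms[of i] by linarith
  have "\<bar>fps_nth (F ^ Suc p) m\<bar> \<le> (\<Sum>i=0..m. \<bar>fps_nth F i * fps_nth (F ^ p) (m - i)\<bar>)"
    by (simp add: fps_mult_nth)
  also have "\<dots> \<le> (\<Sum>i=0..m. fps_nth G i * fps_nth (G ^ p) (m - i))"
    unfolding abs_mult using assms Suc G by (intro sum_mono mult_mono) auto
  also have "\<dots> = fps_nth (G ^ Suc p) m" by (simp add: fps_mult_nth)
  finally show ?case .
qed

lemma fps_has_sum:
  fixes H :: "real fps"
  assumes "fps_conv_radius H = \<infinity>"
  shows "((\<lambda>m. fps_nth H m * h ^ m) has_sum eval_fps H h) UNIV"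
proof (rule norm_summable_imp_has_sum)
  show "summable (\<lambda>m. norm (fps_nth H m * h ^ m))"
    by (rule abs_summable_in_conv_radius) (use assms in \<open>simp add: fps_conv_radius_def\<close>)
  show "(\<lambda>m. fps_nth H m * h ^ m) sums eval_fps H h"
    by (rule sums_eval_fps) (use assms in simp)
qed

text \<open>The increments of \<open>\<delta> sin\<close> are given by an entire power series without constant term, and the series
  of \<open>2 \<bar>\<delta>\<bar> (exp h - 1)\<close> majorises it for every base point \<open>\<theta>\<close>.\<close>

lemma sin_increment_fps:
  fixes \<delta> \<theta> :: real
  obtains F G :: "real fps" where "\<And>m. \<bar>fps_nth F m\<bar> \<le> fps_nth G m"
    "fps_conv_radius F = \<infinity>" "fps_conv_radius G = \<infinity>"
    "\<And>h. eval_fps F h = \<delta> * sin (\<theta> + h) - \<delta> * sin \<theta>" "\<And>h. eval_fps G h = 2 * \<bar>\<delta>\<bar> * (exp h - 1)"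
proof -
  define F where "F = fps_const (\<delta> * sin \<theta>) * (fps_cos 1 - 1) + fps_const (\<delta> * cos \<theta>) * fps_sin 1"
  define G where "G = fps_const (2 * \<bar>\<delta>\<bar>) * (fps_exp 1 - (1 :: real fps))"
  have top: "c = \<infinity>" if "min a b \<le> c" "a = \<infinity>" "b = \<infinity>" for a b c :: ereal
    using that by simp
  have cos1: "fps_conv_radius (fps_cos 1 - 1 :: real fps) = \<infinity>"
    by (rule top[OF fps_conv_radius_diff]) simp_all
  have e1: "fps_conv_radius (fps_exp 1 - 1 :: real fps) = \<infinity>"
    by (rule top[OF fps_conv_radius_diff]) simp_all
  have m1: "fps_conv_radius (fps_const (\<delta> * sin \<theta>) * (fps_cos 1 - 1)) = \<infinity>"
    by (rule top[OF fps_conv_radius_mult]) (simp_all add: cos1)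
  have m2: "fps_conv_radius (fps_const (\<delta> * cos \<theta>) * fps_sin 1) = \<infinity>"
    by (rule top[OF fps_conv_radius_mult]) simp_all
  have F: "fps_conv_radius F = \<infinity>" unfolding F_def
    by (rule top[OF fps_conv_radius_add m1 m2])
  have G: "fps_conv_radius G = \<infinity>" unfolding G_def
    by (rule top[OF fps_conv_radius_mult]) (simp_all add: e1)
  have eF: "eval_fps F h = \<delta> * sin (\<theta> + h) - \<delta> * sin \<theta>" for h
  proof -
    have "eval_fps F h = \<delta> * sin \<theta> * (cos h - 1) + \<delta> * cos \<theta> * sin h"
      unfolding F_def by (simp add: eval_fps_add eval_fps_mult eval_fps_diff m1 m2 cos1)
    then show ?thesis by (simp add: sin_add algebra_simps)
  qed
  have eG: "eval_fps G h = 2 * \<bar>\<delta>\<bar> * (exp h - 1)" for h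
    unfolding G_def by (simp add: eval_fps_mult eval_fps_diff e1)
  have "\<bar>fps_nth F m\<bar> \<le> fps_nth G m" for m
  proof (cases "m = 0")
    case True
    then show ?thesis by (simp add: F_def G_def)
  next
    case False
    have c: "\<bar>fps_nth (fps_cos (1::real)) m\<bar> \<le> 1 / fact m" "\<bar>fps_nth (fps_sin (1::real)) m\<bar> \<le> 1 / fact m"
      by (auto simp: fps_cos_def fps_sin_def abs_mult power_abs)
    have "\<bar>fps_nth F m\<bar> \<le> \<bar>\<delta>\<bar> * (\<bar>sin \<theta>\<bar> * \<bar>fps_nth (fps_cos 1) m\<bar>) + \<bar>\<delta>\<bar> * (\<bar>cos \<theta>\<bar> * \<bar>fps_nth (fps_sin 1) m\<bar>)"
      using False abs_triangle_ineq[of "\<delta> * sin \<theta> * fps_nth (fps_cos 1) m" "\<delta> * cos \<theta> * fps_nth (fps_sin 1) m"]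
      by (simp add: F_def abs_mult mult.assoc)
    also have "\<dots> \<le> \<bar>\<delta>\<bar> * (1 * (1 / fact m)) + \<bar>\<delta>\<bar> * (1 * (1 / fact m))"
      using c abs_sin_le_one abs_cos_le_one by (intro add_mono mult_left_mono mult_mono) auto
    also have "\<dots> = fps_nth G m" using False by (simp add: G_def)
    finally show ?thesis .
  qed
  then show thesis using that F G eF eG by blast
qed

text \<open>The series of the increment of \<open>\<delta> sin\<close> is substituted for the variable \<open>0\<close> in the expansion of \<open>f\<close>.
  If the majorant of this series is smaller than the radius of absolute convergence of the expansion,
  then the double series over the exponent of the variable \<open>0\<close> before and after the substitution
  converges absolutely, and can be ordered by the powers of the new variable.\<close>

lemma analytic_fun_sin_time:
  assumes n: "0 < n" and D: "openin (Euclidean_space n) D" and D': "openin (Euclidean_space n) D'"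
    and maps: "\<And>u. u \<in> D' \<Longrightarrow> sin_time \<delta> u \<in> D"
    and f: "analytic_fun n D f"
  shows "analytic_fun n D' (\<lambda>u. f (sin_time \<delta> u))"
  unfolding analytic_fun_def
proof
  fix x assume x: "x \<in> D'"
  define x' where "x' = sin_time \<delta> x"
  define \<theta> where "\<theta> = x 0"
  have x'D: "x' \<in> D" using maps[OF x] by (simp add: x'_def)
  obtain r a where r: "r > 0" "coord_box n x' r \<subseteq> D"
    and hs: "\<And>y. y \<in> coord_box n x' r \<Longrightarrow> ((\<lambda>\<mu>. a \<mu> * (\<Prod>i<n. (y i - x' i) ^ \<mu> i)) has_sum f y) (multi_indices n)"
    and b: "(\<lambda>\<mu>. \<bar>a \<mu>\<bar> * r ^ (\<Sum>i<n. \<mu> i)) summable_on multi_indices n"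
    using analytic_fun_expansion[OF f D x'D] by blast
  obtain F G :: "real fps" where FG: "\<And>m. \<bar>fps_nth F m\<bar> \<le> fps_nth G m"
    and cr: "fps_conv_radius F = \<infinity>" "fps_conv_radius G = \<infinity>"
    and eF: "\<And>h. eval_fps F h = \<delta> * sin (\<theta> + h) - \<delta> * sin \<theta>" and eG: "\<And>h. eval_fps G h = 2 * \<bar>\<delta>\<bar> * (exp h - 1)"
    using sin_increment_fps[of \<delta> \<theta>] by blast
  have crp: "fps_conv_radius (F ^ p) = \<infinity>" "fps_conv_radius (G ^ p) = \<infinity>" for p
    using fps_conv_radius_power[of F p] fps_conv_radius_power[of G p] cr by simp_all
  have "((\<lambda>h. 2 * \<bar>\<delta>\<bar> * (exp h - 1)) \<longlongrightarrow> 2 * \<bar>\<delta>\<bar> * (exp 0 - 1)) (at_right 0)"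
    by (intro tendsto_intros)
  then have "eventually (\<lambda>h. 2 * \<bar>\<delta>\<bar> * (exp h - 1) < r) (at_right 0)"
    by (rule order_tendstoD) (simp add: r)
  moreover have "eventually (\<lambda>h::real. 0 < h \<and> h < r) (at_right 0)"
    using eventually_at_right_real[OF r(1)] by simp
  ultimately have "eventually (\<lambda>h. 2 * \<bar>\<delta>\<bar> * (exp h - 1) < r \<and> 0 < h \<and> h < r) (at_right 0)"
    by (rule eventually_conj)
  then obtain \<rho> where \<rho>: "2 * \<bar>\<delta>\<bar> * (exp \<rho> - 1) < r" "0 < \<rho>" "\<rho> < r"
    using eventually_happens'[OF trivial_limit_at_right_real] by blast
  let ?MI = "multi_indices n"
  define rest where "rest = (\<lambda>\<mu>::nat\<Rightarrow>nat. \<Sum>i\<in>{..<n}-{0}. \<mu> i)"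
  define Q where "Q = (\<lambda>(\<mu>::nat\<Rightarrow>nat) (y::nat\<Rightarrow>real). \<Prod>i\<in>{..<n}-{0}. (y i - x i) ^ \<mu> i)"
  \<comment> \<open>\<open>C p m\<close> is the coefficient of \<open>h ^ m\<close> in the \<open>p\<close>-th power of the increment\<close>
  define C where "C = (\<lambda>p m. fps_nth (F ^ p) m)"
  have sum_split: "(\<Sum>i<n. \<mu> i) = \<mu> 0 + rest \<mu>" for \<mu> :: "nat \<Rightarrow> nat"
    using n by (simp add: rest_def sum.remove)
  have rest_upd: "rest (\<mu>(0 := k)) = rest \<mu>" and Q_upd: "Q (\<mu>(0 := k)) y = Q \<mu> y" for \<mu> k y
    unfolding rest_def Q_def by (auto intro!: sum.cong prod.cong)
  have majorant: "((\<lambda>m. fps_nth (G ^ p) m * \<rho> ^ m) has_sum (eval_fps G \<rho>) ^ p) UNIV" for p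
    using fps_has_sum[OF crp(2), of p \<rho>] eval_fps_power[of \<rho> G p] cr by simp
  have G\<rho>: "0 \<le> eval_fps G \<rho>" "eval_fps G \<rho> \<le> r" using \<rho> by (auto simp: eG)
  have C_le: "\<bar>C p m\<bar> * \<rho> ^ m \<le> fps_nth (G ^ p) m * \<rho> ^ m" for p m
    using fps_power_abs_le[OF FG, of p m] \<rho> by (simp add: C_def mult_right_mono)
  have C_sum: "(\<lambda>m. \<bar>C p m\<bar> * \<rho> ^ m) summable_on UNIV" for p
    by (rule summable_on_comparison_test[OF has_sum_imp_summable[OF majorant[of p]]]) (use C_le \<rho> in auto)
  have C_infsum: "infsum (\<lambda>m. \<bar>C p m\<bar> * \<rho> ^ m) UNIV \<le> r ^ p" for p
  proof -
    have "infsum (\<lambda>m. \<bar>C p m\<bar> * \<rho> ^ m) UNIV \<le> (eval_fps G \<rho>) ^ p"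
      by (rule has_sum_mono[OF has_sum_infsum[OF C_sum] majorant]) (rule C_le)
    also have "\<dots> \<le> r ^ p" using G\<rho> by (rule power_mono[rotated])
    finally show ?thesis .
  qed
  define S where "S = (\<lambda>(\<mu>, m). \<bar>a \<mu>\<bar> * (\<bar>C (\<mu> 0) m\<bar> * \<rho> ^ m) * r ^ rest \<mu>)"
  have S_sum: "S summable_on ?MI \<times> UNIV"
  proof (rule summable_on_SigmaI)
    show "((\<lambda>m. S (\<mu>, m)) has_sum \<bar>a \<mu>\<bar> * infsum (\<lambda>m. \<bar>C (\<mu> 0) m\<bar> * \<rho> ^ m) UNIV * r ^ rest \<mu>) UNIV" for \<mu>
      unfolding S_def prod.case by (intro has_sum_cmult_left has_sum_cmult_right has_sum_infsum C_sum)
    show "(\<lambda>\<mu>. \<bar>a \<mu>\<bar> * infsum (\<lambda>m. \<bar>C (\<mu> 0) m\<bar> * \<rho> ^ m) UNIV * r ^ rest \<mu>) summable_on ?MI"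
    proof (rule summable_on_comparison_test[OF b])
      fix \<mu> :: "nat \<Rightarrow> nat"
      have "\<bar>a \<mu>\<bar> * infsum (\<lambda>m. \<bar>C (\<mu> 0) m\<bar> * \<rho> ^ m) UNIV * r ^ rest \<mu> \<le> \<bar>a \<mu>\<bar> * r ^ \<mu> 0 * r ^ rest \<mu>"
        using C_infsum[of "\<mu> 0"] r by (intro mult_right_mono mult_left_mono) auto
      then show "\<bar>a \<mu>\<bar> * infsum (\<lambda>m. \<bar>C (\<mu> 0) m\<bar> * \<rho> ^ m) UNIV * r ^ rest \<mu> \<le> \<bar>a \<mu>\<bar> * r ^ (\<Sum>i<n. \<mu> i)"
        unfolding sum_split by (simp add: power_add mult.assoc)
      show "0 \<le> \<bar>a \<mu>\<bar> * infsum (\<lambda>m. \<bar>C (\<mu> 0) m\<bar> * \<rho> ^ m) UNIV * r ^ rest \<mu>"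
        using r \<rho> by (intro mult_nonneg_nonneg infsum_nonneg) auto
    qed
  qed (use r \<rho> in \<open>auto simp: S_def\<close>)
  define A where "A = (\<lambda>\<nu>. infsum (\<lambda>p. a (\<nu>(0 := p)) * C p (\<nu> 0)) UNIV)"
  have A: "((\<lambda>p. a (\<nu>(0 := p)) * C p (\<nu> 0)) has_sum A \<nu>) UNIV" if \<nu>: "\<nu> \<in> ?MI" for \<nu>
  proof -
    let ?j = "\<lambda>p. (\<nu>(0 := p), \<nu> 0)"
    have "inj ?j" by (auto simp: inj_on_def fun_eq_iff)
    moreover have "S summable_on range ?j"
      by (rule summable_on_subset_banach[OF S_sum]) (use \<nu> n in auto)
    ultimately have "(S \<circ> ?j) summable_on UNIV" by (simp add: summable_on_reindex)
    then have "(\<lambda>p. (\<rho> ^ \<nu> 0 * r ^ rest \<nu>) * \<bar>a (\<nu>(0 := p)) * C p (\<nu> 0)\<bar>) summable_on UNIV"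
      by (simp add: S_def o_def rest_upd abs_mult mult_ac)
    then have "(\<lambda>p. \<bar>a (\<nu>(0 := p)) * C p (\<nu> 0)\<bar>) summable_on UNIV"
      using \<rho> r by (subst (asm) summable_on_cmult_right') auto
    then have "(\<lambda>p. norm (a (\<nu>(0 := p)) * C p (\<nu> 0))) summable_on UNIV" by simp
    then show ?thesis unfolding A_def by (rule has_sum_infsum[OF abs_summable_summable])
  qed
  show "\<exists>\<rho>>0. \<exists>a. \<forall>y\<in>D'. (\<forall>i<n. \<bar>y i - x i\<bar> < \<rho>) \<longrightarrow>
        ((\<lambda>\<mu>. a \<mu> * (\<Prod>i<n. (y i - x i) ^ \<mu> i)) has_sum f (sin_time \<delta> y)) ?MI"
  proof (rule exI[of _ \<rho>], rule conjI[OF \<rho>(2)], rule exI[of _ A], intro ballI impI)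
    fix y assume y: "y \<in> D'" "\<forall>i<n. \<bar>y i - x i\<bar> < \<rho>"
    define h where "h = y 0 - \<theta>"
    define v where "v = eval_fps F h"
    have h: "\<bar>h\<bar> \<le> \<rho>" using y n by (auto simp: h_def \<theta>_def intro: less_imp_le)
    have v_eq: "v = sin_time \<delta> y 0 - x' 0" by (simp add: v_def eF h_def x'_def sin_time_def \<theta>_def)
    have C_h: "((\<lambda>m. C p m * h ^ m) has_sum v ^ p) UNIV" for p
      using fps_has_sum[OF crp(1), of p h] eval_fps_power[of h F p] cr by (simp add: C_def v_def)
    have bound: "\<bar>C p m * h ^ m\<bar> \<le> \<bar>C p m\<bar> * \<rho> ^ m" for p m
      using h by (auto simp: abs_mult power_abs intro!: mult_left_mono power_mono)
    have "\<bar>v ^ 1\<bar> \<le> infsum (\<lambda>m. fps_nth (G ^ 1) m * \<rho> ^ m) UNIV"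
      by (rule has_sum_abs_le[OF C_h[of 1] has_sum_imp_summable[OF majorant[of 1]] order_trans[OF bound C_le]])
    also have "\<dots> < r" using infsumI[OF majorant[of 1]] \<rho>(1) by (simp add: eG)
    finally have v_less: "\<bar>v\<bar> < r" by simp
    have ybox: "sin_time \<delta> y \<in> coord_box n x' r"
    proof -
      have "\<forall>i\<ge>n. sin_time \<delta> y i = 0"
        using maps[OF y(1)] openin_subset[OF D] by (auto simp: topspace_Euclidean_space)
      moreover have "\<bar>sin_time \<delta> y i - x' i\<bar> < r" if "i < n" for i
      proof (cases "i = 0")
        case True
        then show ?thesis using v_less v_eq by simp
      next
        case False
        then have "sin_time \<delta> y i - x' i = y i - x i" by (simp add: sin_time_def x'_def)
        then show ?thesis using y(2) that \<rho>(3) by force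
      qed
      ultimately show ?thesis by (simp add: coord_box_def)
    qed
    have Q_eq: "(\<Prod>i<n. (sin_time \<delta> y i - x' i) ^ \<mu> i) = v ^ \<mu> 0 * Q \<mu> y" for \<mu>
    proof -
      have "(\<Prod>i\<in>{..<n}-{0}. (sin_time \<delta> y i - x' i) ^ \<mu> i) = Q \<mu> y"
        unfolding Q_def by (rule prod.cong) (auto simp: sin_time_def x'_def)
      then show ?thesis using n by (simp add: prod.remove[of "{..<n}" 0] v_eq)
    qed
    have Q_eq2: "(\<Prod>i<n. (y i - x i) ^ \<mu> i) = h ^ \<mu> 0 * Q \<mu> y" for \<mu>
      using n by (simp add: prod.remove[of "{..<n}" 0] Q_def h_def \<theta>_def)
    have Q_le: "\<bar>Q \<mu> y\<bar> \<le> r ^ rest \<mu>" for \<mu>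
    proof -
      have "\<bar>Q \<mu> y\<bar> \<le> (\<Prod>i\<in>{..<n}-{0}. r ^ \<mu> i)"
        unfolding Q_def abs_prod power_abs using y(2) \<rho>(3)
        by (intro prod_mono conjI power_mono) (auto intro: order.strict_implies_order less_trans)
      then show ?thesis by (simp add: rest_def power_sum)
    qed
    define T where "T = (\<lambda>(\<mu>, m). a \<mu> * (C (\<mu> 0) m * h ^ m) * Q \<mu> y)"
    have T_sum: "T summable_on ?MI \<times> UNIV"
    proof (rule abs_summable_summable[OF Infinite_Sum.abs_summable_on_comparison_test'[OF S_sum]])
      fix z :: "(nat \<Rightarrow> nat) \<times> nat"
      obtain \<mu> m where z: "z = (\<mu>, m)" by (cases z)
      have "\<bar>a \<mu>\<bar> * \<bar>C (\<mu> 0) m * h ^ m\<bar> * \<bar>Q \<mu> y\<bar> \<le> \<bar>a \<mu>\<bar> * (\<bar>C (\<mu> 0) m\<bar> * \<rho> ^ m) * r ^ rest \<mu>"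
        using bound Q_le \<rho> by (intro mult_mono) auto
      then show "norm (T z) \<le> S z" by (simp add: z T_def S_def abs_mult)
    qed
    have "(T has_sum f (sin_time \<delta> y)) (?MI \<times> UNIV)"
    proof (rule has_sum_SigmaI[OF _ _ T_sum])
      show "((\<lambda>m. T (\<mu>, m)) has_sum a \<mu> * v ^ \<mu> 0 * Q \<mu> y) UNIV" for \<mu>
        unfolding T_def prod.case by (intro has_sum_cmult_left has_sum_cmult_right C_h)
      show "((\<lambda>\<mu>. a \<mu> * v ^ \<mu> 0 * Q \<mu> y) has_sum f (sin_time \<delta> y)) ?MI"
        using hs[OF ybox] unfolding Q_eq by (simp add: mult.assoc)
    qed
    moreover have "(T has_sum f (sin_time \<delta> y)) (?MI \<times> UNIV)
      \<longleftrightarrow> ((\<lambda>(\<nu>, p). (a (\<nu>(0 := p)) * C p (\<nu> 0)) * (h ^ \<nu> 0 * Q \<nu> y)) has_sum f (sin_time \<delta> y)) (?MI \<times> UNIV)"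
      \<comment> \<open>exchanges the old exponent \<open>p\<close> and the new exponent \<open>m\<close> of the variable \<open>0\<close>\<close>
      by (rule has_sum_reindex_bij_witness[of _ "\<lambda>(\<nu>, p). (\<nu>(0 := p), \<nu> 0)" "\<lambda>(\<mu>, m). (\<mu>(0 := m), \<mu> 0)"])
        (use n in \<open>auto simp: T_def Q_upd mult_ac\<close>)
    ultimately have "((\<lambda>(\<nu>, p). (a (\<nu>(0 := p)) * C p (\<nu> 0)) * (h ^ \<nu> 0 * Q \<nu> y)) has_sum f (sin_time \<delta> y)) (?MI \<times> UNIV)"
      by simp
    then have "((\<lambda>\<nu>. A \<nu> * (h ^ \<nu> 0 * Q \<nu> y)) has_sum f (sin_time \<delta> y)) ?MI"
    proof (rule has_sum_SigmaD)
      fix \<nu> assume "\<nu> \<in> ?MI"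
      then show "((\<lambda>p. case (\<nu>, p) of (\<nu>, p) \<Rightarrow> (a (\<nu>(0 := p)) * C p (\<nu> 0)) * (h ^ \<nu> 0 * Q \<nu> y)) has_sum A \<nu> * (h ^ \<nu> 0 * Q \<nu> y)) UNIV"
        unfolding prod.case by (intro has_sum_cmult_left A)
    qed
    then show "((\<lambda>\<mu>. A \<mu> * (\<Prod>i<n. (y i - x i) ^ \<mu> i)) has_sum f (sin_time \<delta> y)) ?MI"
      unfolding Q_eq2 .
  qed
qed

lemma Cr_fun_sin_time:
  assumes n: "0 < n" and D: "openin (Euclidean_space n) D" and D': "openin (Euclidean_space n) D'"
    and maps: "\<And>u. u \<in> D' \<Longrightarrow> sin_time \<delta> u \<in> D"
    and f: "Cr_fun r n D f" and g: "\<And>u. u \<in> D' \<Longrightarrow> g u = f (sin_time \<delta> u)"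
  shows "Cr_fun r n D' g"
proof (cases r)
  case (Differentiable e)
  have "Ck_fun k n D' g" if "enat k \<le> e" for k
  proof (rule Ck_fun_cong[OF D'])
    show "Ck_fun k n D' (\<lambda>u. f (sin_time \<delta> u))"
      by (rule Ck_fun_sin_time[OF D D' maps]) (use f that Differentiable in \<open>auto simp: Cr_fun_def\<close>)
  qed (simp add: g)
  then show ?thesis using Differentiable by (simp add: Cr_fun_def)
next
  case Analytic
  then have "analytic_fun n D' (\<lambda>u. f (sin_time \<delta> u))"
    using analytic_fun_sin_time[OF n D D' maps] f by (simp add: Cr_fun_def)
  then have "analytic_fun n D' g" unfolding analytic_fun_def by (simp add: g)
  then show ?thesis using Analytic by (simp add: Cr_fun_def)
qed

lemma Cr_map_sin_time:
  fixes \<sigma> :: "real \<Rightarrow> 'm::topological_space \<Rightarrow> 'g::topological_space"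
  assumes at: "atlas M" "atlas Y" and \<sigma>: "Cr_map r (prod_mfd real_mfd M) Y (\<lambda>(t, x). \<sigma> t x)"
  shows "Cr_map r (prod_mfd real_mfd M) Y (\<lambda>(t, x). \<sigma> (\<delta> * sin t) x)"
proof -
  let ?P = "prod_mfd real_mfd M" and ?F = "\<lambda>(t, x). \<sigma> t x" and ?F' = "\<lambda>(t, x). \<sigma> (\<delta> * sin t) x"
  define s where "s = (\<lambda>(t::real, x::'m). (\<delta> * sin t, x))"
  have Fs: "?F' = (\<lambda>q. ?F (s q))" by (auto simp: s_def)
  note atP = atlas_prod_mfd[OF atlas_real_mfd at(1)]
  have cont: "continuous_on UNIV ?F" using \<sigma> by (simp add: Cr_on_def)
  have "continuous_on UNIV (\<lambda>q :: real \<times> 'm. \<delta> * sin (fst q))"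
    by (rule continuous_on_compose2[of UNIV "\<lambda>t. \<delta> * sin t" UNIV fst])
      (auto intro!: continuous_intros continuous_on_fst continuous_on_id)
  then have "continuous_on UNIV s" unfolding s_def case_prod_unfold
    by (intro continuous_on_Pair continuous_on_snd continuous_on_id)
  then have cont': "continuous_on UNIV ?F'" unfolding Fs using continuous_on_compose2[OF cont] by auto
  show ?thesis unfolding Cr_on_def
  proof (intro conjI ballI open_UNIV cont')
    fix c c' assume c: "c \<in> charts ?P" "c' \<in> charts Y"
    obtain cM where cM: "cM \<in> charts M" "c = prod_chart 1 real_chart cM"
      using c(1) by (auto simp: prod_mfd_def real_mfd_def)
    have ic: "is_chart (mdim ?P) c" using atlasD(1)[OF atP c(1)] .
    have fc: "fst c = UNIV \<times> fst cM" by (simp add: cM(2) prod_chart_apply)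
    have cs: "sin_time \<delta> (snd c q) = snd c (s q)" for q
      by (cases q) (auto simp: cM(2) prod_chart_apply sin_time_def s_def fun_eq_iff)
    have s_in: "s q \<in> fst c \<longleftrightarrow> q \<in> fst c" for q by (cases q) (simp add: fc s_def)
    let ?D = "snd c ` (fst c \<inter> UNIV \<inter> ?F -` fst c')" and ?D' = "snd c ` (fst c \<inter> UNIV \<inter> ?F' -` fst c')"
    have oc': "open (fst c')" using atlasD(3)[OF at(2) c(2)] .
    have D: "openin (Euclidean_space (mdim ?P)) ?D" "openin (Euclidean_space (mdim ?P)) ?D'"
      by (rule is_chartD(6)[OF ic open_coord_domain[OF ic oc' open_UNIV cont]], simp add: Int_assoc)
         (rule is_chartD(6)[OF ic open_coord_domain[OF ic oc' open_UNIV cont']], simp add: Int_assoc)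
    show "Cr_vec r (mdim ?P) (mdim Y) ?D' (coord_rep c c' ?F')"
      unfolding Cr_vec_def
    proof (intro allI impI)
      fix j assume j: "j < mdim Y"
      show "Cr_fun r (mdim ?P) ?D' (\<lambda>u. coord_rep c c' ?F' u j)"
      proof (rule Cr_fun_sin_time[OF _ D])
        show "0 < mdim ?P" by (simp add: prod_mfd_def real_mfd_def)
        show "Cr_fun r (mdim ?P) ?D (\<lambda>u. coord_rep c c' ?F u j)"
          using \<sigma> c j by (simp add: Cr_on_def Cr_vec_def)
        show "sin_time \<delta> u \<in> ?D" if u: "u \<in> ?D'" for u
        proof -
          obtain q where q: "q \<in> fst c" "?F' q \<in> fst c'" "u = snd c q" using u by blast
          have "s q \<in> fst c \<inter> UNIV \<inter> ?F -` fst c'" using q s_in[of q] fun_cong[OF Fs, of q] by simp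
          then show ?thesis unfolding q(3) cs by (rule imageI)
        qed
        show "coord_rep c c' ?F' u j = coord_rep c c' ?F (sin_time \<delta> u) j" if u: "u \<in> ?D'" for u
        proof -
          obtain q where q: "q \<in> fst c" "u = snd c q" using u by blast
          have "s q \<in> fst c" using q s_in by simp
          then show ?thesis unfolding q(2) cs coord_rep_chart[OF ic q(1)] coord_rep_chart[OF ic \<open>s q \<in> fst c\<close>]
            using fun_cong[OF Fs, of q] by simp
        qed
      qed
    qed
  qed
qed

section \<open>Closeness of 1-jets\<close>

lemma C1_near_of_C1_on: "C1_on X Y UNIV f \<Longrightarrow> C1_near X Y x f"
  unfolding C1_near_def by blast

text \<open>The value of a map at the base point is a continuous function of its jet.\<close>

lemma openin_jets_with_target:
  assumes at: "atlas X" "atlas Y" and V: "open V"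
  shows "openin (jet_topology X Y) {jet1 X Y x f | x f. C1_near X Y x f \<and> f x \<in> V}"
proof (subst openin_subopen, intro ballI)
  fix j assume "j \<in> {jet1 X Y x f | x f. C1_near X Y x f \<and> f x \<in> V}"
  then obtain x f where j: "j = jet1 X Y x f" "C1_near X Y x f" "f x \<in> V" by blast
  obtain c c' where c: "c \<in> charts X" "x \<in> fst c" "c' \<in> charts Y" "f x \<in> fst c'"
    using atlasD(4)[OF at(1)] atlasD(4)[OF at(2)] by metis
  have ic: "is_chart (mdim Y) c'" using atlasD(1)[OF at(2) c(3)] .
  have "openin (Euclidean_space (mdim Y)) (snd c' ` (V \<inter> fst c'))"
    using is_chartD(1,6)[OF ic] V by auto
  then obtain T where T: "open T" "snd c' ` (V \<inter> fst c') = {u. \<forall>i\<ge>mdim Y. u i = 0} \<inter> T"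
    unfolding Euclidean_space_eq openin_open by blast
  let ?N = "{(u :: nat \<Rightarrow> real, v :: nat \<Rightarrow> real, A :: nat \<Rightarrow> nat \<Rightarrow> real). v \<in> T}"
  have N: "open ?N"
  proof -
    have "?N = UNIV \<times> T \<times> UNIV" by auto
    then show ?thesis using T(1) by (simp add: open_Times)
  qed
  have tgt: "f' x' \<in> V \<longleftrightarrow> snd c' (f' x') \<in> T" if "f' x' \<in> fst c'" for f' and x' :: 'a
  proof
    assume "f' x' \<in> V"
    then have "snd c' (f' x') \<in> snd c' ` (V \<inter> fst c')" using that by blast
    then show "snd c' (f' x') \<in> T" unfolding T(2) by blast
  next
    assume "snd c' (f' x') \<in> T"
    then have "snd c' (f' x') \<in> snd c' ` (V \<inter> fst c')" unfolding T(2) using is_chartD(5)[OF ic that] by blast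
    then show "f' x' \<in> V" using that is_chartD(2)[OF ic] by (auto dest: inj_onD)
  qed
  show "\<exists>T. openin (jet_topology X Y) T \<and> j \<in> T \<and> T \<subseteq> {jet1 X Y x f | x f. C1_near X Y x f \<and> f x \<in> V}"
  proof (intro exI conjI)
    show "openin (jet_topology X Y) (jet_coord_nbhd X Y c c' ?N)" by (rule openin_jet_coord_nbhd[OF c(1,3) N])
    show "j \<in> jet_coord_nbhd X Y c c' ?N"
      using c j tgt[of f x] by (simp add: jet1_in_jet_coord_nbhd)
    show "jet_coord_nbhd X Y c c' ?N \<subseteq> {jet1 X Y x f | x f. C1_near X Y x f \<and> f x \<in> V}"
      unfolding jet_coord_nbhd_def using tgt by blast
  qed
qed

lemma jet1_target_iff:
  assumes "C1_near X Y x f"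
  shows "jet1 X Y x f \<in> {jet1 X Y x f | x f. C1_near X Y x f \<and> f x \<in> V} \<longleftrightarrow> f x \<in> V"
proof
  assume "jet1 X Y x f \<in> {jet1 X Y x f | x f. C1_near X Y x f \<and> f x \<in> V}"
  then obtain x' f' where e: "jet1 X Y x f = jet1 X Y x' f'" "C1_near X Y x' f'" "f' x' \<in> V" by blast
  show "f x \<in> V" using jet1_eqD(1,2)[OF e(1,2)] e(3) by simp
qed (use assms in blast)

lemma open_jet_dist_less:
  assumes d: "jet_metric X Y d" and J: "continuous_map euclidean (jet_topology X Y) J"
    and j: "j \<in> topspace (jet_topology X Y)"
  shows "open {s. d j (J s) < e}"
proof -
  have "openin euclidean {s \<in> topspace euclidean. J s \<in> {j' \<in> topspace (jet_topology X Y). d j j' < e}}"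
    by (rule openin_continuous_map_preimage[OF J jet_metricD(5)[OF d j]])
  moreover have "J s \<in> topspace (jet_topology X Y)" for s
    using J unfolding continuous_map_def by auto
  ultimately show ?thesis by simp
qed

text \<open>The strict differential in time and space is restricted to pairs of points with the same time; column
  \<open>0\<close> is the time direction, so the columns are shifted by one.\<close>

lemma jacobian_of_time_slice:
  fixes \<sigma> :: "real \<Rightarrow> 'm::topological_space \<Rightarrow> 'g::topological_space"
  assumes at: "atlas M" "atlas Y" and F: "C1_on (prod_mfd real_mfd M) Y UNIV (\<lambda>(t, x). \<sigma> t x)"
    and c: "c \<in> charts_at M x" "c' \<in> charts_at Y (\<sigma> t x)"
  shows "jacobian M Y c c' (\<sigma> t) x = (\<lambda>j i. if j < mdim Y \<and> i < mdim M
    then jacobian (prod_mfd real_mfd M) Y (prod_chart 1 real_chart c) c' (\<lambda>(t, x). \<sigma> t x) (t, x) j (Suc i) else 0)"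
proof (rule strict_diff_imp_jacobian)
  let ?P = "prod_mfd real_mfd M" and ?F = "\<lambda>(t, x). \<sigma> t x" and ?pc = "prod_chart 1 real_chart c"
  let ?A = "jacobian ?P Y ?pc c' ?F (t, x)"
  have m: "mdim ?P = 1 + mdim M" by (simp add: prod_mfd_def real_mfd_def)
  have "?pc \<in> charts_at ?P (t, x)"
  proof -
    have "real_chart \<in> charts real_mfd" "mdim real_mfd = 1" by (simp_all add: real_mfd_def)
    then have "?pc \<in> charts ?P" using c unfolding prod_mfd_def charts_at_def
      by (simp del: split_paired_Ex) metis
    then show ?thesis using c by (simp add: charts_at_def prod_chart_apply)
  qed
  then have A: "strict_diff (1 + mdim M) (mdim Y) (snd ?pc) (snd c') ?F (t, x) ?A"
    using C1_on_strict_diff[OF atlas_prod_mfd[OF atlas_real_mfd at(1)] at(2) F, of "(t, x)" ?pc c'] c unfolding m by simp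
  show "strict_diff (mdim M) (mdim Y) (snd c) (snd c') (\<sigma> t) x (\<lambda>j i. ?A j (Suc i))"
    unfolding strict_diff_def
  proof (intro allI impI)
    fix e :: real assume e: "e > 0"
    obtain W where W: "open W" "(t, x) \<in> W" "\<And>q q'. q \<in> W \<Longrightarrow> q' \<in> W \<Longrightarrow>
     l1norm (mdim Y) (\<lambda>j. (snd c' (?F q) j - snd c' (?F q') j) - (\<Sum>i<1 + mdim M. ?A j i * (snd ?pc q i - snd ?pc q' i)))
       \<le> e * l1norm (1 + mdim M) (\<lambda>i. snd ?pc q i - snd ?pc q' i)"
      using strict_diffD[OF A e] by blast
    obtain T V where TV: "open V" "t \<in> T" "x \<in> V" "T \<times> V \<subseteq> W"
      by (metis open_prod_elim[OF W(1,2)] mem_Times_iff fst_conv snd_conv)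
    have "l1norm (mdim Y) (\<lambda>j. (snd c' (\<sigma> t q) j - snd c' (\<sigma> t q') j) - (\<Sum>i<mdim M. ?A j (Suc i) * (snd c q i - snd c q' i)))
       \<le> e * l1norm (mdim M) (\<lambda>i. snd c q i - snd c q' i)" if q: "q \<in> V" "q' \<in> V" for q q'
    proof -
      have "(t, q) \<in> W" "(t, q') \<in> W" using q TV by auto
      moreover have "(\<Sum>i<(1::nat). f i) = f 0" for f :: "nat \<Rightarrow> real" by simp
      ultimately show ?thesis using W(3)[of "(t, q)" "(t, q')"]
        by (simp add: l1norm_def sum_lessThan_add prod_chart_apply Suc_eq_plus1_left del: One_nat_def)
    qed
    then show "\<exists>W. open W \<and> x \<in> W \<and> (\<forall>q\<in>W. \<forall>q'\<in>W.
      l1norm (mdim Y) (\<lambda>j. (snd c' (\<sigma> t q) j - snd c' (\<sigma> t q') j) - (\<Sum>i<mdim M. ?A j (Suc i) * (snd c q i - snd c q' i)))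
       \<le> e * l1norm (mdim M) (\<lambda>i. snd c q i - snd c q' i))" using TV(1,3) by blast
  qed
qed (use c at in \<open>auto simp: charts_at_def atlasD\<close>)

lemma continuous_map_isotopy_jets:
  fixes \<sigma> :: "real \<Rightarrow> 'm::topological_space \<Rightarrow> 'g::topological_space"
  assumes at: "atlas M" "atlas Y" and F: "C1_on (prod_mfd real_mfd M) Y UNIV (\<lambda>(t, x). \<sigma> t x)"
    and C1: "\<And>t. C1_on M Y UNIV (\<sigma> t)"
  shows "continuous_map euclidean (jet_topology M Y) (\<lambda>s. jet1 M Y (snd s) (\<sigma> (fst s)))"
proof (rule continuous_map_jets[OF at])
  let ?P = "prod_mfd real_mfd M" and ?F = "\<lambda>(t, x). \<sigma> t x"
  show "continuous_on UNIV (snd :: real \<times> 'm \<Rightarrow> 'm)" by (intro continuous_on_snd continuous_on_id)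
  show "continuous_on UNIV (\<lambda>s. \<sigma> (fst s) (snd s))"
    using C1_onD(2)[OF F] by (simp add: case_prod_unfold)
  show "C1_near M Y (snd s) (\<sigma> (fst s))" for s by (rule C1_near_of_C1_on[OF C1])
  fix c c' j i assume c: "c \<in> charts M" "c' \<in> charts Y"
  let ?pc = "prod_chart 1 real_chart c"
  let ?D = "{s. snd s \<in> fst c \<and> \<sigma> (fst s) (snd s) \<in> fst c'}"
  have "?pc \<in> charts ?P"
  proof -
    have "real_chart \<in> charts real_mfd" "mdim real_mfd = 1" by (simp_all add: real_mfd_def)
    then show ?thesis using c unfolding prod_mfd_def by (simp del: split_paired_Ex) metis
  qed
  moreover have "fst ?pc \<inter> UNIV \<inter> ?F -` fst c' = ?D" by (auto simp: prod_chart_apply)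
  ultimately have "continuous_on ?D (\<lambda>s. jacobian ?P Y ?pc c' ?F s j (Suc i))"
    using continuous_on_jacobian[OF atlas_prod_mfd[OF atlas_real_mfd at(1)] F _ c(2), of ?pc] by simp
  then have *: "continuous_on ?D (\<lambda>s. if j < mdim Y \<and> i < mdim M then jacobian ?P Y ?pc c' ?F s j (Suc i) else 0)"
    by (cases "j < mdim Y \<and> i < mdim M") (auto intro: continuous_on_eq[OF continuous_on_const[of _ 0]])
  show "continuous_on ?D (\<lambda>s. jacobian M Y c c' (\<sigma> (fst s)) (snd s) j i)"
  proof (rule continuous_on_eq[OF *])
    fix s assume "s \<in> ?D"
    then show "(if j < mdim Y \<and> i < mdim M then jacobian ?P Y ?pc c' ?F s j (Suc i) else 0)
        = jacobian M Y c c' (\<sigma> (fst s)) (snd s) j i"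
      using jacobian_of_time_slice[OF at F, of c "snd s" c' "fst s"] c by (simp add: charts_at_def)
  qed
qed

text \<open>The jets of an isotopy depend continuously on time and point, and \<open>K\<close> is compact.\<close>

lemma isotopy_uniformly_close_for_small_times:
  fixes \<sigma> :: "real \<Rightarrow> 'm::topological_space \<Rightarrow> 'g::topological_space"
  assumes at: "atlas M" "atlas Y" and d: "jet_metric M Y d"
    and F: "C1_on (prod_mfd real_mfd M) Y UNIV (\<lambda>(t, x). \<sigma> t x)"
    and C1: "\<And>t. C1_on M Y UNIV (\<sigma> t)" and K: "compact K" and e: "e > 0"
  shows "\<exists>a>0. \<forall>t. \<bar>t\<bar> \<le> a \<longrightarrow> (\<forall>x\<in>K. d (jet1 M Y x (\<sigma> t)) (jet1 M Y x (\<sigma> 0)) < e)"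
proof -
  define J where "J = (\<lambda>s. jet1 M Y (snd s) (\<sigma> (fst s)))"
  have J: "continuous_map euclidean (jet_topology M Y) J"
    unfolding J_def by (rule continuous_map_isotopy_jets[OF at F C1])
  have Jt: "J s \<in> topspace (jet_topology M Y)" for s using J unfolding continuous_map_def by auto
  have "\<exists>W a. open W \<and> p \<in> W \<and> a > 0 \<and> (\<forall>t. \<bar>t\<bar> \<le> a \<longrightarrow> (\<forall>x\<in>W. d (J (0, p)) (J (t, x)) < e / 2))" for p
  proof -
    have "open {s. d (J (0, p)) (J s) < e / 2}" by (rule open_jet_dist_less[OF d J Jt])
    moreover have "(0, p) \<in> {s. d (J (0, p)) (J s) < e / 2}" using e jet_metricD(1)[OF d Jt] by simp
    ultimately obtain T V where TV: "open T" "open V" "0 \<in> T" "p \<in> V" "T \<times> V \<subseteq> {s. d (J (0, p)) (J s) < e / 2}"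
      by (metis open_prod_elim mem_Times_iff fst_conv snd_conv)
    obtain a where a: "a > 0" "cball 0 a \<subseteq> T" using TV by (meson open_contains_cball)
    have "d (J (0, p)) (J (t, x)) < e / 2" if "\<bar>t\<bar> \<le> a" "x \<in> V" for t x
    proof -
      have "t \<in> T" using that a by auto
      then show ?thesis using TV(5) that by auto
    qed
    with TV a show ?thesis by blast
  qed
  then obtain W a where W: "\<And>p. open (W p)" "\<And>p. p \<in> W p" "\<And>p. a p > 0"
    and Wd: "\<And>p t x. \<bar>t\<bar> \<le> a p \<Longrightarrow> x \<in> W p \<Longrightarrow> d (J (0, p)) (J (t, x)) < e / 2"
    by metis
  obtain P where P: "P \<subseteq> K" "finite P" "K \<subseteq> (\<Union>p\<in>P. W p)"
    using compactE_image[OF K, of K W] W by blast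
  define b where "b = Min (insert 1 (a ` P))"
  have "b > 0" using P W unfolding b_def by auto
  have b: "b \<le> a p" if "p \<in> P" for p unfolding b_def by (rule Min_le) (use P that in auto)
  have "d (J (t, x)) (J (0, x)) < e" if t: "\<bar>t\<bar> \<le> b" and x: "x \<in> K" for t x
  proof -
    obtain p where p: "p \<in> P" "x \<in> W p" using P x by blast
    have "d (J (0, p)) (J (t, x)) < e / 2" "d (J (0, p)) (J (0, x)) < e / 2"
      using Wd[of t p x] Wd[of 0 p x] p b[OF p(1)] t W(3)[of p] by auto
    moreover have "d (J (t, x)) (J (0, x)) \<le> d (J (t, x)) (J (0, p)) + d (J (0, p)) (J (0, x))"
      by (rule jet_metricD(3)[OF d Jt Jt Jt])
    ultimately show ?thesis using jet_metricD(2)[OF d Jt Jt, of "(t, x)" "(0, p)"] by linarith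
  qed
  with \<open>b > 0\<close> show ?thesis unfolding J_def by (intro exI[of _ b]) simp
qed

text \<open>A jet determines the value of the map, so closeness of jets in any metric compatible with the
  topology forces closeness of values, uniformly over a compact set of times and points.\<close>

lemma jets_close_imp_values_close:
  fixes \<sigma> :: "real \<Rightarrow> 'm::topological_space \<Rightarrow> 'g::topological_space"
  assumes at: "atlas M" "atlas Y" and d: "jet_metric M Y d"
    and F: "C1_on (prod_mfd real_mfd M) Y UNIV (\<lambda>(t, x). \<sigma> t x)"
    and C1: "\<And>t. C1_on M Y UNIV (\<sigma> t)" and K: "compact K"
    and c: "is_chart n c" and in_c: "\<And>t x. \<bar>t\<bar> \<le> \<delta> \<Longrightarrow> x \<in> K \<Longrightarrow> \<sigma> t x \<in> fst c" and e: "e > 0"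
  shows "\<exists>\<epsilon>>0. \<forall>t x f. \<bar>t\<bar> \<le> \<delta> \<longrightarrow> x \<in> K \<longrightarrow> C1_near M Y x f \<longrightarrow> d (jet1 M Y x f) (jet1 M Y x (\<sigma> t)) < \<epsilon> \<longrightarrow>
    f x \<in> fst c \<and> l1norm n (\<lambda>j. snd c (f x) j - snd c (\<sigma> t x) j) \<le> e"
proof -
  define J where "J = (\<lambda>s. jet1 M Y (snd s) (\<sigma> (fst s)))"
  define B where "B = (\<lambda>s. {g \<in> fst c. l1norm n (\<lambda>j. snd c g j - snd c (\<sigma> (fst s) (snd s)) j) < e / 2})"
  let ?jets = "\<lambda>V. {jet1 M Y x f | x f. C1_near M Y x f \<and> f x \<in> V}"
  let ?T = "{-\<delta>..\<delta>} \<times> K"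
  have J: "continuous_map euclidean (jet_topology M Y) J"
    unfolding J_def by (rule continuous_map_isotopy_jets[OF at F C1])
  have oB: "open (B s)" for s
    unfolding B_def by (rule open_chart_less[OF c continuous_on_l1norm_chart[OF c]])
  have sB: "\<sigma> (fst s) (snd s) \<in> B s" if "s \<in> ?T" for s
    using in_c[of "fst s" "snd s"] that e by (auto simp: B_def l1norm_def)
  have cont: "continuous_on UNIV (\<lambda>s. \<sigma> (fst s) (snd s))"
    using C1_onD(2)[OF F] by (simp add: case_prod_unfold)
  have "\<exists>P \<epsilon>. finite P \<and> P \<subseteq> ?T \<and> \<epsilon> > 0 \<and> (\<forall>s\<in>?T. \<exists>s0\<in>P. s \<in> (\<lambda>s. \<sigma> (fst s) (snd s)) -` B s0 \<and>
    (\<forall>j\<in>topspace (jet_topology M Y). d (J s) j < \<epsilon> \<longrightarrow> j \<in> ?jets (B s0)))"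
  proof (rule compact_uniform_jet_nbhds[OF d _ J])
    show "compact ?T" using K by (intro compact_Times) auto
    show "open ((\<lambda>s. \<sigma> (fst s) (snd s)) -` B s) \<and> s \<in> (\<lambda>s. \<sigma> (fst s) (snd s)) -` B s" if "s \<in> ?T" for s
      using open_vimage[OF oB cont] sB[OF that] by auto
    show "openin (jet_topology M Y) (?jets (B s)) \<and> J s \<in> ?jets (B s)" if "s \<in> ?T" for s
      using openin_jets_with_target[OF at oB] sB[OF that] C1_near_of_C1_on[OF C1] unfolding J_def by blast
  qed
  then obtain P \<epsilon> where "\<epsilon> > 0" and close: "\<forall>s\<in>?T. \<exists>s0\<in>P. s \<in> (\<lambda>s. \<sigma> (fst s) (snd s)) -` B s0 \<and>
    (\<forall>j\<in>topspace (jet_topology M Y). d (J s) j < \<epsilon> \<longrightarrow> j \<in> ?jets (B s0))"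
    by (elim exE conjE)
  have "f x \<in> fst c \<and> l1norm n (\<lambda>j. snd c (f x) j - snd c (\<sigma> t x) j) \<le> e"
    if t: "\<bar>t\<bar> \<le> \<delta>" and x: "x \<in> K" and f: "C1_near M Y x f" and cl: "d (jet1 M Y x f) (jet1 M Y x (\<sigma> t)) < \<epsilon>" for t x f
  proof -
    have "(t, x) \<in> ?T" using t x by auto
    then obtain s0 where s0: "\<sigma> t x \<in> B s0" "\<forall>j\<in>topspace (jet_topology M Y). d (J (t, x)) j < \<epsilon> \<longrightarrow> j \<in> ?jets (B s0)"
      using close by force
    have ft: "jet1 M Y x f \<in> topspace (jet_topology M Y)" by (rule jet1_in_topspace[OF at f])
    have "d (J (t, x)) (jet1 M Y x f) < \<epsilon>"
      using cl jet_metricD(2)[OF d ft jet1_in_topspace[OF at C1_near_of_C1_on[OF C1]]] by (simp add: J_def)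
    then have "jet1 M Y x f \<in> ?jets (B s0)" using s0(2) ft by blast
    then have fB: "f x \<in> B s0" unfolding jet1_target_iff[OF f] .
    have "l1norm n (\<lambda>j. snd c (f x) j - snd c (\<sigma> t x) j)
        \<le> l1norm n (\<lambda>j. snd c (f x) j - snd c (\<sigma> (fst s0) (snd s0)) j) + l1norm n (\<lambda>j. snd c (\<sigma> (fst s0) (snd s0)) j - snd c (\<sigma> t x) j)"
      by (rule l1norm_triangle)
    also have "\<dots> \<le> e / 2 + e / 2"
      using fB s0(1) l1norm_minus_commute[of n "snd c (\<sigma> t x)" "snd c (\<sigma> (fst s0) (snd s0))"] by (auto simp: B_def)
    finally show ?thesis using fB by (simp add: B_def)
  qed
  with \<open>\<epsilon> > 0\<close> show ?thesis by blast
qed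

text \<open>Composition with a fixed map \<open>g\<close> is continuous on jets, and on the compact set \<open>K\<close> uniformly so near
  the jets of \<open>f0\<close>.\<close>

lemma composition_close_to_reference:
  assumes at: "atlas X" "atlas Y" "atlas Z" and dXY: "jet_metric X Y d" and dXZ: "jet_metric X Z d'"
    and f0: "C1_on X Y UNIV f0" and g: "C1_on Y Z UNIV g" and gf0: "C1_on X Z UNIV (\<lambda>x. g (f0 x))"
    and K: "compact K" and e: "e > 0"
  shows "\<exists>\<epsilon>>0. \<forall>f. C1_on X Y UNIV f \<longrightarrow> C1_on X Z UNIV (\<lambda>x. g (f x)) \<longrightarrow>
    (\<forall>x\<in>K. d (jet1 X Y x f) (jet1 X Y x f0) < \<epsilon> \<longrightarrow> d' (jet1 X Z x (\<lambda>x. g (f x))) (jet1 X Z x (\<lambda>x. g (f0 x))) < e)"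
proof -
  define J where "J = (\<lambda>x. jet1 X Y x f0)"
  define J' where "J' = (\<lambda>x. jet1 X Z x (\<lambda>x. g (f0 x)))"
  define H where "H = (\<lambda>y. jet1 Y Z y g)"
  have J: "continuous_map euclidean (jet_topology X Y) J" unfolding J_def by (rule continuous_map_jet1[OF at(1,2) f0])
  have J': "continuous_map euclidean (jet_topology X Z) J'" unfolding J'_def by (rule continuous_map_jet1[OF at(1,3) gf0])
  have H: "continuous_map euclidean (jet_topology Y Z) H" unfolding H_def by (rule continuous_map_jet1[OF at(2,3) g])
  have J't: "J' x \<in> topspace (jet_topology X Z)" for x using J' unfolding continuous_map_def by auto
  note near = C1_near_of_C1_on[OF f0] C1_near_of_C1_on[OF g] C1_near_of_C1_on[OF gf0]
  define Q where "Q = (\<lambda>p. {j \<in> topspace (jet_topology X Z). d' (J' p) j < e / 2})"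
  have Q: "openin (jet_topology X Z) (Q p)" "J' p \<in> Q p" for p
    unfolding Q_def by (rule jet_metricD(5)[OF dXZ J't]) (use jet_metricD(1)[OF dXZ J't] e J't in simp)
  have "\<forall>p. \<exists>O1. openin (jet_topology X Y) O1 \<and> J p \<in> O1 \<and>
    (\<forall>x f. C1_near X Y x f \<longrightarrow> C1_near X Z x (\<lambda>x. g (f x)) \<longrightarrow> jet1 X Y x f \<in> O1 \<longrightarrow> jet1 X Z x (\<lambda>x. g (f x)) \<in> Q p)" (is "\<forall>p. ?ex p")
  proof
    fix p
    obtain O1 O2 where O1: "openin (jet_topology X Y) O1" "J p \<in> O1" and O2: "openin (jet_topology Y Z) O2" "H (f0 p) \<in> O2"
      and comp: "\<forall>x f g. C1_near X Y x f \<longrightarrow> C1_near Y Z (f x) g \<longrightarrow> C1_near X Z x (\<lambda>x. g (f x)) \<longrightarrow>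
       jet1 X Y x f \<in> O1 \<longrightarrow> jet1 Y Z (f x) g \<in> O2 \<longrightarrow> jet1 X Z x (\<lambda>x. g (f x)) \<in> Q p"
      using jet_compose_nbhds[OF at near(1)[of p] near(2) near(3)[of p] Q(1)[of p] Q(2)[of p, unfolded J'_def]]
      unfolding J_def H_def by (elim exE conjE)
    let ?V = "{y. H y \<in> O2}"
    have "open ?V" using openin_continuous_map_preimage[OF H O2(1)] by simp
    then have 1: "openin (jet_topology X Y) (O1 \<inter> {jet1 X Y x f | x f. C1_near X Y x f \<and> f x \<in> ?V})"
      using O1(1) by (intro openin_Int openin_jets_with_target at) auto
    have 2: "J p \<in> O1 \<inter> {jet1 X Y x f | x f. C1_near X Y x f \<and> f x \<in> ?V}"
      using O1(2) O2(2) unfolding J_def Int_iff jet1_target_iff[OF near(1)] by simp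
    have 3: "jet1 X Z x (\<lambda>x. g (f x)) \<in> Q p"
      if "C1_near X Y x f" "C1_near X Z x (\<lambda>x. g (f x))" "jet1 X Y x f \<in> O1 \<inter> {jet1 X Y x f | x f. C1_near X Y x f \<and> f x \<in> ?V}" for x f
      using comp[rule_format, OF that(1) near(2) that(2)] that(3) unfolding Int_iff jet1_target_iff[OF that(1)] H_def by simp
    show "?ex p"
      by (rule exI[of _ "O1 \<inter> {jet1 X Y x f | x f. C1_near X Y x f \<and> f x \<in> ?V}"])
        (intro conjI allI impI; (fact 1 2 | rule 3))
  qed
  from choice[OF this]
  obtain O1 where O1': "\<forall>p. openin (jet_topology X Y) (O1 p) \<and> J p \<in> O1 p \<and>
    (\<forall>x f. C1_near X Y x f \<longrightarrow> C1_near X Z x (\<lambda>x. g (f x)) \<longrightarrow> jet1 X Y x f \<in> O1 p \<longrightarrow> jet1 X Z x (\<lambda>x. g (f x)) \<in> Q p)"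
    by (elim exE)
  have O1: "openin (jet_topology X Y) (O1 p)" "J p \<in> O1 p"
    "\<And>x f. C1_near X Y x f \<Longrightarrow> C1_near X Z x (\<lambda>x. g (f x)) \<Longrightarrow> jet1 X Y x f \<in> O1 p \<Longrightarrow> jet1 X Z x (\<lambda>x. g (f x)) \<in> Q p" for p
    using O1'[THEN spec, of p] by simp_all
  let ?W = "\<lambda>p. {x. d' (J' p) (J' x) < e / 2}"
  have "\<exists>P \<epsilon>. finite P \<and> P \<subseteq> K \<and> \<epsilon> > 0 \<and> (\<forall>s\<in>K. \<exists>s0\<in>P. s \<in> ?W s0 \<and>
    (\<forall>j\<in>topspace (jet_topology X Y). d (J s) j < \<epsilon> \<longrightarrow> j \<in> O1 s0))"
  proof (rule compact_uniform_jet_nbhds[OF dXY K J])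
    show "open (?W p) \<and> p \<in> ?W p" for p
      by (intro conjI open_jet_dist_less[OF dXZ J' J't]) (use jet_metricD(1)[OF dXZ J't] e in simp)
    show "openin (jet_topology X Y) (O1 p) \<and> J p \<in> O1 p" for p using O1 by blast
  qed
  then obtain P \<epsilon> where "\<epsilon> > 0" and close: "\<forall>s\<in>K. \<exists>s0\<in>P. s \<in> ?W s0 \<and>
    (\<forall>j\<in>topspace (jet_topology X Y). d (J s) j < \<epsilon> \<longrightarrow> j \<in> O1 s0)"
    by (elim exE conjE)
  have "d' (jet1 X Z x (\<lambda>x. g (f x))) (jet1 X Z x (\<lambda>x. g (f0 x))) < e"
    if f: "C1_on X Y UNIV f" "C1_on X Z UNIV (\<lambda>x. g (f x))" and x: "x \<in> K" and cl: "d (jet1 X Y x f) (jet1 X Y x f0) < \<epsilon>" for f x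
  proof -
    obtain p where p: "d' (J' p) (J' x) < e / 2" "\<forall>j\<in>topspace (jet_topology X Y). d (J x) j < \<epsilon> \<longrightarrow> j \<in> O1 p"
      using close x by blast
    note fn = C1_near_of_C1_on[OF f(1), of x] C1_near_of_C1_on[OF f(2), of x]
    have ft: "jet1 X Y x f \<in> topspace (jet_topology X Y)" by (rule jet1_in_topspace[OF at(1,2) fn(1)])
    have "d (J x) (jet1 X Y x f) < \<epsilon>"
      using cl jet_metricD(2)[OF dXY ft jet1_in_topspace[OF at(1,2) near(1)]] by (simp add: J_def)
    then have "jet1 X Z x (\<lambda>x. g (f x)) \<in> Q p" using p(2) ft O1(3)[OF fn] by blast
    then have q: "jet1 X Z x (\<lambda>x. g (f x)) \<in> topspace (jet_topology X Z)" "d' (J' p) (jet1 X Z x (\<lambda>x. g (f x))) < e / 2"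
      by (auto simp: Q_def)
    have "d' (jet1 X Z x (\<lambda>x. g (f x))) (J' x) \<le> d' (jet1 X Z x (\<lambda>x. g (f x))) (J' p) + d' (J' p) (J' x)"
      by (rule jet_metricD(3)[OF dXZ q(1) J't J't])
    then show ?thesis using p(1) q jet_metricD(2)[OF dXZ q(1) J't[of p]] unfolding J'_def by linarith
  qed
  with \<open>\<epsilon> > 0\<close> show ?thesis by blast
qed

text \<open>The first map of a composition may move points out of a compact set; a compact neighbourhood leaves
  room for this.\<close>

lemma compact_neighbourhood_of_compact:
  fixes X :: "'a::topological_space mfd" and K :: "'a set"
  assumes at: "atlas X" and K: "compact K" and C: "open C" "K \<subseteq> C"
  obtains K' V where "compact K'" "open V" "K \<subseteq> V" "V \<subseteq> K'" "K' \<subseteq> C"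
proof -
  define \<W> where "\<W> = {W. open W \<and> (\<exists>Q. compact Q \<and> W \<subseteq> Q \<and> Q \<subseteq> C)}"
  have "\<exists>W\<in>\<W>. p \<in> W" if "p \<in> K" for p
  proof -
    obtain c where c: "c \<in> charts X" "p \<in> fst c" using atlasD(4)[OF at] by blast
    have "p \<in> C" using that C by blast
    then obtain Q W where "compact Q" "open W" "p \<in> W" "W \<subseteq> Q" "Q \<subseteq> C \<inter> fst c"
      by (rule chart_compact_nbhd[OF atlasD(1)[OF at c(1)] c(2) C(1)])
    then show ?thesis unfolding \<W>_def by blast
  qed
  then have "K \<subseteq> \<Union>\<W>" by blast
  then obtain \<P> where P: "\<P> \<subseteq> \<W>" "finite \<P>" "K \<subseteq> \<Union>\<P>"
    using compactE[OF K, of \<W>] unfolding \<W>_def by blast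
  have "\<forall>W\<in>\<P>. \<exists>Q. compact Q \<and> W \<subseteq> Q \<and> Q \<subseteq> C" using P(1) unfolding \<W>_def by blast
  from bchoice[OF this] obtain Q where Q: "\<forall>W\<in>\<P>. compact (Q W) \<and> W \<subseteq> Q W \<and> Q W \<subseteq> C" by (elim exE)
  show thesis
  proof (rule that[of "\<Union>W\<in>\<P>. Q W" "\<Union>\<P>"])
    show "compact (\<Union>W\<in>\<P>. Q W)" using P(2) Q by (intro compact_UN) auto
    show "open (\<Union>\<P>)" using P(1) unfolding \<W>_def by blast
    show "\<Union>\<P> \<subseteq> (\<Union>W\<in>\<P>. Q W)" "(\<Union>W\<in>\<P>. Q W) \<subseteq> C" using Q by blast+
  qed (rule P(3))
qed

text \<open>The second map is evaluated at points moved by the first one, so closeness on \<open>K\<close> alone is not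
  enough: it is required on a compact neighbourhood of \<open>K\<close>, which can be chosen inside a given open
  set. Shrinking the neighbourhoods of the jet of the identity keeps \<open>f1\<close> from leaving it.\<close>

lemma composition_of_maps_close_to_id:
  assumes at: "atlas X" and d: "jet_metric X X d" and id: "C1_on X X UNIV id"
    and K: "compact K" and C: "open C" "K \<subseteq> C" and e: "e > 0"
  shows "\<exists>K' \<epsilon>. compact K' \<and> K' \<subseteq> C \<and> \<epsilon> > 0 \<and> (\<forall>f1 f2. C1_on X X UNIV f1 \<longrightarrow> C1_on X X UNIV f2 \<longrightarrow>
    C1_on X X UNIV (\<lambda>x. f2 (f1 x)) \<longrightarrow> (\<forall>x\<in>K'. d (jet1 X X x f1) (jet1 X X x id) < \<epsilon>) \<longrightarrow>
    (\<forall>x\<in>K'. d (jet1 X X x f2) (jet1 X X x id) < \<epsilon>) \<longrightarrow>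
    (\<forall>x\<in>K. d (jet1 X X x (\<lambda>x. f2 (f1 x))) (jet1 X X x id) < e))"
proof -
  obtain K' V where K': "compact K'" "open V" "K \<subseteq> V" "V \<subseteq> K'" "K' \<subseteq> C"
    using compact_neighbourhood_of_compact[OF at K C] by blast
  define J where "J = (\<lambda>x. jet1 X X x id)"
  have J: "continuous_map euclidean (jet_topology X X) J" unfolding J_def by (rule continuous_map_jet1[OF at at id])
  have Jt: "J x \<in> topspace (jet_topology X X)" for x using J unfolding continuous_map_def by auto
  note near = C1_near_of_C1_on[OF id]
  have idid: "(\<lambda>x. id (id x)) = id" by auto
  define Q where "Q = (\<lambda>p. {j \<in> topspace (jet_topology X X). d (J p) j < e / 2})"
  have Q: "openin (jet_topology X X) (Q p)" "J p \<in> Q p" for p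
    unfolding Q_def by (rule jet_metricD(5)[OF d Jt]) (use jet_metricD(1)[OF d Jt] e Jt in simp)
  have "\<forall>p. \<exists>O1 r. openin (jet_topology X X) O1 \<and> J p \<in> O1 \<and> r > 0 \<and>
    (\<forall>x f g. C1_near X X x f \<longrightarrow> C1_near X X (f x) g \<longrightarrow> C1_near X X x (\<lambda>x. g (f x)) \<longrightarrow> jet1 X X x f \<in> O1 \<longrightarrow>
      d (J p) (jet1 X X (f x) g) < 2 * r \<longrightarrow> jet1 X X x (\<lambda>x. g (f x)) \<in> Q p)" (is "\<forall>p. ?ex p")
  proof
    fix p
    have "C1_near X X p (\<lambda>x. id (id x))" "jet1 X X p (\<lambda>x. id (id x)) \<in> Q p" "C1_near X X (id p) id"
      unfolding idid using near Q(2) by (auto simp: J_def)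
    from jet_compose_nbhds[OF at at at near this(3,1) Q(1) this(2)]
    obtain O1 O2 where O1: "openin (jet_topology X X) O1" "J p \<in> O1" and O2: "openin (jet_topology X X) O2" "J (id p) \<in> O2"
      and comp: "\<forall>x f g. C1_near X X x f \<longrightarrow> C1_near X X (f x) g \<longrightarrow> C1_near X X x (\<lambda>x. g (f x)) \<longrightarrow>
       jet1 X X x f \<in> O1 \<longrightarrow> jet1 X X (f x) g \<in> O2 \<longrightarrow> jet1 X X x (\<lambda>x. g (f x)) \<in> Q p"
      unfolding J_def by (elim exE conjE)
    obtain r where r: "r > 0" "\<forall>j'\<in>topspace (jet_topology X X). d (J p) j' < r \<longrightarrow> j' \<in> O2"
      using jet_metricD(4)[OF d O2(1), of "J p"] O2(2) by auto
    have "jet1 X X x (\<lambda>x. g (f x)) \<in> Q p" if "C1_near X X x f" "C1_near X X (f x) g" "C1_near X X x (\<lambda>x. g (f x))"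
      "jet1 X X x f \<in> O1" "d (J p) (jet1 X X (f x) g) < 2 * (r / 2)" for x f g
      using comp[rule_format, OF that(1-4)] r(2) that(5) jet1_in_topspace[OF at at that(2)] by simp
    then show "?ex p" using O1 r(1) by (intro exI[of _ O1]) (rule exI[of _ "r / 2"], simp)
  qed
  from choice[OF this] obtain O1 where "\<forall>p. \<exists>r. openin (jet_topology X X) (O1 p) \<and> J p \<in> O1 p \<and> r > 0 \<and>
    (\<forall>x f g. C1_near X X x f \<longrightarrow> C1_near X X (f x) g \<longrightarrow> C1_near X X x (\<lambda>x. g (f x)) \<longrightarrow> jet1 X X x f \<in> O1 p \<longrightarrow>
      d (J p) (jet1 X X (f x) g) < 2 * r \<longrightarrow> jet1 X X x (\<lambda>x. g (f x)) \<in> Q p)" by (elim exE)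
  from choice[OF this] obtain r where O1': "\<forall>p. openin (jet_topology X X) (O1 p) \<and> J p \<in> O1 p \<and> r p > 0 \<and>
    (\<forall>x f g. C1_near X X x f \<longrightarrow> C1_near X X (f x) g \<longrightarrow> C1_near X X x (\<lambda>x. g (f x)) \<longrightarrow> jet1 X X x f \<in> O1 p \<longrightarrow>
      d (J p) (jet1 X X (f x) g) < 2 * r p \<longrightarrow> jet1 X X x (\<lambda>x. g (f x)) \<in> Q p)" by (elim exE)
  have O1: "openin (jet_topology X X) (O1 p)" "J p \<in> O1 p" and r: "r p > 0"
    and comp: "\<And>x f g. C1_near X X x f \<Longrightarrow> C1_near X X (f x) g \<Longrightarrow> C1_near X X x (\<lambda>x. g (f x)) \<Longrightarrow>
      jet1 X X x f \<in> O1 p \<Longrightarrow> d (J p) (jet1 X X (f x) g) < 2 * r p \<Longrightarrow> jet1 X X x (\<lambda>x. g (f x)) \<in> Q p" for p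
    using O1'[THEN spec, of p] by simp_all
  \<comment> \<open>points to which \<open>f1\<close> may move a point near \<open>p\<close>\<close>
  define B where "B = (\<lambda>p. {q. d (J p) (J q) < r p} \<inter> V)"
  let ?jets = "\<lambda>V. {jet1 X X x f | x f. C1_near X X x f \<and> f x \<in> V}"
  have B: "open (B p)" for p unfolding B_def using open_jet_dist_less[OF d J Jt] K'(2) by auto
  let ?W = "\<lambda>p. {x. d (J p) (J x) < e / 2}"
  have "\<exists>P \<epsilon>. finite P \<and> P \<subseteq> K \<and> \<epsilon> > 0 \<and> (\<forall>s\<in>K. \<exists>s0\<in>P. s \<in> ?W s0 \<and>
    (\<forall>j\<in>topspace (jet_topology X X). d (J s) j < \<epsilon> \<longrightarrow> j \<in> O1 s0 \<inter> ?jets (B s0)))"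
  proof (rule compact_uniform_jet_nbhds[OF d K J])
    show "open (?W p) \<and> p \<in> ?W p" for p
      by (intro conjI open_jet_dist_less[OF d J Jt]) (use jet_metricD(1)[OF d Jt] e in simp)
    fix p assume p: "p \<in> K"
    have "id p \<in> B p" using p K'(3) r jet_metricD(1)[OF d Jt] by (auto simp: B_def)
    then have "J p \<in> ?jets (B p)" unfolding J_def jet1_target_iff[OF near] .
    then show "openin (jet_topology X X) (O1 p \<inter> ?jets (B p)) \<and> J p \<in> O1 p \<inter> ?jets (B p)"
      using O1 openin_jets_with_target[OF at at B] by (auto intro: openin_Int)
  qed
  then obtain P \<epsilon> where P: "finite P" and \<epsilon>: "\<epsilon> > 0" and close: "\<forall>s\<in>K. \<exists>s0\<in>P. s \<in> ?W s0 \<and>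
    (\<forall>j\<in>topspace (jet_topology X X). d (J s) j < \<epsilon> \<longrightarrow> j \<in> O1 s0 \<inter> ?jets (B s0))"
    by (elim exE conjE)
  define \<epsilon>' where "\<epsilon>' = Min (insert \<epsilon> (r ` P))"
  have "\<epsilon>' > 0" using P \<epsilon> r unfolding \<epsilon>'_def by auto
  have \<epsilon>'_le: "\<epsilon>' \<le> \<epsilon>" "\<And>p. p \<in> P \<Longrightarrow> \<epsilon>' \<le> r p"
    unfolding \<epsilon>'_def using P by (auto intro!: Min_le)
  have "d (jet1 X X x (\<lambda>x. f2 (f1 x))) (jet1 X X x id) < e"
    if f: "C1_on X X UNIV f1" "C1_on X X UNIV f2" "C1_on X X UNIV (\<lambda>x. f2 (f1 x))"
      and cl1: "\<forall>x\<in>K'. d (jet1 X X x f1) (jet1 X X x id) < \<epsilon>'" and cl2: "\<forall>x\<in>K'. d (jet1 X X x f2) (jet1 X X x id) < \<epsilon>'"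
      and x: "x \<in> K" for f1 f2 x
  proof -
    obtain p where p: "p \<in> P" "d (J p) (J x) < e / 2"
      "\<forall>j\<in>topspace (jet_topology X X). d (J x) j < \<epsilon> \<longrightarrow> j \<in> O1 p \<inter> ?jets (B p)"
      using close x by blast
    have ft: "C1_on X X UNIV f \<Longrightarrow> jet1 X X z f \<in> topspace (jet_topology X X)" for f z
      by (rule jet1_in_topspace[OF at at C1_near_of_C1_on])
    have xK: "x \<in> K'" using x K' by blast
    have "d (J x) (jet1 X X x f1) < \<epsilon>"
      using cl1 xK \<epsilon>'_le(1) jet_metricD(2)[OF d ft[OF f(1)] Jt, of x x] unfolding J_def by fastforce
    then have 1: "jet1 X X x f1 \<in> O1 p" "jet1 X X x f1 \<in> ?jets (B p)" using p(3) ft[OF f(1)] by blast+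
    have 2: "f1 x \<in> B p" using 1(2) unfolding jet1_target_iff[OF C1_near_of_C1_on[OF f(1)]] .
    then have "f1 x \<in> K'" using K'(4) by (auto simp: B_def)
    then have "d (J (f1 x)) (jet1 X X (f1 x) f2) < r p"
      using cl2 \<epsilon>'_le(2)[OF p(1)] jet_metricD(2)[OF d ft[OF f(2)] Jt, of "f1 x" "f1 x"] unfolding J_def by fastforce
    moreover have "d (J p) (J (f1 x)) < r p" using 2 by (simp add: B_def)
    ultimately have "d (J p) (jet1 X X (f1 x) f2) < 2 * r p"
      using jet_metricD(3)[OF d Jt[of p] Jt[of "f1 x"] ft[OF f(2), of "f1 x"]] by linarith
    then have "jet1 X X x (\<lambda>x. f2 (f1 x)) \<in> Q p"
      by (rule comp[OF C1_near_of_C1_on[OF f(1)] C1_near_of_C1_on[OF f(2)] C1_near_of_C1_on[OF f(3)] 1(1)])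
    then have q: "d (J p) (jet1 X X x (\<lambda>x. f2 (f1 x))) < e / 2" by (simp add: Q_def)
    have "d (jet1 X X x (\<lambda>x. f2 (f1 x))) (J x) \<le> d (jet1 X X x (\<lambda>x. f2 (f1 x))) (J p) + d (J p) (J x)"
      by (rule jet_metricD(3)[OF d ft[OF f(3)] Jt Jt])
    then show ?thesis using p(2) q jet_metricD(2)[OF d ft[OF f(3), of x] Jt[of p]] unfolding J_def by linarith
  qed
  then show ?thesis using K' \<open>\<epsilon>' > 0\<close> by (intro exI[of _ K'] exI[of _ \<epsilon>'] conjI) blast+
qed

section \<open>Bisections and the action on arrows\<close>

lemma act_bisection_mult:
  assumes \<Gamma>: "lie_groupoid r \<Gamma>" and s: "\<And>x. src \<Gamma> (\<sigma> x) = x" "\<And>x. src \<Gamma> (\<tau> x) = x"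
  shows "act \<Gamma> (bisection_mult \<Gamma> \<sigma> \<tau>) h = act \<Gamma> \<sigma> (act \<Gamma> \<tau> h)"
  unfolding act_def bisection_mult_def
  using groupoidD(4)[OF \<Gamma>, of "\<tau> (tgt \<Gamma> h)" h] groupoidD(5)[OF \<Gamma>, of _ "\<tau> (tgt \<Gamma> h)" h] s by simp

lemma tgt_bisection_mult:
  assumes \<Gamma>: "lie_groupoid r \<Gamma>" and s: "\<And>x. src \<Gamma> (\<sigma> x) = x"
  shows "tgt \<Gamma> (bisection_mult \<Gamma> \<sigma> \<tau> x) = tgt \<Gamma> (\<sigma> (tgt \<Gamma> (\<tau> x)))"
  unfolding bisection_mult_def using groupoidD(4)[OF \<Gamma>, of "\<sigma> (tgt \<Gamma> (\<tau> x))" "\<tau> x"] s by simp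

locale locally_extendable_bisection_group =
  fixes r :: regularity
    and \<Gamma> :: "('g::t2_space, 'm::t2_space) groupoid"
    and G :: "('m \<Rightarrow> 'g) set"
    and d\<^sub>\<Gamma> :: "('m, 'g) jet \<Rightarrow> ('m, 'g) jet \<Rightarrow> real"
    and d\<^sub>M :: "('m, 'm) jet \<Rightarrow> ('m, 'm) jet \<Rightarrow> real"
  assumes r: "r \<noteq> Differentiable 0"
    and \<Gamma>: "lie_groupoid r \<Gamma>"
    and d\<Gamma>: "jet_metric (units \<Gamma>) (arrows \<Gamma>) d\<^sub>\<Gamma>"
    and dM: "jet_metric (units \<Gamma>) (units \<Gamma>) d\<^sub>M"
    and G: "subgroup G (Bis r \<Gamma>)"
    and L: "L_condition r \<Gamma> d\<^sub>\<Gamma> G"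
    and transitive: "fiberwise_transitive r \<Gamma> G"
begin

abbreviation "M \<equiv> units \<Gamma>"
abbreviation "A \<equiv> arrows \<Gamma>"

lemmas atA = lie_groupoidD(1)[OF \<Gamma>] and atM = lie_groupoidD(2)[OF \<Gamma>]

lemma bisectionD:
  assumes "\<sigma> \<in> G"
  shows "Cr_map r M A \<sigma>" "src \<Gamma> (\<sigma> x) = x" "C1_on M A UNIV \<sigma>" "C1_on M M UNIV (\<lambda>x. tgt \<Gamma> (\<sigma> x))"
proof -
  have b: "bisection r \<Gamma> \<sigma>" using subgroup.subset[OF G] assms by (auto simp: Bis_def)
  show 1: "Cr_map r M A \<sigma>" and "src \<Gamma> (\<sigma> x) = x" using b by (auto simp: bisection_def)
  show "C1_on M A UNIV \<sigma>" by (rule Cr_on_imp_C1_on[OF r atM atA 1])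
  have "Cr_map r M M (tgt \<Gamma> \<circ> \<sigma>)" using b by (simp add: bisection_def diffeomorphism_def)
  then show "C1_on M M UNIV (\<lambda>x. tgt \<Gamma> (\<sigma> x))" using Cr_on_imp_C1_on[OF r atM atM] by (simp add: o_def)
qed

lemma unit_in: "unit_at \<Gamma> \<in> G"
  using subgroup.one_closed[OF G] by (simp add: Bis_def)

lemma mult_in: "\<sigma> \<in> G \<Longrightarrow> \<tau> \<in> G \<Longrightarrow> bisection_mult \<Gamma> \<sigma> \<tau> \<in> G"
  using subgroup.m_closed[OF G, of \<sigma> \<tau>] by (simp add: Bis_def)

lemma tgt_unit_id: "(\<lambda>x. tgt \<Gamma> (unit_at \<Gamma> x)) = id"
  using groupoidD(2)[OF \<Gamma>] by auto

lemma C1_id: "C1_on M M UNIV id"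
  using bisectionD(4)[OF unit_in] unfolding tgt_unit_id .

lemma isotopyD:
  assumes "\<sigma> \<in> isotopies r \<Gamma> G"
  shows "Cr_map r (prod_mfd real_mfd M) A (\<lambda>(t, x). \<sigma> t x)" "\<sigma> t \<in> G" "\<sigma> 0 = unit_at \<Gamma>"
    "C1_on (prod_mfd real_mfd M) A UNIV (\<lambda>(t, x). \<sigma> t x)" "continuous_on UNIV (\<lambda>(t, x). \<sigma> t x)"
proof -
  show 1: "Cr_map r (prod_mfd real_mfd M) A (\<lambda>(t, x). \<sigma> t x)" and "\<sigma> t \<in> G" "\<sigma> 0 = unit_at \<Gamma>"
    using assms by (auto simp: isotopies_def)
  show "C1_on (prod_mfd real_mfd M) A UNIV (\<lambda>(t, x). \<sigma> t x)"
    by (rule Cr_on_imp_C1_on[OF r atlas_prod_mfd[OF atlas_real_mfd atM] atA 1])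
  show "continuous_on UNIV (\<lambda>(t, x). \<sigma> t x)" using 1 by (simp add: Cr_on_def)
qed

lemma sin_time_isotopy:
  assumes "\<sigma> \<in> isotopies r \<Gamma> G"
  shows "(\<lambda>t. \<sigma> (a * sin t)) \<in> isotopies r \<Gamma> G"
  using isotopyD(2,3)[OF assms] Cr_map_sin_time[OF atM atA isotopyD(1)[OF assms], of a]
  by (simp add: isotopies_def)

text \<open>The reparametrised isotopy runs only through the times in \<open>[- a, a]\<close>, so that it satisfies the
  hypothesis of the (L)-condition at all times.\<close>

lemma small_reparametrised_isotopy:
  assumes \<sigma>: "\<sigma> \<in> isotopies r \<Gamma> G" and K: "compact K" "\<epsilon> > 0"
  shows "\<exists>a>0. \<forall>t. C1_close M A d\<^sub>\<Gamma> K \<epsilon> UNIV (\<sigma> (a * sin t)) (unit_at \<Gamma>)"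
proof -
  obtain a where a: "a > 0" "\<forall>t. \<bar>t\<bar> \<le> a \<longrightarrow> (\<forall>x\<in>K. d\<^sub>\<Gamma> (jet1 M A x (\<sigma> t)) (jet1 M A x (\<sigma> 0)) < \<epsilon>)"
    using isotopy_uniformly_close_for_small_times[OF atM atA d\<Gamma> isotopyD(4)[OF \<sigma>] bisectionD(3)[OF isotopyD(2)[OF \<sigma>]] K] by blast
  have "\<bar>a * sin t\<bar> \<le> a" for t
    using a(1) abs_sin_le_one[of t] by (simp add: abs_mult mult_left_le)
  then show ?thesis using a isotopyD(3)[OF \<sigma>] by (auto simp: C1_close_def)
qed

text \<open>Each velocity is multiplied by \<open>a i > 0\<close>, the derivative of \<open>a i * sin t\<close> at \<open>0\<close>.\<close>

lemma velocities_after_reparametrisation: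
  assumes \<sigma>: "\<And>i. i < k \<Longrightarrow> \<sigma> i \<in> isotopies r \<Gamma> G" and a: "\<And>i. i < k \<Longrightarrow> a i > (0::real)"
    and ind: "independent_velocities A (unit_at \<Gamma> y) k (\<lambda>i t. \<sigma> i t y)"
  shows "independent_velocities A (unit_at \<Gamma> y) k (\<lambda>i t. \<sigma> i (a i * sin t) y)"
  unfolding independent_velocities_def
proof (intro ballI, clarify)
  fix U \<phi> b i
  assume c: "(U, \<phi>) \<in> charts_at A (unit_at \<Gamma> y)" and i: "i < k"
    and z: "\<forall>j<mdim A. (\<Sum>i<k. b i * deriv (\<lambda>t. \<phi> (\<sigma> i (a i * sin t) y) j) 0) = 0"
  have man: "manifold r A" using \<Gamma> by (simp add: lie_groupoid_def)
  have mem: "(U, \<phi>) \<in> maximal_atlas r A" "unit_at \<Gamma> y \<in> U"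
    using c man by (auto simp: charts_at_def maximal_atlas_def manifold_def)
  obtain cM where cM: "cM \<in> charts_at M y" using atlasD(4)[OF atM, of y] by (auto simp: charts_at_def)
  have "deriv (\<lambda>t. \<phi> (\<sigma> i (a i * sin t) y) j) 0 = a i * deriv (\<lambda>t. \<phi> (\<sigma> i t y) j) 0" if i: "i < k" and j: "j < mdim A" for i j
  proof -
    obtain D where D: "strict_diff (1 + mdim M) (mdim A) (snd (prod_chart 1 real_chart cM)) (snd (U, \<phi>)) (\<lambda>(t, x). \<sigma> i t x) (0, y) D"
      using isotopy_strict_diff[OF r \<Gamma> mem(1) _ isotopyD(1,3)[OF \<sigma>[OF i]] cM] mem(2) by auto
    have d: "((\<lambda>t. \<phi> (\<sigma> i t y) j) has_real_derivative D j 0) (at 0)"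
      using strict_diff_time_derivative[OF D j] by simp
    have "((\<lambda>t. a i * sin t) has_real_derivative a i) (at 0)" by (auto intro!: derivative_eq_intros)
    with d have "((\<lambda>t. \<phi> (\<sigma> i (a i * sin t) y) j) has_real_derivative D j 0 * a i) (at 0)"
      using DERIV_chain2[of "\<lambda>t. \<phi> (\<sigma> i t y) j" "D j 0" "\<lambda>t. a i * sin t" 0 "a i" UNIV] by simp
    then show ?thesis using DERIV_imp_deriv[OF d] DERIV_imp_deriv by (metis mult.commute)
  qed
  then have *: "\<forall>j<mdim A. (\<Sum>i<k. (b i * a i) * deriv (\<lambda>t. \<phi> (\<sigma> i t y) j) 0) = 0"
    using z by (simp add: mult.assoc)
  have "\<forall>b. (\<forall>j<mdim A. (\<Sum>i<k. b i * deriv (\<lambda>t. \<phi> (\<sigma> i t y) j) 0) = 0) \<longrightarrow> (\<forall>i<k. b i = 0)"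
    using bspec[OF ind[unfolded independent_velocities_def] c] by (simp only: case_prod_conv)
  from this[THEN spec, of "\<lambda>i. b i * a i", THEN mp, OF *] have "\<forall>i<k. b i * a i = 0" .
  then show "b i = 0" using i a[OF i] by auto
qed


section \<open>Bisections that move the base only slightly outside an open set\<close>

text \<open>Control of the diffeomorphism induced on the units. Analytic maps cannot be cut off, so in the
  analytic case the support condition is replaced by closeness of the 1-jets to those of the identity
  on a compact set \<open>K\<close>.\<close>

definition moves :: "'m set \<Rightarrow> 'm set \<Rightarrow> real \<Rightarrow> ('m \<Rightarrow> 'g) \<Rightarrow> bool" where
  "moves V K \<epsilon> \<tau> \<longleftrightarrow> \<tau> \<in> G \<and> (if r \<noteq> Analytic then supp_diffeo (\<lambda>x. tgt \<Gamma> (\<tau> x)) \<subseteq> V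
     else \<forall>x\<in>K. d\<^sub>M (jet1 M M x (\<lambda>x. tgt \<Gamma> (\<tau> x))) (jet1 M M x id) < \<epsilon>)"

lemma moves_mono: "moves V K \<epsilon> \<tau> \<Longrightarrow> K' \<subseteq> K \<Longrightarrow> \<epsilon> \<le> \<epsilon>' \<Longrightarrow> moves V K' \<epsilon>' \<tau>"
  unfolding moves_def by (auto split: if_splits) fastforce+

lemma moves_unit: "\<epsilon> > 0 \<Longrightarrow> moves V K \<epsilon> (unit_at \<Gamma>)"
  using jet_metricD(1)[OF dM jet1_in_topspace[OF atM atM C1_near_of_C1_on[OF C1_id]]]
  unfolding moves_def tgt_unit_id by (simp add: unit_in supp_diffeo_def)

text \<open>Supports in \<open>V\<close> are preserved by products. In the analytic case \<open>K'\<close> has to be larger than \<open>K\<close>, but it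
  can be kept inside any given open set \<open>C\<close> that contains \<open>K\<close>.\<close>

lemma moves_mult:
  assumes C: "open C" "K \<subseteq> C" and K: "compact K" and \<epsilon>: "\<epsilon> > 0"
  shows "\<exists>K' \<epsilon>'. compact K' \<and> K' \<subseteq> C \<and> \<epsilon>' > 0 \<and>
    (\<forall>\<sigma> \<tau>. moves V K' \<epsilon>' \<sigma> \<longrightarrow> moves V K' \<epsilon>' \<tau> \<longrightarrow> moves V K \<epsilon> (bisection_mult \<Gamma> \<sigma> \<tau>))"
proof (cases "r = Analytic")
  case False
  have "moves V K \<epsilon> (bisection_mult \<Gamma> \<sigma> \<tau>)" if "moves V K \<epsilon> \<sigma>" "moves V K \<epsilon> \<tau>" for \<sigma> \<tau>
  proof -
    have st: "\<sigma> \<in> G" "\<tau> \<in> G" "supp_diffeo (\<lambda>x. tgt \<Gamma> (\<sigma> x)) \<subseteq> V" "supp_diffeo (\<lambda>x. tgt \<Gamma> (\<tau> x)) \<subseteq> V"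
      using that False by (auto simp: moves_def)
    have "{x. tgt \<Gamma> (bisection_mult \<Gamma> \<sigma> \<tau> x) \<noteq> x} \<subseteq> {x. tgt \<Gamma> (\<sigma> x) \<noteq> x} \<union> {x. tgt \<Gamma> (\<tau> x) \<noteq> x}"
      using tgt_bisection_mult[OF \<Gamma> bisectionD(2)[OF st(1)]] by auto
    then have "supp_diffeo (\<lambda>x. tgt \<Gamma> (bisection_mult \<Gamma> \<sigma> \<tau> x)) \<subseteq> V"
      using st(3,4) unfolding supp_diffeo_def by (metis (no_types, lifting) closure_Un closure_mono le_sup_iff order_trans)
    then show ?thesis using mult_in[OF st(1,2)] False by (simp add: moves_def)
  qed
  then show ?thesis using C K \<epsilon> by blast
next
  case True
  obtain K' \<epsilon>' where K': "compact K'" "K' \<subseteq> C" "\<epsilon>' > 0" and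
    comp: "\<forall>f1 f2. C1_on M M UNIV f1 \<longrightarrow> C1_on M M UNIV f2 \<longrightarrow>
    C1_on M M UNIV (\<lambda>x. f2 (f1 x)) \<longrightarrow> (\<forall>x\<in>K'. d\<^sub>M (jet1 M M x f1) (jet1 M M x id) < \<epsilon>') \<longrightarrow>
    (\<forall>x\<in>K'. d\<^sub>M (jet1 M M x f2) (jet1 M M x id) < \<epsilon>') \<longrightarrow>
    (\<forall>x\<in>K. d\<^sub>M (jet1 M M x (\<lambda>x. f2 (f1 x))) (jet1 M M x id) < \<epsilon>)"
    using composition_of_maps_close_to_id[OF atM dM C1_id K C \<epsilon>] by (elim exE conjE)
  have "moves V K \<epsilon> (bisection_mult \<Gamma> \<sigma> \<tau>)" if "moves V K' \<epsilon>' \<sigma>" "moves V K' \<epsilon>' \<tau>" for \<sigma> \<tau>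
  proof -
    have st: "\<sigma> \<in> G" "\<tau> \<in> G" using that by (auto simp: moves_def)
    have eq: "(\<lambda>x. tgt \<Gamma> (bisection_mult \<Gamma> \<sigma> \<tau> x)) = (\<lambda>x. tgt \<Gamma> (\<sigma> (tgt \<Gamma> (\<tau> x))))"
      using tgt_bisection_mult[OF \<Gamma> bisectionD(2)[OF st(1)]] by auto
    have "C1_on M M UNIV (\<lambda>x. tgt \<Gamma> (\<sigma> (tgt \<Gamma> (\<tau> x))))"
      using bisectionD(4)[OF mult_in[OF st]] unfolding eq .
    then have "\<forall>x\<in>K. d\<^sub>M (jet1 M M x (\<lambda>x. tgt \<Gamma> (\<sigma> (tgt \<Gamma> (\<tau> x))))) (jet1 M M x id) < \<epsilon>"
      using comp[THEN spec, THEN spec, THEN mp, THEN mp, THEN mp, THEN mp, THEN mp, OF bisectionD(4)[OF st(2)] bisectionD(4)[OF st(1)]]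
        that unfolding moves_def using True by simp
    then show ?thesis using mult_in[OF st] True unfolding moves_def eq by simp
  qed
  with K' show ?thesis by blast
qed

text \<open>The order matches \<open>iterate_acts\<close>: the factor with index \<open>0\<close> acts first.\<close>

primrec iterated_product :: "(nat \<Rightarrow> 'm \<Rightarrow> 'g) \<Rightarrow> nat \<Rightarrow> 'm \<Rightarrow> 'g" where
  "iterated_product s 0 = unit_at \<Gamma>"
| "iterated_product s (Suc m) = bisection_mult \<Gamma> (s m) (iterated_product s m)"

lemma iterated_product_in: "(\<And>i. i < m \<Longrightarrow> s i \<in> G) \<Longrightarrow> iterated_product s m \<in> G"
  by (induction m) (auto intro: unit_in mult_in)

lemma act_iterated_product:
  assumes "\<And>i t. i < m \<Longrightarrow> \<tau> i t \<in> G"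
  shows "act \<Gamma> (iterated_product (\<lambda>i. \<tau> i (t i)) m) h = iterate_acts (\<lambda>i t. act \<Gamma> (\<tau> i t)) t m h"
  using assms
proof (induction m)
  case 0
  then show ?case using groupoidD(7)[OF \<Gamma>] by (simp add: act_def)
next
  case (Suc m)
  have "iterated_product (\<lambda>i. \<tau> i (t i)) m \<in> G" "\<tau> m (t m) \<in> G"
    using Suc.prems by (auto intro: iterated_product_in)
  from act_bisection_mult[OF \<Gamma> bisectionD(2)[OF this(2)] bisectionD(2)[OF this(1)]]
  show ?case using Suc by simp
qed

lemma moves_iterated_product:
  assumes C: "open C" "K \<subseteq> C" and K: "compact K" and \<epsilon>: "\<epsilon> > 0"
  shows "\<exists>K' \<epsilon>'. compact K' \<and> K' \<subseteq> C \<and> \<epsilon>' > 0 \<and>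
    (\<forall>s. (\<forall>i<m. moves V K' \<epsilon>' (s i)) \<longrightarrow> moves V K \<epsilon> (iterated_product s m))"
  using C(2) K \<epsilon>
proof (induction m arbitrary: K \<epsilon>)
  case 0
  then show ?case using moves_unit by (intro exI[of _ K] exI[of _ \<epsilon>]) simp
next
  case (Suc m)
  obtain K1 \<epsilon>1 where 1: "compact K1" "K1 \<subseteq> C" "\<epsilon>1 > 0"
    "\<forall>\<sigma> \<tau>. moves V K1 \<epsilon>1 \<sigma> \<longrightarrow> moves V K1 \<epsilon>1 \<tau> \<longrightarrow> moves V K \<epsilon> (bisection_mult \<Gamma> \<sigma> \<tau>)"
    using moves_mult[where V = V, OF C(1) Suc.prems] by (elim exE conjE)
  obtain K2 \<epsilon>2 where 2: "compact K2" "K2 \<subseteq> C" "\<epsilon>2 > 0"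
    "\<forall>s. (\<forall>i<m. moves V K2 \<epsilon>2 (s i)) \<longrightarrow> moves V K1 \<epsilon>1 (iterated_product s m)"
    using Suc.IH[OF 1(2,1,3)] by (elim exE conjE)
  have "moves V K \<epsilon> (iterated_product s (Suc m))" if s: "\<forall>i<Suc m. moves V (K1 \<union> K2) (min \<epsilon>1 \<epsilon>2) (s i)" for s
  proof -
    have "moves V K1 \<epsilon>1 (s m)" by (rule moves_mono[of V "K1 \<union> K2" "min \<epsilon>1 \<epsilon>2"]) (use s in auto)
    moreover have "moves V K2 \<epsilon>2 (s i)" if "i < m" for i
      by (rule moves_mono[of V "K1 \<union> K2" "min \<epsilon>1 \<epsilon>2"]) (use s that in auto)
    ultimately show ?thesis using 1(4) 2(4) by simp
  qed
  moreover have "compact (K1 \<union> K2)" "K1 \<union> K2 \<subseteq> C" "min \<epsilon>1 \<epsilon>2 > 0" using 1 2 by auto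
  ultimately show ?case by blast
qed

text \<open>The induced map is the composition with the target map, which sends the units to the identity.\<close>

lemma moves_of_close_to_unit:
  assumes "r = Analytic" and K: "compact K" and \<epsilon>: "\<epsilon> > 0"
  shows "\<exists>\<epsilon>'>0. \<forall>\<tau>\<in>G. (\<forall>x\<in>K. d\<^sub>\<Gamma> (jet1 M A x \<tau>) (jet1 M A x (unit_at \<Gamma>)) < \<epsilon>') \<longrightarrow> moves V K \<epsilon> \<tau>"
proof -
  have tgt: "C1_on A M UNIV (tgt \<Gamma>)" by (rule Cr_on_imp_C1_on[OF r atA atM lie_groupoidD(5)[OF \<Gamma>]])
  obtain \<epsilon>' where \<epsilon>': "\<epsilon>' > 0" and close: "\<forall>f. C1_on M A UNIV f \<longrightarrow> C1_on M M UNIV (\<lambda>x. tgt \<Gamma> (f x)) \<longrightarrow>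
    (\<forall>x\<in>K. d\<^sub>\<Gamma> (jet1 M A x f) (jet1 M A x (unit_at \<Gamma>)) < \<epsilon>' \<longrightarrow>
      d\<^sub>M (jet1 M M x (\<lambda>x. tgt \<Gamma> (f x))) (jet1 M M x (\<lambda>x. tgt \<Gamma> (unit_at \<Gamma> x))) < \<epsilon>)"
    using composition_close_to_reference[OF atM atA atM d\<Gamma> dM bisectionD(3)[OF unit_in] tgt bisectionD(4)[OF unit_in] K \<epsilon>]
    by (elim exE conjE)
  have "moves V K \<epsilon> \<tau>" if "\<tau> \<in> G" "\<forall>x\<in>K. d\<^sub>\<Gamma> (jet1 M A x \<tau>) (jet1 M A x (unit_at \<Gamma>)) < \<epsilon>'" for \<tau>
    using close[rule_format, OF bisectionD(3)[OF that(1)] bisectionD(4)[OF that(1)]] that assms(1)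
    unfolding moves_def tgt_unit_id by simp
  with \<epsilon>' show ?thesis by blast
qed

lemma moves_of_small_support:
  assumes "r \<noteq> Analytic" "\<tau> \<in> G" "supp_bisection \<Gamma> \<tau> \<subseteq> V"
  shows "moves V K \<epsilon> \<tau>"
proof -
  have "{x. tgt \<Gamma> (\<tau> x) \<noteq> x} \<subseteq> {x. \<tau> x \<noteq> unit_at \<Gamma> x}" using groupoidD(2)[OF \<Gamma>] by auto
  then have "supp_diffeo (\<lambda>x. tgt \<Gamma> (\<tau> x)) \<subseteq> V"
    using assms(3) closure_mono unfolding supp_diffeo_def supp_bisection_def by (metis (no_types, lifting) order_trans)
  then show ?thesis using assms by (simp add: moves_def)
qed

text \<open>Fibrewise transitivity at \<open>y\<close>, reparametrised, is fed into the (L)-condition for neighbourhoods of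
  \<open>y\<close> inside \<open>V\<close>. The resulting isotopies are as close to the original ones near \<open>y\<close> as
  \<open>isotopies_locally_transitive\<close> demands, and their members are controlled outside a compact
  neighbourhood of \<open>y\<close> in \<open>V\<close>. The neighbourhood \<open>W\<close> of the unit is fixed before \<open>K\<close> and \<open>\<epsilon>\<close>.\<close>

lemma local_moves:
  assumes V: "open V" "y \<in> V"
  shows "\<exists>W C. open W \<and> unit_at \<Gamma> y \<in> W \<and> open C \<and> - V \<subseteq> C \<and>
    (\<forall>K \<epsilon>. compact K \<longrightarrow> K \<subseteq> C \<longrightarrow> \<epsilon> > 0 \<longrightarrow> (\<forall>h1\<in>W \<inter> src_fibre \<Gamma> y. \<forall>h2\<in>W \<inter> src_fibre \<Gamma> y.
       \<exists>\<tau>. moves V K \<epsilon> \<tau> \<and> act \<Gamma> \<tau> h1 = h2))"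
proof -
  let ?e = "unit_at \<Gamma> y"
  obtain k \<sigma> where sub: "submanifold_dim r A (src_fibre \<Gamma> y) k"
    and \<sigma>: "\<And>i. i < k \<Longrightarrow> \<sigma> i \<in> isotopies r \<Gamma> G" and ind: "independent_velocities A ?e k (\<lambda>i t. \<sigma> i t y)"
    using transitive[unfolded fiberwise_transitive_def, THEN spec, of y] by blast
  have "?e \<in> src_fibre \<Gamma> y" using groupoidD(1)[OF \<Gamma>] by (simp add: src_fibre_def)
  then obtain U\<psi> \<phi> where "(U\<psi>, \<phi>) \<in> maximal_atlas r A" "?e \<in> U\<psi>"
    "\<phi> ` (U\<psi> \<inter> src_fibre \<Gamma> y) = {u \<in> \<phi> ` U\<psi>. \<forall>i\<ge>k. u i = 0}"
    using sub unfolding submanifold_dim_def by blast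
  then obtain \<psi> where \<psi>: "\<psi> \<in> maximal_atlas r A" "?e \<in> fst \<psi>"
    and slice: "snd \<psi> ` (fst \<psi> \<inter> src_fibre \<Gamma> y) = {u \<in> snd \<psi> ` fst \<psi>. \<forall>i\<ge>k. u i = 0}" by auto
  have k: "k \<le> mdim A" using sub by (simp add: submanifold_dim_def)
  have i\<psi>: "is_chart (mdim A) \<psi>" using \<psi>(1) by (simp add: maximal_atlas_def)
  obtain cM where cM: "cM \<in> charts M" "y \<in> fst cM" using atlasD(4)[OF atM] by blast
  note icM = atlasD(1)[OF atM cM(1)]
  obtain Q1 V' where Q1: "compact Q1" "open V'" "y \<in> V'" "V' \<subseteq> Q1" "Q1 \<subseteq> V \<inter> fst cM"
    by (rule chart_compact_nbhd[OF icM cM(2) V])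
  obtain Q2 U where Q2: "compact Q2" "open U" "y \<in> U" "U \<subseteq> Q2" "Q2 \<subseteq> V' \<inter> fst cM"
    by (rule chart_compact_nbhd[OF icM cM(2) Q1(2,3)])
  have clV: "closure V' \<subseteq> Q1" by (rule closure_minimal[OF Q1(4) compact_imp_closed[OF Q1(1)]])
  have clU: "closure U \<subseteq> Q2" by (rule closure_minimal[OF Q2(4) compact_imp_closed[OF Q2(1)]])
  have cpt: "compact (closure V')" "compact (closure U)"
    using clV clU Q1(1) Q2(1) compact_Int_closed[of Q1 "closure V'"] compact_Int_closed[of Q2 "closure U"]
    by (simp_all add: Int_absorb1)
  have "open U \<and> open V' \<and> compact (closure U) \<and> compact (closure V') \<and> closure U \<subseteq> V'"
    using Q1(2) Q2(2,5) cpt clU by auto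
  from L[unfolded L_condition_def Let_def, rule_format, OF this]
  obtain KL \<epsilon>L where KL: "compact KL" "\<epsilon>L > 0" and Lc: "\<forall>\<sigma>\<in>isotopies r \<Gamma> G.
      (\<forall>t. C1_close M A d\<^sub>\<Gamma> KL \<epsilon>L UNIV (\<sigma> t) (unit_at \<Gamma>)) \<longrightarrow>
      (if r \<noteq> Analytic then
         \<exists>\<tau>\<in>isotopies r \<Gamma> G. \<forall>t. (\<forall>x\<in>U. \<tau> t x = \<sigma> t x) \<and> supp_bisection \<Gamma> (\<tau> t) \<subseteq> V'
       else \<forall>K' \<epsilon>'. compact K' \<and> \<epsilon>' > 0 \<longrightarrow>
         (\<exists>\<tau>\<in>isotopies r \<Gamma> G. \<forall>t. C1_close M A d\<^sub>\<Gamma> K' \<epsilon>' U (\<tau> t) (\<sigma> t) \<and>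
            C1_close M A d\<^sub>\<Gamma> K' \<epsilon>' (- V') (\<tau> t) (unit_at \<Gamma>)))"
    by (elim exE conjE)
  have "\<forall>i\<in>{..<k}. \<exists>a>0. \<forall>t. C1_close M A d\<^sub>\<Gamma> KL \<epsilon>L UNIV (\<sigma> i (a * sin t)) (unit_at \<Gamma>)"
    using small_reparametrised_isotopy[OF \<sigma> KL] by blast
  from bchoice[OF this] obtain a where a': "\<forall>i\<in>{..<k}. a i > 0 \<and>
      (\<forall>t. C1_close M A d\<^sub>\<Gamma> KL \<epsilon>L UNIV (\<sigma> i (a i * sin t)) (unit_at \<Gamma>))" by (elim exE)
  have a: "a i > 0" "C1_close M A d\<^sub>\<Gamma> KL \<epsilon>L UNIV (\<sigma> i (a i * sin t)) (unit_at \<Gamma>)" if "i < k" for i t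
    using a' that by simp_all
  define \<rho> where "\<rho> = (\<lambda>i t. \<sigma> i (a i * sin t))"
  have \<rho>: "\<rho> i \<in> isotopies r \<Gamma> G" if "i < k" for i
    unfolding \<rho>_def by (rule sin_time_isotopy[OF \<sigma>[OF that]])
  have ind': "independent_velocities A ?e k (\<lambda>i t. \<rho> i t y)"
    unfolding \<rho>_def by (rule velocities_after_reparametrisation[OF \<sigma> a(1) ind])
  have "\<exists>Y \<delta>. open Y \<and> y \<in> Y \<and> \<delta> > 0 \<and> (\<forall>i<k. \<forall>t. \<bar>t\<bar> \<le> \<delta> \<longrightarrow> (\<forall>z\<in>Y. \<rho> i t z \<in> fst \<psi>))"
  proof (rule common_nbhd)
    fix i assume i: "i < k"
    have "\<rho> i 0 y \<in> fst \<psi>" using isotopyD(3)[OF \<rho>[OF i]] \<psi>(2) by simp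
    then show "\<exists>Y \<delta>. open Y \<and> y \<in> Y \<and> \<delta> > 0 \<and> (\<forall>t. \<bar>t\<bar> \<le> \<delta> \<longrightarrow> (\<forall>z\<in>Y. \<rho> i t z \<in> fst \<psi>))"
      by (rule joint_nbhd[OF isotopyD(5)[OF \<rho>[OF i]] is_chartD(1)[OF i\<psi>]])
  qed
  then obtain Y0 \<delta>0 where Y0: "open Y0" "y \<in> Y0" "\<delta>0 > 0" "\<forall>i<k. \<forall>t. \<bar>t\<bar> \<le> \<delta>0 \<longrightarrow> (\<forall>z\<in>Y0. \<rho> i t z \<in> fst \<psi>)"
    by (elim exE conjE)
  have "open (Y0 \<inter> U)" "y \<in> Y0 \<inter> U" using Y0 Q2 by auto
  then obtain Kz Y where Kz: "compact Kz" "open Y" "y \<in> Y" "Y \<subseteq> Kz" "Kz \<subseteq> Y0 \<inter> U \<inter> fst cM"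
    by (rule chart_compact_nbhd[OF icM cM(2)])
  obtain \<delta> \<eta> W where \<delta>: "\<delta> > 0" "\<delta> \<le> \<delta>0" "\<eta> > 0" "open W" "?e \<in> W"
    and trans: "\<forall>\<tau>. (\<forall>i<k. continuous_on UNIV (\<lambda>(t, x). \<tau> i t x)) \<longrightarrow> (\<forall>i<k. \<forall>t x. src \<Gamma> (\<tau> i t x) = x) \<longrightarrow>
      (\<forall>i<k. \<forall>t. \<bar>t\<bar> \<le> \<delta> \<longrightarrow> (\<forall>z\<in>Y. \<tau> i t z \<in> fst \<psi> \<and>
        l1norm (mdim A) (\<lambda>j. snd \<psi> (\<tau> i t z) j - snd \<psi> (\<rho> i t z) j) \<le> \<eta>)) \<longrightarrow>
      (\<forall>h1\<in>W \<inter> src_fibre \<Gamma> y. \<forall>h2\<in>W \<inter> src_fibre \<Gamma> y. \<exists>t. iterate_acts (\<lambda>i t. act \<Gamma> (\<tau> i t)) t k h1 = h2)"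
    by (atomize_elim, rule isotopies_locally_transitive[OF r \<Gamma> \<psi> slice k isotopyD(1)[OF \<rho>] isotopyD(3)[OF \<rho>] bisectionD(2)[OF isotopyD(2)[OF \<rho>]] ind' Kz(2,3) Y0(3)])
  \<comment> \<open>the modified isotopies are close to the units outside \<open>V'\<close>, hence on compact subsets of \<open>C\<close>\<close>
  define C where "C = - Q1"
  have C: "open C" "- V \<subseteq> C" using Q1 by (auto simp: C_def compact_imp_closed)
  have approx: "\<exists>\<tau>\<in>isotopies r \<Gamma> G. (\<forall>t. moves V K \<epsilon> (\<tau> t)) \<and> (\<forall>t. \<bar>t\<bar> \<le> \<delta> \<longrightarrow> (\<forall>z\<in>Y. \<tau> t z \<in> fst \<psi> \<and>
      l1norm (mdim A) (\<lambda>j. snd \<psi> (\<tau> t z) j - snd \<psi> (\<rho> i t z) j) \<le> \<eta>))"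
    if i: "i < k" and K: "compact K" "K \<subseteq> C" and \<epsilon>: "\<epsilon> > 0" for i K \<epsilon>
  proof -
    have in_\<psi>: "\<rho> i t z \<in> fst \<psi>" if "\<bar>t\<bar> \<le> \<delta>" "z \<in> Kz" for t z
      using Y0(4)[rule_format, OF i, of t z] that \<delta>(2) Kz(5) by auto
    have Li: "if r \<noteq> Analytic then
         \<exists>\<tau>\<in>isotopies r \<Gamma> G. \<forall>t. (\<forall>x\<in>U. \<tau> t x = \<rho> i t x) \<and> supp_bisection \<Gamma> (\<tau> t) \<subseteq> V'
       else \<forall>K' \<epsilon>'. compact K' \<and> \<epsilon>' > 0 \<longrightarrow>
         (\<exists>\<tau>\<in>isotopies r \<Gamma> G. \<forall>t. C1_close M A d\<^sub>\<Gamma> K' \<epsilon>' U (\<tau> t) (\<rho> i t) \<and>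
            C1_close M A d\<^sub>\<Gamma> K' \<epsilon>' (- V') (\<tau> t) (unit_at \<Gamma>))"
      by (rule Lc[THEN bspec, OF \<rho>[OF i], THEN mp]) (simp add: \<rho>_def a(2)[OF i])
    show ?thesis
    proof (cases "r = Analytic")
      case False
      then obtain \<tau> where \<tau>: "\<tau> \<in> isotopies r \<Gamma> G" "\<And>t x. x \<in> U \<Longrightarrow> \<tau> t x = \<rho> i t x" "\<And>t. supp_bisection \<Gamma> (\<tau> t) \<subseteq> V'"
        using Li by auto
      have "moves V K \<epsilon> (\<tau> t)" for t
        by (rule moves_of_small_support[OF False isotopyD(2)[OF \<tau>(1)]]) (use \<tau>(3) Q1 in blast)
      moreover have "\<tau> t z \<in> fst \<psi> \<and> l1norm (mdim A) (\<lambda>j. snd \<psi> (\<tau> t z) j - snd \<psi> (\<rho> i t z) j) \<le> \<eta>"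
        if "\<bar>t\<bar> \<le> \<delta>" "z \<in> Y" for t z
      proof -
        have "z \<in> U" "z \<in> Kz" using that(2) Kz by auto
        then show ?thesis using \<tau>(2) in_\<psi>[OF that(1)] \<delta>(3) by (simp add: l1norm_def)
      qed
      ultimately show ?thesis using \<tau>(1) by blast
    next
      case True
      obtain \<epsilon>1 where \<epsilon>1: "\<epsilon>1 > 0" "\<forall>\<tau>\<in>G. (\<forall>x\<in>K. d\<^sub>\<Gamma> (jet1 M A x \<tau>) (jet1 M A x (unit_at \<Gamma>)) < \<epsilon>1) \<longrightarrow> moves V K \<epsilon> \<tau>"
        using moves_of_close_to_unit[OF True K(1) \<epsilon>] by blast
      obtain \<epsilon>2 where \<epsilon>2: "\<epsilon>2 > 0" "\<forall>t x f. \<bar>t\<bar> \<le> \<delta> \<longrightarrow> x \<in> Kz \<longrightarrow> C1_near M A x f \<longrightarrow>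
          d\<^sub>\<Gamma> (jet1 M A x f) (jet1 M A x (\<rho> i t)) < \<epsilon>2 \<longrightarrow>
          f x \<in> fst \<psi> \<and> l1norm (mdim A) (\<lambda>j. snd \<psi> (f x) j - snd \<psi> (\<rho> i t x) j) \<le> \<eta>"
        by (atomize_elim, rule jets_close_imp_values_close[OF atM atA d\<Gamma> isotopyD(4)[OF \<rho>[OF i]] bisectionD(3)[OF isotopyD(2)[OF \<rho>[OF i]]] Kz(1) i\<psi> in_\<psi> \<delta>(3)])
      have "compact (K \<union> Kz)" "min \<epsilon>1 \<epsilon>2 > 0" using K Kz \<epsilon>1 \<epsilon>2 by auto
      moreover have "\<forall>K' \<epsilon>'. compact K' \<and> \<epsilon>' > 0 \<longrightarrow>
         (\<exists>\<tau>\<in>isotopies r \<Gamma> G. \<forall>t. C1_close M A d\<^sub>\<Gamma> K' \<epsilon>' U (\<tau> t) (\<rho> i t) \<and>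
            C1_close M A d\<^sub>\<Gamma> K' \<epsilon>' (- V') (\<tau> t) (unit_at \<Gamma>))"
        using Li True by simp
      ultimately have "\<exists>\<tau>\<in>isotopies r \<Gamma> G. \<forall>t. C1_close M A d\<^sub>\<Gamma> (K \<union> Kz) (min \<epsilon>1 \<epsilon>2) U (\<tau> t) (\<rho> i t) \<and>
            C1_close M A d\<^sub>\<Gamma> (K \<union> Kz) (min \<epsilon>1 \<epsilon>2) (- V') (\<tau> t) (unit_at \<Gamma>)"
        by blast
      then obtain \<tau> where \<tau>: "\<tau> \<in> isotopies r \<Gamma> G"
        and cl: "\<And>t. C1_close M A d\<^sub>\<Gamma> (K \<union> Kz) (min \<epsilon>1 \<epsilon>2) U (\<tau> t) (\<rho> i t)"
          "\<And>t. C1_close M A d\<^sub>\<Gamma> (K \<union> Kz) (min \<epsilon>1 \<epsilon>2) (- V') (\<tau> t) (unit_at \<Gamma>)"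
        by (elim bexE) blast
      have "moves V K \<epsilon> (\<tau> t)" for t
      proof (rule \<epsilon>1(2)[rule_format, OF isotopyD(2)[OF \<tau>]])
        fix x assume "x \<in> K"
        then have "x \<in> (K \<union> Kz) \<inter> - V'" using K(2) Q1(4) by (auto simp: C_def)
        then show "d\<^sub>\<Gamma> (jet1 M A x (\<tau> t)) (jet1 M A x (unit_at \<Gamma>)) < \<epsilon>1"
          using cl(2)[of t] unfolding C1_close_def by fastforce
      qed
      moreover have "\<tau> t z \<in> fst \<psi> \<and> l1norm (mdim A) (\<lambda>j. snd \<psi> (\<tau> t z) j - snd \<psi> (\<rho> i t z) j) \<le> \<eta>"
        if "\<bar>t\<bar> \<le> \<delta>" "z \<in> Y" for t z
      proof (rule \<epsilon>2(2)[rule_format, OF that(1)])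
        show "z \<in> Kz" using that(2) Kz by auto
        then have "z \<in> (K \<union> Kz) \<inter> U" using Kz by auto
        then show "d\<^sub>\<Gamma> (jet1 M A z (\<tau> t)) (jet1 M A z (\<rho> i t)) < \<epsilon>2"
          using cl(1)[of t] unfolding C1_close_def by fastforce
        show "C1_near M A z (\<tau> t)" by (rule C1_near_of_C1_on[OF bisectionD(3)[OF isotopyD(2)[OF \<tau>]]])
      qed
      ultimately show ?thesis using \<tau> by blast
    qed
  qed
  have mv: "\<exists>\<tau>. moves V K \<epsilon> \<tau> \<and> act \<Gamma> \<tau> h1 = h2"
    if K: "compact K" "K \<subseteq> C" "\<epsilon> > 0" and h: "h1 \<in> W \<inter> src_fibre \<Gamma> y" "h2 \<in> W \<inter> src_fibre \<Gamma> y" for K \<epsilon> h1 h2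
  proof -
    obtain K' \<epsilon>' where K': "compact K'" "K' \<subseteq> C" "\<epsilon>' > 0"
      "\<forall>s. (\<forall>i<k. moves V K' \<epsilon>' (s i)) \<longrightarrow> moves V K \<epsilon> (iterated_product s k)"
      using moves_iterated_product[where V = V and m = k, OF C(1) K(2,1,3)] by (elim exE conjE)
    have "\<forall>i\<in>{..<k}. \<exists>\<tau>. \<tau> \<in> isotopies r \<Gamma> G \<and> (\<forall>t. moves V K' \<epsilon>' (\<tau> t)) \<and> (\<forall>t. \<bar>t\<bar> \<le> \<delta> \<longrightarrow> (\<forall>z\<in>Y. \<tau> t z \<in> fst \<psi> \<and>
      l1norm (mdim A) (\<lambda>j. snd \<psi> (\<tau> t z) j - snd \<psi> (\<rho> i t z) j) \<le> \<eta>))"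
      using approx[OF _ K'(1-3)] unfolding Bex_def by (intro ballI) simp
    from bchoice[OF this] obtain \<tau> where \<tau>: "\<forall>i\<in>{..<k}. \<tau> i \<in> isotopies r \<Gamma> G \<and> (\<forall>t. moves V K' \<epsilon>' (\<tau> i t)) \<and> (\<forall>t. \<bar>t\<bar> \<le> \<delta> \<longrightarrow> (\<forall>z\<in>Y. \<tau> i t z \<in> fst \<psi> \<and>
      l1norm (mdim A) (\<lambda>j. snd \<psi> (\<tau> i t z) j - snd \<psi> (\<rho> i t z) j) \<le> \<eta>))" by (elim exE)
    have "\<forall>h1\<in>W \<inter> src_fibre \<Gamma> y. \<forall>h2\<in>W \<inter> src_fibre \<Gamma> y. \<exists>t. iterate_acts (\<lambda>i t. act \<Gamma> (\<tau> i t)) t k h1 = h2"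
    proof (rule trans[THEN spec, of \<tau>, THEN mp, THEN mp, THEN mp])
      show "\<forall>i<k. continuous_on UNIV (\<lambda>(t, x). \<tau> i t x)" using \<tau> isotopyD(5) by blast
      show "\<forall>i<k. \<forall>t x. src \<Gamma> (\<tau> i t x) = x" using \<tau> isotopyD(2) bisectionD(2) by blast
    qed (use \<tau> in blast)
    then obtain t where t: "iterate_acts (\<lambda>i t. act \<Gamma> (\<tau> i t)) t k h1 = h2" using h by blast
    have "moves V K \<epsilon> (iterated_product (\<lambda>i. \<tau> i (t i)) k)" using K'(4) \<tau> by simp
    moreover have "act \<Gamma> (iterated_product (\<lambda>i. \<tau> i (t i)) k) h1 = h2"
      using act_iterated_product[of k \<tau> t h1] t \<tau> isotopyD(2) by simp
    ultimately show ?thesis by blast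
  qed
  show ?thesis
    by (rule exI[of _ W], rule exI[of _ C], intro conjI allI impI ballI)
      (rule \<delta>(4,5) C | (rule mv; assumption))+
qed

section \<open>Transitivity on the components of the source fibres\<close>

text \<open>The set \<open>C\<close> is open, rather than the complement of \<open>V\<close>, so that there is room for the larger compact
  sets needed for products. Asking for all \<open>K\<close> and \<open>\<epsilon>\<close> makes the relation transitive: the accuracy of
  two consecutive steps is chosen after that of their product.\<close>

definition joined :: "'m set \<Rightarrow> 'g \<Rightarrow> 'g \<Rightarrow> bool" where
  "joined V g g' \<longleftrightarrow> (\<exists>C. open C \<and> - V \<subseteq> C \<and>
     (\<forall>K \<epsilon>. compact K \<longrightarrow> K \<subseteq> C \<longrightarrow> \<epsilon> > 0 \<longrightarrow> (\<exists>\<tau>. moves V K \<epsilon> \<tau> \<and> act \<Gamma> \<tau> g = g')))"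

lemma joined_trans:
  assumes "joined V g g'" "joined V g' g''"
  shows "joined V g g''"
proof -
  obtain C1 where C1: "open C1" "- V \<subseteq> C1" "\<And>K \<epsilon>. compact K \<Longrightarrow> K \<subseteq> C1 \<Longrightarrow> \<epsilon> > 0 \<Longrightarrow> \<exists>\<tau>. moves V K \<epsilon> \<tau> \<and> act \<Gamma> \<tau> g = g'"
    using assms(1) unfolding joined_def by blast
  obtain C2 where C2: "open C2" "- V \<subseteq> C2" "\<And>K \<epsilon>. compact K \<Longrightarrow> K \<subseteq> C2 \<Longrightarrow> \<epsilon> > 0 \<Longrightarrow> \<exists>\<tau>. moves V K \<epsilon> \<tau> \<and> act \<Gamma> \<tau> g' = g''"
    using assms(2) unfolding joined_def by blast
  have "\<exists>\<tau>. moves V K \<epsilon> \<tau> \<and> act \<Gamma> \<tau> g = g''" if K: "compact K" "K \<subseteq> C1 \<inter> C2" "\<epsilon> > 0" for K \<epsilon>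
  proof -
    have "open (C1 \<inter> C2)" using C1 C2 by auto
    from moves_mult[where V = V, OF this K(2,1,3)] obtain K' \<epsilon>' where K': "compact K'" "K' \<subseteq> C1 \<inter> C2" "\<epsilon>' > 0"
      "\<forall>\<sigma> \<tau>. moves V K' \<epsilon>' \<sigma> \<longrightarrow> moves V K' \<epsilon>' \<tau> \<longrightarrow> moves V K \<epsilon> (bisection_mult \<Gamma> \<sigma> \<tau>)" by (elim exE conjE)
    obtain \<tau>1 where 1: "moves V K' \<epsilon>' \<tau>1" "act \<Gamma> \<tau>1 g = g'" using C1(3)[of K' \<epsilon>'] K' by auto
    obtain \<tau>2 where 2: "moves V K' \<epsilon>' \<tau>2" "act \<Gamma> \<tau>2 g' = g''" using C2(3)[of K' \<epsilon>'] K' by auto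
    have "\<tau>1 \<in> G" "\<tau>2 \<in> G" using 1 2 by (auto simp: moves_def)
    from act_bisection_mult[OF \<Gamma> bisectionD(2)[OF this(2)] bisectionD(2)[OF this(1)]]
    have "act \<Gamma> (bisection_mult \<Gamma> \<tau>2 \<tau>1) g = g''" using 1 2 by simp
    moreover have "moves V K \<epsilon> (bisection_mult \<Gamma> \<tau>2 \<tau>1)" using K'(4) 1(1) 2(1) by simp
    ultimately show ?thesis by blast
  qed
  then show ?thesis unfolding joined_def using C1 C2 by (intro exI[of _ "C1 \<inter> C2"]) auto
qed

text \<open>Right multiplication by \<open>g\<close> maps the source fibre of the unit at \<open>tgt \<Gamma> g\<close> to that of \<open>g\<close> and commutes
  with the action of bisections, so \<open>local_moves\<close> at this unit can be transported to \<open>g\<close>.\<close>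

lemma joined_locally:
  assumes V: "open V" "tgt \<Gamma> g \<in> V"
  shows "\<exists>T. openin (top_of_set (src_fibre \<Gamma> (src \<Gamma> g))) T \<and> g \<in> T \<and> (\<forall>g1\<in>T. \<forall>g2\<in>T. joined V g1 g2)"
proof -
  let ?F = "src_fibre \<Gamma> (src \<Gamma> g)" and ?g' = "inverse_arrow \<Gamma> g"
  obtain W C where W: "open W" "unit_at \<Gamma> (tgt \<Gamma> g) \<in> W" "open C" "- V \<subseteq> C"
    and mv: "\<forall>K \<epsilon>. compact K \<longrightarrow> K \<subseteq> C \<longrightarrow> \<epsilon> > 0 \<longrightarrow> (\<forall>h1\<in>W \<inter> src_fibre \<Gamma> (tgt \<Gamma> g). \<forall>h2\<in>W \<inter> src_fibre \<Gamma> (tgt \<Gamma> g).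
       \<exists>\<tau>. moves V K \<epsilon> \<tau> \<and> act \<Gamma> \<tau> h1 = h2)"
    using local_moves[OF V] by (elim exE conjE)
  define R where "R = (\<lambda>g1. arrow_comp \<Gamma> g1 ?g')"
  have src': "src \<Gamma> ?g' = tgt \<Gamma> g" "tgt \<Gamma> ?g' = src \<Gamma> g" by (rule groupoidD(8,9)[OF \<Gamma>])+
  have "continuous_on ?F (\<lambda>g1. case (g1, ?g') of (g, h) \<Rightarrow> arrow_comp \<Gamma> g h)"
    by (rule continuous_on_compose2[OF continuous_on_arrow_comp[OF \<Gamma>] continuous_on_Pair[OF continuous_on_id continuous_on_const]])
      (auto simp: src_fibre_def src')
  then have cont: "continuous_on ?F R" by (simp add: R_def)
  have R: "src \<Gamma> (R g1) = tgt \<Gamma> g" "tgt \<Gamma> (R g1) = tgt \<Gamma> g1" "arrow_comp \<Gamma> (R g1) g = g1" if "g1 \<in> ?F" for g1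
  proof -
    have s: "src \<Gamma> g1 = tgt \<Gamma> ?g'" using that by (simp add: src_fibre_def src')
    show "src \<Gamma> (R g1) = tgt \<Gamma> g" "tgt \<Gamma> (R g1) = tgt \<Gamma> g1"
      using groupoidD(3,4)[OF \<Gamma> s] src' by (simp_all add: R_def)
    show "arrow_comp \<Gamma> (R g1) g = g1"
      using groupoidD(5)[OF \<Gamma> s src'(1)] groupoidD(10)[OF \<Gamma>, of g] groupoidD(6)[OF \<Gamma>, of g1] that
      by (simp add: R_def src_fibre_def)
  qed
  define T where "T = ?F \<inter> R -` W"
  have "openin (top_of_set ?F) T" unfolding T_def by (rule continuous_openin_preimage_gen[OF cont W(1)])
  moreover have "g \<in> T" using W(2) groupoidD(11)[OF \<Gamma>, of g] by (simp add: T_def R_def src_fibre_def)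
  moreover have "joined V g1 g2" if g: "g1 \<in> T" "g2 \<in> T" for g1 g2
  proof -
    have F: "g1 \<in> ?F" "g2 \<in> ?F" and h: "R g1 \<in> W \<inter> src_fibre \<Gamma> (tgt \<Gamma> g)" "R g2 \<in> W \<inter> src_fibre \<Gamma> (tgt \<Gamma> g)"
      using g R(1) by (auto simp: T_def src_fibre_def)
    have "\<exists>\<tau>. moves V K \<epsilon> \<tau> \<and> act \<Gamma> \<tau> g1 = g2" if K: "compact K" "K \<subseteq> C" "\<epsilon> > 0" for K \<epsilon>
    proof -
      obtain \<tau> where \<tau>: "moves V K \<epsilon> \<tau>" "act \<Gamma> \<tau> (R g1) = R g2" using mv K h by blast
      have \<tau>G: "\<tau> \<in> G" using \<tau>(1) by (simp add: moves_def)
      have "act \<Gamma> \<tau> g1 = arrow_comp \<Gamma> (\<tau> (tgt \<Gamma> (R g1))) (arrow_comp \<Gamma> (R g1) g)"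
        using R(2,3)[OF F(1)] by (simp add: act_def)
      also have "\<dots> = arrow_comp \<Gamma> (act \<Gamma> \<tau> (R g1)) g"
        unfolding act_def using groupoidD(5)[OF \<Gamma>, of "\<tau> (tgt \<Gamma> (R g1))" "R g1" g] bisectionD(2)[OF \<tau>G] R(1)[OF F(1)] by simp
      also have "\<dots> = g2" unfolding \<tau>(2) by (rule R(3)[OF F(2)])
      finally show ?thesis using \<tau>(1) by blast
    qed
    then show ?thesis unfolding joined_def using W(3,4) by blast
  qed
  ultimately show ?thesis by blast
qed

text \<open>The targets of the arrows in the component are points of the leaf, hence of \<open>V\<close>. So \<open>joined\<close> is
  locally universal on the component, which is connected.\<close>

lemma unit_joined_to_component:
  assumes V: "open V" "leaf \<Gamma> x \<subseteq> V" and g: "g \<in> src_fibre_component \<Gamma> x"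
  shows "joined V (unit_at \<Gamma> x) g"
proof (rule connected_equivalence_relation_gen[where P = "\<lambda>_. True" and S = "src_fibre_component \<Gamma> x"])
  let ?S = "src_fibre_component \<Gamma> x"
  have sub: "?S \<subseteq> src_fibre \<Gamma> x" unfolding src_fibre_component_def by (rule connected_component_subset)
  show "connected ?S" unfolding src_fibre_component_def by (rule connected_connected_component)
  have "unit_at \<Gamma> x \<in> src_fibre \<Gamma> x" using groupoidD(1)[OF \<Gamma>] by (simp add: src_fibre_def)
  then show "unit_at \<Gamma> x \<in> ?S" unfolding src_fibre_component_def by (simp add: connected_component_refl)
  show "joined V a c" if "joined V a b" "joined V b c" for a b c using that by (rule joined_trans)
  show "\<exists>T. openin (top_of_set ?S) T \<and> a \<in> T \<and> (\<forall>x\<in>T. \<forall>y\<in>T. True \<and> True \<longrightarrow> joined V x y)" if a: "a \<in> ?S" for a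
  proof -
    have "tgt \<Gamma> a \<in> V" using a V(2) by (auto simp: leaf_def)
    moreover have "src \<Gamma> a = x" using a sub by (auto simp: src_fibre_def)
    ultimately obtain T where T: "openin (top_of_set (src_fibre \<Gamma> x)) T" "a \<in> T" "\<forall>g1\<in>T. \<forall>g2\<in>T. joined V g1 g2"
      using joined_locally[OF V(1), of a] by auto
    then show ?thesis using sub a
      by (intro exI[of _ "T \<inter> ?S"]) (auto intro: openin_subtopology_Int_subset simp: openin_open)
  qed
qed (use g in auto)

end

section \<open>Prescribing one value of a bisection\<close>

theorem corollary1p5:
  fixes r :: regularity
    and \<Gamma> :: "('g::t2_space, 'm::t2_space) groupoid"
    and G :: "('m \<Rightarrow> 'g) set"
    and d\<^sub>\<Gamma> :: "('m, 'g) jet \<Rightarrow> ('m, 'g) jet \<Rightarrow> real"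
    and d\<^sub>M :: "('m, 'm) jet \<Rightarrow> ('m, 'm) jet \<Rightarrow> real"
    and \<gamma> :: 'g
  assumes "r \<noteq> Differentiable 0"
    and "lie_groupoid r \<Gamma>"
    and "jet_metric (units \<Gamma>) (arrows \<Gamma>) d\<^sub>\<Gamma>"
    and "jet_metric (units \<Gamma>) (units \<Gamma>) d\<^sub>M"
    and "subgroup G (Bis r \<Gamma>)"
    and "L_condition r \<Gamma> d\<^sub>\<Gamma> G"
    and "fiberwise_transitive r \<Gamma> G"
    and "\<gamma> \<in> identity_component \<Gamma>"
  shows "(\<exists>\<sigma>\<in>G. \<sigma> (src \<Gamma> \<gamma>) = \<gamma>) \<and>
    (\<forall>V. open V \<and> leaf \<Gamma> (src \<Gamma> \<gamma>) \<subseteq> V \<longrightarrow>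
       (if r \<noteq> Analytic then
          \<exists>\<sigma>\<in>G. \<sigma> (src \<Gamma> \<gamma>) = \<gamma> \<and> supp_diffeo (tgt \<Gamma> \<circ> \<sigma>) \<subseteq> V
        else
          \<forall>K \<epsilon>. compact K \<and> \<epsilon> > 0 \<longrightarrow>
            (\<exists>\<sigma>\<in>G. \<sigma> (src \<Gamma> \<gamma>) = \<gamma> \<and>
               C1_close (units \<Gamma>) (units \<Gamma>) d\<^sub>M K \<epsilon> (- V) (tgt \<Gamma> \<circ> \<sigma>) id)))"
proof -
  interpret locally_extendable_bisection_group r \<Gamma> G d\<^sub>\<Gamma> d\<^sub>M
    by (rule locally_extendable_bisection_group.intro) (rule assms)+
  let ?x = "src \<Gamma> \<gamma>"
  \<comment> \<open>the component through \<open>\<gamma>\<close> is that of the unit at the source of \<open>\<gamma>\<close>\<close>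
  obtain x where x: "\<gamma> \<in> src_fibre_component \<Gamma> x" using assms(8) by (auto simp: identity_component_def)
  then have "\<gamma> \<in> src_fibre \<Gamma> x"
    unfolding src_fibre_component_def using connected_component_subset by blast
  then have \<gamma>: "\<gamma> \<in> src_fibre_component \<Gamma> ?x" using x by (simp add: src_fibre_def)
  have key: "\<exists>\<sigma>. moves V (K - V) \<epsilon> \<sigma> \<and> \<sigma> ?x = \<gamma>"
    if V: "open V" "leaf \<Gamma> ?x \<subseteq> V" and K: "compact K" "\<epsilon> > 0" for V K \<epsilon>
  proof -
    obtain C where C: "- V \<subseteq> C" and mv: "\<forall>K \<epsilon>. compact K \<longrightarrow> K \<subseteq> C \<longrightarrow> \<epsilon> > 0 \<longrightarrow> (\<exists>\<tau>. moves V K \<epsilon> \<tau> \<and> act \<Gamma> \<tau> (unit_at \<Gamma> ?x) = \<gamma>)"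
      using unit_joined_to_component[OF V \<gamma>] unfolding joined_def by (elim exE conjE)
    have "compact (K - V)" "K - V \<subseteq> C" using K V C by (auto simp: compact_diff)
    then obtain \<tau> where \<tau>: "moves V (K - V) \<epsilon> \<tau>" "act \<Gamma> \<tau> (unit_at \<Gamma> ?x) = \<gamma>" using mv K(2) by blast
    have "act \<Gamma> \<tau> (unit_at \<Gamma> ?x) = \<tau> ?x"
      using groupoidD(2)[OF \<Gamma>] groupoidD(6)[OF \<Gamma>, of "\<tau> ?x"] bisectionD(2)[of \<tau>] \<tau>(1)
      by (simp add: act_def moves_def)
    with \<tau> show ?thesis by auto
  qed
  show ?thesis
  proof (intro conjI allI impI)
    show "\<exists>\<sigma>\<in>G. \<sigma> ?x = \<gamma>"
      using key[of UNIV "{}" 1] by (auto simp: moves_def)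
    fix V assume V: "open V \<and> leaf \<Gamma> ?x \<subseteq> V"
    show "if r \<noteq> Analytic then \<exists>\<sigma>\<in>G. \<sigma> ?x = \<gamma> \<and> supp_diffeo (tgt \<Gamma> \<circ> \<sigma>) \<subseteq> V
        else \<forall>K \<epsilon>. compact K \<and> \<epsilon> > 0 \<longrightarrow>
            (\<exists>\<sigma>\<in>G. \<sigma> ?x = \<gamma> \<and> C1_close (units \<Gamma>) (units \<Gamma>) d\<^sub>M K \<epsilon> (- V) (tgt \<Gamma> \<circ> \<sigma>) id)"
    proof (cases "r = Analytic")
      case False
      then show ?thesis using key[of V "{}" 1] V by (auto simp: moves_def o_def)
    next
      case True
      have "\<exists>\<sigma>\<in>G. \<sigma> ?x = \<gamma> \<and> C1_close (units \<Gamma>) (units \<Gamma>) d\<^sub>M K \<epsilon> (- V) (tgt \<Gamma> \<circ> \<sigma>) id"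
        if K: "compact K \<and> \<epsilon> > 0" for K \<epsilon>
      proof -
        obtain \<sigma> where \<sigma>: "moves V (K - V) \<epsilon> \<sigma>" "\<sigma> ?x = \<gamma>" using key V K by blast
        then have "\<sigma> \<in> G" "\<forall>x\<in>K - V. d\<^sub>M (jet1 M M x (\<lambda>x. tgt \<Gamma> (\<sigma> x))) (jet1 M M x id) < \<epsilon>"
          unfolding moves_def using True by simp_all
        with \<sigma>(2) show ?thesis by (intro bexI[of _ \<sigma>]) (auto simp: C1_close_def o_def)
      qed
      then show ?thesis using True by simp
    qed
  qed
qed

end
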